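(* Let $M$ be an analytic bihamiltonian structure which admits a Lax structure near $m_0\in M$, and suppose that for one particular $(\lambda_1,\lambda_2)\in\mathbb C^2$ the Poisson structure $\lambda_1\{,\}_1+\lambda_2\{,\}_2$ has constant corank $1$. Then the bihamiltonian structure is a Kronecker structure of type $(\dim M)$ near $m_0$.
   Context: A bihamiltonian structure is a manifold $M$ with two Poisson brackets $\{,\}_1,\{,\}_2$ such that $\lambda_1\{,\}_1+\lambda_2\{,\}_2$ is Poisson for all $\lambda_1,\lambda_2$ (complex combinations act on complex-valued functions). It is analytic if $M$ and both brackets are analytic (real-analytic or, replacing $\mathbb R$ by $\mathbb C$, complex-analytic). A function $F$ is Casimir for $\{,\}$ if $\{F,f\}=0$ for every $f$. Each bracket induces a skew-symmetric pairing $(df|_m,dg|_m)=\{f,g\}|_m$ on $T_m^*M$; the corank of the bracket at $m$ is the dimension of the null-space of this pairing. Any pair of skew-symmetric pairings on a finite-dimensional complex vector space is a direct sum of indecomposable pairs, uniquely determined up to isomorphism: even-dimensional Jordan blocks and odd-dimensional Kronecker blocks $\mathcal K_{2k-1}$ (basis $\mathbf w_0,\dots,\mathbf w_{2k-2}$, only nonzero pairings up to skew-symmetry $(\mathbf w_{2l},\mathbf w_{2l+1})_1=1$, $(\mathbf w_{2l+1},\mathbf w_{2l+2})_2=1$, $0\le l\le k-2$). The action dimension of such a space $V$ is $\frac{\dim V+s}{2}$, where $s$ is the number of Kronecker blocks. The action dimension of a bihamiltonian structure at $m_0$ is the lower limit of the action dimensions of $T_m^*M\otimes\mathbb C$ ($T_m^*M$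 for complex $M$) as $m\to m_0$. Let $\mathcal P_{n-1}$ be the $n$-dimensional vector space of polynomials in one variable of degree at most $n-1$; $p|_\lambda$ denotes the value of $p$ at $\lambda$. A mapping $\mathbf L\colon M\to\mathcal P_{n-1}$ is a weak Lax structure on $M$ of rank $n$ if for any $\lambda\in\mathbb R$ the function $m\mapsto\mathbf L(m)|_\lambda$ is a Casimir function for $\lambda\{,\}_1+\{,\}_2$. If the action dimension of $M$ at $m_0$ is $n$, a Lax structure on $M$ near $m_0$ is a weak Lax structure $\mathbf L$ of rank $n$ such that the mapping $\mathbf L$ is a submersion. A bihamiltonian structure on a vector space is translation-invariant if both brackets are invariant under parallel translations; it is decomposable if it is isomorphic to a direct product of two bihamiltonian structures of positive dimension. A structure is Kronecker of type $(d)$ near $m_0$, $d$ odd, if in a neighbourhood of $m_0$ it is locally isomorphic to an indecomposable translation-invariant structure of dimension $d$; for $d=2k-1$ the latter has coordinates $x_0,\dots,x_{2k-2}$ with $\{x_{2l},x_{2l+1}\}_1=1$, $\{x_{2l+1},x_{2l+2}\}_2=1$, $0\le l\le k-2$, all other brackets of coordinates zero. *)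

theory Defs
  imports "HOL-Analysis.Analysis" "HOL-Computational_Algebra.Polynomial"
begin

section \<open>The ground field\<close>

text \<open>
  A field of this class is either the reals or the complex numbers, up to an isometric isomorphism.
  It lets the real and the complex theory be stated at once.
\<close>

class real_or_complex = real_normed_field +
  fixes to_complex :: "'a \<Rightarrow> complex"
  assumes to_complex_add: "to_complex (x + y) = to_complex x + to_complex y"
    and to_complex_mult: "to_complex (x * y) = to_complex x * to_complex y"
    and to_complex_one: "to_complex 1 = 1"
    and to_complex_scaleR: "to_complex (r *\<^sub>R x) = r *\<^sub>R to_complex x"
    and norm_to_complex: "norm (to_complex x) = norm x"
    and range_to_complex: "range to_complex = \<real> \<or> range to_complex = UNIV"

instantiation real :: real_or_complex
begin
definition to_complex_real :: "real \<Rightarrow> complex" where "to_complex_real = complex_of_real"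
instance
  by standard (auto simp: to_complex_real_def Reals_def scaleR_conv_of_real)
end

instantiation complex :: real_or_complex
begin
definition to_complex_complex :: "complex \<Rightarrow> complex" where "to_complex_complex = id"
instance
  by standard (auto simp: to_complex_complex_def)
end


section \<open>Smooth and analytic functions on open subsets of the coordinate space\<close>

text \<open>
  The derivative is required to be linear over the ground field: for the reals \<open>smooth_on\<close> is
  the class of infinitely differentiable functions, for the complex numbers it is holomorphy.
  Both notions are used for open \<open>S\<close> only.
\<close>

primrec C_k_on :: "nat \<Rightarrow> ('k::real_or_complex ^ 'n) set \<Rightarrow> ('k ^ 'n \<Rightarrow> 'k) \<Rightarrow> bool" where
  "C_k_on 0 = (\<lambda>S f. continuous_on S f)"
| "C_k_on (Suc k) = (\<lambda>S f. \<exists>g :: 'n \<Rightarrow> 'k ^ 'n \<Rightarrow> 'k.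
     (\<forall>x\<in>S. (f has_derivative (\<lambda>h. \<Sum>i\<in>UNIV. g i x * h $ i)) (at x)) \<and> (\<forall>i. C_k_on k S (g i)))"

definition smooth_on :: "('k::real_or_complex ^ 'n) set \<Rightarrow> ('k ^ 'n \<Rightarrow> 'k) \<Rightarrow> bool" where
  "smooth_on S f \<longleftrightarrow> (\<forall>k. C_k_on k S f)"

definition power_series_on :: "('k::real_or_complex ^ 'n) set \<Rightarrow> ('k ^ 'n \<Rightarrow> 'k) \<Rightarrow> bool" where
  "power_series_on S f \<longleftrightarrow> (\<forall>a\<in>S. \<exists>(c :: ('n \<Rightarrow> nat) \<Rightarrow> 'k) r. r > 0 \<and>
     (\<forall>x\<in>ball a r. ((\<lambda>\<alpha>. c \<alpha> * (\<Prod>i\<in>UNIV. (x $ i - a $ i) ^ \<alpha> i)) has_sum f x) UNIV))"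

definition partial_deriv :: "'n \<Rightarrow> ('k::real_or_complex ^ 'n \<Rightarrow> 'k) \<Rightarrow> 'k ^ 'n \<Rightarrow> 'k" where
  "partial_deriv i f x = frechet_derivative f (at x) (axis i 1)"


section \<open>Analytic manifolds\<close>

text \<open>
  The manifold is the whole type \<open>'m\<close> (Hausdorff and second countable by its sort), with an
  analytic atlas that need not be maximal.  Its dimension is \<open>CARD('n)\<close>.
\<close>

type_synonym ('m, 'k, 'n) atlas = "('m set \<times> ('m \<Rightarrow> 'k ^ 'n)) set"

definition chart :: "'m::topological_space set \<Rightarrow> ('m \<Rightarrow> 'k::real_or_complex ^ 'n) \<Rightarrow> bool" where
  "chart U \<phi> \<longleftrightarrow> open U \<and> open (\<phi> ` U) \<and> inj_on \<phi> U \<and>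
     homeomorphism U (\<phi> ` U) \<phi> (inv_into U \<phi>)"

definition analytic_transition ::
  "'m set \<times> ('m \<Rightarrow> 'k::real_or_complex ^ 'n) \<Rightarrow> 'm set \<times> ('m \<Rightarrow> 'k ^ 'n) \<Rightarrow> bool" where
  "analytic_transition = (\<lambda>(U, \<phi>) (V, \<psi>).
     \<forall>i. power_series_on (\<phi> ` (U \<inter> V)) (\<lambda>x. \<psi> (inv_into U \<phi> x) $ i))"

definition analytic_manifold ::
  "('m::{t2_space, second_countable_topology}, 'k::real_or_complex, 'n::finite) atlas \<Rightarrow> bool" where
  "analytic_manifold A \<longleftrightarrow> (\<forall>(U, \<phi>)\<in>A. chart U \<phi>) \<and> (\<Union>(U, \<phi>)\<in>A. U) = UNIV \<and>
     (\<forall>c\<in>A. \<forall>c'\<in>A. analytic_transition c c')"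

text \<open>
  Functions are total on \<open>'m\<close>, but only their values on the open set \<open>W\<close> matter.
\<close>

definition smooth_fun ::
  "('m, 'k::real_or_complex, 'n::finite) atlas \<Rightarrow> 'm set \<Rightarrow> ('m \<Rightarrow> 'k) \<Rightarrow> bool" where
  "smooth_fun A W f \<longleftrightarrow> (\<forall>(U, \<phi>)\<in>A. smooth_on (\<phi> ` (U \<inter> W)) (f \<circ> inv_into U \<phi>))"

definition analytic_fun ::
  "('m, 'k::real_or_complex, 'n::finite) atlas \<Rightarrow> 'm set \<Rightarrow> ('m \<Rightarrow> 'k) \<Rightarrow> bool" where
  "analytic_fun A W f \<longleftrightarrow> (\<forall>(U, \<phi>)\<in>A. power_series_on (\<phi> ` (U \<inter> W)) (f \<circ> inv_into U \<phi>))"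


section \<open>Bihamiltonian structures\<close>

type_synonym ('m, 'k) bracket = "('m \<Rightarrow> 'k) \<Rightarrow> ('m \<Rightarrow> 'k) \<Rightarrow> 'm \<Rightarrow> 'k"

text \<open>
  A bracket acts on locally defined functions (a complex manifold may have few global ones):
  for every open \<open>W\<close> it restricts, by the first two clauses, to a bracket of functions on \<open>W\<close>.
  Its values on functions that are not smooth near a point are irrelevant.
\<close>

definition poisson_bracket ::
  "('m::topological_space, 'k::real_or_complex, 'n::finite) atlas \<Rightarrow> ('m, 'k) bracket \<Rightarrow> bool" where
  "poisson_bracket A B \<longleftrightarrow>
     (\<forall>W f g h. open W \<longrightarrow> smooth_fun A W f \<longrightarrow> smooth_fun A W g \<longrightarrow> smooth_fun A W h \<longrightarrow>
        smooth_fun A W (B f g) \<and>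
        (\<forall>f'. (\<forall>m\<in>W. f' m = f m) \<longrightarrow> (\<forall>m\<in>W. B f' g m = B f g m)) \<and>
        (\<forall>m\<in>W. B f g m = - B g f m) \<and>
        (\<forall>c. \<forall>m\<in>W. B (\<lambda>x. c * f x + g x) h m = c * B f h m + B g h m) \<and>
        (\<forall>m\<in>W. B (\<lambda>x. f x * g x) h m = f m * B g h m + B f h m * g m) \<and>
        (\<forall>m\<in>W. B f (B g h) m + B g (B h f) m + B h (B f g) m = 0))"

definition bracket_comb ::
  "'k::real_or_complex \<Rightarrow> 'k \<Rightarrow> ('m, 'k) bracket \<Rightarrow> ('m, 'k) bracket \<Rightarrow> ('m, 'k) bracket" where
  "bracket_comb l1 l2 B1 B2 = (\<lambda>f g m. l1 * B1 f g m + l2 * B2 f g m)"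

text \<open>
  Over the reals, the Jacobi identity for all real combinations gives it for all complex
  combinations on complex-valued functions, since the Jacobiator is a quadratic form in the
  coefficients.
\<close>

definition bihamiltonian ::
  "('m::topological_space, 'k::real_or_complex, 'n::finite) atlas \<Rightarrow>
    ('m, 'k) bracket \<Rightarrow> ('m, 'k) bracket \<Rightarrow> bool" where
  "bihamiltonian A B1 B2 \<longleftrightarrow> poisson_bracket A B1 \<and> poisson_bracket A B2 \<and>
     (\<forall>l1 l2. poisson_bracket A (bracket_comb l1 l2 B1 B2))"

definition analytic_bracket ::
  "('m::topological_space, 'k::real_or_complex, 'n::finite) atlas \<Rightarrow> ('m, 'k) bracket \<Rightarrow> bool" where
  "analytic_bracket A B \<longleftrightarrow>
     (\<forall>W f g. open W \<longrightarrow> analytic_fun A W f \<longrightarrow> analytic_fun A W g \<longrightarrow> analytic_fun A W (B f g))"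

definition analytic_bihamiltonian ::
  "('m::{t2_space, second_countable_topology}, 'k::real_or_complex, 'n::finite) atlas \<Rightarrow>
    ('m, 'k) bracket \<Rightarrow> ('m, 'k) bracket \<Rightarrow> bool" where
  "analytic_bihamiltonian A B1 B2 \<longleftrightarrow> analytic_manifold A \<and> bihamiltonian A B1 B2 \<and>
     analytic_bracket A B1 \<and> analytic_bracket A B2"

definition casimir_on ::
  "('m::topological_space, 'k::real_or_complex, 'n::finite) atlas \<Rightarrow> ('m, 'k) bracket \<Rightarrow>
    'm set \<Rightarrow> ('m \<Rightarrow> 'k) \<Rightarrow> bool" where
  "casimir_on A B U F \<longleftrightarrow> smooth_fun A U F \<and>
     (\<forall>W f. open W \<longrightarrow> W \<subseteq> U \<longrightarrow> smooth_fun A W f \<longrightarrow> (\<forall>m\<in>W. B F f m = 0))"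


section \<open>Pairs of skew-symmetric pairings\<close>

type_synonym 'n pairing = "complex ^ 'n \<Rightarrow> complex ^ 'n \<Rightarrow> complex"

text \<open>
  The pairing induced by \<open>B\<close> on the complexified cotangent space at \<open>m\<close>; the vector \<open>v\<close> stands for
  the covector \<open>\<Sum>i. v $ i * d(\<phi>\<^sub>i)\<close>.  (For a complex manifold \<open>to_complex\<close> is an isomorphism,
  so this is the cotangent space itself.)
\<close>

definition cotangent_pairing ::
  "('m \<Rightarrow> 'k::real_or_complex ^ 'n::finite) \<Rightarrow> ('m, 'k) bracket \<Rightarrow> 'm \<Rightarrow> 'n pairing" where
  "cotangent_pairing \<phi> B m = (\<lambda>v w. \<Sum>i\<in>UNIV. \<Sum>j\<in>UNIV.
     v $ i * w $ j * to_complex (B (\<lambda>x. \<phi> x $ i) (\<lambda>x. \<phi> x $ j) m))"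

definition pairing_corank :: "'n::finite pairing \<Rightarrow> nat" where
  "pairing_corank a = vec.dim {v. \<forall>w. a v w = 0}"

definition pair_orthogonal ::
  "'n::finite pairing \<Rightarrow> 'n pairing \<Rightarrow> (complex ^ 'n) set \<Rightarrow> (complex ^ 'n) set \<Rightarrow> bool" where
  "pair_orthogonal a b X Y \<longleftrightarrow> (\<forall>x\<in>X. \<forall>y\<in>Y. a x y = 0 \<and> b x y = 0)"

definition pair_indecomposable ::
  "'n::finite pairing \<Rightarrow> 'n pairing \<Rightarrow> (complex ^ 'n) set \<Rightarrow> bool" where
  "pair_indecomposable a b W \<longleftrightarrow> vec.subspace W \<and> W \<noteq> {0} \<and>
     \<not> (\<exists>X Y. vec.subspace X \<and> vec.subspace Y \<and> X \<noteq> {0} \<and> Y \<noteq> {0} \<and> X \<inter> Y = {0} \<and>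
          W = {x + y | x y. x \<in> X \<and> y \<in> Y} \<and> pair_orthogonal a b X Y)"

text \<open>
  The summands of a decomposition are nonzero and independent, hence distinct, so they can be
  collected in a set.
\<close>

definition pair_decomposition ::
  "'n::finite pairing \<Rightarrow> 'n pairing \<Rightarrow> (complex ^ 'n) set set \<Rightarrow> bool" where
  "pair_decomposition a b D \<longleftrightarrow> finite D \<and> (\<forall>W\<in>D. pair_indecomposable a b W) \<and>
     (\<forall>v. \<exists>!f. f \<in> (\<Pi>\<^sub>E W\<in>D. W) \<and> v = (\<Sum>W\<in>D. f W)) \<and>
     (\<forall>X\<in>D. \<forall>Y\<in>D. X \<noteq> Y \<longrightarrow> pair_orthogonal a b X Y)"

definition kron1 :: "nat \<Rightarrow> nat \<Rightarrow> 'a::comm_ring_1" where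
  "kron1 i j = (if even i \<and> j = i + 1 then 1 else if even j \<and> i = j + 1 then - 1 else 0)"

definition kron2 :: "nat \<Rightarrow> nat \<Rightarrow> 'a::comm_ring_1" where
  "kron2 i j = (if odd i \<and> j = i + 1 then 1 else if odd j \<and> i = j + 1 then - 1 else 0)"

definition kronecker_block ::
  "'n::finite pairing \<Rightarrow> 'n pairing \<Rightarrow> (complex ^ 'n) set \<Rightarrow> bool" where
  "kronecker_block a b W \<longleftrightarrow> (\<exists>k (w :: nat \<Rightarrow> complex ^ 'n). k \<ge> 1 \<and>
     inj_on w {..<2*k-1} \<and> vec.independent (w ` {..<2*k-1}) \<and> vec.span (w ` {..<2*k-1}) = W \<and>
     (\<forall>i<2*k-1. \<forall>j<2*k-1. a (w i) (w j) = kron1 i j \<and> b (w i) (w j) = kron2 i j))"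

text \<open>
  The number of Kronecker blocks does not depend on the decomposition, as the indecomposable
  summands are unique up to isomorphism.
\<close>

definition num_kronecker_blocks :: "'n::finite pairing \<Rightarrow> 'n pairing \<Rightarrow> nat" where
  "num_kronecker_blocks a b = card {W \<in> (SOME D. pair_decomposition a b D). kronecker_block a b W}"

definition pair_action_dim :: "'n::finite pairing \<Rightarrow> 'n pairing \<Rightarrow> real" where
  "pair_action_dim a b = (real CARD('n) + real (num_kronecker_blocks a b)) / 2"

text \<open>
  Different charts give isomorphic pairs at a point, so the next two notions are independent of
  the chart.
\<close>

definition has_constant_corank ::
  "('m, 'k::real_or_complex, 'n::finite) atlas \<Rightarrow> ('m, 'k) bracket \<Rightarrow> ('m, 'k) bracket \<Rightarrow>
    complex \<Rightarrow> complex \<Rightarrow> nat \<Rightarrow> bool" where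
  "has_constant_corank A B1 B2 l1 l2 r \<longleftrightarrow> (\<forall>(U, \<phi>)\<in>A. \<forall>m\<in>U.
     pairing_corank (\<lambda>v w. l1 * cotangent_pairing \<phi> B1 m v w + l2 * cotangent_pairing \<phi> B2 m v w) = r)"

definition has_action_dim_at ::
  "('m::topological_space, 'k::real_or_complex, 'n::finite) atlas \<Rightarrow>
    ('m, 'k) bracket \<Rightarrow> ('m, 'k) bracket \<Rightarrow> 'm \<Rightarrow> nat \<Rightarrow> bool" where
  "has_action_dim_at A B1 B2 m0 n \<longleftrightarrow> (\<forall>(U, \<phi>)\<in>A. m0 \<in> U \<longrightarrow>
     Liminf (at m0) (\<lambda>m. ereal (pair_action_dim (cotangent_pairing \<phi> B1 m) (cotangent_pairing \<phi> B2 m)))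
       = ereal (real n))"


section \<open>Lax structures\<close>

text \<open>
  The \<open>n\<close>-dimensional space of polynomials of degree at most \<open>n - 1\<close> (zero for \<open>n = 0\<close>).
\<close>

definition poly_space :: "nat \<Rightarrow> 'k::real_or_complex poly set" where
  "poly_space n = {p. \<forall>i\<ge>n. coeff p i = 0}"

definition weak_lax_structure_on ::
  "('m::topological_space, 'k::real_or_complex, 'n::finite) atlas \<Rightarrow>
    ('m, 'k) bracket \<Rightarrow> ('m, 'k) bracket \<Rightarrow> 'm set \<Rightarrow> nat \<Rightarrow> ('m \<Rightarrow> 'k poly) \<Rightarrow> bool" where
  "weak_lax_structure_on A B1 B2 U n L \<longleftrightarrow>
     (\<forall>m\<in>U. L m \<in> poly_space n) \<and> (\<forall>i. smooth_fun A U (\<lambda>m. coeff (L m) i)) \<and>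
     (\<forall>l::real. casimir_on A (bracket_comb (of_real l) 1 B1 B2) U (\<lambda>m. poly (L m) (of_real l)))"

definition submersion_on ::
  "('m, 'k::real_or_complex, 'n::finite) atlas \<Rightarrow> 'm set \<Rightarrow> nat \<Rightarrow> ('m \<Rightarrow> 'k poly) \<Rightarrow> bool" where
  "submersion_on A U n L \<longleftrightarrow> (\<forall>(V, \<phi>)\<in>A. \<forall>m\<in>U \<inter> V. \<forall>p\<in>poly_space n. \<exists>v :: 'k ^ 'n. \<forall>i.
     frechet_derivative (\<lambda>x. coeff (L (inv_into V \<phi> x)) i) (at (\<phi> m)) v = coeff p i)"

definition lax_structure_near ::
  "('m::topological_space, 'k::real_or_complex, 'n::finite) atlas \<Rightarrow>
    ('m, 'k) bracket \<Rightarrow> ('m, 'k) bracket \<Rightarrow> 'm \<Rightarrow> 'm set \<Rightarrow> ('m \<Rightarrow> 'k poly) \<Rightarrow> bool" where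
  "lax_structure_near A B1 B2 m0 U L \<longleftrightarrow> open U \<and> m0 \<in> U \<and>
     (\<exists>n. has_action_dim_at A B1 B2 m0 n \<and> weak_lax_structure_on A B1 B2 U n L \<and>
          submersion_on A U n L)"


section \<open>Kronecker structures\<close>

text \<open>
  A bracket on the coordinate space with constant structure matrix \<open>s\<close>, the coordinates being
  numbered by \<open>e\<close>.
\<close>

definition constant_bracket ::
  "('n::finite \<Rightarrow> nat) \<Rightarrow> (nat \<Rightarrow> nat \<Rightarrow> 'k) \<Rightarrow> ('k::real_or_complex ^ 'n, 'k) bracket" where
  "constant_bracket e s f g x =
     (\<Sum>i\<in>UNIV. \<Sum>j\<in>UNIV. s (e i) (e j) * partial_deriv i f x * partial_deriv j g x)"

text \<open>
  Isomorphism, over a neighbourhood \<open>U\<close>, with an open part of the coordinate space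
  carrying the brackets \<open>C1\<close> and \<open>C2\<close>.
\<close>

definition local_isomorphism ::
  "('m::topological_space, 'k::real_or_complex, 'n::finite) atlas \<Rightarrow>
    ('m, 'k) bracket \<Rightarrow> ('m, 'k) bracket \<Rightarrow> ('k ^ 'n, 'k) bracket \<Rightarrow> ('k ^ 'n, 'k) bracket \<Rightarrow>
    'm set \<Rightarrow> ('m \<Rightarrow> 'k ^ 'n) \<Rightarrow> bool" where
  "local_isomorphism A B1 B2 C1 C2 U \<psi> \<longleftrightarrow> chart U \<psi> \<and>
     (\<forall>c\<in>A. analytic_transition (U, \<psi>) c \<and> analytic_transition c (U, \<psi>)) \<and>
     (\<forall>V f g. open V \<longrightarrow> V \<subseteq> \<psi> ` U \<longrightarrow> smooth_on V f \<longrightarrow> smooth_on V g \<longrightarrow>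
        (\<forall>m\<in>U. \<psi> m \<in> V \<longrightarrow>
           B1 (f \<circ> \<psi>) (g \<circ> \<psi>) m = C1 f g (\<psi> m) \<and> B2 (f \<circ> \<psi>) (g \<circ> \<psi>) m = C2 f g (\<psi> m)))"

text \<open>
  The model is the indecomposable translation-invariant structure of odd dimension \<open>d = 2k - 1\<close>
  in its coordinates \<open>x\<^sub>0, \<dots>, x\<^bsub>2k-2\<^esub>\<close>.
\<close>

definition kronecker_of_type_near ::
  "('m::topological_space, 'k::real_or_complex, 'n::finite) atlas \<Rightarrow>
    ('m, 'k) bracket \<Rightarrow> ('m, 'k) bracket \<Rightarrow> nat \<Rightarrow> 'm \<Rightarrow> bool" where
  "kronecker_of_type_near A B1 B2 d m0 \<longleftrightarrow> odd d \<and> d = CARD('n) \<and>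
     (\<exists>U \<psi> e. m0 \<in> U \<and> bij_betw e (UNIV :: 'n set) {..<d} \<and>
        local_isomorphism A B1 B2 (constant_bracket e kron1) (constant_bracket e kron2) U \<psi>)"

end

theory Submission
  imports Defs
begin

text \<open>
  A skew-symmetric form of corank 1 lives in an odd dimension \<open>2n + 1\<close>.  Each Kronecker block
  contains a null vector of every combination of the two forms, so there is at most one block and
  the action dimension, an integer, must be \<open>n + 1\<close>.  The coefficients \<open>L\<^sub>0, \<dots>, L\<^sub>n\<close> of the Lax polynomial
  therefore form a chain \<open>{L\<^sub>0, f}\<^sub>2 = 0\<close>, \<open>{L\<^bsub>i+1\<^esub>, f}\<^sub>2 = - {L\<^sub>i, f}\<^sub>1\<close>, \<open>{L\<^sub>n, f}\<^sub>1 = 0\<close>; they are in involution, and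
  by the corank condition the Hamiltonian vector fields \<open>{L\<^sub>i, -}\<^sub>1\<close>, \<open>i < n\<close>, are independent.  A priori
  the \<open>L\<^sub>i\<close> are only smooth, but chains at a point are unique up to a factor, hence solve an analytic
  linear system, which makes the \<open>L\<^sub>i\<close> analytic.

  The commuting vector fields have dual analytic functions \<open>y\<^sub>j\<close> with \<open>{L\<^sub>i, y\<^sub>j}\<^sub>1 = \<delta>\<^bsub>i,j\<^esub>\<close> and
  \<open>{L\<^sub>i, y\<^sub>j}\<^sub>2 = - \<delta>\<^bsub>i,j+1\<^esub>\<close>.  By the Jacobi identities the brackets of the \<open>y\<^sub>j\<close> are functions of \<open>L\<close> alone.
  Adding functions of \<open>L\<close> to the \<open>y\<^sub>j\<close>, the first brackets are removed by the Poincare lemma for 2-forms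
  and then the second ones by a potential solving a system with constant coefficients, on whose jets the
  equations act by shifts of indices.  The resulting \<open>L\<^sub>0, y\<^sub>0, L\<^sub>1, y\<^sub>1, \<dots>, L\<^sub>n\<close> are Kronecker coordinates.
\<close>

section \<open>The ground field\<close>

text \<open>The chain relations come from comparing coefficients in \<lambda> in the Casimir
  condition, which holds at infinitely many real \<lambda>. Most of the work then takes place in
  germs at one point of a chart, where an analytic function is interchangeable with its Taylor
  coefficients: a linear equation with constant coefficients becomes a recursion on multi-indices,
  with a growth bound as the only estimate. Hence the smooth L_i must be made analytic first. Their
  differentials are analytic covectors times one common factor \<mu>, and the closedness of two
  independent differentials determines d\<mu>/\<mu>. This requires n \<ge> 1; for n = 0 both
  brackets vanish, the Lax function may be merely smooth, and a coordinate replaces it.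

  Adding h_j(L) to y_j changes the first brackets by the exterior derivative of the form with
  components h_j, up to sign, and the second brackets by its analogue with derivations shifted by
  one index. Once the first brackets vanish, h has to be a gradient, so a single potential must
  remove all second brackets at once. That overdetermined system is the crux; its compatibility
  conditions are the remaining Jacobi identities.\<close>

lemma to_complex_0 [simp]: "to_complex 0 = 0"
  using norm_to_complex[of 0] by simp

lemma bounded_linear_to_complex: "bounded_linear to_complex"
  by (rule bounded_linear_intro[of _ 1])
    (auto simp: to_complex_add to_complex_scaleR norm_to_complex)

lemma to_complex_diff: "to_complex (x - y) = to_complex x - to_complex y"
  by (simp add: bounded_linear_to_complex linear_diff bounded_linear.linear)

lemma to_complex_minus: "to_complex (- x) = - to_complex x"
  using to_complex_diff[of 0 x] by simp

lemma to_complex_sum: "to_complex (sum f A) = (\<Sum>x\<in>A. to_complex (f x))"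
  by (simp add: bounded_linear_to_complex linear_sum bounded_linear.linear)

lemma inj_to_complex: "inj to_complex"
proof (rule injI)
  fix x y :: 'a assume "to_complex x = to_complex y"
  hence "norm (x - y) = 0" using norm_to_complex[of "x - y"] by (simp add: to_complex_diff)
  thus "x = y" by simp
qed

lemma to_complex_eq_iff [simp]: "to_complex x = to_complex y \<longleftrightarrow> x = y"
  using inj_to_complex by (auto dest: injD)

lemma to_complex_eq_0_iff [simp]: "to_complex x = 0 \<longleftrightarrow> x = 0"
  using to_complex_eq_iff[of x 0] by (simp del: to_complex_eq_iff)

text \<open>Completeness is inherited from the complex numbers because the image of
  \<open>to_complex\<close> is the real line or everything, hence closed. It makes absolutely
  summable families summable.\<close>

instance real_or_complex \<subseteq> banach
proof
  fix X :: "nat \<Rightarrow> 'a" assume X: "Cauchy X"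
  have d: "dist (to_complex x) (to_complex y) = dist x y" for x y :: 'a
    by (metis dist_norm norm_to_complex to_complex_diff)
  from X have "Cauchy (\<lambda>n. to_complex (X n))"
    by (simp add: Cauchy_def d)
  then obtain l where l: "(\<lambda>n. to_complex (X n)) \<longlonglongrightarrow> l"
    using Cauchy_convergent convergent_def by blast
  have "closed (range (to_complex :: 'a \<Rightarrow> complex))"
    using range_to_complex by (metis closed_complex_Reals closed_UNIV)
  with l have "l \<in> range (to_complex :: 'a \<Rightarrow> complex)"
    by (meson closed_sequentially rangeI)
  then obtain x :: 'a where x: "l = to_complex x" by (rule rangeE)
  have "X \<longlonglongrightarrow> x"
    using l unfolding x tendsto_dist_iff[of _ "to_complex x"] tendsto_dist_iff[of X] d .
  thus "convergent X" by (auto simp: convergent_def)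
qed

section \<open>Power series in several variables\<close>

definition mdeg :: "('n::finite \<Rightarrow> nat) \<Rightarrow> nat" where
  "mdeg \<alpha> = (\<Sum>i\<in>UNIV. \<alpha> i)"

definition mpow :: "'k::real_or_complex ^ 'n \<Rightarrow> ('n::finite \<Rightarrow> nat) \<Rightarrow> 'k" where
  "mpow v \<alpha> = (\<Prod>i\<in>UNIV. (v $ i) ^ \<alpha> i)"

text \<open>Polydiscs rather than balls: on them a monomial is bounded by a power of the radius, so
  one weighted sum of coefficients controls the whole series.\<close>

definition polydisc :: "'k::real_or_complex ^ 'n \<Rightarrow> real \<Rightarrow> ('k ^ 'n) set" where
  "polydisc a \<rho> = {x. \<forall>i. norm (x $ i - a $ i) \<le> \<rho>}"

text \<open>The weighted absolute summability is what justifies every later rearrangement, in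
  products, substitutions and recentring.\<close>

definition has_expansion ::
  "'k::real_or_complex ^ 'n::finite \<Rightarrow> real \<Rightarrow> (('n \<Rightarrow> nat) \<Rightarrow> 'k) \<Rightarrow> ('k ^ 'n \<Rightarrow> 'k) \<Rightarrow> bool" where
  "has_expansion a \<rho> c f \<longleftrightarrow> \<rho> > 0 \<and> (\<lambda>\<alpha>. norm (c \<alpha>) * \<rho> ^ mdeg \<alpha>) summable_on UNIV \<and>
     (\<forall>x\<in>polydisc a \<rho>. ((\<lambda>\<alpha>. c \<alpha> * mpow (x - a) \<alpha>) has_sum f x) UNIV)"

text \<open>The weighted l1 norm of the coefficients is at most \<open>M\<close>. This norm is
  submultiplicative and complete, so composition and the fixed point theorem reduce to norm
  estimates.\<close>

definition psn :: "'k::real_or_complex ^ 'n::finite \<Rightarrow> real \<Rightarrow> real \<Rightarrow> ('k ^ 'n \<Rightarrow> 'k) \<Rightarrow> bool" where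
  "psn a \<rho> M f \<longleftrightarrow> (\<exists>c. has_expansion a \<rho> c f \<and> (\<Sum>\<^sub>\<infinity>\<alpha>. norm (c \<alpha>) * \<rho> ^ mdeg \<alpha>) \<le> M)"

lemma mdeg_add: "mdeg (\<lambda>i. \<alpha> i + \<beta> i) = mdeg \<alpha> + mdeg \<beta>"
  by (simp add: mdeg_def sum.distrib)

lemma mdeg_0 [simp]: "mdeg (\<lambda>i. 0) = 0"
  by (simp add: mdeg_def)

lemma mdeg_eq_0_iff: "mdeg \<alpha> = 0 \<longleftrightarrow> \<alpha> = (\<lambda>i. 0)"
  by (auto simp: mdeg_def)

lemma mpow_0 [simp]: "mpow v (\<lambda>i. 0) = 1"
  by (simp add: mpow_def)

lemma mpow_add: "mpow v (\<lambda>i. \<alpha> i + \<beta> i) = mpow v \<alpha> * mpow v \<beta>"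
  by (simp add: mpow_def power_add prod.distrib)

lemma norm_mpow_le:
  assumes "\<And>i. norm (v $ i) \<le> \<rho>"
  shows "norm (mpow v \<alpha>) \<le> \<rho> ^ mdeg \<alpha>"
proof -
  have "norm (mpow v \<alpha>) = (\<Prod>i\<in>UNIV. norm (v $ i) ^ \<alpha> i)"
    by (simp add: mpow_def norm_power flip: prod_norm)
  also have "\<dots> \<le> (\<Prod>i\<in>UNIV. \<rho> ^ \<alpha> i)"
    using assms by (intro prod_mono) (auto intro: power_mono)
  also have "\<dots> = \<rho> ^ mdeg \<alpha>"
    by (simp add: mdeg_def power_sum)
  finally show ?thesis .
qed

lemma norm_mpow_le_polydisc:
  "x \<in> polydisc a \<rho> \<Longrightarrow> norm (mpow (x - a) \<alpha>) \<le> \<rho> ^ mdeg \<alpha>"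
  by (rule norm_mpow_le) (simp add: polydisc_def)

lemma polydisc_mono: "\<rho>' \<le> \<rho> \<Longrightarrow> polydisc a \<rho>' \<subseteq> polydisc a \<rho>"
  by (auto simp: polydisc_def intro: order_trans)

text \<open>The index set is the disjoint union of the fibres of \<open>\<delta>\<close>; the claim
  is iterated summation over the pairs (y, j) with j in the fibre over y.\<close>

lemma has_sum_fibre:
  fixes g :: "'j \<Rightarrow> 'a::banach"
  assumes "(g has_sum S) J" and "\<And>y. (g has_sum h y) {j \<in> J. \<delta> j = y}"
  shows "(h has_sum S) UNIV"
proof -
  let ?T = "Sigma UNIV (\<lambda>y. {j \<in> J. \<delta> j = y})"
  have "((\<lambda>p. g (snd p)) has_sum S) ?T \<longleftrightarrow> (g has_sum S) (snd ` ?T)"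
    by (subst has_sum_reindex) (auto simp: inj_on_def o_def)
  moreover have "snd ` ?T = J" by force
  ultimately have "((\<lambda>p. g (snd p)) has_sum S) ?T" using assms(1) by simp
  thus ?thesis
    by (rule has_sum_SigmaD) (simp add: assms(2))
qed

text \<open>Here a monomial may occur many times: \<open>c \<gamma>\<close> collects all
  \<open>b j\<close> with exponent \<gamma>, and by the triangle inequality collecting does not
  increase the weighted norm. Infinite sums, products and compositions are all reduced to
  this.\<close>

lemma psnI_family:
  fixes b :: "'j \<Rightarrow> 'k::real_or_complex" and \<delta> :: "'j \<Rightarrow> 'n::finite \<Rightarrow> nat"
  assumes \<rho>: "\<rho> > 0" and s: "((\<lambda>j. norm (b j) * \<rho> ^ mdeg (\<delta> j)) has_sum s) J" "s \<le> M"
    and f: "\<And>x. x \<in> polydisc a \<rho> \<Longrightarrow> ((\<lambda>j. b j * mpow (x - a) (\<delta> j)) has_sum f x) J"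
  shows "psn a \<rho> M f"
proof -
  let ?F = "\<lambda>\<gamma>. {j \<in> J. \<delta> j = \<gamma>}"
  define c where "c \<gamma> = infsum b (?F \<gamma>)" for \<gamma>
  define m where "m \<gamma> = infsum (\<lambda>j. norm (b j) * \<rho> ^ mdeg (\<delta> j)) (?F \<gamma>)" for \<gamma>
  have sf: "(\<lambda>j. norm (b j) * \<rho> ^ mdeg (\<delta> j)) summable_on ?F \<gamma>" for \<gamma>
    by (rule summable_on_subset_banach[OF has_sum_imp_summable[OF s(1)]]) auto
  have m: "((\<lambda>j. norm (b j) * \<rho> ^ mdeg (\<delta> j)) has_sum m \<gamma>) (?F \<gamma>)" for \<gamma>
    unfolding m_def using sf by simp
  have ms: "(m has_sum s) UNIV"
    by (rule has_sum_fibre[OF s(1) m])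
  have bs: "(\<lambda>j. norm (b j)) summable_on ?F \<gamma>" for \<gamma>
  proof -
    have "(\<lambda>j. norm (b j) * \<rho> ^ mdeg \<gamma>) summable_on ?F \<gamma>"
      using sf[of \<gamma>] by (rule summable_on_cong[THEN iffD1, rotated]) auto
    moreover have "\<rho> ^ mdeg \<gamma> \<noteq> 0" using \<rho> by simp
    ultimately show ?thesis using iffD1[OF summable_on_cmult_left'[of "\<rho> ^ mdeg \<gamma>" "\<lambda>j. norm (b j)" "?F \<gamma>"]] by blast
  qed
  have c: "(b has_sum c \<gamma>) (?F \<gamma>)" for \<gamma>
    unfolding c_def using bs[THEN abs_summable_summable] by simp
  have cm: "norm (c \<gamma>) * \<rho> ^ mdeg \<gamma> \<le> m \<gamma>" for \<gamma>
  proof -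
    have "norm (c \<gamma>) \<le> infsum (\<lambda>j. norm (b j)) (?F \<gamma>)"
      unfolding c_def by (rule norm_infsum_bound[OF bs])
    hence "norm (c \<gamma>) * \<rho> ^ mdeg \<gamma> \<le> infsum (\<lambda>j. norm (b j)) (?F \<gamma>) * \<rho> ^ mdeg \<gamma>"
      using \<rho> by (intro mult_right_mono) auto
    also have "\<dots> = infsum (\<lambda>j. norm (b j) * \<rho> ^ mdeg \<gamma>) (?F \<gamma>)"
      using bs by (subst infsum_cmult_left) auto
    also have "\<dots> = m \<gamma>" unfolding m_def by (rule infsum_cong) auto
    finally show ?thesis .
  qed
  have cs: "(\<lambda>\<gamma>. norm (c \<gamma>) * \<rho> ^ mdeg \<gamma>) summable_on UNIV"
    using ms cm \<rho>
    by (intro summable_on_comparison_test[OF has_sum_imp_summable[OF ms]]) auto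
  have "has_expansion a \<rho> c f"
    unfolding has_expansion_def
  proof (intro conjI ballI \<rho> cs)
    fix x assume x: "x \<in> polydisc a \<rho>"
    show "((\<lambda>\<gamma>. c \<gamma> * mpow (x - a) \<gamma>) has_sum f x) UNIV"
    proof (rule has_sum_fibre[OF f[OF x], where \<delta> = \<delta>])
      fix \<gamma>
      have "((\<lambda>j. b j * mpow (x - a) \<gamma>) has_sum c \<gamma> * mpow (x - a) \<gamma>) (?F \<gamma>)"
        by (rule has_sum_cmult_left[OF c])
      thus "((\<lambda>j. b j * mpow (x - a) (\<delta> j)) has_sum c \<gamma> * mpow (x - a) \<gamma>) {j \<in> J. \<delta> j = \<gamma>}"
        by (rule has_sum_cong[THEN iffD1, rotated]) auto
    qed
  qed
  moreover have "(\<Sum>\<^sub>\<infinity>\<alpha>. norm (c \<alpha>) * \<rho> ^ mdeg \<alpha>) \<le> M"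
  proof -
    have "(\<Sum>\<^sub>\<infinity>\<alpha>. norm (c \<alpha>) * \<rho> ^ mdeg \<alpha>) \<le> infsum m UNIV"
      by (rule infsum_mono[OF cs has_sum_imp_summable[OF ms]]) (rule cm)
    thus ?thesis using ms s(2) by (simp add: infsumI)
  qed
  ultimately show ?thesis by (auto simp: psn_def)
qed

lemma expansion_term_le:
  "x \<in> polydisc a \<rho> \<Longrightarrow> norm (c * mpow (x - a) \<alpha>) \<le> norm c * \<rho> ^ mdeg \<alpha>"
  by (simp add: norm_mult mult_left_mono norm_mpow_le_polydisc)

lemma has_expansionD:
  assumes "has_expansion a \<rho> c f"
  shows "\<rho> > 0" "(\<lambda>\<alpha>. norm (c \<alpha>) * \<rho> ^ mdeg \<alpha>) summable_on UNIV"
    "x \<in> polydisc a \<rho> \<Longrightarrow> ((\<lambda>\<alpha>. c \<alpha> * mpow (x - a) \<alpha>) has_sum f x) UNIV"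
  using assms by (auto simp: has_expansion_def)

lemma expansion_term_abs_summable:
  assumes "has_expansion a \<rho> c f" and "x \<in> polydisc a \<rho>"
  shows "(\<lambda>\<alpha>. norm (c \<alpha> * mpow (x - a) \<alpha>)) summable_on UNIV"
  by (rule summable_on_comparison_test[OF has_expansionD(2)[OF assms(1)] expansion_term_le[OF assms(2)]]) simp

lemma psn_pos: "psn a \<rho> M f \<Longrightarrow> \<rho> > 0"
  by (auto simp: psn_def has_expansion_def)

lemma psn_norm_le:
  assumes "psn a \<rho> M f" and "x \<in> polydisc a \<rho>"
  shows "norm (f x) \<le> M"
proof -
  from assms(1) obtain c where c: "has_expansion a \<rho> c f"
    and M: "(\<Sum>\<^sub>\<infinity>\<alpha>. norm (c \<alpha>) * \<rho> ^ mdeg \<alpha>) \<le> M"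
    by (auto simp: psn_def)
  have "((\<lambda>\<alpha>. c \<alpha> * mpow (x - a) \<alpha>) has_sum f x) UNIV"
    using c assms(2) by (auto simp: has_expansion_def)
  hence "norm (f x) \<le> (\<Sum>\<^sub>\<infinity>\<alpha>. norm (c \<alpha> * mpow (x - a) \<alpha>))"
    using norm_infsum_bound[OF expansion_term_abs_summable[OF c assms(2)]] by (simp add: infsumI)
  also have "\<dots> \<le> (\<Sum>\<^sub>\<infinity>\<alpha>. norm (c \<alpha>) * \<rho> ^ mdeg \<alpha>)"
    by (rule infsum_mono[OF expansion_term_abs_summable[OF c assms(2)] has_expansionD(2)[OF c]
        expansion_term_le[OF assms(2)]])
  finally show ?thesis using M by simp
qed

lemma center_in_polydisc: "\<rho> > 0 \<Longrightarrow> a \<in> polydisc a \<rho>"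
  by (simp add: polydisc_def)

lemma psn_nonneg: "psn a \<rho> M f \<Longrightarrow> M \<ge> 0"
  by (rule order_trans[OF norm_ge_zero psn_norm_le[OF _ center_in_polydisc[OF psn_pos]]])

lemma psn_mono: "psn a \<rho> M f \<Longrightarrow> M \<le> N \<Longrightarrow> psn a \<rho> N f"
  by (auto simp: psn_def intro: order_trans)

lemma has_expansion_cong:
  "has_expansion a \<rho> c f \<Longrightarrow> (\<And>x. x \<in> polydisc a \<rho> \<Longrightarrow> f x = g x) \<Longrightarrow> has_expansion a \<rho> c g"
  by (auto simp: has_expansion_def)

lemma psn_cong:
  "psn a \<rho> M f \<Longrightarrow> (\<And>x. x \<in> polydisc a \<rho> \<Longrightarrow> f x = g x) \<Longrightarrow> psn a \<rho> M g"
  by (metis psn_def has_expansion_cong)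

lemma has_expansion_shrink:
  assumes "has_expansion a \<rho> c f" and "0 < \<rho>'" "\<rho>' \<le> \<rho>"
  shows "has_expansion a \<rho>' c f"
proof -
  have "(\<lambda>\<alpha>. norm (c \<alpha>) * \<rho>' ^ mdeg \<alpha>) summable_on UNIV"
    by (rule summable_on_comparison_test[OF has_expansionD(2)[OF assms(1)]])
      (use assms in \<open>simp_all add: mult_left_mono power_mono\<close>)
  thus ?thesis using assms polydisc_mono[of \<rho>' \<rho> a] by (auto simp: has_expansion_def)
qed

lemma psn_shrink:
  assumes "psn a \<rho> M f" and "0 < \<rho>'" "\<rho>' \<le> \<rho>"
  shows "psn a \<rho>' M f"
proof -
  from assms(1) obtain c where c: "has_expansion a \<rho> c f"
    and M: "(\<Sum>\<^sub>\<infinity>\<alpha>. norm (c \<alpha>) * \<rho> ^ mdeg \<alpha>) \<le> M"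
    by (auto simp: psn_def)
  have c': "has_expansion a \<rho>' c f" using has_expansion_shrink[OF c assms(2,3)] .
  have "(\<Sum>\<^sub>\<infinity>\<alpha>. norm (c \<alpha>) * \<rho>' ^ mdeg \<alpha>) \<le> (\<Sum>\<^sub>\<infinity>\<alpha>. norm (c \<alpha>) * \<rho> ^ mdeg \<alpha>)"
    by (rule infsum_mono[OF has_expansionD(2)[OF c'] has_expansionD(2)[OF c]])
      (use assms in \<open>simp add: mult_left_mono power_mono\<close>)
  thus ?thesis using c' M by (auto simp: psn_def)
qed

lemma expansion_at_center:
  assumes "has_expansion a \<rho> c f"
  shows "f a = c (\<lambda>i. 0)"
proof -
  have "a \<in> polydisc a \<rho>" using assms by (auto simp: has_expansion_def polydisc_def)
  hence 1: "((\<lambda>\<alpha>. c \<alpha> * mpow (a - a) \<alpha>) has_sum f a) UNIV"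
    using assms by (auto simp: has_expansion_def)
  have "c \<alpha> * mpow (a - a) \<alpha> = 0" if "\<alpha> \<noteq> (\<lambda>i. 0)" for \<alpha>
  proof -
    from that obtain i where "\<alpha> i \<noteq> 0" by auto
    hence "mpow (a - a) \<alpha> = 0" by (auto simp: mpow_def)
    thus ?thesis by simp
  qed
  hence "((\<lambda>\<alpha>. c \<alpha> * mpow (a - a) \<alpha>) has_sum f a) {\<lambda>i. 0}"
    by (intro has_sum_cong_neutral[THEN iffD1, OF _ _ _ 1]) auto
  moreover have "((\<lambda>\<alpha>. c \<alpha> * mpow (a - a) \<alpha>) has_sum c (\<lambda>i. 0)) {\<lambda>i. 0}"
    by (rule has_sum_finiteI) auto
  ultimately show ?thesis by (rule has_sum_unique)
qed

text \<open>Without a constant term every monomial has degree at least 1, so shrinking the radius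
  gains at least the factor \<rho>'/\<rho>. All smallness in the later estimates comes from
  here.\<close>

lemma psn_vanish:
  assumes "psn a \<rho> M f" and "f a = 0" and "0 < \<rho>'" "\<rho>' \<le> \<rho>"
  shows "psn a \<rho>' (M * \<rho>' / \<rho>) f"
proof -
  from assms(1) obtain c where c: "has_expansion a \<rho> c f"
    and M: "(\<Sum>\<^sub>\<infinity>\<alpha>. norm (c \<alpha>) * \<rho> ^ mdeg \<alpha>) \<le> M"
    by (auto simp: psn_def)
  have c0: "c (\<lambda>i. 0) = 0" using expansion_at_center[OF c] assms(2) by simp
  have c': "has_expansion a \<rho>' c f" using has_expansion_shrink[OF c assms(3,4)] .
  have "\<rho> > 0" using assms by simp
  have "norm (c \<alpha>) * \<rho>' ^ mdeg \<alpha> \<le> norm (c \<alpha>) * \<rho> ^ mdeg \<alpha> * (\<rho>' / \<rho>)" for \<alpha>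
  proof (cases "mdeg \<alpha>")
    case 0
    thus ?thesis using c0 by (simp add: mdeg_eq_0_iff)
  next
    case (Suc m)
    have "\<rho>' ^ m * \<rho>' \<le> \<rho> ^ m * \<rho>'" using assms by (intro mult_right_mono power_mono) auto
    hence "\<rho>' ^ Suc m \<le> \<rho> ^ Suc m * (\<rho>' / \<rho>)" using \<open>\<rho> > 0\<close> by (simp add: mult.commute)
    thus ?thesis unfolding Suc by (metis mult.assoc mult_left_mono norm_ge_zero)
  qed
  hence "(\<Sum>\<^sub>\<infinity>\<alpha>. norm (c \<alpha>) * \<rho>' ^ mdeg \<alpha>) \<le> (\<Sum>\<^sub>\<infinity>\<alpha>. norm (c \<alpha>) * \<rho> ^ mdeg \<alpha> * (\<rho>' / \<rho>))"
    by (intro infsum_mono summable_on_cmult_left has_expansionD(2)[OF c'] has_expansionD(2)[OF c])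
  also have "\<dots> = (\<Sum>\<^sub>\<infinity>\<alpha>. norm (c \<alpha>) * \<rho> ^ mdeg \<alpha>) * (\<rho>' / \<rho>)"
    by (rule infsum_cmult_left) (use has_expansionD(2)[OF c] in simp)
  also have "\<dots> \<le> M * (\<rho>' / \<rho>)" using M assms \<open>\<rho> > 0\<close> by (intro mult_right_mono) auto
  finally show ?thesis using c' by (auto simp: psn_def)
qed

lemma psn_monomial:
  assumes "\<rho> > 0" shows "psn a \<rho> (norm c * \<rho> ^ mdeg \<alpha>) (\<lambda>x. c * mpow (x - a) \<alpha>)"
proof (rule psnI_family[OF assms, where J = "{()}" and b = "\<lambda>_. c" and \<delta> = "\<lambda>_. \<alpha>", OF _ order_refl])
  show "((\<lambda>j. norm c * \<rho> ^ mdeg \<alpha>) has_sum norm c * \<rho> ^ mdeg \<alpha>) {()}"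
    by (rule has_sum_finiteI) simp_all
  show "((\<lambda>j. c * mpow (x - a) \<alpha>) has_sum c * mpow (x - a) \<alpha>) {()}" for x
    by (rule has_sum_finiteI) simp_all
qed

lemma psn_const: "\<rho> > 0 \<Longrightarrow> psn a \<rho> (norm c) (\<lambda>_. c)"
  using psn_monomial[of \<rho> a c "\<lambda>i. 0"] by simp

lemma mdeg_single: "mdeg (\<lambda>j. if j = i then m else 0) = m"
  by (simp add: mdeg_def)

lemma mpow_single: "mpow v (\<lambda>j. if j = i then m else 0) = v $ i ^ m"
proof -
  have "mpow v (\<lambda>j. if j = i then m else 0) = (\<Prod>j\<in>UNIV. if j = i then v $ i ^ m else 1)"
    unfolding mpow_def by (rule prod.cong) auto
  thus ?thesis by simp
qed

lemma psn_coord: "\<rho> > 0 \<Longrightarrow> psn a \<rho> \<rho> (\<lambda>x. x $ i - a $ i)"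
  using psn_monomial[of \<rho> a 1 "\<lambda>j. if j = i then 1 else 0"] by (simp add: mdeg_single mpow_single)

text \<open>The coefficients of all members form an absolutely summable family over pairs of a
  member and a multi-index, which may be regrouped by monomials.\<close>

lemma psn_infsum:
  fixes f :: "'j \<Rightarrow> 'k::real_or_complex ^ 'n::finite \<Rightarrow> 'k"
  assumes "\<rho> > 0" and f: "\<And>j. j \<in> J \<Longrightarrow> psn a \<rho> (M j) (f j)" and M: "M summable_on J" "infsum M J \<le> N"
    and g: "\<And>x. x \<in> polydisc a \<rho> \<Longrightarrow> ((\<lambda>j. f j x) has_sum g x) J"
  shows "psn a \<rho> N g"
proof -
  from f have "\<forall>j. \<exists>c. j \<in> J \<longrightarrow> has_expansion a \<rho> c (f j) \<and> (\<Sum>\<^sub>\<infinity>\<alpha>. norm (c \<alpha>) * \<rho> ^ mdeg \<alpha>) \<le> M j"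
    by (auto simp: psn_def)
  then obtain c where c: "\<And>j. j \<in> J \<Longrightarrow> has_expansion a \<rho> (c j) (f j)"
    and cM: "\<And>j. j \<in> J \<Longrightarrow> (\<Sum>\<^sub>\<infinity>\<alpha>. norm (c j \<alpha>) * \<rho> ^ mdeg \<alpha>) \<le> M j"
    by metis
  let ?w = "\<lambda>j. \<Sum>\<^sub>\<infinity>\<alpha>. norm (c j \<alpha>) * \<rho> ^ mdeg \<alpha>"
  have w0: "?w j \<ge> 0" for j by (rule infsum_nonneg) (use \<open>\<rho> > 0\<close> in auto)
  have ws: "?w summable_on J"
    by (rule summable_on_comparison_test[OF M(1)]) (use cM w0 in auto)
  have hs: "((\<lambda>\<alpha>. norm (c j \<alpha>) * \<rho> ^ mdeg \<alpha>) has_sum ?w j) UNIV" if "j \<in> J" for j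
    using c[OF that] by (simp add: has_expansion_def)
  have sm: "(\<lambda>p. norm (c (fst p) (snd p)) * \<rho> ^ mdeg (snd p)) summable_on Sigma J (\<lambda>_. UNIV)"
    by (rule summable_on_SigmaI[OF _ ws]) (use hs \<open>\<rho> > 0\<close> in auto)
  have S1: "((\<lambda>p. norm (c (fst p) (snd p)) * \<rho> ^ mdeg (snd p)) has_sum infsum ?w J) (Sigma J (\<lambda>_. UNIV))"
    by (rule has_sum_SigmaI[OF _ has_sum_infsum[OF ws] sm], unfold fst_conv snd_conv, rule hs)
  have S2: "infsum ?w J \<le> N"
    by (rule order_trans[OF infsum_mono[OF ws M(1) cM] M(2)])
  have S3: "((\<lambda>p. c (fst p) (snd p) * mpow (x - a) (snd p)) has_sum g x) (Sigma J (\<lambda>_. UNIV))"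
    if x: "x \<in> polydisc a \<rho>" for x
  proof -
    have 1: "(\<lambda>p. norm (c (fst p) (snd p) * mpow (x - a) (snd p))) summable_on Sigma J (\<lambda>_. UNIV)"
      by (rule summable_on_comparison_test[OF sm expansion_term_le[OF x]]) simp
    show ?thesis
      by (rule has_sum_SigmaI[OF _ g[OF x] abs_summable_summable[OF 1]], unfold fst_conv snd_conv,
          rule has_expansionD(3)[OF c x])
  qed
  show ?thesis by (rule psnI_family[OF \<open>\<rho> > 0\<close> S1 S2 S3])
qed

lemma psn_sum:
  assumes "\<rho> > 0" "finite J" and "\<And>j. j \<in> J \<Longrightarrow> psn a \<rho> (M j) (f j)"
  shows "psn a \<rho> (sum M J) (\<lambda>x. \<Sum>j\<in>J. f j x)"
proof (rule psn_infsum[OF assms(1,3)])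
  show "infsum M J \<le> sum M J" using assms(2) by simp
  show "((\<lambda>j. f j x) has_sum (\<Sum>j\<in>J. f j x)) J" for x
    by (rule has_sum_finiteI[OF assms(2)]) simp
qed (use assms(2) in simp_all)

lemma psn_add:
  assumes "psn a \<rho> M f" and "psn a \<rho> N g"
  shows "psn a \<rho> (M + N) (\<lambda>x. f x + g x)"
  using psn_sum[of \<rho> "UNIV :: bool set" a "\<lambda>b. if b then M else N" "\<lambda>b. if b then f else g"] assms
    psn_pos[OF assms(1)] by (simp add: UNIV_bool add.commute)

lemma psn_mult:
  assumes f: "psn a \<rho> M f" and g: "psn a \<rho> N g"
  shows "psn a \<rho> (M * N) (\<lambda>x. f x * g x)"
proof -
  have \<rho>: "\<rho> > 0" using psn_pos[OF f] .
  from f obtain c where c: "has_expansion a \<rho> c f"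
    and M: "(\<Sum>\<^sub>\<infinity>\<alpha>. norm (c \<alpha>) * \<rho> ^ mdeg \<alpha>) \<le> M" by (auto simp: psn_def)
  from g obtain d where d: "has_expansion a \<rho> d g"
    and N: "(\<Sum>\<^sub>\<infinity>\<alpha>. norm (d \<alpha>) * \<rho> ^ mdeg \<alpha>) \<le> N" by (auto simp: psn_def)
  let ?u = "\<lambda>\<alpha>. norm (c \<alpha>) * \<rho> ^ mdeg \<alpha>" and ?v = "\<lambda>\<alpha>. norm (d \<alpha>) * \<rho> ^ mdeg \<alpha>"
  have u: "(?u has_sum infsum ?u UNIV) UNIV" and v: "(?v has_sum infsum ?v UNIV) UNIV"
    using c d by (auto simp: has_expansion_def)
  have u0: "infsum ?u UNIV \<ge> 0" and v0: "infsum ?v UNIV \<ge> 0"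
    using \<rho> by (auto intro!: infsum_nonneg)
  let ?b = "\<lambda>p. c (fst p) * d (snd p)" and ?\<delta> = "\<lambda>p i. fst p i + snd p i"
  have 1: "((\<lambda>\<beta>. ?u \<alpha> * ?v \<beta>) has_sum ?u \<alpha> * infsum ?v UNIV) UNIV" for \<alpha>
    by (rule has_sum_cmult_right[OF v])
  have 2: "((\<lambda>\<alpha>. ?u \<alpha> * infsum ?v UNIV) has_sum infsum ?u UNIV * infsum ?v UNIV) UNIV"
    by (rule has_sum_cmult_left[OF u])
  have e: "norm (?b p) * \<rho> ^ mdeg (?\<delta> p) = ?u (fst p) * ?v (snd p)" for p
    by (simp add: norm_mult mdeg_add power_add)
  have sm: "(\<lambda>p. ?u (fst p) * ?v (snd p)) summable_on Sigma UNIV (\<lambda>_. UNIV)"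
    by (rule summable_on_SigmaI[OF _ has_sum_imp_summable[OF 2]]) (use 1 \<rho> in simp_all)
  have S1: "((\<lambda>p. norm (?b p) * \<rho> ^ mdeg (?\<delta> p)) has_sum infsum ?u UNIV * infsum ?v UNIV)
      (Sigma UNIV (\<lambda>_. UNIV))"
    unfolding e by (rule has_sum_SigmaI[OF _ 2 sm], unfold fst_conv snd_conv, rule 1)
  have S2: "infsum ?u UNIV * infsum ?v UNIV \<le> M * N"
    by (rule mult_mono[OF M N order_trans[OF u0 M] v0])
  have S3: "((\<lambda>p. ?b p * mpow (x - a) (?\<delta> p)) has_sum f x * g x) (Sigma UNIV (\<lambda>_. UNIV))"
    if x: "x \<in> polydisc a \<rho>" for x
  proof -
    have fx: "((\<lambda>\<alpha>. c \<alpha> * mpow (x - a) \<alpha>) has_sum f x) UNIV"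
      and gx: "((\<lambda>\<alpha>. d \<alpha> * mpow (x - a) \<alpha>) has_sum g x) UNIV"
      using has_expansionD(3)[OF c x] has_expansionD(3)[OF d x] by simp_all
    have "norm (?b p * mpow (x - a) (?\<delta> p)) \<le> ?u (fst p) * ?v (snd p)" for p
      using expansion_term_le[OF x, of "?b p" "?\<delta> p"] unfolding e .
    from summable_on_comparison_test[OF sm this]
    have 3: "(\<lambda>p. norm (?b p * mpow (x - a) (?\<delta> p))) summable_on Sigma UNIV (\<lambda>_. UNIV)" by simp
    have 4: "?b p * mpow (x - a) (?\<delta> p)
        = (c (fst p) * mpow (x - a) (fst p)) * (d (snd p) * mpow (x - a) (snd p))" for p
      by (simp add: mpow_add mult_ac)
    show ?thesis
      using abs_summable_summable[OF 3] unfolding 4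
      by (rule has_sum_SigmaI[OF _ has_sum_cmult_left[OF fx], rotated], unfold fst_conv snd_conv)
        (rule has_sum_cmult_right[OF gx])
  qed
  show ?thesis by (rule psnI_family[OF \<rho> S1 S2 S3])
qed

lemma psn_power: "psn a \<rho> M f \<Longrightarrow> psn a \<rho> (M ^ m) (\<lambda>x. f x ^ m)"
proof (induction m)
  case 0
  show ?case using psn_const[OF psn_pos[OF 0], of a 1] by simp
next
  case (Suc m)
  show ?case using psn_mult[OF Suc.prems Suc.IH[OF Suc.prems]] by simp
qed

lemma psn_prod:
  assumes "\<rho> > 0" "finite I" "\<And>i. i \<in> I \<Longrightarrow> psn a \<rho> (M i) (f i)"
  shows "psn a \<rho> (prod M I) (\<lambda>x. \<Prod>i\<in>I. f i x)"
  using assms(2,3)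
proof (induction I)
  case empty
  show ?case using psn_const[OF assms(1), of a 1] by simp
next
  case (insert i I)
  have "psn a \<rho> (M i * prod M I) (\<lambda>x. f i x * (\<Prod>i\<in>I. f i x))"
    by (rule psn_mult) (use insert in auto)
  thus ?case using insert.hyps by simp
qed

lemma psn_mpow:
  fixes g :: "'p::finite \<Rightarrow> 'k::real_or_complex ^ 'n::finite \<Rightarrow> 'k"
  assumes "\<And>i. psn a \<rho> \<sigma> (g i)"
  shows "psn a \<rho> (\<sigma> ^ mdeg \<alpha>) (\<lambda>x. mpow (\<chi> i. g i x) \<alpha>)"
proof -
  have \<rho>: "\<rho> > 0" by (rule psn_pos[OF assms[of undefined]])
  have "psn a \<rho> (\<Prod>i\<in>UNIV. \<sigma> ^ \<alpha> i) (\<lambda>x. \<Prod>i\<in>UNIV. g i x ^ \<alpha> i)"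
    by (rule psn_prod[OF \<rho> _ psn_power[OF assms]]) simp
  thus ?thesis by (simp add: mpow_def mdeg_def power_sum)
qed

lemma psn_cmult:
  assumes "psn a \<rho> M f" shows "psn a \<rho> (norm c * M) (\<lambda>x. c * f x)"
  by (rule psn_mult[OF psn_const[OF psn_pos[OF assms]] assms])

text \<open>Substitution is legitimate as soon as the inner functions, measured from the centre
  \<open>b\<close>, have norm at most the outer radius; by submultiplicativity each outer term then
  keeps its weight as a bound.\<close>

lemma psn_compose:
  fixes g :: "'p::finite \<Rightarrow> 'k::real_or_complex ^ 'n::finite \<Rightarrow> 'k"
  assumes F: "has_expansion b \<sigma> c F" and g: "\<And>i. psn a \<rho> \<sigma> (\<lambda>x. g i x - b $ i)"
  shows "psn a \<rho> (\<Sum>\<^sub>\<infinity>\<alpha>. norm (c \<alpha>) * \<sigma> ^ mdeg \<alpha>) (\<lambda>x. F (\<chi> i. g i x))"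
proof (rule psn_infsum[OF psn_pos[OF g[of undefined]] _ has_expansionD(2)[OF F] order_refl])
  show "psn a \<rho> (norm (c \<alpha>) * \<sigma> ^ mdeg \<alpha>) (\<lambda>x. c \<alpha> * mpow (\<chi> i. g i x - b $ i) \<alpha>)" for \<alpha>
    by (rule psn_cmult[OF psn_mpow[OF g]])
  fix x assume x: "x \<in> polydisc a \<rho>"
  have w: "(\<chi> i. g i x) \<in> polydisc b \<sigma>"
    using psn_norm_le[OF g x] by (simp add: polydisc_def)
  have e: "(\<chi> i. g i x) - b = (\<chi> i. g i x - b $ i)" by (simp add: vec_eq_iff)
  show "((\<lambda>\<alpha>. c \<alpha> * mpow (\<chi> i. g i x - b $ i) \<alpha>) has_sum F (\<chi> i. g i x)) UNIV"
    using has_expansionD(3)[OF F w] unfolding e .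
qed

text \<open>Composition with the identity, whose components are written as x - a = (b - a) + (x - b)
  in order to bound their norm around the new centre.\<close>

lemma psn_recenter:
  fixes a b :: "'k::real_or_complex ^ 'n::finite"
  assumes f: "psn a \<rho> M f" and "\<rho>' > 0" and b: "\<And>i. norm (b $ i - a $ i) + \<rho>' \<le> \<rho>"
  shows "psn b \<rho>' M f"
proof -
  from f obtain c where c: "has_expansion a \<rho> c f"
    and M: "(\<Sum>\<^sub>\<infinity>\<alpha>. norm (c \<alpha>) * \<rho> ^ mdeg \<alpha>) \<le> M"
    by (auto simp: psn_def)
  have "psn b \<rho>' \<rho> (\<lambda>x. x $ i - a $ i)" for i
  proof -
    have "psn b \<rho>' (norm (b $ i - a $ i) + \<rho>') (\<lambda>x. (b $ i - a $ i) + (x $ i - b $ i))"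
      by (rule psn_add[OF psn_const[OF \<open>\<rho>' > 0\<close>] psn_coord[OF \<open>\<rho>' > 0\<close>]])
    thus ?thesis using b[of i] by (simp add: psn_mono)
  qed
  from psn_compose[where g = "\<lambda>i x. x $ i", OF c this]
  have "psn b \<rho>' (\<Sum>\<^sub>\<infinity>\<alpha>. norm (c \<alpha>) * \<rho> ^ mdeg \<alpha>) f" by (simp only: vec_nth_inverse vec_lambda_eta)
  thus ?thesis using M by (rule psn_mono)
qed

lemma dist_le_polydisc:
  fixes x a :: "'k::real_or_complex ^ 'n::finite" and \<rho> :: real
  assumes "x \<in> polydisc a \<rho>"
  shows "dist x a \<le> CARD('n) * \<rho>"
proof -
  have "dist x a \<le> (\<Sum>i\<in>UNIV. norm (x $ i - a $ i))"
    unfolding dist_norm norm_vec_def vector_minus_component by (rule L2_set_le_sum) simp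
  also have "\<dots> \<le> (\<Sum>i\<in>(UNIV::'n set). \<rho>)"
    by (rule sum_mono) (use assms in \<open>simp add: polydisc_def\<close>)
  finally show ?thesis by simp
qed

lemma cball_subset_polydisc: "cball a \<rho> \<subseteq> polydisc a \<rho>"
proof
  fix x assume "x \<in> cball a \<rho>"
  hence "norm (x - a) \<le> \<rho>" by (simp add: dist_norm norm_minus_commute)
  thus "x \<in> polydisc a \<rho>"
    using order_trans[OF Finite_Cartesian_Product.norm_nth_le, of "x - a" \<rho>]
    by (simp add: polydisc_def)
qed

lemma eventually_nhds_polydisc:
  fixes a :: "'k::real_or_complex ^ 'n::finite"
  shows "eventually P (nhds a) \<longleftrightarrow> (\<exists>\<rho>>0. \<forall>x\<in>polydisc a \<rho>. P x)"
proof
  assume "eventually P (nhds a)"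
  then obtain d where d: "d > 0" "\<And>x. dist x a < d \<Longrightarrow> P x"
    unfolding eventually_nhds_metric by blast
  define \<rho> where "\<rho> = d / (2 * CARD('n))"
  have "\<rho> > 0" using d by (simp add: \<rho>_def)
  moreover have "P x" if "x \<in> polydisc a \<rho>" for x
  proof (rule d(2))
    have "dist x a \<le> CARD('n) * \<rho>" by (rule dist_le_polydisc[OF that])
    also have "\<dots> < d" using d by (simp add: \<rho>_def)
    finally show "dist x a < d" .
  qed
  ultimately show "\<exists>\<rho>>0. \<forall>x\<in>polydisc a \<rho>. P x" by blast
next
  assume "\<exists>\<rho>>0. \<forall>x\<in>polydisc a \<rho>. P x"
  then obtain \<rho> where \<rho>: "\<rho> > 0" "\<And>x. x \<in> polydisc a \<rho> \<Longrightarrow> P x" by blast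
  show "eventually P (nhds a)"
    unfolding eventually_nhds_metric
  proof (intro exI conjI allI impI)
    fix x assume "dist x a < \<rho>"
    thus "P x" using cball_subset_polydisc[of a \<rho>] by (intro \<rho>) (auto simp: dist_commute)
  qed (rule \<rho>)
qed

subsection \<open>Analytic germs\<close>

text \<open>Functions are total, but only the behaviour near \<open>a\<close> counts; equality of
  germs is expressed by eventual equality in \<open>nhds a\<close>.\<close>

definition analytic_germ :: "'k::real_or_complex ^ 'n::finite \<Rightarrow> ('k ^ 'n \<Rightarrow> 'k) \<Rightarrow> bool" where
  "analytic_germ a f \<longleftrightarrow> (\<exists>\<rho> M. psn a \<rho> M f)"

lemma analytic_germ_cong:
  assumes f: "analytic_germ a f" and ev: "\<forall>\<^sub>F x in nhds a. f x = g x"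
  shows "analytic_germ a g"
proof -
  from f obtain \<rho> M where 1: "psn a \<rho> M f" by (auto simp: analytic_germ_def)
  from ev obtain r where r: "r > 0" "\<And>x. x \<in> polydisc a r \<Longrightarrow> f x = g x"
    unfolding eventually_nhds_polydisc by blast
  have "psn a (min r \<rho>) M f" by (rule psn_shrink[OF 1]) (use r psn_pos[OF 1] in auto)
  hence "psn a (min r \<rho>) M g"
    by (rule psn_cong) (use r polydisc_mono[of "min r \<rho>" r a] in auto)
  thus ?thesis by (auto simp: analytic_germ_def)
qed

lemma analytic_germ2E:
  assumes "analytic_germ a f" "analytic_germ a g"
  obtains \<rho> M N where "psn a \<rho> M f" "psn a \<rho> N g"
proof -
  from assms obtain \<rho> M \<rho>' N where 1: "psn a \<rho> M f" "psn a \<rho>' N g" by (auto simp: analytic_germ_def)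
  have "psn a (min \<rho> \<rho>') M f" "psn a (min \<rho> \<rho>') N g"
    by (rule psn_shrink[OF 1(1)] psn_shrink[OF 1(2)]; use psn_pos[OF 1(1)] psn_pos[OF 1(2)] in simp)+
  thus ?thesis by (rule that)
qed

named_theorems agerm

lemma analytic_germ_const [agerm]: "analytic_germ a (\<lambda>_. c)"
  unfolding analytic_germ_def using psn_const[of 1 a c] by auto

lemma analytic_germ_add [agerm]:
  "analytic_germ a f \<Longrightarrow> analytic_germ a g \<Longrightarrow> analytic_germ a (\<lambda>x. f x + g x)"
  by (erule (1) analytic_germ2E) (auto simp: analytic_germ_def dest: psn_add)

lemma analytic_germ_mult [agerm]:
  "analytic_germ a f \<Longrightarrow> analytic_germ a g \<Longrightarrow> analytic_germ a (\<lambda>x. f x * g x)"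
  by (erule (1) analytic_germ2E) (auto simp: analytic_germ_def dest: psn_mult)

lemma analytic_germ_minus [agerm]: "analytic_germ a f \<Longrightarrow> analytic_germ a (\<lambda>x. - f x)"
  using analytic_germ_mult[OF analytic_germ_const[of a "-1"]] by simp

lemma analytic_germ_diff [agerm]:
  "analytic_germ a f \<Longrightarrow> analytic_germ a g \<Longrightarrow> analytic_germ a (\<lambda>x. f x - g x)"
  using analytic_germ_add[OF _ analytic_germ_minus, of a f g] by simp

lemma analytic_germ_sum [agerm]:
  "(\<And>i. i \<in> I \<Longrightarrow> analytic_germ a (f i)) \<Longrightarrow> analytic_germ a (\<lambda>x. \<Sum>i\<in>I. f i x)"
  by (induction I rule: infinite_finite_induct) (auto intro: agerm)

lemma analytic_germ_coord [agerm]: "analytic_germ a (\<lambda>x. x $ i)"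
proof -
  have "analytic_germ a (\<lambda>x. x $ i - a $ i)"
    unfolding analytic_germ_def using psn_coord[of 1 a i] by auto
  from analytic_germ_add[OF this analytic_germ_const[of a "a $ i"]] show ?thesis by simp
qed

lemma analytic_germ_small:
  assumes "analytic_germ a f" and "f a = 0" and "\<epsilon> > 0"
  obtains r where "r > 0" "\<And>\<rho>. 0 < \<rho> \<Longrightarrow> \<rho> \<le> r \<Longrightarrow> psn a \<rho> \<epsilon> f"
proof -
  from assms(1) obtain R M where 1: "psn a R M f" by (auto simp: analytic_germ_def)
  have R: "R > 0" and M: "M \<ge> 0" using psn_pos[OF 1] psn_nonneg[OF 1] by auto
  \<comment> \<open>The norm \<open>M\<close> may be 0, hence \<open>M + 1\<close> in the
    denominator.\<close>
  define r where "r = min R (\<epsilon> * R / (M + 1))"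
  have "r > 0" using R M assms(3) by (simp add: r_def)
  moreover have "psn a \<rho> \<epsilon> f" if "0 < \<rho>" "\<rho> \<le> r" for \<rho>
  proof (rule psn_mono[OF psn_vanish[OF 1 assms(2)]])
    have "\<rho> \<le> \<epsilon> * R / (M + 1)" using that by (simp add: r_def)
    hence "\<rho> * (M + 1) \<le> \<epsilon> * R" using M by (simp add: pos_le_divide_eq)
    moreover have "\<rho> * M \<le> \<rho> * (M + 1)" using that by simp
    ultimately have "M * \<rho> \<le> \<epsilon> * R" by (simp add: mult.commute)
    thus "M * \<rho> / R \<le> \<epsilon>" using R by (simp add: pos_divide_le_eq)
  qed (use that in \<open>auto simp: r_def\<close>)
  ultimately show ?thesis by (rule that)
qed

lemma analytic_germ_compose:
  fixes g :: "'p::finite \<Rightarrow> 'k::real_or_complex ^ 'n::finite \<Rightarrow> 'k"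
  assumes F: "analytic_germ b F" and g: "\<And>i. analytic_germ a (g i)" and b: "\<And>i. g i a = b $ i"
  shows "analytic_germ a (\<lambda>x. F (\<chi> i. g i x))"
proof -
  from F obtain \<sigma> c where c: "has_expansion b \<sigma> c F" by (auto simp: analytic_germ_def psn_def)
  have \<sigma>: "\<sigma> > 0" using has_expansionD(1)[OF c] .
  have "\<exists>r. r > 0 \<and> (\<forall>\<rho>. 0 < \<rho> \<longrightarrow> \<rho> \<le> r \<longrightarrow> psn a \<rho> \<sigma> (\<lambda>x. g i x - b $ i))" for i
    by (rule analytic_germ_small[OF analytic_germ_diff[OF g[of i] analytic_germ_const[of a "b $ i"]] _ \<sigma>])
      (use b in auto)
  then obtain r where r: "\<And>i. r i > 0"
    "\<And>i \<rho>. 0 < \<rho> \<Longrightarrow> \<rho> \<le> r i \<Longrightarrow> psn a \<rho> \<sigma> (\<lambda>x. g i x - b $ i)" by metis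
  have "Min (range r) > 0" using r(1) by (subst Min_gr_iff) auto
  hence "psn a (Min (range r)) \<sigma> (\<lambda>x. g i x - b $ i)" for i by (intro r(2)) auto
  from psn_compose[OF c this] show ?thesis by (auto simp: analytic_germ_def)
qed

lemma eventually_analytic_germ:
  assumes "analytic_germ a f"
  shows "\<forall>\<^sub>F x in nhds a. analytic_germ x f"
proof -
  from assms obtain \<rho> M where 1: "psn a \<rho> M f" by (auto simp: analytic_germ_def)
  have \<rho>: "\<rho> > 0" using psn_pos[OF 1] .
  have "analytic_germ x f" if "x \<in> polydisc a (\<rho> / 2)" for x
  proof -
    have "psn x (\<rho> / 2) M f"
    proof (rule psn_recenter[OF 1])
      show "norm (x $ i - a $ i) + \<rho> / 2 \<le> \<rho>" for i
        using that[unfolded polydisc_def, simplified, rule_format, of i] by linarith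
    qed (use \<rho> in simp)
    thus ?thesis by (auto simp: analytic_germ_def)
  qed
  thus ?thesis unfolding eventually_nhds_polydisc using \<rho> by (intro exI[of _ "\<rho> / 2"]) auto
qed

text \<open>Substitution into a power series in one variable; it provides inverses through the
  geometric series, and the exponential.\<close>

lemma psn_nat_series:
  assumes u: "psn a \<rho> r u" and s: "summable (\<lambda>m. norm (c m) * r ^ m)"
    and F: "\<And>z. norm z \<le> r \<Longrightarrow> (\<lambda>m. c m * z ^ m) sums F z"
  shows "analytic_germ a (\<lambda>x. F (u x))"
proof -
  have r: "r \<ge> 0" by (rule psn_nonneg[OF u])
  have "psn a \<rho> (\<Sum>\<^sub>\<infinity>m. norm (c m) * r ^ m) (\<lambda>x. F (u x))"
  proof (rule psn_infsum[OF psn_pos[OF u] _ _ order_refl])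
    show "psn a \<rho> (norm (c m) * r ^ m) (\<lambda>x. c m * u x ^ m)" for m
      by (rule psn_cmult[OF psn_power[OF u]])
    show "(\<lambda>m. norm (c m) * r ^ m) summable_on UNIV"
      using s r by (subst summable_on_UNIV_nonneg_real_iff) auto
    fix x assume "x \<in> polydisc a \<rho>"
    hence x: "norm (u x) \<le> r" by (rule psn_norm_le[OF u])
    have "summable (\<lambda>m. norm (c m * u x ^ m))"
      by (rule summable_comparison_test'[OF s, of 0])
        (use x in \<open>simp add: norm_mult norm_power mult_left_mono power_mono\<close>)
    from norm_summable_imp_has_sum[OF this F[OF x]]
    show "((\<lambda>m. c m * u x ^ m) has_sum F (u x)) UNIV" .
  qed
  thus ?thesis by (auto simp: analytic_germ_def)
qed

lemma analytic_germ_inverse [agerm]: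
  assumes f: "analytic_germ a f" and "f a \<noteq> 0"
  shows "analytic_germ a (\<lambda>x. inverse (f x))"
proof -
  \<comment> \<open>Since f = f(a) (1 - u) with u(a) = 0, the inverse is a geometric series in
    \<open>u\<close>.\<close>
  define u where "u x = 1 - inverse (f a) * f x" for x
  have u: "analytic_germ a u" unfolding u_def by (intro agerm f)
  have "u a = 0" using assms(2) by (simp add: u_def)
  from analytic_germ_small[OF u this, of "1/2"] obtain r where r: "r > 0" "psn a r (1/2) u"
    by (metis half_gt_zero_iff zero_less_one order_refl)
  have "analytic_germ a (\<lambda>x. 1 / (1 - u x))"
  proof (rule psn_nat_series[OF r(2), of "\<lambda>_. 1"])
    show "summable (\<lambda>m. norm (1::'a) * (1/2) ^ m)" by (simp add: summable_geometric)
    show "(\<lambda>m. 1 * z ^ m) sums (1 / (1 - z))" if "norm z \<le> 1/2" for z :: 'a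
      using geometric_sums[of z] that by simp
  qed
  from analytic_germ_mult[OF analytic_germ_const[of a "inverse (f a)"] this]
  show ?thesis using assms(2) by (simp add: u_def field_simps)
qed

lemma analytic_germ_exp [agerm]:
  assumes f: "analytic_germ a f"
  shows "analytic_germ a (\<lambda>x. exp (f x))"
proof -
  from f obtain \<rho> r where 1: "psn a \<rho> r f" by (auto simp: analytic_germ_def)
  show ?thesis
  proof (rule psn_nat_series[OF 1, of "\<lambda>m. inverse (fact m)"])
    show "summable (\<lambda>m. norm (inverse (fact m) :: 'a) * r ^ m)"
      using summable_exp[of r] by (simp add: norm_inverse)
    show "(\<lambda>m. inverse (fact m) * z ^ m) sums exp z" for z :: 'a
      using exp_converges[of z] by (simp add: scaleR_conv_of_real)
  qed
qed

subsection \<open>Derivatives and jets\<close>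

definition minc :: "'n \<Rightarrow> ('n \<Rightarrow> nat) \<Rightarrow> 'n \<Rightarrow> nat" where
  "minc i \<alpha> = \<alpha>(i := Suc (\<alpha> i))"

text \<open>An exponent 0 stays 0. In the derivative of a monomial the factor
  \<open>\<alpha> i\<close> annihilates that term anyway.\<close>

definition mdec :: "'n \<Rightarrow> ('n \<Rightarrow> nat) \<Rightarrow> 'n \<Rightarrow> nat" where
  "mdec i \<alpha> = \<alpha>(i := \<alpha> i - 1)"

lemma mdec_minc [simp]: "mdec i (minc i \<alpha>) = \<alpha>"
  by (simp add: mdec_def minc_def)

lemma minc_mdec: "\<alpha> i \<noteq> 0 \<Longrightarrow> minc i (mdec i \<alpha>) = \<alpha>"
  by (simp add: mdec_def minc_def)

lemma minc_commute: "minc i (minc j \<alpha>) = minc j (minc i \<alpha>)"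
  by (auto simp: minc_def fun_eq_iff)

lemma minc_apply: "minc i \<alpha> j = (if j = i then Suc (\<alpha> j) else \<alpha> j)"
  by (simp add: minc_def)

lemma minc_same [simp]: "minc i \<alpha> i = Suc (\<alpha> i)"
  by (simp add: minc_def)

lemma minc_conv_add: "minc i \<alpha> = (\<lambda>j. \<alpha> j + (if j = i then 1 else 0))"
  by (auto simp: minc_def)

lemma mdeg_minc [simp]: "mdeg (minc i \<alpha>) = Suc (mdeg \<alpha>)"
  unfolding minc_conv_add mdeg_add mdeg_single by simp

lemma mdeg_pos_imp: "mdeg \<alpha> = Suc m \<Longrightarrow> \<exists>i \<beta>. \<alpha> = minc i \<beta> \<and> mdeg \<beta> = m"
proof -
  assume m: "mdeg \<alpha> = Suc m"
  then obtain i where "\<alpha> i \<noteq> 0" using mdeg_eq_0_iff[of \<alpha>] by auto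
  hence "\<alpha> = minc i (mdec i \<alpha>)" by (simp add: minc_mdec)
  with m show ?thesis by (metis mdeg_minc nat.inject)
qed

lemma mpow_has_derivative:
  fixes a :: "'k::real_or_complex ^ 'n::finite"
  shows "((\<lambda>x. mpow (x - a) \<alpha>) has_derivative
    (\<lambda>h. \<Sum>i\<in>UNIV. of_nat (\<alpha> i) * mpow (x - a) (mdec i \<alpha>) * h $ i)) (at x within S)"
proof -
  have 1: "((\<lambda>x. (x - a) $ i) has_derivative (\<lambda>h. h $ i)) (at x within S)" for i
    unfolding vector_minus_component
    by (rule has_derivative_eq_rhs[OF has_derivative_diff[OF
          bounded_linear_imp_has_derivative[OF bounded_linear_vec_nth] has_derivative_const]]) simp
  have "((\<lambda>x. \<Prod>i\<in>UNIV. (x - a) $ i ^ \<alpha> i) has_derivative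
      (\<lambda>h. \<Sum>i\<in>UNIV. (of_nat (\<alpha> i) * h $ i * (x - a) $ i ^ (\<alpha> i - 1)) *
        (\<Prod>j\<in>UNIV - {i}. (x - a) $ j ^ \<alpha> j))) (at x within S)"
    by (intro has_derivative_prod has_derivative_power 1)
  moreover have "mpow (x - a) (mdec i \<alpha>) =
      (x - a) $ i ^ (\<alpha> i - 1) * (\<Prod>j\<in>UNIV - {i}. (x - a) $ j ^ \<alpha> j)" for i
    unfolding mpow_def by (subst prod.remove[of _ i]) (auto simp: mdec_def intro!: prod.cong)
  ultimately show ?thesis
    by (simp add: mpow_def mult_ac)
qed

lemma convex_polydisc: "convex (polydisc a \<rho>)"
proof (rule convexI)
  fix x y and u v :: real
  assume x: "x \<in> polydisc a \<rho>" and y: "y \<in> polydisc a \<rho>" and uv: "0 \<le> u" "0 \<le> v" "u + v = 1"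
  show "u *\<^sub>R x + v *\<^sub>R y \<in> polydisc a \<rho>"
    unfolding polydisc_def
  proof (intro CollectI allI)
    fix i
    have "(u *\<^sub>R x + v *\<^sub>R y) $ i - a $ i = u *\<^sub>R (x $ i - a $ i) + v *\<^sub>R (y $ i - a $ i)"
      using uv(3) by (simp add: algebra_simps flip: scaleR_add_left)
    also have "norm \<dots> \<le> u * norm (x $ i - a $ i) + v * norm (y $ i - a $ i)"
      using uv by (intro order_trans[OF norm_triangle_ineq]) simp
    also have "\<dots> \<le> u * \<rho> + v * \<rho>"
      using x y uv by (intro add_mono mult_left_mono) (auto simp: polydisc_def)
    also have "\<dots> = \<rho>" using uv(3) by (simp flip: distrib_right)
    finally show "norm ((u *\<^sub>R x + v *\<^sub>R y) $ i - a $ i) \<le> \<rho>" .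
  qed
qed

text \<open>Differentiation multiplies a coefficient by its exponent, and a smaller radius pays for
  this with a constant independent of \<open>m\<close>: with t = r/\<rho>, the number m t^m is at
  most the geometric sum of the t^j with j < m.\<close>

lemma of_nat_power_le:
  fixes r \<rho> :: real
  assumes "0 < r" "r < \<rho>"
  shows "real m * r ^ (m - 1) \<le> (\<rho> / (r * (\<rho> - r))) * \<rho> ^ m"
proof (cases m)
  case 0
  thus ?thesis using assms by simp
next
  case (Suc l)
  define t where "t = r / \<rho>"
  have t: "0 < t" "t < 1" using assms by (auto simp: t_def)
  have "real m * t ^ m = (\<Sum>j<m. t ^ m)" by simp
  also have "\<dots> \<le> (\<Sum>j<m. t ^ j)"
    by (rule sum_mono) (use t in \<open>simp add: power_decreasing\<close>)
  also have "\<dots> = (1 - t ^ m) / (1 - t)" using t by (subst sum_gp_strict) auto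
  also have "\<dots> \<le> 1 / (1 - t)" using t by (intro divide_right_mono) auto
  also have "\<dots> = \<rho> / (\<rho> - r)" using assms by (simp add: t_def field_simps)
  finally have "real m * t ^ m * (\<rho> ^ m / r) \<le> \<rho> / (\<rho> - r) * (\<rho> ^ m / r)"
    using assms by (intro mult_right_mono) auto
  moreover have "real m * r ^ (m - 1) = real m * t ^ m * (\<rho> ^ m / r)"
    using assms Suc by (simp add: t_def power_divide)
  moreover have "\<rho> / (\<rho> - r) * (\<rho> ^ m / r) = (\<rho> / (r * (\<rho> - r))) * \<rho> ^ m"
    by simp
  ultimately show ?thesis by (simp only:)
qed

text \<open>Termwise differentiation. The intermediate radius \<open>r\<close> leaves room on both
  sides: below \<rho> for the convergence of the differentiated series, above \<rho>' for a
  neighbourhood of each point of the smaller polydisc.\<close>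

lemma expansion_deriv:
  fixes a :: "'k::real_or_complex ^ 'n::finite"
  assumes c: "has_expansion a \<rho> c f" and \<rho>': "0 < \<rho>'" "\<rho>' < \<rho>"
  obtains g where "\<And>i. has_expansion a \<rho>' (\<lambda>\<beta>. of_nat (Suc (\<beta> i)) * c (minc i \<beta>)) (g i)"
    and "\<And>x. x \<in> polydisc a \<rho>' \<Longrightarrow> (f has_derivative (\<lambda>h. \<Sum>i\<in>UNIV. g i x * h $ i)) (at x)"
proof -
  define r where "r = (\<rho>' + \<rho>) / 2"
  have r: "0 < r" "r < \<rho>" "\<rho>' < r" using \<rho>' by (auto simp: r_def)
  define t where "t i \<alpha> x = of_nat (\<alpha> i) * c \<alpha> * mpow (x - a) (mdec i \<alpha>)" for i \<alpha> x
  define C where "C = \<rho> / (r * (\<rho> - r))"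
  define m where "m \<alpha> = C * (norm (c \<alpha>) * \<rho> ^ mdeg \<alpha>)" for \<alpha>
  have ms: "m summable_on UNIV"
    unfolding m_def by (rule summable_on_cmult_right[OF has_expansionD(2)[OF c]])
  have C0: "C \<ge> 0" using r by (simp add: C_def)
  have m0: "m \<alpha> \<ge> 0" for \<alpha> using C0 r by (simp add: m_def)
  have bnd: "real (\<alpha> i) * norm (c \<alpha>) * r ^ mdeg (mdec i \<alpha>) \<le> m \<alpha>" for i \<alpha>
  proof (cases "\<alpha> i = 0")
    case True thus ?thesis using m0 by simp
  next
    case False
    hence d: "mdeg \<alpha> = Suc (mdeg (mdec i \<alpha>))" using mdeg_minc[of i "mdec i \<alpha>"] by (simp add: minc_mdec)
    have "\<alpha> i \<le> mdeg \<alpha>" unfolding mdeg_def by (rule member_le_sum) auto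
    hence "real (\<alpha> i) * r ^ mdeg (mdec i \<alpha>) \<le> real (mdeg \<alpha>) * r ^ (mdeg \<alpha> - 1)"
      using r d by (simp add: mult_right_mono)
    also have "\<dots> \<le> C * \<rho> ^ mdeg \<alpha>" unfolding C_def by (rule of_nat_power_le) (use r in auto)
    finally have "real (\<alpha> i) * r ^ mdeg (mdec i \<alpha>) * norm (c \<alpha>) \<le> C * \<rho> ^ mdeg \<alpha> * norm (c \<alpha>)"
      by (rule mult_right_mono) simp
    thus ?thesis by (simp add: m_def mult_ac)
  qed
  have tb: "norm (t i \<alpha> x) \<le> m \<alpha>" if "x \<in> polydisc a r" for i \<alpha> x
    by (rule order_trans[OF _ bnd[of \<alpha> i]])
      (use expansion_term_le[OF that, of "of_nat (\<alpha> i) * c \<alpha>" "mdec i \<alpha>"] in \<open>simp add: t_def norm_mult\<close>)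
  define g where "g i x = (\<Sum>\<^sub>\<infinity>\<alpha>. t i \<alpha> x)" for i x
  have ts: "((\<lambda>\<alpha>. t i \<alpha> x) has_sum g i x) UNIV" if "x \<in> polydisc a r" for i x
  proof -
    have 1: "(\<lambda>\<alpha>. norm (t i \<alpha> x)) summable_on UNIV"
      by (rule summable_on_comparison_test[OF ms tb[OF that]]) simp
    show ?thesis unfolding g_def by (rule has_sum_infsum[OF abs_summable_summable[OF 1]])
  qed
  \<comment> \<open>Terms with exponent 0 in direction i disappear, so the differentiated family may
    be reindexed by \<alpha> \<mapsto> \<open>minc i \<alpha>\<close>, which gives it the shape of a
    power series again.\<close>
  have re: "((\<lambda>\<alpha>. h (minc i \<alpha>)) has_sum s) UNIV \<longleftrightarrow> (h has_sum s) UNIV"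
    if "\<And>\<alpha>. \<alpha> i = 0 \<Longrightarrow> h \<alpha> = 0" for h :: "('n \<Rightarrow> nat) \<Rightarrow> 'b::{comm_monoid_add,topological_space}" and s i
  proof -
    have "((\<lambda>\<alpha>. h (minc i \<alpha>)) has_sum s) UNIV \<longleftrightarrow> (h has_sum s) {\<alpha>. \<alpha> i \<noteq> 0}"
      by (rule has_sum_reindex_bij_witness[of _ "mdec i" "minc i"]) (simp_all add: minc_mdec)
    also have "\<dots> \<longleftrightarrow> (h has_sum s) UNIV"
      by (rule has_sum_cong_neutral) (auto simp: that)
    finally show ?thesis .
  qed
  have re': "(\<lambda>\<alpha>. h (minc i \<alpha>)) summable_on UNIV \<longleftrightarrow> h summable_on UNIV"
    if "\<And>\<alpha>. \<alpha> i = 0 \<Longrightarrow> h \<alpha> = 0" for h :: "('n \<Rightarrow> nat) \<Rightarrow> real" and i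
    using re[of i h, OF that] by (simp add: summable_on_def)
  show ?thesis
  proof
    fix i
    have "has_expansion a r (\<lambda>\<beta>. of_nat (Suc (\<beta> i)) * c (minc i \<beta>)) (g i)"
      unfolding has_expansion_def
    proof (intro conjI ballI r)
      have "(\<lambda>\<alpha>. real (\<alpha> i) * norm (c \<alpha>) * r ^ mdeg (mdec i \<alpha>)) summable_on UNIV"
        by (rule summable_on_comparison_test[OF ms bnd]) (use r in simp)
      thus "(\<lambda>\<alpha>. norm (of_nat (Suc (\<alpha> i)) * c (minc i \<alpha>)) * r ^ mdeg \<alpha>) summable_on UNIV"
        by (subst (asm) re'[of i, symmetric]) (simp_all add: norm_mult del: of_nat_Suc)
      fix x assume "x \<in> polydisc a r"
      from ts[OF this, of i]
      show "((\<lambda>\<alpha>. of_nat (Suc (\<alpha> i)) * c (minc i \<alpha>) * mpow (x - a) \<alpha>) has_sum g i x) UNIV"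
        by (subst (asm) re[of i, symmetric]) (simp_all add: t_def del: of_nat_Suc)
    qed
    thus "has_expansion a \<rho>' (\<lambda>\<beta>. of_nat (Suc (\<beta> i)) * c (minc i \<beta>)) (g i)"
      by (rule has_expansion_shrink) (use r \<rho>' in auto)
  next
    fix x assume x: "x \<in> polydisc a \<rho>'"
    have xr: "x \<in> polydisc a r" using x polydisc_mono[of \<rho>' r a] r by auto
    \<comment> \<open>Differentiation of series is a statement about sequences, so the multi-indices
      are enumerated by a bijection \<open>e\<close> with the natural numbers.\<close>
    have "infinite (UNIV :: ('n \<Rightarrow> nat) set)"
    proof
      assume "finite (UNIV :: ('n \<Rightarrow> nat) set)"
      hence "finite (range (mdeg :: ('n \<Rightarrow> nat) \<Rightarrow> nat))" by simp
      moreover have "n \<in> range (mdeg :: ('n \<Rightarrow> nat) \<Rightarrow> nat)" for n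
        by (metis mdeg_single rangeI)
      hence "range (mdeg :: ('n \<Rightarrow> nat) \<Rightarrow> nat) = UNIV" by auto
      ultimately show False by simp
    qed
    then obtain e' :: "('n \<Rightarrow> nat) \<Rightarrow> nat" where "bij e'"
      by (rule countableE_infinite[OF countableI_type])
    define e where "e = inv e'"
    have e: "bij e" unfolding e_def by (rule bij_imp_bij_inv[OF \<open>bij e'\<close>])
    have hs: "((\<lambda>n. h (e n)) has_sum s) UNIV \<longleftrightarrow> (h has_sum s) UNIV"
      for h :: "('n \<Rightarrow> nat) \<Rightarrow> 'b::{comm_monoid_add,topological_space}" and s
      by (rule has_sum_reindex_bij_betw[OF e])
    have mse: "summable (\<lambda>n. m (e n))"
      using ms hs[of m] by (metis has_sum_imp_sums summable_on_def sums_summable)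
    have UL: "uniform_limit (polydisc a r) (\<lambda>N x. \<Sum>n<N. t i (e n) x) (g i) sequentially" for i
    proof -
      have "uniform_limit (polydisc a r) (\<lambda>N x. \<Sum>n<N. t i (e n) x) (\<lambda>x. suminf (\<lambda>n. t i (e n) x)) sequentially"
        by (rule Weierstrass_m_test[OF tb mse])
      moreover have "suminf (\<lambda>n. t i (e n) x) = g i x" if "x \<in> polydisc a r" for x
        using ts[OF that, of i] hs[of "\<lambda>\<alpha>. t i \<alpha> x"] by (metis has_sum_imp_sums sums_unique)
      ultimately show ?thesis by (simp cong: uniform_limit_cong')
    qed
    have D1: "((\<lambda>x. c (e n) * mpow (x - a) (e n)) has_derivative (\<lambda>h. \<Sum>i\<in>UNIV. t i (e n) x * h $ i))
        (at x within polydisc a r)" for n x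
      by (rule has_derivative_eq_rhs[OF has_derivative_mult_right[OF mpow_has_derivative]])
        (simp add: t_def sum_distrib_left mult_ac)
    have D2: "\<forall>\<^sub>F N in sequentially. \<forall>x\<in>polydisc a r. \<forall>h. norm ((\<Sum>n<N. \<Sum>i\<in>UNIV. t i (e n) x * h $ i) -
          (\<Sum>i\<in>UNIV. g i x * h $ i)) \<le> \<epsilon> * norm h" if "\<epsilon> > 0" for \<epsilon> :: real
    proof -
      define \<delta> where "\<delta> = \<epsilon> / CARD('n)"
      have "\<delta> > 0" using \<open>\<epsilon> > 0\<close> by (simp add: \<delta>_def)
      have "\<forall>\<^sub>F N in sequentially. \<forall>i. \<forall>x\<in>polydisc a r. dist (\<Sum>n<N. t i (e n) x) (g i x) < \<delta>"
        by (intro eventually_all_finite uniform_limitD[OF UL \<open>\<delta> > 0\<close>])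
      thus "\<forall>\<^sub>F N in sequentially. \<forall>x\<in>polydisc a r. \<forall>h. norm ((\<Sum>n<N. \<Sum>i\<in>UNIV. t i (e n) x * h $ i) -
          (\<Sum>i\<in>UNIV. g i x * h $ i)) \<le> \<epsilon> * norm h"
      proof eventually_elim
        case (elim N)
        show ?case
        proof (intro ballI allI)
          fix x h assume x: "x \<in> polydisc a r"
          have "(\<Sum>n<N. \<Sum>i\<in>UNIV. t i (e n) x * h $ i) - (\<Sum>i\<in>UNIV. g i x * h $ i) =
              (\<Sum>i\<in>UNIV. ((\<Sum>n<N. t i (e n) x) - g i x) * h $ i)"
            by (subst sum.swap) (simp add: sum_distrib_right left_diff_distrib sum_subtractf)
          also have "norm \<dots> \<le> (\<Sum>i\<in>(UNIV::'n set). \<delta> * norm h)"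
          proof (rule order_trans[OF norm_sum sum_mono])
            fix i
            have "norm ((\<Sum>n<N. t i (e n) x) - g i x) \<le> \<delta>"
              using elim x by (auto simp: dist_norm intro: less_imp_le)
            thus "norm (((\<Sum>n<N. t i (e n) x) - g i x) * h $ i) \<le> \<delta> * norm h"
              unfolding norm_mult using \<open>\<delta> > 0\<close>
              by (intro mult_mono Finite_Cartesian_Product.norm_nth_le) auto
          qed
          also have "\<dots> = \<epsilon> * norm h" by (simp add: \<delta>_def)
          finally show "norm ((\<Sum>n<N. \<Sum>i\<in>UNIV. t i (e n) x * h $ i) - (\<Sum>i\<in>UNIV. g i x * h $ i))
            \<le> \<epsilon> * norm h" .
        qed
      qed
    qed
    have D4: "(\<lambda>n. c (e n) * mpow (x - a) (e n)) sums f x"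
      using has_expansionD(3)[OF c, of x] x polydisc_mono[of \<rho>' \<rho> a] \<rho>' hs[of "\<lambda>\<alpha>. c \<alpha> * mpow (x - a) \<alpha>"]
      by (intro has_sum_imp_sums) auto
    have "\<exists>F. \<forall>x\<in>polydisc a r. (\<lambda>n. c (e n) * mpow (x - a) (e n)) sums F x \<and>
        (F has_derivative (\<lambda>h. \<Sum>i\<in>UNIV. g i x * h $ i)) (at x within polydisc a r)"
      by (rule has_derivative_series[OF convex_polydisc D1 D2 xr D4])
    then obtain F where F: "\<And>x. x \<in> polydisc a r \<Longrightarrow> (\<lambda>n. c (e n) * mpow (x - a) (e n)) sums F x"
      and dF: "\<And>x. x \<in> polydisc a r \<Longrightarrow>
        (F has_derivative (\<lambda>h. \<Sum>i\<in>UNIV. g i x * h $ i)) (at x within polydisc a r)" by blast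
    have Ff: "F y = f y" if "y \<in> polydisc a r" for y
    proof -
      have "(\<lambda>n. c (e n) * mpow (y - a) (e n)) sums f y"
        using has_expansionD(3)[OF c, of y] that polydisc_mono[of r \<rho> a] r hs[of "\<lambda>\<alpha>. c \<alpha> * mpow (y - a) \<alpha>"]
        by (intro has_sum_imp_sums) auto
      with F[OF that] show ?thesis by (rule sums_unique2)
    qed
    \<comment> \<open>Thus \<open>x\<close> is interior to the polydisc of radius \<open>r\<close>,
      and the derivative within that polydisc is a derivative in full neighbourhoods.\<close>
    have "polydisc x (r - \<rho>') \<subseteq> polydisc a r"
    proof
      fix y assume y: "y \<in> polydisc x (r - \<rho>')"
      show "y \<in> polydisc a r" unfolding polydisc_def
      proof (intro CollectI allI)
        fix i
        have "norm (y $ i - a $ i) \<le> norm (y $ i - x $ i) + norm (x $ i - a $ i)"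
          using norm_triangle_ineq[of "y $ i - x $ i" "x $ i - a $ i"] by simp
        also have "\<dots> \<le> (r - \<rho>') + \<rho>'" using x y by (intro add_mono) (auto simp: polydisc_def)
        finally show "norm (y $ i - a $ i) \<le> r" by simp
      qed
    qed
    hence "ball x (r - \<rho>') \<subseteq> polydisc a r"
      using cball_subset_polydisc[of x "r - \<rho>'"] ball_subset_cball by blast
    hence int: "x \<in> interior (polydisc a r)" using r unfolding mem_interior by (intro exI[of _ "r - \<rho>'"]) simp
    have "(f has_derivative (\<lambda>h. \<Sum>i\<in>UNIV. g i x * h $ i)) (at x within polydisc a r)"
      by (rule has_derivative_transform[OF xr _ dF[OF xr]]) (simp add: Ff)
    thus "(f has_derivative (\<lambda>h. \<Sum>i\<in>UNIV. g i x * h $ i)) (at x)"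
      using at_within_interior[OF int] by simp
  qed
qed

lemma partial_deriv_eqI:
  assumes "(f has_derivative (\<lambda>h. \<Sum>j\<in>UNIV. g j * h $ j)) (at x)"
  shows "partial_deriv i f x = g i"
proof -
  have "partial_deriv i f x = (\<Sum>j\<in>UNIV. g j * axis i 1 $ j)"
    unfolding partial_deriv_def frechet_derivative_at[OF assms, symmetric] ..
  also have "\<dots> = (\<Sum>j\<in>UNIV. if j = i then g j else 0)"
    by (rule sum.cong) (auto simp: axis_def)
  finally show ?thesis by simp
qed

lemma partial_deriv_expansion:
  fixes a :: "'k::real_or_complex ^ 'n::finite"
  assumes c: "has_expansion a \<rho> c f" and \<rho>': "0 < \<rho>'" "\<rho>' < \<rho>"
  shows "has_expansion a \<rho>' (\<lambda>\<beta>. of_nat (Suc (\<beta> i)) * c (minc i \<beta>)) (partial_deriv i f)"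
    and "x \<in> polydisc a \<rho>' \<Longrightarrow> (f has_derivative (\<lambda>h. \<Sum>i\<in>UNIV. partial_deriv i f x * h $ i)) (at x)"
proof -
  from expansion_deriv[OF assms] obtain g
    where g: "\<And>i. has_expansion a \<rho>' (\<lambda>\<beta>. of_nat (Suc (\<beta> i)) * c (minc i \<beta>)) (g i)"
      and d: "\<And>x. x \<in> polydisc a \<rho>' \<Longrightarrow> (f has_derivative (\<lambda>h. \<Sum>i\<in>UNIV. g i x * h $ i)) (at x)" by blast
  have e: "partial_deriv i f x = g i x" if "x \<in> polydisc a \<rho>'" for i x
    by (rule partial_deriv_eqI[OF d[OF that]])
  show "has_expansion a \<rho>' (\<lambda>\<beta>. of_nat (Suc (\<beta> i)) * c (minc i \<beta>)) (partial_deriv i f)"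
    by (rule has_expansion_cong[OF g]) (simp add: e)
  show "(f has_derivative (\<lambda>h. \<Sum>i\<in>UNIV. partial_deriv i f x * h $ i)) (at x)" if "x \<in> polydisc a \<rho>'"
    using d[OF that] by (simp add: e[OF that])
qed

lemma analytic_germE:
  assumes "analytic_germ a f"
  obtains \<rho> c where "has_expansion a \<rho> c f"
  using assms by (auto simp: analytic_germ_def psn_def)

lemma analytic_germI: "has_expansion a \<rho> c f \<Longrightarrow> analytic_germ a f"
  by (auto simp: analytic_germ_def psn_def)

lemma analytic_germ_partial_deriv [agerm]:
  assumes "analytic_germ a f" shows "analytic_germ a (partial_deriv i f)"
proof -
  obtain \<rho> c where c: "has_expansion a \<rho> c f" by (rule analytic_germE[OF assms])
  have "has_expansion a (\<rho> / 2) (\<lambda>\<beta>. of_nat (Suc (\<beta> i)) * c (minc i \<beta>)) (partial_deriv i f)"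
    by (rule partial_deriv_expansion[OF c]) (use has_expansionD(1)[OF c] in auto)
  thus ?thesis by (rule analytic_germI)
qed

lemma analytic_germ_has_derivative:
  assumes "analytic_germ a f"
  shows "(f has_derivative (\<lambda>h. \<Sum>i\<in>UNIV. partial_deriv i f a * h $ i)) (at a)"
proof -
  obtain \<rho> c where c: "has_expansion a \<rho> c f" by (rule analytic_germE[OF assms])
  show ?thesis
    by (rule partial_deriv_expansion(2)[OF c, of "\<rho> / 2"])
      (use has_expansionD(1)[OF c] in \<open>auto intro: center_in_polydisc\<close>)
qed

lemma eventually_eq_imp_partial_deriv_eq:
  fixes f g :: "'k::real_or_complex ^ 'n::finite \<Rightarrow> 'k"
  assumes "\<forall>\<^sub>F y in nhds x. f y = g y"
  shows "partial_deriv i f x = partial_deriv i g x"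
proof -
  have 1: "\<forall>\<^sub>F y in at x. f y = g y"
    using assms by (simp add: eventually_at_filter eventually_mono)
  hence 2: "\<forall>\<^sub>F y in at x. g y = f y" by (rule eventually_mono) simp
  have x: "f x = g x" by (rule eventually_nhds_x_imp_x[OF assms])
  have "(f has_derivative D) (at x) \<longleftrightarrow> (g has_derivative D) (at x)" for D
    using has_derivative_transform_eventually[OF _ 1 x] has_derivative_transform_eventually[OF _ 2 x[symmetric]]
    by blast
  thus ?thesis by (simp add: partial_deriv_def frechet_derivative_def)
qed

lemma eventually_partial_deriv_cong:
  fixes f g :: "'k::real_or_complex ^ 'n::finite \<Rightarrow> 'k"
  assumes "\<forall>\<^sub>F y in nhds x. f y = g y"
  shows "\<forall>\<^sub>F y in nhds x. partial_deriv i f y = partial_deriv i g y"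
proof -
  from assms have "\<forall>\<^sub>F y in nhds x. \<forall>\<^sub>F z in nhds y. f z = g z"
    by (simp only: eventually_eventually)
  thus ?thesis
    by (rule eventually_mono) (rule eventually_eq_imp_partial_deriv_eq)
qed

text \<open>Induction on the degree, for all functions at once: the constant coefficient is the
  value at the centre, and any other one is up to a positive factor a coefficient of lower degree of
  a partial derivative.\<close>

lemma expansion_unique:
  assumes "has_expansion a \<rho> c f" "has_expansion a \<rho>' d f"
  shows "c = d"
proof -
  have "c \<alpha> = d \<alpha>" if "mdeg \<alpha> = m" "has_expansion a \<rho> c f" "has_expansion a \<rho>' d f" for \<alpha> \<rho> \<rho>' c d f m
    using that
  proof (induction m arbitrary: \<alpha> \<rho> \<rho>' c d f)
    case 0
    hence "\<alpha> = (\<lambda>i. 0)" by (simp add: mdeg_eq_0_iff)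
    thus ?case using expansion_at_center[OF 0(2)] expansion_at_center[OF 0(3)] by simp
  next
    case (Suc m)
    from mdeg_pos_imp[OF Suc.prems(1)] obtain i \<beta> where \<beta>: "\<alpha> = minc i \<beta>" "mdeg \<beta> = m" by blast
    have c: "has_expansion a (\<rho>/2) (\<lambda>\<beta>. of_nat (Suc (\<beta> i)) * c (minc i \<beta>)) (partial_deriv i f)"
      by (rule partial_deriv_expansion[OF Suc.prems(2)]) (use has_expansionD(1)[OF Suc.prems(2)] in auto)
    have d: "has_expansion a (\<rho>'/2) (\<lambda>\<beta>. of_nat (Suc (\<beta> i)) * d (minc i \<beta>)) (partial_deriv i f)"
      by (rule partial_deriv_expansion[OF Suc.prems(3)]) (use has_expansionD(1)[OF Suc.prems(3)] in auto)
    from Suc.IH[OF \<beta>(2) c d] show ?case by (simp add: \<beta>(1) del: of_nat_Suc)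
  qed
  thus ?thesis using assms by (intro ext) blast
qed

definition mfact :: "('n::finite \<Rightarrow> nat) \<Rightarrow> nat" where
  "mfact \<alpha> = (\<Prod>i\<in>UNIV. fact (\<alpha> i))"

text \<open>The iterated partial derivatives at \<open>a\<close>. With the factor \<alpha>!
  differentiation is a pure shift of the multi-index, without numerical factors. The value is
  meaningful for analytic germs only.\<close>

definition jet :: "'k::real_or_complex ^ 'n::finite \<Rightarrow> ('k ^ 'n \<Rightarrow> 'k) \<Rightarrow> ('n \<Rightarrow> nat) \<Rightarrow> 'k" where
  "jet a f \<alpha> = of_nat (mfact \<alpha>) * (THE c. \<exists>\<rho>. has_expansion a \<rho> c f) \<alpha>"

lemma jet_eq: "has_expansion a \<rho> c f \<Longrightarrow> jet a f \<alpha> = of_nat (mfact \<alpha>) * c \<alpha>"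
  unfolding jet_def by (subst the_equality[of _ c]) (auto intro: expansion_unique)

lemma mfact_pos: "mfact \<alpha> > 0"
  by (simp add: mfact_def prod_pos)

lemma mfact_minc: "mfact (minc i \<alpha>) = Suc (\<alpha> i) * mfact \<alpha>"
proof -
  have "(\<Prod>j\<in>UNIV - {i}. fact (minc i \<alpha> j)) = (\<Prod>j\<in>UNIV - {i}. fact (\<alpha> j) :: nat)"
    by (rule prod.cong) (auto simp: minc_def)
  thus ?thesis unfolding mfact_def
    by (simp add: prod.remove[of UNIV i] algebra_simps)
qed

lemma jet_partial_deriv:
  assumes "analytic_germ a f"
  shows "jet a (partial_deriv i f) \<beta> = jet a f (minc i \<beta>)"
proof -
  obtain \<rho> c where c: "has_expansion a \<rho> c f" by (rule analytic_germE[OF assms])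
  have "has_expansion a (\<rho> / 2) (\<lambda>\<beta>. of_nat (Suc (\<beta> i)) * c (minc i \<beta>)) (partial_deriv i f)"
    by (rule partial_deriv_expansion[OF c]) (use has_expansionD(1)[OF c] in auto)
  from jet_eq[OF this] show ?thesis unfolding jet_eq[OF c] mfact_minc of_nat_mult by (simp only: mult_ac)
qed

lemma has_expansion_eventually_cong:
  assumes c: "has_expansion a \<rho> c f" and ev: "\<forall>\<^sub>F x in nhds a. f x = g x"
  obtains r where "has_expansion a r c g"
proof -
  from ev obtain r where r: "r > 0" "\<And>x. x \<in> polydisc a r \<Longrightarrow> f x = g x"
    unfolding eventually_nhds_polydisc by blast
  have "has_expansion a (min r \<rho>) c f"
    by (rule has_expansion_shrink[OF c]) (use r has_expansionD(1)[OF c] in auto)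
  hence "has_expansion a (min r \<rho>) c g"
    by (rule has_expansion_cong) (use r polydisc_mono[of "min r \<rho>" r a] in auto)
  thus ?thesis by (rule that)
qed

lemma jet_cong:
  assumes "analytic_germ a f" and ev: "\<forall>\<^sub>F x in nhds a. f x = g x"
  shows "jet a f = jet a g"
proof -
  obtain \<rho> c where c: "has_expansion a \<rho> c f" by (rule analytic_germE[OF assms(1)])
  obtain r where "has_expansion a r c g" by (rule has_expansion_eventually_cong[OF c ev])
  thus ?thesis by (auto simp: jet_eq[OF c] jet_eq)
qed

lemma eventually_eq_of_jet_eq:
  assumes f: "analytic_germ a f" and g: "analytic_germ a g" and e: "\<And>\<alpha>. jet a f \<alpha> = jet a g \<alpha>"
  shows "\<forall>\<^sub>F x in nhds a. f x = g x"
proof -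
  obtain \<rho> c where c: "has_expansion a \<rho> c f" by (rule analytic_germE[OF f])
  obtain \<rho>' d where d: "has_expansion a \<rho>' d g" by (rule analytic_germE[OF g])
  have "c \<alpha> = d \<alpha>" for \<alpha>
    using e[of \<alpha>] mfact_pos[of \<alpha>] by (simp add: jet_eq[OF c] jet_eq[OF d])
  hence "c = d" ..
  have "f x = g x" if "x \<in> polydisc a (min \<rho> \<rho>')" for x
  proof -
    have "x \<in> polydisc a \<rho>" "x \<in> polydisc a \<rho>'"
      using that polydisc_mono[of "min \<rho> \<rho>'" _ a] by (meson min.cobounded1 min.cobounded2 subsetD)+
    from has_expansionD(3)[OF c this(1)] has_expansionD(3)[OF d this(2)] show ?thesis
      unfolding \<open>c = d\<close> by (rule has_sum_unique)
  qed
  thus ?thesis unfolding eventually_nhds_polydisc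
    using has_expansionD(1)[OF c] has_expansionD(1)[OF d] by (intro exI[of _ "min \<rho> \<rho>'"]) auto
qed

lemma jet_lincomb:
  assumes f: "analytic_germ a f" and g: "analytic_germ a g"
  shows "jet a (\<lambda>x. f x + k * g x) \<alpha> = jet a f \<alpha> + k * jet a g \<alpha>"
proof -
  obtain \<rho>1 c where c1: "has_expansion a \<rho>1 c f" by (rule analytic_germE[OF f])
  obtain \<rho>2 d where d1: "has_expansion a \<rho>2 d g" by (rule analytic_germE[OF g])
  define \<rho> where "\<rho> = min \<rho>1 \<rho>2"
  have \<rho>: "\<rho> > 0" using has_expansionD(1)[OF c1] has_expansionD(1)[OF d1] by (simp add: \<rho>_def)
  have c: "has_expansion a \<rho> c f" by (rule has_expansion_shrink[OF c1 \<rho>]) (simp add: \<rho>_def)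
  have d: "has_expansion a \<rho> d g" by (rule has_expansion_shrink[OF d1 \<rho>]) (simp add: \<rho>_def)
  have "has_expansion a \<rho> (\<lambda>\<alpha>. c \<alpha> + k * d \<alpha>) (\<lambda>x. f x + k * g x)"
    unfolding has_expansion_def
  proof (intro conjI ballI \<rho>)
    have s: "(\<lambda>\<alpha>. norm (c \<alpha>) * \<rho> ^ mdeg \<alpha> + norm k * (norm (d \<alpha>) * \<rho> ^ mdeg \<alpha>)) summable_on UNIV"
      by (rule summable_on_add[OF has_expansionD(2)[OF c] summable_on_cmult_right[OF has_expansionD(2)[OF d]]])
    have "norm (c \<alpha> + k * d \<alpha>) * \<rho> ^ mdeg \<alpha>
        \<le> norm (c \<alpha>) * \<rho> ^ mdeg \<alpha> + norm k * (norm (d \<alpha>) * \<rho> ^ mdeg \<alpha>)" for \<alpha>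
    proof -
      have "norm (c \<alpha> + k * d \<alpha>) \<le> norm (c \<alpha>) + norm k * norm (d \<alpha>)"
        using norm_triangle_ineq[of "c \<alpha>" "k * d \<alpha>"] by (simp add: norm_mult)
      hence "norm (c \<alpha> + k * d \<alpha>) * \<rho> ^ mdeg \<alpha> \<le> (norm (c \<alpha>) + norm k * norm (d \<alpha>)) * \<rho> ^ mdeg \<alpha>"
        by (rule mult_right_mono) (use \<rho> in simp)
      thus ?thesis by (simp add: algebra_simps)
    qed
    from summable_on_comparison_test[OF s this]
    show "(\<lambda>\<alpha>. norm (c \<alpha> + k * d \<alpha>) * \<rho> ^ mdeg \<alpha>) summable_on UNIV" using \<rho> by simp
    fix x assume x: "x \<in> polydisc a \<rho>"
    from has_sum_add[OF has_expansionD(3)[OF c x] has_sum_cmult_right[OF has_expansionD(3)[OF d x], of k]]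
    show "((\<lambda>\<alpha>. (c \<alpha> + k * d \<alpha>) * mpow (x - a) \<alpha>) has_sum f x + k * g x) UNIV"
      by (simp only: distrib_right mult.assoc)
  qed
  from jet_eq[OF this] show ?thesis by (simp add: jet_eq[OF c] jet_eq[OF d] algebra_simps)
qed

lemma jet_zero: "jet a (\<lambda>x. 0) \<alpha> = 0"
  using jet_lincomb[OF analytic_germ_const[of a 0] analytic_germ_const[of a 0], of "-1"] by simp

lemma jet_diff:
  "analytic_germ a f \<Longrightarrow> analytic_germ a g \<Longrightarrow> jet a (\<lambda>x. f x - g x) \<alpha> = jet a f \<alpha> - jet a g \<alpha>"
  using jet_lincomb[of a f g "-1"] by simp

lemma jet_add:
  "analytic_germ a f \<Longrightarrow> analytic_germ a g \<Longrightarrow> jet a (\<lambda>x. f x + g x) \<alpha> = jet a f \<alpha> + jet a g \<alpha>"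
  using jet_lincomb[of a f g 1] by simp

lemma mfact_le: "mfact \<alpha> \<le> fact (mdeg \<alpha>)"
proof -
  have "(\<Prod>i\<in>I. fact (\<alpha> i)) \<le> (fact (\<Sum>i\<in>I. \<alpha> i) :: nat)" if "finite I" for I
    using that
  proof (induction I)
    case (insert i I)
    have "(\<Prod>i\<in>insert i I. fact (\<alpha> i)) \<le> fact (\<alpha> i) * (fact (\<Sum>i\<in>I. \<alpha> i) :: nat)"
      using insert by simp
    also have "\<dots> \<le> fact (\<alpha> i + (\<Sum>i\<in>I. \<alpha> i))"
      by (rule dvd_imp_le[OF fact_fact_dvd_fact]) simp
    finally show ?case using insert.hyps by simp
  qed simp
  thus ?thesis by (simp add: mfact_def mdeg_def)
qed

text \<open>A bound for the multinomial coefficient |\<alpha>|!/\<alpha>!, by splitting off one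
  variable at a time and estimating each binomial coefficient by a power of 2.\<close>

lemma fact_mdeg_le: "fact (mdeg \<alpha>) \<le> (2 ^ CARD('n)) ^ mdeg \<alpha> * mfact \<alpha>"
  for \<alpha> :: "'n::finite \<Rightarrow> nat"
proof -
  have "(fact (\<Sum>i\<in>I. \<alpha> i) :: nat) \<le> (2 ^ card I) ^ (\<Sum>i\<in>I. \<alpha> i) * (\<Prod>i\<in>I. fact (\<alpha> i))" if "finite I" for I
    using that
  proof (induction I)
    case (insert i I)
    let ?s = "\<Sum>i\<in>I. \<alpha> i" and ?m = "\<alpha> i"
    have "(fact (?m + ?s) :: nat) = (?m + ?s choose ?m) * (fact ?m * fact ?s)"
      using binomial_fact_lemma[of ?m "?m + ?s"] by (simp add: mult_ac)
    also have "\<dots> \<le> 2 ^ (?m + ?s) * (fact ?m * fact ?s)"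
      by (rule mult_right_mono[OF binomial_le_pow2]) simp
    also have "\<dots> \<le> 2 ^ (?m + ?s) * (fact ?m * ((2 ^ card I) ^ ?s * (\<Prod>i\<in>I. fact (\<alpha> i))))"
      by (intro mult_left_mono insert.IH) auto
    also have "\<dots> \<le> 2 ^ (?m + ?s) * (fact ?m * ((2 ^ card I) ^ (?m + ?s) * (\<Prod>i\<in>I. fact (\<alpha> i))))"
      by (intro mult_left_mono mult_right_mono power_increasing) auto
    finally show ?case using insert.hyps by (simp add: power_mult_distrib mult_ac)
  qed simp
  thus ?thesis by (simp add: mfact_def mdeg_def)
qed

text \<open>A finite set of multi-indices lies in a box, over which the sum is a product of partial
  geometric sums, each at most 2.\<close>

lemma summable_half_mdeg: "(\<lambda>\<alpha>::'n::finite \<Rightarrow> nat. (1/2::real) ^ mdeg \<alpha>) summable_on UNIV"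
proof (rule nonneg_bdd_above_summable_on)
  show "bdd_above (sum (\<lambda>\<alpha>::'n \<Rightarrow> nat. (1/2::real) ^ mdeg \<alpha>) ` {F. F \<subseteq> UNIV \<and> finite F})"
  proof (rule bdd_aboveI2)
    fix F :: "('n \<Rightarrow> nat) set" assume F: "F \<in> {F. F \<subseteq> UNIV \<and> finite F}"
    define N where "N = Max (mdeg ` F)"
    have "\<alpha> i \<le> N" if "\<alpha> \<in> F" for \<alpha> i
    proof -
      have "\<alpha> i \<le> mdeg \<alpha>" unfolding mdeg_def by (rule member_le_sum) auto
      also have "\<dots> \<le> N" unfolding N_def using F that by (intro Max_ge) auto
      finally show ?thesis .
    qed
    hence "F \<subseteq> PiE UNIV (\<lambda>_. {..N})" by auto
    hence "sum (\<lambda>\<alpha>. (1/2::real) ^ mdeg \<alpha>) F \<le> (\<Sum>\<alpha>\<in>PiE (UNIV::'n set) (\<lambda>_. {..N}). (1/2::real) ^ mdeg \<alpha>)"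
      by (rule sum_mono2[rotated]) (auto intro!: finite_PiE)
    also have "(\<Sum>\<alpha>\<in>PiE (UNIV::'n set) (\<lambda>_. {..N}). (1/2::real) ^ mdeg \<alpha>) =
        (\<Sum>\<alpha>\<in>PiE (UNIV::'n set) (\<lambda>_. {..N}). \<Prod>i\<in>UNIV. (1/2::real) ^ \<alpha> i)"
      by (simp add: mdeg_def power_sum)
    also have "\<dots> = (\<Prod>i\<in>(UNIV::'n set). \<Sum>m\<le>N. (1/2::real) ^ m)"
      by (subst prod_sum_PiE) auto
    also have "\<dots> \<le> (\<Prod>i\<in>(UNIV::'n set). 2)"
    proof (rule prod_mono)
      have "(\<Sum>m\<le>N. (1/2) ^ m) = (\<Sum>m<Suc N. (1/2::real) ^ m)" by (simp add: lessThan_Suc_atMost)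
      also have "\<dots> = (1 - (1/2) ^ Suc N) / (1 - 1/2)" by (subst sum_gp_strict) simp
      also have "\<dots> \<le> 2" by simp
      finally show "0 \<le> (\<Sum>m\<le>N. (1/2::real) ^ m) \<and> (\<Sum>m\<le>N. (1/2) ^ m) \<le> (2::real)" by (simp add: sum_nonneg)
    qed
    finally show "sum (\<lambda>\<alpha>. (1/2::real) ^ mdeg \<alpha>) F \<le> (\<Prod>i\<in>(UNIV::'n set). 2)" .
  qed
qed simp

text \<open>With |\<alpha>|! in place of \<alpha>! the bound depends on the degree alone, and is
  therefore insensitive to equations that move indices inside a multi-index.\<close>

definition jet_bounded :: "(('n::finite \<Rightarrow> nat) \<Rightarrow> 'k::real_or_complex) \<Rightarrow> bool" where
  "jet_bounded d \<longleftrightarrow> (\<exists>M R. \<forall>\<alpha>. norm (d \<alpha>) \<le> M * R ^ mdeg \<alpha> * fact (mdeg \<alpha>))"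

lemma jet_boundedE:
  assumes "jet_bounded d"
  obtains M R where "M \<ge> 0" "R \<ge> 1" "\<And>\<alpha>. norm (d \<alpha>) \<le> M * R ^ mdeg \<alpha> * fact (mdeg \<alpha>)"
proof -
  from assms obtain M R where 1: "\<And>\<alpha>. norm (d \<alpha>) \<le> M * R ^ mdeg \<alpha> * fact (mdeg \<alpha>)"
    by (auto simp: jet_bounded_def)
  have "norm (d \<alpha>) \<le> \<bar>M\<bar> * (max \<bar>R\<bar> 1) ^ mdeg \<alpha> * fact (mdeg \<alpha>)" for \<alpha>
  proof -
    have "M * R ^ mdeg \<alpha> \<le> \<bar>M\<bar> * \<bar>R\<bar> ^ mdeg \<alpha>"
      by (metis abs_ge_self abs_mult power_abs)
    also have "\<dots> \<le> \<bar>M\<bar> * (max \<bar>R\<bar> 1) ^ mdeg \<alpha>" by (intro mult_left_mono power_mono) auto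
    finally have "M * R ^ mdeg \<alpha> * fact (mdeg \<alpha>) \<le> \<bar>M\<bar> * (max \<bar>R\<bar> 1) ^ mdeg \<alpha> * fact (mdeg \<alpha>)"
      by (rule mult_right_mono) simp
    with 1[of \<alpha>] show ?thesis by linarith
  qed
  thus ?thesis by (intro that[of "\<bar>M\<bar>" "max \<bar>R\<bar> 1"]) auto
qed

lemma jet_bounded_jet:
  assumes "analytic_germ a f" shows "jet_bounded (jet a f)"
proof -
  obtain \<rho> c where c: "has_expansion a \<rho> c f" by (rule analytic_germE[OF assms])
  have \<rho>: "\<rho> > 0" by (rule has_expansionD(1)[OF c])
  let ?M = "\<Sum>\<^sub>\<infinity>\<alpha>. norm (c \<alpha>) * \<rho> ^ mdeg \<alpha>"
  have "norm (jet a f \<alpha>) \<le> ?M * (1 / \<rho>) ^ mdeg \<alpha> * fact (mdeg \<alpha>)" for \<alpha>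
  proof -
    have "infsum (\<lambda>\<alpha>. norm (c \<alpha>) * \<rho> ^ mdeg \<alpha>) {\<alpha>} \<le> ?M"
      by (rule infsum_mono2) (use has_expansionD(2)[OF c] \<rho> in auto)
    hence "norm (c \<alpha>) \<le> ?M * (1 / \<rho>) ^ mdeg \<alpha>" using \<rho> by (simp add: field_simps power_one_over)
    moreover have "real (mfact \<alpha>) \<le> fact (mdeg \<alpha>)" using mfact_le[of \<alpha>] by (metis of_nat_fact of_nat_le_iff)
    ultimately have "norm (c \<alpha>) * real (mfact \<alpha>) \<le> ?M * (1 / \<rho>) ^ mdeg \<alpha> * fact (mdeg \<alpha>)"
      using \<rho> by (intro mult_mono) (auto intro!: mult_nonneg_nonneg infsum_nonneg)
    thus ?thesis by (simp add: jet_eq[OF c] norm_mult mult.commute)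
  qed
  thus ?thesis by (auto simp: jet_bounded_def)
qed

lemma ex_germ_of_jet:
  fixes d :: "('n::finite \<Rightarrow> nat) \<Rightarrow> 'k::real_or_complex"
  assumes "jet_bounded d"
  obtains f where "analytic_germ a f" "jet a f = d"
proof -
  obtain M R where M: "M \<ge> 0" and R: "R \<ge> 1"
    and d: "\<And>\<alpha>. norm (d \<alpha>) \<le> M * R ^ mdeg \<alpha> * fact (mdeg \<alpha>)"
    using jet_boundedE[OF assms] by metis
  \<comment> \<open>|\<alpha>|!/\<alpha>! is at most K^|\<alpha>|, so with the radius chosen next
    the terms are dominated by M / 2^|\<alpha>|.\<close>
  define K :: real where "K = 2 ^ CARD('n)"
  have K: "K \<ge> 1" by (simp add: K_def)
  define \<rho> where "\<rho> = 1 / (2 * K * R)"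
  have \<rho>: "\<rho> > 0" using K R by (simp add: \<rho>_def)
  define c where "c \<alpha> = d \<alpha> / of_nat (mfact \<alpha>)" for \<alpha>
  define f where "f x = (\<Sum>\<^sub>\<infinity>\<alpha>. c \<alpha> * mpow (x - a) \<alpha>)" for x
  have cb: "norm (c \<alpha>) * \<rho> ^ mdeg \<alpha> \<le> M * (1/2) ^ mdeg \<alpha>" for \<alpha>
  proof -
    have "real (fact (mdeg \<alpha>)) \<le> real ((2 ^ CARD('n)) ^ mdeg \<alpha> * mfact \<alpha>)"
      using fact_mdeg_le[of \<alpha>] by (simp only: of_nat_le_iff)
    hence "fact (mdeg \<alpha>) \<le> K ^ mdeg \<alpha> * real (mfact \<alpha>)" by (simp add: K_def)
    hence "M * R ^ mdeg \<alpha> * fact (mdeg \<alpha>) \<le> M * R ^ mdeg \<alpha> * (K ^ mdeg \<alpha> * real (mfact \<alpha>))"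
      using M R by (intro mult_left_mono) auto
    with d[of \<alpha>] have "norm (d \<alpha>) \<le> M * R ^ mdeg \<alpha> * (K ^ mdeg \<alpha> * real (mfact \<alpha>))" by linarith
    hence "norm (c \<alpha>) \<le> M * (R * K) ^ mdeg \<alpha>"
      using mfact_pos[of \<alpha>] by (simp add: c_def norm_divide field_simps power_mult_distrib)
    hence "norm (c \<alpha>) * \<rho> ^ mdeg \<alpha> \<le> M * (R * K) ^ mdeg \<alpha> * \<rho> ^ mdeg \<alpha>"
      by (rule mult_right_mono) (use \<rho> in simp)
    also have "\<dots> = M * (R * K * \<rho>) ^ mdeg \<alpha>" by (simp add: power_mult_distrib)
    also have "R * K * \<rho> = 1/2" using K R by (simp add: \<rho>_def)
    finally show ?thesis .
  qed
  have "(\<lambda>\<alpha>. M * (1/2) ^ mdeg \<alpha>) summable_on (UNIV :: ('n \<Rightarrow> nat) set)"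
    by (rule summable_on_cmult_right[OF summable_half_mdeg])
  from summable_on_comparison_test[OF this cb] \<rho>
  have s: "(\<lambda>\<alpha>. norm (c \<alpha>) * \<rho> ^ mdeg \<alpha>) summable_on UNIV" by simp
  have "has_expansion a \<rho> c f"
    unfolding has_expansion_def
  proof (intro conjI ballI \<rho> s)
    fix x assume x: "x \<in> polydisc a \<rho>"
    have "(\<lambda>\<alpha>. norm (c \<alpha> * mpow (x - a) \<alpha>)) summable_on UNIV"
      by (rule summable_on_comparison_test[OF s expansion_term_le[OF x]]) simp
    thus "((\<lambda>\<alpha>. c \<alpha> * mpow (x - a) \<alpha>) has_sum f x) UNIV"
      unfolding f_def by (rule has_sum_infsum[OF abs_summable_summable])
  qed
  moreover from jet_eq[OF this] have "jet a f = d"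
    using mfact_pos by (simp add: c_def fun_eq_iff less_imp_neq[OF mfact_pos, symmetric])
  ultimately show ?thesis using that analytic_germI by blast
qed

subsection \<open>Rules for partial derivatives\<close>

text \<open>Differentiability over the ground field: over the complex numbers this is stronger than
  real differentiability.\<close>

definition kdiff :: "('k::real_or_complex ^ 'n::finite \<Rightarrow> 'k) \<Rightarrow> 'k ^ 'n \<Rightarrow> bool" where
  "kdiff f x \<longleftrightarrow> (f has_derivative (\<lambda>h. \<Sum>i\<in>UNIV. partial_deriv i f x * h $ i)) (at x)"

lemma kdiffI:
  assumes "(f has_derivative (\<lambda>h. \<Sum>j\<in>UNIV. g j * h $ j)) (at x)"
  shows "kdiff f x" and "partial_deriv i f x = g i"
  using assms partial_deriv_eqI[OF assms] by (simp_all add: kdiff_def)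

lemma analytic_germ_kdiff: "analytic_germ x f \<Longrightarrow> kdiff f x"
  unfolding kdiff_def by (rule analytic_germ_has_derivative)

lemma kdiff_const [simp]: "kdiff (\<lambda>_. c) x" and partial_deriv_const [simp]: "partial_deriv i (\<lambda>_. c) x = 0"
proof -
  have "((\<lambda>_. c) has_derivative (\<lambda>h. \<Sum>j\<in>UNIV. 0 * h $ j)) (at x)" by simp
  from kdiffI[OF this] show "kdiff (\<lambda>_. c) x" "partial_deriv i (\<lambda>_. c) x = 0" by blast+
qed

lemma kdiff_coord [simp]: "kdiff (\<lambda>x. x $ j) x"
  and partial_deriv_coord: "partial_deriv i (\<lambda>x. x $ j) x = (if i = j then 1 else 0)"
proof -
  have "((\<lambda>x. x $ j) has_derivative (\<lambda>h. \<Sum>i\<in>UNIV. (if i = j then 1 else 0) * h $ i)) (at x)"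
    by (rule has_derivative_eq_rhs[OF bounded_linear_imp_has_derivative[OF bounded_linear_vec_nth]])
      (simp add: if_distrib[of "\<lambda>c. c * _"] cong: if_cong)
  from kdiffI[OF this] show "kdiff (\<lambda>x. x $ j) x" "partial_deriv i (\<lambda>x. x $ j) x = (if i = j then 1 else 0)"
    by blast+
qed

lemma
  assumes f: "kdiff f x" and g: "kdiff g x"
  shows kdiff_add: "kdiff (\<lambda>x. f x + g x) x"
    and partial_deriv_add: "partial_deriv i (\<lambda>x. f x + g x) x = partial_deriv i f x + partial_deriv i g x"
    and kdiff_diff: "kdiff (\<lambda>x. f x - g x) x"
    and partial_deriv_diff: "partial_deriv i (\<lambda>x. f x - g x) x = partial_deriv i f x - partial_deriv i g x"
    and kdiff_mult: "kdiff (\<lambda>x. f x * g x) x"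
    and partial_deriv_mult: "partial_deriv i (\<lambda>x. f x * g x) x = partial_deriv i f x * g x + f x * partial_deriv i g x"
proof -
  note d = f[unfolded kdiff_def] g[unfolded kdiff_def]
  have "((\<lambda>x. f x + g x) has_derivative
      (\<lambda>h. \<Sum>j\<in>UNIV. (partial_deriv j f x + partial_deriv j g x) * h $ j)) (at x)"
    by (rule has_derivative_eq_rhs[OF has_derivative_add[OF d]]) (simp add: algebra_simps sum.distrib)
  from kdiffI[OF this] show "kdiff (\<lambda>x. f x + g x) x"
    "partial_deriv i (\<lambda>x. f x + g x) x = partial_deriv i f x + partial_deriv i g x" by blast+
  have "((\<lambda>x. f x - g x) has_derivative
      (\<lambda>h. \<Sum>j\<in>UNIV. (partial_deriv j f x - partial_deriv j g x) * h $ j)) (at x)"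
    by (rule has_derivative_eq_rhs[OF has_derivative_diff[OF d]]) (simp add: algebra_simps sum_subtractf)
  from kdiffI[OF this] show "kdiff (\<lambda>x. f x - g x) x"
    "partial_deriv i (\<lambda>x. f x - g x) x = partial_deriv i f x - partial_deriv i g x" by blast+
  have "((\<lambda>x. f x * g x) has_derivative
      (\<lambda>h. \<Sum>j\<in>UNIV. (partial_deriv j f x * g x + f x * partial_deriv j g x) * h $ j)) (at x)"
    by (rule has_derivative_eq_rhs[OF has_derivative_mult[OF d]])
      (simp add: algebra_simps sum.distrib sum_distrib_left)
  from kdiffI[OF this] show "kdiff (\<lambda>x. f x * g x) x"
    "partial_deriv i (\<lambda>x. f x * g x) x = partial_deriv i f x * g x + f x * partial_deriv i g x" by blast+
qed

lemma kdiff_cmult: "kdiff f x \<Longrightarrow> kdiff (\<lambda>x. c * f x) x"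
  and partial_deriv_cmult: "kdiff f x \<Longrightarrow> partial_deriv i (\<lambda>x. c * f x) x = c * partial_deriv i f x"
  using kdiff_mult[OF kdiff_const] partial_deriv_mult[OF kdiff_const, of f x i c] by simp_all

lemma kdiff_minus: "kdiff f x \<Longrightarrow> kdiff (\<lambda>x. - f x) x"
  and partial_deriv_minus: "kdiff f x \<Longrightarrow> partial_deriv i (\<lambda>x. - f x) x = - partial_deriv i f x"
  using kdiff_cmult[of f x "-1"] partial_deriv_cmult[of f x i "-1"] by simp_all

lemma kdiff_sum: "(\<And>j. j \<in> J \<Longrightarrow> kdiff (f j) x) \<Longrightarrow> kdiff (\<lambda>x. \<Sum>j\<in>J. f j x) x"
  and partial_deriv_sum: "(\<And>j. j \<in> J \<Longrightarrow> kdiff (f j) x) \<Longrightarrow>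
    partial_deriv i (\<lambda>x. \<Sum>j\<in>J. f j x) x = (\<Sum>j\<in>J. partial_deriv i (f j) x)"
proof (induction J rule: infinite_finite_induct)
  case (insert j J)
  { case 1
    thus ?case using insert kdiff_add[of "f j" x "\<lambda>x. \<Sum>j\<in>J. f j x"] by simp
  next
    case 2
    thus ?case using insert partial_deriv_add[of "f j" x "\<lambda>x. \<Sum>j\<in>J. f j x" i] by simp }
qed simp_all

lemma has_derivative_vec_lambda:
  fixes g :: "'p::finite \<Rightarrow> 'a::real_normed_vector \<Rightarrow> 'k::real_or_complex"
  assumes "\<And>j. (g j has_derivative g' j) (at x)"
  shows "((\<lambda>x. \<chi> j. g j x) has_derivative (\<lambda>h. \<chi> j. g' j h)) (at x)"
proof -
  have ax: "bounded_linear (\<lambda>c::'k. (axis j c :: 'k ^ 'p))" for j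
  proof (rule bounded_linear_intro[of _ 1])
    fix c :: 'k
    have "norm (axis j c :: 'k ^ 'p) \<le> (\<Sum>i\<in>UNIV. norm ((axis j c :: 'k ^ 'p) $ i))"
      unfolding norm_vec_def by (rule L2_set_le_sum) simp
    also have "\<dots> = (\<Sum>i\<in>UNIV. if i = j then norm c else 0)"
      by (rule sum.cong) (auto simp: axis_def)
    finally show "norm (axis j c :: 'k ^ 'p) \<le> norm c * 1" by simp
  qed (auto simp: vec_eq_iff axis_def)
  have e: "(\<chi> j. v j) = (\<Sum>j\<in>UNIV. axis j (v j))" for v :: "'p \<Rightarrow> 'k"
    by (simp add: vec_eq_iff axis_def)
  show ?thesis unfolding e
    by (intro has_derivative_sum bounded_linear.has_derivative[OF ax] assms)
qed

lemma
  fixes g :: "'p::finite \<Rightarrow> 'k::real_or_complex ^ 'n::finite \<Rightarrow> 'k"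
  assumes F: "kdiff F (\<chi> j. g j x)" and g: "\<And>j. kdiff (g j) x"
  shows kdiff_compose: "kdiff (\<lambda>x. F (\<chi> j. g j x)) x"
    and partial_deriv_compose: "partial_deriv i (\<lambda>x. F (\<chi> j. g j x)) x =
      (\<Sum>j\<in>UNIV. partial_deriv j F (\<chi> j. g j x) * partial_deriv i (g j) x)"
proof -
  have "((\<lambda>x. F (\<chi> j. g j x)) has_derivative (\<lambda>h. \<Sum>i\<in>UNIV.
      (\<Sum>j\<in>UNIV. partial_deriv j F (\<chi> j. g j x) * partial_deriv i (g j) x) * h $ i)) (at x)"
  proof (rule has_derivative_eq_rhs)
    show "((\<lambda>x. F (\<chi> j. g j x)) has_derivative (\<lambda>h. \<Sum>j\<in>UNIV. partial_deriv j F (\<chi> j. g j x) *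
        (\<chi> j. \<Sum>i\<in>UNIV. partial_deriv i (g j) x * h $ i) $ j)) (at x)"
      by (rule has_derivative_compose[OF has_derivative_vec_lambda[OF g[unfolded kdiff_def]] F[unfolded kdiff_def]])
    show "(\<lambda>h. \<Sum>j\<in>UNIV. partial_deriv j F (\<chi> j. g j x) *
        (\<chi> j. \<Sum>i\<in>UNIV. partial_deriv i (g j) x * h $ i) $ j) = (\<lambda>h. \<Sum>i\<in>UNIV.
      (\<Sum>j\<in>UNIV. partial_deriv j F (\<chi> j. g j x) * partial_deriv i (g j) x) * h $ i)"
      by (rule ext, simp add: sum_distrib_left sum_distrib_right mult.assoc) (rule sum.swap)
  qed
  from kdiffI[OF this] show "kdiff (\<lambda>x. F (\<chi> j. g j x)) x"
    "partial_deriv i (\<lambda>x. F (\<chi> j. g j x)) x =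
      (\<Sum>j\<in>UNIV. partial_deriv j F (\<chi> j. g j x) * partial_deriv i (g j) x)" by blast+
qed

lemma partial_deriv_exp:
  assumes f: "kdiff f x"
  shows "partial_deriv i (\<lambda>x. exp (f x)) x = exp (f x) * partial_deriv i f x"
proof -
  have "((\<lambda>x. exp (f x)) has_derivative (\<lambda>h. \<Sum>j\<in>UNIV. (exp (f x) * partial_deriv j f x) * h $ j)) (at x)"
    by (rule has_derivative_eq_rhs[OF has_derivative_compose[OF f[unfolded kdiff_def]
          DERIV_exp[unfolded has_field_derivative_def]]]) (simp add: sum_distrib_left mult.assoc)
  from kdiffI[OF this] show ?thesis by blast
qed

lemma jet_0: "analytic_germ a f \<Longrightarrow> jet a f (\<lambda>_. 0) = f a"
  by (erule analytic_germE) (simp add: jet_eq expansion_at_center mfact_def)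

text \<open>Both iterated derivatives are the same entry of the jet.\<close>

lemma analytic_germ_partial_deriv_commute:
  assumes "analytic_germ a f"
  shows "partial_deriv i (partial_deriv j f) a = partial_deriv j (partial_deriv i f) a"
proof -
  have "partial_deriv i (partial_deriv j f) a = jet a f (minc j (minc i (\<lambda>_. 0)))" for i j
    using jet_0[of a "partial_deriv i (partial_deriv j f)"] assms
    by (simp add: jet_partial_deriv agerm)
  thus ?thesis by (metis minc_commute)
qed

lemma analytic_germ_isCont: "analytic_germ a f \<Longrightarrow> isCont f a"
  using analytic_germ_has_derivative has_derivative_continuous by blast

lemma kdiff_isCont: "kdiff f a \<Longrightarrow> isCont f a"
  unfolding kdiff_def using has_derivative_continuous by blast

lemma eventually_neq:
  fixes f :: "'a::t2_space \<Rightarrow> 'b::t2_space"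
  assumes "isCont f a" "f a \<noteq> c" shows "\<forall>\<^sub>F x in nhds a. f x \<noteq> c"
proof -
  have "filterlim f (nhds (f a)) (nhds a)" using assms(1) by (simp add: continuous_at tendsto_at_iff_tendsto_nhds)
  thus ?thesis using assms(2) by (rule tendsto_imp_eventually_ne)
qed

subsection \<open>Analytic linear systems\<close>

text \<open>Gaussian elimination, one row at a time.\<close>

lemma analytic_linear_system:
  fixes T :: "'r \<Rightarrow> 'j \<Rightarrow> 'k::real_or_complex ^ 'n::finite \<Rightarrow> 'k"
  assumes "finite R" "finite J" "\<And>r j. r \<in> R \<Longrightarrow> j \<in> J \<Longrightarrow> analytic_germ a (T r j)"
    "\<And>r. r \<in> R \<Longrightarrow> analytic_germ a (c r)"
    "\<And>v. (\<And>j. j \<in> J \<Longrightarrow> (\<Sum>r\<in>R. v r * T r j a) = 0) \<Longrightarrow> \<forall>r\<in>R. v r = 0"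
  obtains u where "\<And>j. j \<in> J \<Longrightarrow> analytic_germ a (u j)"
    "\<forall>\<^sub>F x in nhds a. \<forall>r\<in>R. (\<Sum>j\<in>J. T r j x * u j x) = c r x"
proof -
  have "\<exists>u. (\<forall>j\<in>J. analytic_germ a (u j)) \<and> (\<forall>\<^sub>F x in nhds a. \<forall>r\<in>R. (\<Sum>j\<in>J. T r j x * u j x) = c r x)"
    using assms
  proof (induction R arbitrary: J T c rule: finite_induct)
    case empty
    show ?case by (rule exI[of _ "\<lambda>_ _. 0"]) (auto intro: agerm)
  next
    case (insert r R)
    note T = insert.prems(2) and c = insert.prems(3) and ind = insert.prems(4)
    \<comment> \<open>The pivot: a row vanishing at \<open>a\<close> would by itself be a relation
      among the rows.\<close>
    have "\<exists>j\<in>J. T r j a \<noteq> 0"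
    proof (rule ccontr)
      assume n: "\<not> ?thesis"
      have "(\<Sum>s\<in>insert r R. (if s = r then 1 else 0) * T s j a) = 0" if "j \<in> J" for j
        using n that insert.hyps by (auto intro!: sum.neutral)
      from ind[OF this] show False by simp
    qed
    then obtain p where p: "p \<in> J" "T r p a \<noteq> 0" by blast
    have Tp: "analytic_germ a (T r p)" using T p by auto
    define J' where "J' = J - {p}"
    have J': "finite J'" "J = insert p J'" "p \<notin> J'" using p insert.prems(1) by (auto simp: J'_def)
    define q where "q x = inverse (T r p x)" for x
    have q: "analytic_germ a q" unfolding q_def using T[of r p] p by (auto intro!: agerm)
    define T' where "T' s j x = T s j x - T s p x * q x * T r j x" for s j x
    define c' where "c' s x = c s x - T s p x * q x * c r x" for s x
    have "\<exists>u. (\<forall>j\<in>J'. analytic_germ a (u j)) \<and>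
        (\<forall>\<^sub>F x in nhds a. \<forall>r\<in>R. (\<Sum>j\<in>J'. T' r j x * u j x) = c' r x)"
    proof (rule insert.IH[OF J'(1)])
      show "analytic_germ a (T' s j)" if "s \<in> R" "j \<in> J'" for s j
        unfolding T'_def using that J' by (intro agerm T q) auto
      show "analytic_germ a (c' s)" if "s \<in> R" for s
        unfolding c'_def using that J' by (intro agerm T q c) auto
      fix v assume v: "\<And>j. j \<in> J' \<Longrightarrow> (\<Sum>s\<in>R. v s * T' s j a) = 0"
      \<comment> \<open>A relation among the reduced rows becomes one among the original rows when
        the pivot row is given the coefficient that was subtracted from them in total.\<close>
      define w where "w s = (if s = r then - (\<Sum>s\<in>R. v s * T s p a) * q a else v s)" for s
      have wR: "(\<Sum>s\<in>R. w s * h s) = (\<Sum>s\<in>R. v s * h s)" for h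
        by (rule sum.cong) (use insert.hyps in \<open>auto simp: w_def\<close>)
      have "(\<Sum>s\<in>insert r R. w s * T s j a) = 0" if "j \<in> J" for j
      proof (cases "j = p")
        case True
        thus ?thesis using p insert.hyps wR[of "\<lambda>s. T s p a"] by (simp add: w_def q_def)
      next
        case False
        have "(\<Sum>s\<in>insert r R. w s * T s j a) = (\<Sum>s\<in>R. v s * T' s j a)"
          using insert.hyps wR[of "\<lambda>s. T s j a"]
          by (simp add: w_def T'_def algebra_simps sum_subtractf sum_distrib_right sum_distrib_left)
        also have "\<dots> = 0" using v that False J' by auto
        finally show ?thesis .
      qed
      hence w0: "\<forall>s\<in>insert r R. w s = 0" by (rule ind)
      show "\<forall>s\<in>R. v s = 0"
      proof
        fix s assume "s \<in> R"
        moreover from this have "s \<noteq> r" using insert.hyps by auto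
        ultimately show "v s = 0" using bspec[OF w0, of s] by (simp add: w_def)
      qed
    qed
    then obtain u where u: "\<And>j. j \<in> J' \<Longrightarrow> analytic_germ a (u j)"
      and ue: "\<forall>\<^sub>F x in nhds a. \<forall>r\<in>R. (\<Sum>j\<in>J'. T' r j x * u j x) = c' r x" by blast
    define w where "w j x = (if j = p then q x * (c r x - (\<Sum>j\<in>J'. T r j x * u j x)) else u j x)" for j x
    have wJ: "(\<Sum>j\<in>J'. h j * w j x) = (\<Sum>j\<in>J'. h j * u j x)" for h x
      by (rule sum.cong) (use J' in \<open>auto simp: w_def\<close>)
    have "analytic_germ a (w j)" if "j \<in> J" for j
    proof (cases "j = p")
      case True
      have "analytic_germ a (\<lambda>x. q x * (c r x - (\<Sum>j\<in>J'. T r j x * u j x)))"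
        using J' by (intro agerm q c T u) auto
      thus ?thesis using True by (simp add: w_def[abs_def])
    next
      case False
      thus ?thesis using u[of j] that J' by (simp add: w_def[abs_def])
    qed
    moreover have "\<forall>\<^sub>F x in nhds a. \<forall>s\<in>insert r R. (\<Sum>j\<in>J. T s j x * w j x) = c s x"
      using ue eventually_neq[OF analytic_germ_isCont[OF Tp] p(2)]
    proof (eventually_elim, intro ballI)
      fix x s assume ue: "\<forall>r\<in>R. (\<Sum>j\<in>J'. T' r j x * u j x) = c' r x" and n: "T r p x \<noteq> 0"
        and s: "s \<in> insert r R"
      have S: "(\<Sum>j\<in>J. T s j x * w j x) =
          T s p x * (q x * (c r x - (\<Sum>j\<in>J'. T r j x * u j x))) + (\<Sum>j\<in>J'. T s j x * u j x)"
        using J' wJ[of "\<lambda>j. T s j x" x] by (simp add: w_def)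
      show "(\<Sum>j\<in>J. T s j x * w j x) = c s x"
      proof (cases "s = r")
        case True
        thus ?thesis unfolding S using n by (simp add: q_def flip: mult.assoc)
      next
        case False
        hence "(\<Sum>j\<in>J'. T' s j x * u j x) = c' s x" using ue s by auto
        thus ?thesis unfolding S
          by (simp add: T'_def c'_def algebra_simps sum_subtractf sum_distrib_left)
      qed
    qed
    ultimately show ?case by blast
  qed
  thus ?thesis using that by blast
qed

text \<open>No regularity of \<open>u\<close> is assumed. Solving the transposed system gives
  analytic \<open>w\<close> with \<Sum>r. T r j * w r = \<delta>(j, p), one row of an analytic left
  inverse of \<open>T\<close>, and this row expresses \<open>u p\<close> through the right-hand
  sides.\<close>

lemma analytic_linear_system_unique:
  fixes T :: "'r \<Rightarrow> 'j \<Rightarrow> 'k::real_or_complex ^ 'n::finite \<Rightarrow> 'k"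
  assumes fin: "finite R" "finite J" and T: "\<And>r j. r \<in> R \<Longrightarrow> j \<in> J \<Longrightarrow> analytic_germ a (T r j)"
    and c: "\<And>r. r \<in> R \<Longrightarrow> analytic_germ a (c r)"
    and inj: "\<And>v. (\<And>r. r \<in> R \<Longrightarrow> (\<Sum>j\<in>J. T r j a * v j) = 0) \<Longrightarrow> \<forall>j\<in>J. v j = 0"
    and u: "\<forall>\<^sub>F x in nhds a. \<forall>r\<in>R. (\<Sum>j\<in>J. T r j x * u j x) = c r x"
    and p: "p \<in> J"
  shows "analytic_germ a (u p)"
proof -
  obtain w where w: "\<And>r. r \<in> R \<Longrightarrow> analytic_germ a (w r)"
    and we: "\<forall>\<^sub>F x in nhds a. \<forall>j\<in>J. (\<Sum>r\<in>R. T r j x * w r x) = (if j = p then 1 else 0)"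
    by (rule analytic_linear_system[of J R a "\<lambda>j r. T r j" "\<lambda>j x. if j = p then 1 else 0"])
      (use fin T inj in \<open>auto simp: mult.commute intro: agerm\<close>)
  have "analytic_germ a (\<lambda>x. \<Sum>r\<in>R. w r x * c r x)" by (intro agerm w c)
  moreover have "\<forall>\<^sub>F x in nhds a. (\<Sum>r\<in>R. w r x * c r x) = u p x"
    using u we
  proof eventually_elim
    case (elim x)
    have "(\<Sum>r\<in>R. w r x * c r x) = (\<Sum>r\<in>R. \<Sum>j\<in>J. w r x * (T r j x * u j x))"
      using elim(1) by (simp flip: sum_distrib_left)
    also have "\<dots> = (\<Sum>j\<in>J. (\<Sum>r\<in>R. T r j x * w r x) * u j x)"
      by (subst sum.swap) (simp add: sum_distrib_left sum_distrib_right mult_ac)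
    also have "\<dots> = (\<Sum>j\<in>J. if j = p then u p x else 0)"
      using elim(2) by (intro sum.cong) auto
    also have "\<dots> = u p x" using fin p by simp
    finally show ?case .
  qed
  ultimately show ?thesis by (rule analytic_germ_cong)
qed

subsection \<open>The analytic inverse function theorem\<close>

text \<open>From f^(m+1) - g^(m+1) = f (f^m - g^m) + (f - g) g^m. Measuring the difference as
  \<open>r * e\<close> gives the bound the form m r^m e, which survives products of several
  powers.\<close>

lemma psn_power_diff:
  assumes f: "psn a \<rho> r f" and g: "psn a \<rho> r g" and d: "psn a \<rho> (r * e) (\<lambda>x. f x - g x)"
  shows "psn a \<rho> (real m * r ^ m * e) (\<lambda>x. f x ^ m - g x ^ m)"
proof (induction m)
  case 0
  show ?case using psn_const[OF psn_pos[OF f], of a 0] by simp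
next
  case (Suc m)
  have "psn a \<rho> (r * (real m * r ^ m * e) + r * e * r ^ m)
      (\<lambda>x. f x * (f x ^ m - g x ^ m) + (f x - g x) * g x ^ m)"
    by (rule psn_add[OF psn_mult[OF f Suc] psn_mult[OF d psn_power[OF g]]])
  thus ?case by (simp add: algebra_simps)
qed

lemma psn_mpow_diff:
  fixes f g :: "'p::finite \<Rightarrow> 'k::real_or_complex ^ 'n::finite \<Rightarrow> 'k"
  assumes f: "\<And>i. psn a \<rho> r (f i)" and g: "\<And>i. psn a \<rho> r (g i)"
    and d: "\<And>i. psn a \<rho> (r * e) (\<lambda>x. f i x - g i x)"
  shows "psn a \<rho> (real (mdeg \<alpha>) * r ^ mdeg \<alpha> * e) (\<lambda>x. mpow (\<chi> i. f i x) \<alpha> - mpow (\<chi> i. g i x) \<alpha>)"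
proof -
  have \<rho>: "\<rho> > 0" by (rule psn_pos[OF f[of undefined]])
  have "psn a \<rho> (real (\<Sum>i\<in>I. \<alpha> i) * r ^ (\<Sum>i\<in>I. \<alpha> i) * e)
      (\<lambda>x. (\<Prod>i\<in>I. f i x ^ \<alpha> i) - (\<Prod>i\<in>I. g i x ^ \<alpha> i))" if "finite I" for I
    using that
  proof (induction I)
    case empty
    show ?case using psn_const[OF \<rho>, of a 0] by simp
  next
    case (insert i I)
    let ?s = "\<Sum>i\<in>I. \<alpha> i"
    have "psn a \<rho> (\<Prod>i\<in>I. r ^ \<alpha> i) (\<lambda>x. \<Prod>i\<in>I. g i x ^ \<alpha> i)"
      by (rule psn_prod[OF \<rho> insert.hyps(1) psn_power[OF g]])
    hence G: "psn a \<rho> (r ^ ?s) (\<lambda>x. \<Prod>i\<in>I. g i x ^ \<alpha> i)" by (simp add: power_sum)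
    have "psn a \<rho> (r ^ \<alpha> i * (real ?s * r ^ ?s * e) + (real (\<alpha> i) * r ^ \<alpha> i * e) * r ^ ?s)
      (\<lambda>x. f i x ^ \<alpha> i * ((\<Prod>i\<in>I. f i x ^ \<alpha> i) - (\<Prod>i\<in>I. g i x ^ \<alpha> i)) +
        (f i x ^ \<alpha> i - g i x ^ \<alpha> i) * (\<Prod>i\<in>I. g i x ^ \<alpha> i))"
      by (rule psn_add[OF psn_mult[OF psn_power[OF f] insert.IH] psn_mult[OF psn_power_diff[OF f g d] G]])
    moreover have "r ^ \<alpha> i * (real ?s * r ^ ?s * e) + (real (\<alpha> i) * r ^ \<alpha> i * e) * r ^ ?s =
        real (\<alpha> i + ?s) * r ^ (\<alpha> i + ?s) * e"
      unfolding power_add of_nat_add by algebra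
    ultimately show ?case using insert.hyps by (simp add: algebra_simps)
  qed
  from this[of UNIV] show ?thesis by (simp add: mpow_def mdeg_def)
qed

lemma real_le_two_power: "real m \<le> 2 ^ m"
  by (metis less_exp less_imp_le of_nat_le_iff of_nat_numeral of_nat_power)

text \<open>\<open>H\<close> starts in degree 2, so on inner functions scaled down by the factor
  \<open>t\<close> its Lipschitz constant is of order t; the condition 8 t W \<le> \<sigma> makes it
  at most 1/2.\<close>

lemma psn_contraction:
  fixes H :: "'k::real_or_complex ^ 'p::finite \<Rightarrow> 'k" and u v :: "'p \<Rightarrow> 'k ^ 'n::finite \<Rightarrow> 'k"
  assumes c: "has_expansion a \<sigma> c H" and c0: "\<And>\<alpha>. mdeg \<alpha> \<le> 1 \<Longrightarrow> c \<alpha> = 0"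
    and W: "(\<Sum>\<^sub>\<infinity>\<alpha>. norm (c \<alpha>) * \<sigma> ^ mdeg \<alpha>) \<le> W"
    and t: "0 < t" "t \<le> 1/2" "8 * t * W \<le> \<sigma>"
    and u: "\<And>i. psn b \<rho> (\<sigma> * t) (u i)" and v: "\<And>i. psn b \<rho> (\<sigma> * t) (v i)"
    and d: "\<And>i. psn b \<rho> \<delta> (\<lambda>x. u i x - v i x)"
  shows "psn b \<rho> (\<delta> / 2) (\<lambda>x. H (\<chi> i. a $ i + u i x) - H (\<chi> i. a $ i + v i x))"
proof -
  have \<sigma>: "\<sigma> > 0" by (rule has_expansionD(1)[OF c])
  have \<rho>: "\<rho> > 0" by (rule psn_pos[OF u[of undefined]])
  have \<delta>: "\<delta> \<ge> 0" by (rule psn_nonneg[OF d[of undefined]])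
  define r where "r = \<sigma> * t"
  have r: "r > 0" "r \<le> \<sigma>" using \<sigma> t by (auto simp: r_def mult_left_le)
  define e where "e = \<delta> / r"
  have e: "e \<ge> 0" using \<delta> r by (simp add: e_def)
  have re: "r * e = \<delta>" using r by (simp add: e_def)
  let ?m = "\<lambda>\<alpha>. norm (c \<alpha>) * \<sigma> ^ mdeg \<alpha>"
  \<comment> \<open>For degree m \<ge> 2 and 2t \<le> 1 one has m t^m \<le> (2t)^m \<le> 4
    t^2.\<close>
  have bnd: "norm (c \<alpha>) * (real (mdeg \<alpha>) * r ^ mdeg \<alpha> * e) \<le> (4 * t\<^sup>2 * e) * ?m \<alpha>" for \<alpha>
  proof (cases "mdeg \<alpha> \<le> 1")
    case True thus ?thesis using c0 by simp
  next
    case False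
    have "real (mdeg \<alpha>) * t ^ mdeg \<alpha> \<le> 2 ^ mdeg \<alpha> * t ^ mdeg \<alpha>"
      by (rule mult_right_mono[OF real_le_two_power]) (use t in simp)
    also have "\<dots> = (2 * t) ^ mdeg \<alpha>" by (simp add: power_mult_distrib)
    also have "\<dots> \<le> (2 * t) ^ 2" by (rule power_decreasing) (use False t in auto)
    finally have "real (mdeg \<alpha>) * t ^ mdeg \<alpha> \<le> 4 * t\<^sup>2" by (simp add: power2_eq_square)
    hence "real (mdeg \<alpha>) * t ^ mdeg \<alpha> * (norm (c \<alpha>) * \<sigma> ^ mdeg \<alpha> * e) \<le>
        4 * t\<^sup>2 * (norm (c \<alpha>) * \<sigma> ^ mdeg \<alpha> * e)"
      by (rule mult_right_mono) (use \<sigma> e in simp)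
    thus ?thesis by (simp add: r_def power_mult_distrib mult_ac)
  qed
  have s: "(\<lambda>\<alpha>. (4 * t\<^sup>2 * e) * ?m \<alpha>) summable_on UNIV"
    by (rule summable_on_cmult_right[OF has_expansionD(2)[OF c]])
  have s': "(\<lambda>\<alpha>. norm (c \<alpha>) * (real (mdeg \<alpha>) * r ^ mdeg \<alpha> * e)) summable_on UNIV"
    by (rule summable_on_comparison_test[OF s bnd]) (use r e in simp)
  have "(\<Sum>\<^sub>\<infinity>\<alpha>. norm (c \<alpha>) * (real (mdeg \<alpha>) * r ^ mdeg \<alpha> * e)) \<le> (\<Sum>\<^sub>\<infinity>\<alpha>. (4 * t\<^sup>2 * e) * ?m \<alpha>)"
    by (rule infsum_mono[OF s' s bnd])
  also have "\<dots> = (4 * t\<^sup>2 * e) * infsum ?m UNIV"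
    by (rule infsum_cmult_right[OF has_expansionD(2)[OF c]])
  also have "\<dots> \<le> (4 * t\<^sup>2 * e) * W" by (rule mult_left_mono[OF W]) (use t e in simp)
  also have "\<dots> = (t * e / 2) * (8 * t * W)" by (simp add: power2_eq_square)
  also have "\<dots> \<le> (t * e / 2) * \<sigma>" by (rule mult_left_mono[OF t(3)]) (use t e in simp)
  also have "\<dots> = \<delta> / 2" using re by (simp add: r_def mult_ac)
  finally have S: "(\<Sum>\<^sub>\<infinity>\<alpha>. norm (c \<alpha>) * (real (mdeg \<alpha>) * r ^ mdeg \<alpha> * e)) \<le> \<delta> / 2" .
  have P: "psn b \<rho> (norm (c \<alpha>) * (real (mdeg \<alpha>) * r ^ mdeg \<alpha> * e))
      (\<lambda>x. c \<alpha> * (mpow (\<chi> i. u i x) \<alpha> - mpow (\<chi> i. v i x) \<alpha>))" for \<alpha>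
    by (rule psn_cmult[OF psn_mpow_diff]) (use u v d in \<open>simp_all add: r_def[symmetric] re\<close>)
  have hs: "((\<lambda>\<alpha>. c \<alpha> * mpow (\<chi> i. w i x) \<alpha>) has_sum H (\<chi> i. a $ i + w i x)) UNIV"
    if w: "\<And>i. psn b \<rho> (\<sigma> * t) (w i)" and x: "x \<in> polydisc b \<rho>" for w :: "'p \<Rightarrow> 'k ^ 'n \<Rightarrow> 'k" and x
  proof -
    have "norm (w i x) \<le> \<sigma>" for i using psn_norm_le[OF w[of i] x] r by (simp add: r_def)
    hence 1: "(\<chi> i. a $ i + w i x) \<in> polydisc a \<sigma>" by (simp add: polydisc_def)
    have 2: "(\<chi> i. a $ i + w i x) - a = (\<chi> i. w i x)" by (simp add: vec_eq_iff)
    show ?thesis using has_expansionD(3)[OF c 1] unfolding 2 .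
  qed
  show ?thesis
  proof (rule psn_infsum[OF \<rho> P s' S])
    fix x assume x: "x \<in> polydisc b \<rho>"
    have "((\<lambda>\<alpha>. c \<alpha> * mpow (\<chi> i. u i x) \<alpha> + - (c \<alpha> * mpow (\<chi> i. v i x) \<alpha>)) has_sum
        (H (\<chi> i. a $ i + u i x) + - H (\<chi> i. a $ i + v i x))) UNIV"
      by (rule has_sum_add[OF hs[OF u x] has_sum_uminus[THEN iffD2]]) (use hs[OF v x] in simp)
    thus "((\<lambda>\<alpha>. c \<alpha> * (mpow (\<chi> i. u i x) \<alpha> - mpow (\<chi> i. v i x) \<alpha>)) has_sum
        (H (\<chi> i. a $ i + u i x) - H (\<chi> i. a $ i + v i x))) UNIV"
      by (simp add: right_diff_distrib)
  qed
qed

lemma analytic_germ_second_order: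
  assumes H: "analytic_germ a H" "H a = 0" "\<And>j. partial_deriv j H a = 0"
    and c: "has_expansion a \<sigma> c H" and "mdeg \<alpha> \<le> 1"
  shows "c \<alpha> = 0"
proof (cases "mdeg \<alpha> = 0")
  case True
  hence "\<alpha> = (\<lambda>i. 0)" by (simp add: mdeg_eq_0_iff)
  thus ?thesis using expansion_at_center[OF c] H(2) by simp
next
  case False
  hence "mdeg \<alpha> = Suc 0" using assms(5) by simp
  from mdeg_pos_imp[OF this] obtain i \<beta> where b: "\<alpha> = minc i \<beta>" "mdeg \<beta> = 0" by blast
  have "jet a H \<alpha> = jet a (partial_deriv i H) \<beta>" by (simp add: b(1) jet_partial_deriv[OF H(1)])
  also have "\<beta> = (\<lambda>_. 0)" using b(2) by (simp add: mdeg_eq_0_iff)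
  also have "jet a (partial_deriv i H) (\<lambda>_. 0) = 0" using H by (simp add: jet_0 agerm)
  finally show ?thesis using mfact_pos[of \<alpha>] by (simp add: jet_eq[OF c])
qed

text \<open>Iteration of g \<mapsto> L + H(a + g). With \<open>L\<close> of norm at most r/2 and
  \<open>H\<close> contracting by 1/2, all iterates stay in the ball of radius r.\<close>

lemma analytic_fixed_point:
  fixes H :: "'n::finite \<Rightarrow> 'k::real_or_complex ^ 'n \<Rightarrow> 'k" and L :: "'n \<Rightarrow> 'k ^ 'n \<Rightarrow> 'k"
  assumes H: "\<And>i. analytic_germ a (H i)" "\<And>i. H i a = 0" "\<And>i j. partial_deriv j (H i) a = 0"
    and L: "\<And>i. analytic_germ b (L i)" "\<And>i. L i b = 0"
  obtains g where "\<And>i. analytic_germ b (g i)" "\<And>i. g i b = 0"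
    "\<forall>\<^sub>F y in nhds b. \<forall>i. g i y = L i y + H i (\<chi> j. a $ j + g j y)"
proof -
  have "\<forall>i. \<exists>\<sigma> c. has_expansion a \<sigma> c (H i)" using H(1) analytic_germE by metis
  then obtain \<sigma>' c where c': "\<And>i. has_expansion a (\<sigma>' i) (c i) (H i)" by metis
  define \<sigma> where "\<sigma> = Min (range \<sigma>')"
  have \<sigma>0: "\<sigma> > 0" unfolding \<sigma>_def by (subst Min_gr_iff) (auto intro: has_expansionD(1)[OF c'])
  have c: "has_expansion a \<sigma> (c i) (H i)" for i
    by (rule has_expansion_shrink[OF c' \<sigma>0]) (auto simp: \<sigma>_def)
  have c0: "mdeg \<alpha> \<le> 1 \<Longrightarrow> c i \<alpha> = 0" for i \<alpha>
    by (rule analytic_germ_second_order[OF H(1,2,3) c])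
  let ?W = "\<lambda>i. \<Sum>\<^sub>\<infinity>\<alpha>. norm (c i \<alpha>) * \<sigma> ^ mdeg \<alpha>"
  define W where "W = Max (range ?W)"
  have W: "?W i \<le> W" for i unfolding W_def by (rule Max_ge) auto
  have "?W undefined \<ge> 0" by (rule infsum_nonneg) (use \<sigma>0 in simp)
  hence W0: "W \<ge> 0" using W[of undefined] by linarith
  \<comment> \<open>Small enough for the contraction lemma; \<open>W + 1\<close> avoids division by
    0.\<close>
  define t where "t = min (1/4) (\<sigma> / (8 * (W + 1)))"
  have t: "0 < t" "t \<le> 1/2" using \<sigma>0 W0 by (auto simp: t_def)
  have t3: "8 * t * W \<le> \<sigma>"
  proof -
    have "t \<le> \<sigma> / (8 * (W + 1))" by (simp add: t_def)
    hence "t * (8 * (W + 1)) \<le> \<sigma>" using W0 by (simp add: pos_le_divide_eq)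
    moreover have "8 * t * W \<le> t * (8 * (W + 1))" using t by (simp add: algebra_simps)
    ultimately show ?thesis by linarith
  qed
  define r where "r = \<sigma> * t"
  have r: "r > 0" "r < \<sigma>" using \<sigma>0 t by (auto simp: r_def)
  have "\<exists>q. q > 0 \<and> (\<forall>\<rho>. 0 < \<rho> \<longrightarrow> \<rho> \<le> q \<longrightarrow> psn b \<rho> (r/2) (L i))" for i
    by (rule analytic_germ_small[OF L(1,2), of "r/2" i]) (use r in auto)
  then obtain q where q: "\<And>i. q i > 0" "\<And>i \<rho>. 0 < \<rho> \<Longrightarrow> \<rho> \<le> q i \<Longrightarrow> psn b \<rho> (r/2) (L i)" by metis
  define \<rho> where "\<rho> = Min (range q)"
  have \<rho>: "\<rho> > 0" unfolding \<rho>_def using q(1) by (subst Min_gr_iff) auto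
  have Lp: "psn b \<rho> (r/2) (L i)" for i by (rule q(2)[OF \<rho>]) (simp add: \<rho>_def)
  define gs where "gs = rec_nat (\<lambda>i y. 0) (\<lambda>_ g i y. L i y + H i (\<chi> j. a $ j + g j y))"
  have gs0: "gs 0 = (\<lambda>i y. 0)" and gsS: "gs (Suc m) = (\<lambda>i y. L i y + H i (\<chi> j. a $ j + gs m j y))" for m
    by (simp_all add: gs_def)
  have z: "psn b \<rho> M (\<lambda>y. 0)" if "M \<ge> 0" for M
    using psn_mono[OF psn_const[OF \<rho>, of b 0]] that by simp
  have a0: "(\<chi> j. a $ j + 0) = a" by (simp add: vec_eq_iff)
  have contr: "psn b \<rho> (\<delta> / 2) (\<lambda>x. H i (\<chi> j. a $ j + u j x) - H i (\<chi> j. a $ j + v j x))"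
    if "\<And>j. psn b \<rho> r (u j)" "\<And>j. psn b \<rho> r (v j)" "\<And>j. psn b \<rho> \<delta> (\<lambda>x. u j x - v j x)"
    for u v :: "'n \<Rightarrow> 'k ^ 'n \<Rightarrow> 'k" and \<delta> i
    by (rule psn_contraction[OF c c0 W t t3]) (use that in \<open>simp_all add: r_def\<close>)
  have gp: "psn b \<rho> r (gs m i)" for m i
  proof (induction m arbitrary: i)
    case 0 show ?case unfolding gs0 by (rule z) (use r in simp)
  next
    case (Suc m)
    have "psn b \<rho> (r / 2) (\<lambda>x. H i (\<chi> j. a $ j + gs m j x) - H i (\<chi> j. a $ j + 0))"
      by (rule contr[OF Suc z]) (use r Suc in auto)
    hence "psn b \<rho> (r / 2) (\<lambda>x. H i (\<chi> j. a $ j + gs m j x))" unfolding a0 H(2) by simp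
    from psn_add[OF Lp[of i] this] show ?case unfolding gsS by simp
  qed
  have gd: "psn b \<rho> (r * (1/2) ^ m) (\<lambda>x. gs (Suc m) i x - gs m i x)" for m i
  proof (induction m arbitrary: i)
    case 0
    have "psn b \<rho> r (L i)" by (rule psn_mono[OF Lp]) (use r in simp)
    thus ?case unfolding gsS gs0 a0 H(2) by simp
  next
    case (Suc m)
    have "psn b \<rho> (r * (1/2) ^ m / 2)
        (\<lambda>x. H i (\<chi> j. a $ j + gs (Suc m) j x) - H i (\<chi> j. a $ j + gs m j x))"
      by (rule contr[OF gp gp Suc])
    thus ?case by (simp add: gsS)
  qed
  have geo: "((\<lambda>m. r * (1/2) ^ m) has_sum 2 * r) UNIV"
  proof (rule norm_summable_imp_has_sum)
    have 1: "(\<lambda>m. (1/2::real) ^ m) sums 2" using geometric_sums[of "1/2::real"] by simp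
    show "(\<lambda>m. r * (1/2) ^ m) sums (2 * r)" using sums_mult[OF 1, of r] by (simp add: mult.commute)
    from sums_summable[OF this] show "summable (\<lambda>m. norm (r * (1/2) ^ m))" using r by simp
  qed
  \<comment> \<open>The limit is the telescoping series of the differences, whose norms are at most
    r/2^m; this makes it analytic and not only a pointwise limit.\<close>
  define g where "g i y = (\<Sum>m. gs (Suc m) i y - gs m i y)" for i y
  have sm: "summable (\<lambda>m. norm (gs (Suc m) i y - gs m i y))" if "y \<in> polydisc b \<rho>" for i y
    by (rule summable_comparison_test'[OF sums_summable[OF has_sum_imp_sums[OF geo]], of 0])
      (use psn_norm_le[OF gd that] in simp)
  have gpsn: "psn b \<rho> (2 * r) (g i)" for i
  proof (rule psn_infsum[OF \<rho> gd])
    show "(\<lambda>m. r * (1/2) ^ m) summable_on UNIV" by (rule has_sum_imp_summable[OF geo])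
    show "(\<Sum>\<^sub>\<infinity>m. r * (1/2) ^ m) \<le> 2 * r" using infsumI[OF geo] by simp
    show "((\<lambda>m. gs (Suc m) i x - gs m i x) has_sum g i x) UNIV" if "x \<in> polydisc b \<rho>" for x
      unfolding g_def
      by (rule norm_summable_imp_has_sum[OF sm[OF that] summable_sums[OF summable_norm_cancel[OF sm[OF that]]]])
  qed
  have lim: "(\<lambda>m. gs m i y) \<longlonglongrightarrow> g i y" if "y \<in> polydisc b \<rho>" for i y
  proof -
    have "(\<lambda>m. gs (Suc m) i y - gs m i y) sums g i y"
      unfolding g_def by (rule summable_sums[OF summable_norm_cancel[OF sm[OF that]]])
    thus ?thesis unfolding sums_def sum_lessThan_telescope[of "\<lambda>m. gs m i y"] by (simp add: gs0)
  qed
  have fp: "g i y = L i y + H i (\<chi> j. a $ j + g j y)" if y: "y \<in> polydisc b \<rho>" for i y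
  proof -
    have "norm (g j y) \<le> r" for j
      by (rule LIMSEQ_le_const2[OF tendsto_norm[OF lim[OF y, of j]]]) (use psn_norm_le[OF gp y] in auto)
    hence "(\<chi> j. a $ j + g j y) \<in> polydisc a r" by (simp add: polydisc_def)
    hence "isCont (H i) (\<chi> j. a $ j + g j y)"
      using partial_deriv_expansion(2)[OF c[of i] r] has_derivative_continuous by blast
    moreover have "(\<lambda>m. \<chi> j. a $ j + gs m j y) \<longlonglongrightarrow> (\<chi> j. a $ j + g j y)"
      by (intro tendsto_intros lim y)
    ultimately have "(\<lambda>m. H i (\<chi> j. a $ j + gs m j y)) \<longlonglongrightarrow> H i (\<chi> j. a $ j + g j y)"
      by (rule isCont_tendsto_compose)
    hence "(\<lambda>m. L i y + H i (\<chi> j. a $ j + gs m j y)) \<longlonglongrightarrow> L i y + H i (\<chi> j. a $ j + g j y)"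
      by (intro tendsto_intros)
    hence "(\<lambda>m. gs (Suc m) i y) \<longlonglongrightarrow> L i y + H i (\<chi> j. a $ j + g j y)" by (simp add: gsS)
    thus ?thesis using LIMSEQ_unique LIMSEQ_Suc[OF lim[OF y, of i]] by blast
  qed
  have "gs m i b = 0" for m i
  proof (induction m arbitrary: i)
    case (Suc m) thus ?case using a0 H(2)[of i] L(2)[of i] by (simp add: gsS)
  qed (simp add: gs0)
  hence "g i b = 0" for i by (simp add: g_def)
  moreover have "analytic_germ b (g i)" for i using gpsn by (auto simp: analytic_germ_def)
  moreover have "\<forall>\<^sub>F y in nhds b. \<forall>i. g i y = L i y + H i (\<chi> j. a $ j + g j y)"
    unfolding eventually_nhds_polydisc using \<rho> fp by blast
  ultimately show ?thesis using that by blast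
qed

lemma jacobian_inverse:
  fixes A :: "'n::finite \<Rightarrow> 'n \<Rightarrow> 'k::field"
  assumes "\<And>v. (\<And>i. (\<Sum>j\<in>UNIV. A i j * v j) = 0) \<Longrightarrow> \<forall>j. v j = 0"
  obtains S where "\<And>i j. (\<Sum>l\<in>UNIV. S i l * A l j) = (if i = j then 1 else 0)"
    "\<And>i j. (\<Sum>l\<in>UNIV. A i l * S l j) = (if i = j then 1 else 0)"
proof -
  define M :: "'k ^ 'n ^ 'n" where "M = (\<chi> i j. A i j)"
  have "v = 0" if "M *v v = 0" for v
    using assms[of "\<lambda>j. v $ j"] that by (simp add: M_def matrix_vector_mult_def vec_eq_iff)
  hence "\<exists>B. B ** M = mat 1" by (simp add: matrix_left_invertible_injective vec.inj_iff_eq_0)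
  then obtain B where B: "B ** M = mat 1" by blast
  hence B': "M ** B = mat 1" by (simp add: matrix_left_right_inverse)
  show ?thesis
  proof (rule that[of "\<lambda>i j. B $ i $ j"])
    show "(\<Sum>l\<in>UNIV. B $ i $ l * A l j) = (if i = j then 1 else 0)" for i j
      using arg_cong[OF B, of "\<lambda>X. X $ i $ j"] by (simp add: M_def matrix_matrix_mult_def mat_def)
    show "(\<Sum>l\<in>UNIV. A i l * B $ l $ j) = (if i = j then 1 else 0)" for i j
      using arg_cong[OF B', of "\<lambda>X. X $ i $ j"] by (simp add: M_def matrix_matrix_mult_def mat_def)
  qed
qed

text \<open>With \<open>S\<close> the inverse Jacobian, F(x) = y is equivalent to the fixed point
  equation x - a = S(y - b) + H(x), where H(x) = (x - a) - S(F(x) - b) vanishes to second order at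
  \<open>a\<close>.\<close>

lemma analytic_right_inverse:
  fixes F :: "'n::finite \<Rightarrow> 'k::real_or_complex ^ 'n \<Rightarrow> 'k"
  assumes F: "\<And>i. analytic_germ a (F i)"
    and inj: "\<And>v. (\<And>i. (\<Sum>j\<in>UNIV. partial_deriv j (F i) a * v j) = 0) \<Longrightarrow> \<forall>j. v j = 0"
  obtains G where "\<And>i. analytic_germ (\<chi> i. F i a) (G i)" "\<And>i. G i (\<chi> i. F i a) = a $ i"
    "\<forall>\<^sub>F y in nhds (\<chi> i. F i a). \<forall>i. F i (\<chi> j. G j y) = y $ i"
proof -
  define b where "b = (\<chi> i. F i a)"
  obtain S where S: "\<And>i j. (\<Sum>l\<in>UNIV. S i l * partial_deriv j (F l) a) = (if i = j then 1 else 0)"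
    and S': "\<And>i j. (\<Sum>l\<in>UNIV. partial_deriv l (F i) a * S l j) = (if i = j then 1 else 0)"
    by (rule jacobian_inverse[of "\<lambda>i j. partial_deriv j (F i) a"]) (use inj in auto)
  define H where "H i x = (x $ i - a $ i) - (\<Sum>l\<in>UNIV. S i l * (F l x - b $ l))" for i x
  define L where "L i y = (\<Sum>l\<in>UNIV. S i l * (y $ l - b $ l))" for i y
  have 1: "analytic_germ a (H i)" for i unfolding H_def by (intro agerm F)
  have 2: "H i a = 0" for i by (simp add: H_def b_def)
  have 3: "partial_deriv j (H i) a = 0" for i j
  proof -
    note k = kdiff_diff kdiff_sum kdiff_cmult kdiff_const kdiff_coord analytic_germ_kdiff[OF F]
    have "partial_deriv j (H i) a = (if j = i then 1 else 0) - (\<Sum>l\<in>UNIV. S i l * partial_deriv j (F l) a)"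
      unfolding H_def
      by (simp add: partial_deriv_diff partial_deriv_sum partial_deriv_cmult partial_deriv_coord k)
    thus ?thesis by (simp add: S)
  qed
  have 4: "analytic_germ b (L i)" for i unfolding L_def by (intro agerm)
  have 5: "L i b = 0" for i by (simp add: L_def)
  obtain g where g: "\<And>i. analytic_germ b (g i)" "\<And>i. g i b = 0"
    and ev: "\<forall>\<^sub>F y in nhds b. \<forall>i. g i y = L i y + H i (\<chi> j. a $ j + g j y)"
    using analytic_fixed_point[where H = H and L = L, OF 1 2 3 4 5] by blast
  define G where "G i y = a $ i + g i y" for i y
  have "analytic_germ b (G i)" for i unfolding G_def by (intro agerm g)
  moreover have "G i b = a $ i" for i by (simp add: G_def g)
  moreover have "\<forall>\<^sub>F y in nhds b. \<forall>i. F i (\<chi> j. G j y) = y $ i"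
    using ev
  proof (eventually_elim, intro allI)
    fix y m assume e: "\<forall>i. g i y = L i y + H i (\<chi> j. a $ j + g j y)"
    let ?x = "\<chi> j. G j y"
    have "(\<Sum>l\<in>UNIV. S i l * (F l ?x - b $ l)) = (\<Sum>l\<in>UNIV. S i l * (y $ l - b $ l))" for i
      using e[rule_format, of i] by (simp add: H_def L_def G_def)
    hence d: "(\<Sum>l\<in>UNIV. S i l * (F l ?x - y $ l)) = 0" for i
      by (simp add: right_diff_distrib sum_subtractf)
    have "0 = (\<Sum>i\<in>UNIV. partial_deriv i (F m) a * (\<Sum>l\<in>UNIV. S i l * (F l ?x - y $ l)))"
      by (simp add: d)
    also have "\<dots> = (\<Sum>l\<in>UNIV. (\<Sum>i\<in>UNIV. partial_deriv i (F m) a * S i l) * (F l ?x - y $ l))"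
      by (simp add: sum_distrib_left sum_distrib_right mult.assoc) (rule sum.swap)
    also have "\<dots> = F m ?x - y $ m"
      unfolding S' by (simp add: if_distrib[of "\<lambda>c. c * _"] cong: if_cong)
    finally show "F m ?x = y $ m" by simp
  qed
  ultimately show ?thesis using that unfolding b_def by blast
qed

text \<open>The right inverse \<open>G\<close> has a right inverse \<open>K\<close> of its own, and
  F = F \<circ> G \<circ> K = K near \<open>a\<close>; so \<open>G\<close> is a left inverse of
  \<open>F\<close> as well.\<close>

lemma analytic_local_inverse:
  fixes F :: "'n::finite \<Rightarrow> 'k::real_or_complex ^ 'n \<Rightarrow> 'k"
  assumes F: "\<And>i. analytic_germ a (F i)"
    and inj: "\<And>v. (\<And>i. (\<Sum>j\<in>UNIV. partial_deriv j (F i) a * v j) = 0) \<Longrightarrow> \<forall>j. v j = 0"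
    and b: "b = (\<chi> i. F i a)"
  obtains G where "\<And>i. analytic_germ b (G i)" "\<And>i. G i b = a $ i"
    "\<forall>\<^sub>F y in nhds b. \<forall>i. F i (\<chi> j. G j y) = y $ i"
    "\<forall>\<^sub>F x in nhds a. \<forall>i. G i (\<chi> j. F j x) = x $ i"
proof -
  obtain G where G: "\<And>i. analytic_germ b (G i)" "\<And>i. G i b = a $ i"
    and FG: "\<forall>\<^sub>F y in nhds b. \<forall>i. F i (\<chi> j. G j y) = y $ i"
    using analytic_right_inverse[where F = F, OF F inj] unfolding b by blast
  have a: "(\<chi> i. G i b) = a" by (simp add: vec_eq_iff G(2))
  have chain: "(\<Sum>l\<in>UNIV. partial_deriv l (F i) a * partial_deriv j (G l) b) = (if j = i then 1 else 0)" for i j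
  proof -
    have "partial_deriv j (\<lambda>y. F i (\<chi> l. G l y)) b =
        (\<Sum>l\<in>UNIV. partial_deriv l (F i) (\<chi> l. G l b) * partial_deriv j (G l) b)"
      by (rule partial_deriv_compose) (use a F G in \<open>auto intro: analytic_germ_kdiff\<close>)
    moreover have "partial_deriv j (\<lambda>y. F i (\<chi> l. G l y)) b = partial_deriv j (\<lambda>y. y $ i) b"
      by (rule eventually_eq_imp_partial_deriv_eq) (use FG in \<open>auto elim: eventually_mono\<close>)
    ultimately show ?thesis by (simp add: a partial_deriv_coord)
  qed
  have injG: "\<forall>j. v j = 0" if v: "\<And>i. (\<Sum>j\<in>UNIV. partial_deriv j (G i) b * v j) = 0" for v
  proof
    fix i
    have "0 = (\<Sum>l\<in>UNIV. partial_deriv l (F i) a * (\<Sum>j\<in>UNIV. partial_deriv j (G l) b * v j))"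
      by (simp add: v)
    also have "\<dots> = (\<Sum>j\<in>UNIV. (\<Sum>l\<in>UNIV. partial_deriv l (F i) a * partial_deriv j (G l) b) * v j)"
      by (simp add: sum_distrib_left sum_distrib_right mult.assoc) (rule sum.swap)
    also have "\<dots> = v i"
      unfolding chain by (simp add: if_distrib[of "\<lambda>c. c * _"] cong: if_cong)
    finally show "v i = 0" ..
  qed
  obtain K where K: "\<And>i. analytic_germ a (K i)" "\<And>i. K i a = b $ i"
    and GK: "\<forall>\<^sub>F x in nhds a. \<forall>i. G i (\<chi> j. K j x) = x $ i"
    using analytic_right_inverse[where F = G, OF G(1) injG] unfolding a by blast
  have "filterlim (\<lambda>x. \<chi> j. K j x) (nhds b) (nhds a)"
  proof -
    have "filterlim (\<lambda>x. \<chi> j. K j x) (nhds (\<chi> j. K j a)) (nhds a)"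
      by (intro tendsto_vec_lambda)
        (use analytic_germ_isCont[OF K(1)] in \<open>simp add: continuous_at tendsto_at_iff_tendsto_nhds\<close>)
    moreover have "(\<chi> j. K j a) = b" by (simp add: vec_eq_iff K(2))
    ultimately show ?thesis by simp
  qed
  from eventually_compose_filterlim[OF FG this]
  have "\<forall>\<^sub>F x in nhds a. \<forall>i. G i (\<chi> j. F j x) = x $ i"
    using GK
  proof eventually_elim
    case (elim x)
    have "(\<chi> j. G j (\<chi> j. K j x)) = x" using elim(2) by (simp add: vec_eq_iff)
    hence "F i x = K i x" for i using elim(1)[rule_format, of i] by simp
    thus ?case using elim(2) by simp
  qed
  with G FG show ?thesis using that by blast
qed

subsection \<open>Solving linear equations with constant coefficients by their jets\<close>

lemma jet_bounded_family:
  assumes "finite I" "\<And>i. i \<in> I \<Longrightarrow> jet_bounded (d i)"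
  obtains M R where "M \<ge> 0" "R \<ge> 1" "\<And>i \<alpha>. i \<in> I \<Longrightarrow> norm (d i \<alpha>) \<le> M * R ^ mdeg \<alpha> * fact (mdeg \<alpha>)"
proof -
  have "\<exists>M\<ge>0. \<exists>R\<ge>1. \<forall>i\<in>I. \<forall>\<alpha>. norm (d i \<alpha>) \<le> M * R ^ mdeg \<alpha> * fact (mdeg \<alpha>)"
    using assms
  proof (induction I rule: finite_induct)
    case empty
    show ?case by force
  next
    case (insert i I)
    then obtain M R where 1: "M \<ge> 0" "R \<ge> 1"
      "\<And>i \<alpha>. i \<in> I \<Longrightarrow> norm (d i \<alpha>) \<le> M * R ^ mdeg \<alpha> * fact (mdeg \<alpha>)" by auto
    obtain N S where 2: "N \<ge> 0" "S \<ge> 1" "\<And>\<alpha>. norm (d i \<alpha>) \<le> N * S ^ mdeg \<alpha> * fact (mdeg \<alpha>)"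
      using jet_boundedE[OF insert.prems[of i]] by blast
    have mono: "A * B ^ m * fact m \<le> (M + N) * (max R S) ^ m * fact m"
      if "0 \<le> A" "A \<le> M + N" "0 \<le> B" "B \<le> max R S" for A B :: real and m
      using that by (intro mult_right_mono mult_mono power_mono) auto
    have "\<forall>j\<in>insert i I. \<forall>\<alpha>. norm (d j \<alpha>) \<le> (M + N) * (max R S) ^ mdeg \<alpha> * fact (mdeg \<alpha>)"
    proof (intro ballI allI)
      fix j \<alpha> assume "j \<in> insert i I"
      thus "norm (d j \<alpha>) \<le> (M + N) * (max R S) ^ mdeg \<alpha> * fact (mdeg \<alpha>)"
        using order_trans[OF 1(3) mono[of M R]] order_trans[OF 2(3) mono[of N S]] 1(1,2) 2(1,2) by auto
    qed
    moreover have "M + N \<ge> 0" "max R S \<ge> 1" using 1 2 by auto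
    ultimately show ?case by blast
  qed
  thus ?thesis using that by blast
qed

lemma jet_bound_shift:
  fixes M R :: real
  assumes "M \<ge> 0" "R \<ge> 1" "m \<le> m'" shows "M * R ^ m * fact m \<le> M * R ^ m' * fact m'"
  using assms by (intro mult_mono mult_left_mono power_increasing fact_mono) auto

lemma mdeg_mdec_le: "mdeg (mdec i \<alpha>) \<le> mdeg \<alpha>"
  unfolding mdeg_def by (rule sum_mono) (simp add: mdec_def)

lemma mdec_minc_minc: "mdec p (minc t (minc p \<gamma>)) = minc t \<gamma>"
  by (metis mdec_minc minc_commute)

lemma minc_eq_minc:
  assumes "minc i \<alpha> = minc j \<beta>" "i \<noteq> j" shows "\<exists>\<gamma>. \<alpha> = minc j \<gamma> \<and> \<beta> = minc i \<gamma>"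
proof (intro exI conjI)
  have "\<alpha> j = Suc (\<beta> j)" "\<beta> i = Suc (\<alpha> i)"
    using fun_cong[OF assms(1), of j] fun_cong[OF assms(1), of i] assms(2) by (simp_all add: minc_apply)
  thus "\<alpha> = minc j (mdec j \<alpha>)" by (simp add: minc_mdec)
  show "\<beta> = minc i (mdec j \<alpha>)"
  proof
    fix l show "\<beta> l = minc i (mdec j \<alpha>) l"
      using fun_cong[OF assms(1), of l] assms(2) by (auto simp: minc_def mdec_def split: if_splits)
  qed
qed

text \<open>The Poincare lemma for 1-forms along the directions \<open>T\<close>, the other
  variables being parameters. The Taylor coefficient of \<open>y\<close> at \<alpha> can be read off
  from \<open>c m\<close> for any \<open>m\<close> in \<open>T\<close> occurring in \<alpha>;
  closedness makes it independent of \<open>m\<close>, so an arbitrary choice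
  \<open>s \<alpha>\<close> is consistent. Coefficients without such an index are free and set to
  0.\<close>

lemma analytic_potential:
  fixes a :: "'k::real_or_complex ^ 'n::finite" and T :: "'n set"
  assumes c: "\<And>m. m \<in> T \<Longrightarrow> analytic_germ a (c m)"
    and comm: "\<And>p m. p \<in> T \<Longrightarrow> m \<in> T \<Longrightarrow> \<forall>\<^sub>F x in nhds a. partial_deriv p (c m) x = partial_deriv m (c p) x"
  obtains y where "analytic_germ a y" "\<And>m. m \<in> T \<Longrightarrow> \<forall>\<^sub>F x in nhds a. partial_deriv m y x = c m x"
proof -
  have jc: "jet a (c m) (minc p \<beta>) = jet a (c p) (minc m \<beta>)" if "p \<in> T" "m \<in> T" for p m \<beta>
    using fun_cong[OF jet_cong[OF analytic_germ_partial_deriv[OF c] comm], of m p \<beta>] that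
    by (simp add: jet_partial_deriv c)
  define s where "s \<alpha> = (SOME m. m \<in> T \<and> \<alpha> m \<noteq> 0)" for \<alpha> :: "'n \<Rightarrow> nat"
  have s: "s \<alpha> \<in> T \<and> \<alpha> (s \<alpha>) \<noteq> 0" if "m \<in> T" "\<alpha> m \<noteq> 0" for m and \<alpha> :: "'n \<Rightarrow> nat"
    unfolding s_def by (rule someI[of _ m]) (use that in simp)
  define d where "d \<alpha> = (if \<exists>m\<in>T. \<alpha> m \<noteq> 0 then jet a (c (s \<alpha>)) (mdec (s \<alpha>) \<alpha>) else 0)" for \<alpha>
  obtain M R where MR: "M \<ge> 0" "R \<ge> 1"
    "\<And>m \<alpha>. m \<in> T \<Longrightarrow> norm (jet a (c m) \<alpha>) \<le> M * R ^ mdeg \<alpha> * fact (mdeg \<alpha>)"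
    using jet_bounded_family[of T "\<lambda>m. jet a (c m)", OF _ jet_bounded_jet[OF c]] by auto
  have "norm (d \<alpha>) \<le> M * R ^ mdeg \<alpha> * fact (mdeg \<alpha>)" for \<alpha>
  proof (cases "\<exists>m\<in>T. \<alpha> m \<noteq> 0")
    case True
    hence "s \<alpha> \<in> T" using s by blast
    from order_trans[OF MR(3)[OF this] jet_bound_shift[OF MR(1,2) mdeg_mdec_le]] True
    show ?thesis by (simp add: d_def)
  qed (use MR in \<open>simp add: d_def\<close>)
  hence "jet_bounded d" by (auto simp: jet_bounded_def)
  then obtain y where y: "analytic_germ a y" "jet a y = d" by (rule ex_germ_of_jet)
  have "\<forall>\<^sub>F x in nhds a. partial_deriv m y x = c m x" if m: "m \<in> T" for m
  proof (rule eventually_eq_of_jet_eq)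
    fix \<alpha>
    have sm: "s (minc m \<alpha>) \<in> T \<and> minc m \<alpha> (s (minc m \<alpha>)) \<noteq> 0" by (rule s[OF m]) simp
    let ?p = "s (minc m \<alpha>)"
    have "jet a (partial_deriv m y) \<alpha> = jet a (c ?p) (mdec ?p (minc m \<alpha>))"
      using m by (auto simp: jet_partial_deriv[OF y(1)] y(2) d_def minc_apply)
    also have "\<dots> = jet a (c m) \<alpha>"
    proof (cases "?p = m")
      case True thus ?thesis by simp
    next
      case False
      hence "\<alpha> ?p \<noteq> 0" using sm by (simp add: minc_apply)
      then obtain \<beta> where \<beta>: "\<alpha> = minc ?p \<beta>" using minc_mdec by metis
      have "mdec ?p (minc m \<alpha>) = minc m \<beta>" by (rule mdec_minc_minc[of ?p m \<beta>, folded \<beta>])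
      thus ?thesis using jc[of m ?p \<beta>] sm m \<beta> by simp
    qed
    finally show "jet a (partial_deriv m y) \<alpha> = jet a (c m) \<alpha>" .
  qed (use y c m in \<open>auto intro: agerm\<close>)
  with y(1) show ?thesis by (rule that)
qed

text \<open>The Poincare lemma for 2-forms, in axial gauge: the component of the potential in a direction
  is integrated along the first of the preceding directions.\<close>

lemma analytic_potential_2form:
  fixes a :: "'k::real_or_complex ^ 'n::finite" and \<iota> :: "nat \<Rightarrow> 'n"
  assumes inj: "inj_on \<iota> {..<n}"
    and f: "\<And>i j. i < j \<Longrightarrow> j < n \<Longrightarrow> analytic_germ a (f i j)"
    and closed: "\<And>i j l. i < j \<Longrightarrow> j < l \<Longrightarrow> l < n \<Longrightarrow> \<forall>\<^sub>F x in nhds a.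
      partial_deriv (\<iota> i) (f j l) x - partial_deriv (\<iota> j) (f i l) x + partial_deriv (\<iota> l) (f i j) x = 0"
    and dep: "\<And>t i j. t \<in> Z \<Longrightarrow> i < j \<Longrightarrow> j < n \<Longrightarrow> \<forall>\<^sub>F x in nhds a. partial_deriv t (f i j) x = 0"
    and Z: "Z \<inter> \<iota> ` {..<n} = {}"
  obtains h where "\<And>j. analytic_germ a (h j)"
    "\<And>i j. i < j \<Longrightarrow> j < n \<Longrightarrow>
      \<forall>\<^sub>F x in nhds a. partial_deriv (\<iota> i) (h j) x - partial_deriv (\<iota> j) (h i) x = f i j x"
    "\<And>t j. t \<in> Z \<Longrightarrow> j < n \<Longrightarrow> \<forall>\<^sub>F x in nhds a. partial_deriv t (h j) x = 0"
proof -
  have jc: "jet a (f j l) (minc (\<iota> i) \<beta>) - jet a (f i l) (minc (\<iota> j) \<beta>) + jet a (f i j) (minc (\<iota> l) \<beta>) = 0"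
    if "i < j" "j < l" "l < n" for i j l \<beta>
  proof -
    have 1: "analytic_germ a (f j l)" "analytic_germ a (f i l)" "analytic_germ a (f i j)"
      using f that by auto
    have "jet a (\<lambda>x. partial_deriv (\<iota> i) (f j l) x - partial_deriv (\<iota> j) (f i l) x
        + partial_deriv (\<iota> l) (f i j) x) \<beta> = 0"
      by (subst jet_cong[OF _ closed[OF that]], intro agerm 1, rule jet_zero)
    thus ?thesis using 1 by (simp add: jet_add jet_diff jet_partial_deriv agerm)
  qed
  define E where "E j \<alpha> \<longleftrightarrow> (\<exists>i<j. \<alpha> (\<iota> i) \<noteq> 0)" for j and \<alpha> :: "'n \<Rightarrow> nat"
  define s where "s \<alpha> = (LEAST i. \<alpha> (\<iota> i) \<noteq> 0)" for \<alpha> :: "'n \<Rightarrow> nat"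
  define d where "d j \<alpha> = (if j < n \<and> E j \<alpha> then jet a (f (s \<alpha>) j) (mdec (\<iota> (s \<alpha>)) \<alpha>) else 0)" for j \<alpha>
  have s: "s \<alpha> < j" "\<alpha> (\<iota> (s \<alpha>)) \<noteq> 0" if "E j \<alpha>" for j \<alpha>
  proof -
    from that obtain i where i: "i < j" "\<alpha> (\<iota> i) \<noteq> 0" by (auto simp: E_def)
    show "\<alpha> (\<iota> (s \<alpha>)) \<noteq> 0" unfolding s_def by (rule LeastI[of _ i]) (rule i(2))
    have "s \<alpha> \<le> i" unfolding s_def by (rule Least_le) (rule i(2))
    thus "s \<alpha> < j" using i(1) by simp
  qed
  define P where "P = {(i, j). i < j \<and> j < n}"
  have "finite P" by (rule finite_subset[of _ "{..<n} \<times> {..<n}"]) (auto simp: P_def)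
  moreover have "jet_bounded (jet a (f (fst p) (snd p)))" if "p \<in> P" for p
    using that f by (auto simp: P_def intro: jet_bounded_jet)
  ultimately obtain M R where MR: "M \<ge> 0" "R \<ge> 1"
    "\<And>p \<alpha>. p \<in> P \<Longrightarrow> norm (jet a (f (fst p) (snd p)) \<alpha>) \<le> M * R ^ mdeg \<alpha> * fact (mdeg \<alpha>)"
    using jet_bounded_family[of P "\<lambda>p. jet a (f (fst p) (snd p))"] by blast
  have "norm (d j \<alpha>) \<le> M * R ^ mdeg \<alpha> * fact (mdeg \<alpha>)" for j \<alpha>
  proof (cases "j < n \<and> E j \<alpha>")
    case True
    hence "(s \<alpha>, j) \<in> P" using s by (auto simp: P_def)
    from order_trans[OF MR(3)[OF this] jet_bound_shift[OF MR(1,2) mdeg_mdec_le]] True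
    show ?thesis by (simp add: d_def)
  next
    case False
    hence "d j \<alpha> = 0" unfolding d_def by (rule if_not_P)
    thus ?thesis using MR(1,2) by simp
  qed
  hence "jet_bounded (d j)" for j by (auto simp: jet_bounded_def)
  hence "\<forall>j. \<exists>h. analytic_germ a h \<and> jet a h = d j" using ex_germ_of_jet by metis
  then obtain h where h: "\<And>j. analytic_germ a (h j)" "\<And>j. jet a (h j) = d j" by metis
  \<comment> \<open>If no direction before i occurs in \<beta>, the second term is 0 by the gauge
    and the first is read off from f i j itself. Otherwise both terms were integrated along the same
    first direction, and closedness for that direction, i and j gives their difference.\<close>
  have eq: "d j (minc (\<iota> i) \<beta>) - d i (minc (\<iota> j) \<beta>) = jet a (f i j) \<beta>" if ij: "i < j" "j < n" for i j \<beta>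
  proof (cases "E i \<beta>")
    case False
    hence z: "\<beta> (\<iota> l) = 0" if "l < i" for l using that by (auto simp: E_def)
    have ne: "\<iota> l \<noteq> \<iota> i" "\<iota> l \<noteq> \<iota> j" if "l < i" for l
      using inj_onD[OF inj, of l i] inj_onD[OF inj, of l j] that ij by auto
    have si: "s (minc (\<iota> i) \<beta>) = i" unfolding s_def
    proof (rule Least_equality)
      show "i \<le> y" if "minc (\<iota> i) \<beta> (\<iota> y) \<noteq> 0" for y
      proof (rule ccontr)
        assume "\<not> i \<le> y"
        hence y: "y < i" by simp
        show False using that z[OF y] ne(1)[OF y] by (simp add: minc_apply)
      qed
    qed simp
    have "E j (minc (\<iota> i) \<beta>)" unfolding E_def using ij by (intro exI[of _ i]) simp
    moreover have "\<not> E i (minc (\<iota> j) \<beta>)" unfolding E_def using z ne by (auto simp: minc_apply)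
    ultimately show ?thesis using ij by (simp add: d_def si)
  next
    case True
    let ?m = "s \<beta>"
    have m: "?m < i" "\<beta> (\<iota> ?m) \<noteq> 0" using s[OF True] by auto
    have sm: "s (minc (\<iota> l) \<beta>) = ?m" if "i \<le> l" "l < n" for l
      unfolding s_def[of "minc (\<iota> l) \<beta>"]
    proof (rule Least_equality)
      show "minc (\<iota> l) \<beta> (\<iota> ?m) \<noteq> 0" using m by (auto simp: minc_apply)
      show "?m \<le> y" if "minc (\<iota> l) \<beta> (\<iota> y) \<noteq> 0" for y
      proof (rule ccontr)
        assume "\<not> ?m \<le> y"
        hence y: "y < ?m" by simp
        hence "\<beta> (\<iota> y) = 0" unfolding s_def using not_less_Least by blast
        moreover have "\<iota> y \<noteq> \<iota> l" using inj_onD[OF inj, of y l] y m(1) \<open>i \<le> l\<close> \<open>l < n\<close> by auto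
        ultimately show False using that by (simp add: minc_apply)
      qed
    qed
    obtain \<gamma> where \<gamma>: "\<beta> = minc (\<iota> ?m) \<gamma>" using minc_mdec m(2) by metis
    have dec: "mdec (\<iota> ?m) (minc (\<iota> l) \<beta>) = minc (\<iota> l) \<gamma>" for l
      by (rule mdec_minc_minc[of "\<iota> ?m" "\<iota> l" \<gamma>, folded \<gamma>])
    have E: "E j (minc (\<iota> i) \<beta>)" "E i (minc (\<iota> j) \<beta>)"
      unfolding E_def using m ij by (auto simp: minc_apply intro!: exI[of _ ?m])
    have "d j (minc (\<iota> i) \<beta>) - d i (minc (\<iota> j) \<beta>) =
        jet a (f ?m j) (minc (\<iota> i) \<gamma>) - jet a (f ?m i) (minc (\<iota> j) \<gamma>)"
      using E ij sm[of i] sm[of j] by (simp add: d_def dec)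
    also have "\<dots> = jet a (f i j) (minc (\<iota> ?m) \<gamma>)"
      using jc[OF m(1) ij, of \<gamma>] by (simp add: algebra_simps)
    finally show ?thesis using \<gamma> by simp
  qed
  show ?thesis
  proof (rule that[OF h(1)])
    fix i j assume ij: "i < j" "j < n"
    show "\<forall>\<^sub>F x in nhds a. partial_deriv (\<iota> i) (h j) x - partial_deriv (\<iota> j) (h i) x = f i j x"
    proof (rule eventually_eq_of_jet_eq)
      show "analytic_germ a (\<lambda>x. partial_deriv (\<iota> i) (h j) x - partial_deriv (\<iota> j) (h i) x)"
        by (intro agerm h)
      show "jet a (\<lambda>x. partial_deriv (\<iota> i) (h j) x - partial_deriv (\<iota> j) (h i) x) \<alpha> = jet a (f i j) \<alpha>" for \<alpha>
        using eq[OF ij, of \<alpha>] h by (simp add: jet_diff jet_partial_deriv agerm)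
    qed (use f ij in simp)
  next
    fix t j assume t: "t \<in> Z" and j: "j < n"
    show "\<forall>\<^sub>F x in nhds a. partial_deriv t (h j) x = 0"
    proof (rule eventually_eq_of_jet_eq)
      fix \<alpha>
      have "d j (minc t \<alpha>) = 0"
      proof (cases "E j (minc t \<alpha>)")
        case True
        let ?m = "s (minc t \<alpha>)"
        have m: "?m < j" "minc t \<alpha> (\<iota> ?m) \<noteq> 0" using s[OF True] by auto
        have "t \<noteq> \<iota> ?m" using t Z m j by auto
        hence "\<alpha> (\<iota> ?m) \<noteq> 0" using m(2) by (auto simp: minc_apply split: if_splits)
        then obtain \<gamma> where \<gamma>: "\<alpha> = minc (\<iota> ?m) \<gamma>" using minc_mdec by metis
        have "mdec (\<iota> ?m) (minc t \<alpha>) = minc t \<gamma>"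
          by (rule mdec_minc_minc[of "\<iota> ?m" t \<gamma>, folded \<gamma>])
        moreover have "jet a (f ?m j) (minc t \<gamma>) = 0"
          using fun_cong[OF jet_cong[OF analytic_germ_partial_deriv[OF f[OF m(1) j]] dep[OF t m(1) j]], of \<gamma>]
          by (simp add: jet_partial_deriv f[OF m(1) j] jet_zero)
        ultimately show ?thesis by (simp add: d_def)
      qed (simp add: d_def)
      thus "jet a (partial_deriv t (h j)) \<alpha> = jet a (\<lambda>x. 0) \<alpha>"
        by (simp add: jet_partial_deriv[OF h(1)] h(2) jet_zero)
    qed (auto intro: agerm h)
  qed
qed

text \<open>The operators \<open>\<partial>\<^bsub>i+1\<^esub> \<partial>\<^sub>j - \<partial>\<^sub>i \<partial>\<^bsub>j+1\<^esub>\<close> are the 2 by 2 minors that cut out the rational normal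
  curve.  On jets, each equation moves two indices towards each other; the recursion moves the two
  outermost ones until all indices are adjacent.  The two families of linear syzygies make
  the result independent of the order of the moves.\<close>

lemma jet_minors_solution:
  fixes \<iota> :: "nat \<Rightarrow> 'n::finite" and G :: "nat \<Rightarrow> nat \<Rightarrow> ('n \<Rightarrow> nat) \<Rightarrow> 'k::real_or_complex"
  assumes inj: "inj_on \<iota> {..n}"
    and u: "\<And>i j l \<beta>. i < j \<Longrightarrow> j < l \<Longrightarrow> l < n \<Longrightarrow>
      G j l (minc (\<iota> i) \<beta>) - G i l (minc (\<iota> j) \<beta>) + G i j (minc (\<iota> l) \<beta>) = 0"
    and v: "\<And>i j l \<beta>. i < j \<Longrightarrow> j < l \<Longrightarrow> l < n \<Longrightarrow>
      G j l (minc (\<iota> (Suc i)) \<beta>) - G i l (minc (\<iota> (Suc j)) \<beta>) + G i j (minc (\<iota> (Suc l)) \<beta>) = 0"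
    and B: "\<And>i j \<beta>. i < j \<Longrightarrow> j < n \<Longrightarrow> norm (G i j \<beta>) \<le> B (mdeg \<beta> + 2)"
    and B0: "\<And>m. B m \<ge> 0"
  obtains \<phi> where
    "\<And>i j \<beta>. i < j \<Longrightarrow> j < n \<Longrightarrow>
      \<phi> (minc (\<iota> (Suc i)) (minc (\<iota> j) \<beta>)) - \<phi> (minc (\<iota> i) (minc (\<iota> (Suc j)) \<beta>)) = G i j \<beta>"
    and "\<And>\<alpha>. norm (\<phi> \<alpha>) \<le> real (n\<^sup>2 * mdeg \<alpha>) * B (mdeg \<alpha>)"
    and "\<And>t \<alpha>. t \<notin> \<iota> ` {..n} \<Longrightarrow> \<alpha> t \<noteq> 0 \<Longrightarrow>
      (\<And>i j \<beta>. i < j \<Longrightarrow> j < n \<Longrightarrow> \<beta> t \<noteq> 0 \<Longrightarrow> G i j \<beta> = 0) \<Longrightarrow> \<phi> \<alpha> = 0"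
proof -
  \<comment> \<open>The measure for the recursion: moving i and j + 1 to i + 1 and j keeps the sum
    of the indices but lowers the sum of their squares when i < j.\<close>
  define Q where "Q \<alpha> = (\<Sum>i\<le>n. i\<^sup>2 * \<alpha> (\<iota> i))" for \<alpha> :: "'n \<Rightarrow> nat"
  have Qm: "Q (minc (\<iota> i) \<alpha>) = i\<^sup>2 + Q \<alpha>" if i: "i \<le> n" for i \<alpha>
  proof -
    have "Q (minc (\<iota> i) \<alpha>) = (\<Sum>l\<le>n. (if l = i then i\<^sup>2 else 0) + l\<^sup>2 * \<alpha> (\<iota> l))"
      unfolding Q_def
    proof (rule sum.cong)
      fix l assume "l \<in> {..n}"
      hence "\<iota> l = \<iota> i \<longleftrightarrow> l = i" using inj i by (auto dest: inj_onD)
      thus "l\<^sup>2 * minc (\<iota> i) \<alpha> (\<iota> l) = (if l = i then i\<^sup>2 else 0) + l\<^sup>2 * \<alpha> (\<iota> l)"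
        by (auto simp: minc_apply)
    qed simp
    thus ?thesis using i by (simp add: sum.distrib Q_def)
  qed
  define S where "S \<alpha> = {i. i \<le> n \<and> \<alpha> (\<iota> i) \<noteq> 0}" for \<alpha> :: "'n \<Rightarrow> nat"
  have finS: "finite (S \<alpha>)" for \<alpha> by (simp add: S_def)
  define p where "p \<alpha> = Min (S \<alpha>)" for \<alpha>
  define q where "q \<alpha> = Max (S \<alpha>)" for \<alpha>
  \<comment> \<open>If the outermost indices are less than 2 apart, \<alpha> is in no equation the
    monomial with the more distant indices; its coefficient is free and is set to 0.\<close>
  define C where "C \<alpha> \<longleftrightarrow> S \<alpha> \<noteq> {} \<and> p \<alpha> + 2 \<le> q \<alpha>" for \<alpha>
  define D where "D \<alpha> = mdec (\<iota> (p \<alpha>)) (mdec (\<iota> (q \<alpha>)) \<alpha>)" for \<alpha>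
  define N where "N \<alpha> = minc (\<iota> (Suc (p \<alpha>))) (minc (\<iota> (q \<alpha> - 1)) (D \<alpha>))" for \<alpha>
  have split: "p \<alpha> + 2 \<le> q \<alpha> \<and> q \<alpha> \<le> n \<and> \<alpha> = minc (\<iota> (p \<alpha>)) (minc (\<iota> (q \<alpha>)) (D \<alpha>))" if "C \<alpha>" for \<alpha>
  proof -
    from that have ne: "S \<alpha> \<noteq> {}" and pq: "p \<alpha> + 2 \<le> q \<alpha>" by (auto simp: C_def)
    have "p \<alpha> \<in> S \<alpha>" "q \<alpha> \<in> S \<alpha>" unfolding p_def q_def by (rule Min_in[OF finS ne] Max_in[OF finS ne])+
    hence 1: "p \<alpha> \<le> n" "q \<alpha> \<le> n" "\<alpha> (\<iota> (p \<alpha>)) \<noteq> 0" "\<alpha> (\<iota> (q \<alpha>)) \<noteq> 0" by (auto simp: S_def)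
    have "\<iota> (p \<alpha>) \<noteq> \<iota> (q \<alpha>)" using inj_onD[OF inj, of "p \<alpha>" "q \<alpha>"] 1 pq by auto
    hence "mdec (\<iota> (q \<alpha>)) \<alpha> (\<iota> (p \<alpha>)) \<noteq> 0" using 1 by (simp add: mdec_def)
    hence "minc (\<iota> (p \<alpha>)) (D \<alpha>) = mdec (\<iota> (q \<alpha>)) \<alpha>" unfolding D_def by (rule minc_mdec)
    hence "minc (\<iota> (q \<alpha>)) (minc (\<iota> (p \<alpha>)) (D \<alpha>)) = \<alpha>" using minc_mdec[of \<alpha>, OF 1(4)] by simp
    thus ?thesis using pq 1 by (simp add: minc_commute)
  qed
  have split1: "p \<alpha> + 2 \<le> q \<alpha>" and split2: "q \<alpha> \<le> n"
    and split3: "minc (\<iota> (p \<alpha>)) (minc (\<iota> (q \<alpha>)) (D \<alpha>)) = \<alpha>" if "C \<alpha>" for \<alpha>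
    using split[OF that] by simp_all
  have cancel: "y - f = w" if "r - f = x" "r - y = z" "w - x + z = 0" for r f x y z w :: 'k
  proof -
    have "y - f = (r - f) - (r - y)" by simp
    also have "\<dots> = x - z" using that by simp
    also have "\<dots> = w" using that(3) by (simp add: algebra_simps)
    finally show ?thesis .
  qed
  have sq: "(Suc i)\<^sup>2 + j\<^sup>2 < i\<^sup>2 + (Suc j)\<^sup>2" if "i < j" for i j :: nat
    using that by (simp add: power2_eq_square)
  have QN: "Q (N \<alpha>) < Q \<alpha>" if C: "C \<alpha>" for \<alpha>
  proof -
    obtain j where j: "q \<alpha> = Suc j" "p \<alpha> < j" using split1[OF C] by (cases "q \<alpha>") auto
    have "Q (N \<alpha>) = (Suc (p \<alpha>))\<^sup>2 + (j\<^sup>2 + Q (D \<alpha>))"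
      unfolding N_def using split2[OF C] j by (simp add: Qm)
    also have "\<dots> < (p \<alpha>)\<^sup>2 + ((Suc j)\<^sup>2 + Q (D \<alpha>))" using sq[OF j(2)] by linarith
    also have "\<dots> = Q (minc (\<iota> (p \<alpha>)) (minc (\<iota> (q \<alpha>)) (D \<alpha>)))"
      using split2[OF C] j by (simp add: Qm)
    also have "\<dots> = Q \<alpha>" by (simp add: split3[OF C])
    finally show ?thesis .
  qed
  define \<phi> where "\<phi> = wfrec (Wellfounded.measure Q) (\<lambda>f \<alpha>. if C \<alpha> then f (N \<alpha>) - G (p \<alpha>) (q \<alpha> - 1) (D \<alpha>) else 0)"
  have \<phi>: "\<phi> \<alpha> = (if C \<alpha> then \<phi> (N \<alpha>) - G (p \<alpha>) (q \<alpha> - 1) (D \<alpha>) else 0)" for \<alpha>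
    unfolding \<phi>_def by (subst wfrec[OF wf_measure]) (simp add: cut_apply QN)
  \<comment> \<open>The recursion is the equation for the outermost pair. If only the upper index is
    outermost, the syzygies \<open>u\<close> reduce to that equation (\<open>A\<close> below); if
    the upper index is not outermost, the syzygies \<open>v\<close> reduce to \<open>A\<close>. Each
    time the third equation belongs to a multi-index with smaller \<open>Q\<close>.\<close>
  have main: "\<forall>i j \<beta>. i < j \<longrightarrow> j < n \<longrightarrow> \<alpha> = minc (\<iota> i) (minc (\<iota> (Suc j)) \<beta>) \<longrightarrow>
      \<phi> (minc (\<iota> (Suc i)) (minc (\<iota> j) \<beta>)) - \<phi> \<alpha> = G i j \<beta>" for \<alpha>
  proof (induction "Q \<alpha>" arbitrary: \<alpha> rule: less_induct)
    case less
    have IH: "\<phi> (minc (\<iota> (Suc i)) (minc (\<iota> j) \<beta>)) - \<phi> (minc (\<iota> i) (minc (\<iota> (Suc j)) \<beta>)) = G i j \<beta>"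
      if "i < j" "j < n" "Q (minc (\<iota> i) (minc (\<iota> (Suc j)) \<beta>)) < Q \<alpha>" for i j \<beta>
      using less[OF that(3)] that(1,2) by blast
    have pq: "p \<alpha> \<le> i" "Suc j \<le> q \<alpha>" "C \<alpha>"
      if "i < j" "j < n" "\<alpha> = minc (\<iota> i) (minc (\<iota> (Suc j)) \<beta>)" for i j \<beta>
    proof -
      have "i \<in> S \<alpha>" "Suc j \<in> S \<alpha>" using that by (auto simp: S_def minc_apply)
      thus 1: "p \<alpha> \<le> i" "Suc j \<le> q \<alpha>" unfolding p_def q_def using finS by auto
      thus "C \<alpha>" using that \<open>i \<in> S \<alpha>\<close> by (auto simp: C_def)
    qed
    have A: "\<phi> (minc (\<iota> (Suc i)) (minc (\<iota> j) \<beta>)) - \<phi> \<alpha> = G i j \<beta>"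
      if ij: "i < j" "j < n" and \<alpha>: "\<alpha> = minc (\<iota> i) (minc (\<iota> (Suc j)) \<beta>)" and top: "Suc j = q \<alpha>" for i j \<beta>
    proof -
      note pq' = pq[OF ij \<alpha>]
      have sp: "\<alpha> = minc (\<iota> (p \<alpha>)) (minc (\<iota> (Suc j)) (D \<alpha>))" using split3[OF pq'(3)] top by simp
      have rec: "\<phi> \<alpha> = \<phi> (minc (\<iota> (Suc (p \<alpha>))) (minc (\<iota> j) (D \<alpha>))) - G (p \<alpha>) j (D \<alpha>)"
        unfolding \<phi>[of \<alpha>] if_P[OF pq'(3)] N_def top[symmetric] by simp
      show ?thesis
      proof (cases "p \<alpha> = i")
        case True
        have "minc (\<iota> i) (minc (\<iota> (Suc j)) (D \<alpha>)) = minc (\<iota> i) (minc (\<iota> (Suc j)) \<beta>)"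
          using sp \<alpha> True by simp
        hence "D \<alpha> = \<beta>" by (metis mdec_minc)
        thus ?thesis using rec True by simp
      next
        case False
        hence pi: "p \<alpha> < i" using pq' by simp
        have ne: "\<iota> (p \<alpha>) \<noteq> \<iota> i" using inj_onD[OF inj, of "p \<alpha>" i] pi ij by auto
        have "minc (\<iota> (Suc j)) (minc (\<iota> (p \<alpha>)) (D \<alpha>)) = minc (\<iota> (Suc j)) (minc (\<iota> i) \<beta>)"
          using sp \<alpha> by (simp add: minc_commute)
        hence "minc (\<iota> (p \<alpha>)) (D \<alpha>) = minc (\<iota> i) \<beta>" by (metis mdec_minc)
        from minc_eq_minc[OF this ne] obtain \<gamma> where \<gamma>: "D \<alpha> = minc (\<iota> i) \<gamma>" "\<beta> = minc (\<iota> (p \<alpha>)) \<gamma>" by blast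
        have Q1: "Q (minc (\<iota> (p \<alpha>)) (minc (\<iota> (Suc i)) (minc (\<iota> j) \<gamma>))) < Q \<alpha>"
        proof -
          have "Q \<alpha> = i\<^sup>2 + ((Suc j)\<^sup>2 + ((p \<alpha>)\<^sup>2 + Q \<gamma>))"
            by (subst \<alpha>) (use ij pi \<gamma> in \<open>simp add: Qm\<close>)
          moreover have "Q (minc (\<iota> (p \<alpha>)) (minc (\<iota> (Suc i)) (minc (\<iota> j) \<gamma>))) =
              (p \<alpha>)\<^sup>2 + ((Suc i)\<^sup>2 + (j\<^sup>2 + Q \<gamma>))" using ij pi by (simp add: Qm)
          ultimately show ?thesis using sq[OF ij(1)] by linarith
        qed
        have E: "\<phi> (minc (\<iota> (Suc (p \<alpha>))) (minc (\<iota> i) (minc (\<iota> j) \<gamma>))) -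
            \<phi> (minc (\<iota> (p \<alpha>)) (minc (\<iota> (Suc i)) (minc (\<iota> j) \<gamma>))) = G (p \<alpha>) i (minc (\<iota> j) \<gamma>)"
          by (rule IH[OF pi _ Q1]) (use ij in simp)
        have c1: "minc (\<iota> (Suc i)) (minc (\<iota> j) \<beta>) = minc (\<iota> (p \<alpha>)) (minc (\<iota> (Suc i)) (minc (\<iota> j) \<gamma>))"
          by (simp add: \<gamma>(2) minc_commute)
        have c2: "minc (\<iota> (Suc (p \<alpha>))) (minc (\<iota> j) (D \<alpha>)) = minc (\<iota> (Suc (p \<alpha>))) (minc (\<iota> i) (minc (\<iota> j) \<gamma>))"
          by (simp add: \<gamma>(1) minc_commute)
        show ?thesis unfolding c1
        proof (rule cancel[OF _ E])
          show "\<phi> (minc (\<iota> (Suc (p \<alpha>))) (minc (\<iota> i) (minc (\<iota> j) \<gamma>))) - \<phi> \<alpha> = G (p \<alpha>) j (minc (\<iota> i) \<gamma>)"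
            using rec unfolding c2 unfolding \<gamma> by simp
          show "G i j \<beta> - G (p \<alpha>) j (minc (\<iota> i) \<gamma>) + G (p \<alpha>) i (minc (\<iota> j) \<gamma>) = 0"
            unfolding \<gamma> by (rule u[OF pi ij])
        qed
      qed
    qed
    show ?case
    proof (intro allI impI)
      fix i j \<beta> assume ij: "i < j" "j < n" and \<alpha>: "\<alpha> = minc (\<iota> i) (minc (\<iota> (Suc j)) \<beta>)"
      note pq' = pq[OF ij \<alpha>]
      show "\<phi> (minc (\<iota> (Suc i)) (minc (\<iota> j) \<beta>)) - \<phi> \<alpha> = G i j \<beta>"
      proof (cases "Suc j = q \<alpha>")
        case True thus ?thesis by (rule A[OF ij \<alpha>])
      next
        case False
        obtain l where l: "q \<alpha> = Suc l" "j < l" using False pq' by (cases "q \<alpha>") auto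
        have ln: "l < n" using split2[OF pq'(3)] l by simp
        have "\<alpha> (\<iota> (Suc l)) \<noteq> 0"
          using split3[OF pq'(3)] l by (metis minc_same minc_commute nat.distinct(1))
        moreover have "\<iota> (Suc l) \<noteq> \<iota> i" "\<iota> (Suc l) \<noteq> \<iota> (Suc j)"
          using inj_onD[OF inj, of "Suc l" i] inj_onD[OF inj, of "Suc l" "Suc j"] ij l ln by auto
        ultimately have "\<beta> (\<iota> (Suc l)) \<noteq> 0" unfolding \<alpha> by (simp add: minc_apply)
        then obtain \<gamma> where \<gamma>: "\<beta> = minc (\<iota> (Suc l)) \<gamma>" using minc_mdec by metis
        have A1: "\<phi> (minc (\<iota> (Suc i)) (minc (\<iota> l) (minc (\<iota> (Suc j)) \<gamma>))) - \<phi> \<alpha> = G i l (minc (\<iota> (Suc j)) \<gamma>)"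
          by (rule A) (use ij l ln \<alpha> \<gamma> in \<open>auto simp: minc_commute\<close>)
        have Q1: "Q (minc (\<iota> j) (minc (\<iota> (Suc l)) (minc (\<iota> (Suc i)) \<gamma>))) < Q \<alpha>"
        proof -
          have "Q \<alpha> = i\<^sup>2 + ((Suc j)\<^sup>2 + ((Suc l)\<^sup>2 + Q \<gamma>))"
            by (subst \<alpha>) (use ij ln \<gamma> in \<open>simp add: Qm\<close>)
          moreover have "Q (minc (\<iota> j) (minc (\<iota> (Suc l)) (minc (\<iota> (Suc i)) \<gamma>))) =
              j\<^sup>2 + ((Suc l)\<^sup>2 + ((Suc i)\<^sup>2 + Q \<gamma>))" using ij ln by (simp add: Qm)
          ultimately show ?thesis using sq[OF ij(1)] by linarith
        qed
        have A2: "\<phi> (minc (\<iota> (Suc j)) (minc (\<iota> l) (minc (\<iota> (Suc i)) \<gamma>))) -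
            \<phi> (minc (\<iota> j) (minc (\<iota> (Suc l)) (minc (\<iota> (Suc i)) \<gamma>))) = G j l (minc (\<iota> (Suc i)) \<gamma>)"
          by (rule IH[OF l(2) ln Q1])
        have c1: "minc (\<iota> (Suc i)) (minc (\<iota> j) \<beta>) = minc (\<iota> j) (minc (\<iota> (Suc l)) (minc (\<iota> (Suc i)) \<gamma>))"
          by (simp add: \<gamma> minc_commute)
        have c2: "minc (\<iota> (Suc i)) (minc (\<iota> l) (minc (\<iota> (Suc j)) \<gamma>)) =
            minc (\<iota> (Suc j)) (minc (\<iota> l) (minc (\<iota> (Suc i)) \<gamma>))"
          by (simp add: minc_commute)
        show ?thesis unfolding c1
        proof (rule cancel[OF A1[unfolded c2] A2])
          show "G i j \<beta> - G i l (minc (\<iota> (Suc j)) \<gamma>) + G j l (minc (\<iota> (Suc i)) \<gamma>) = 0"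
            unfolding \<gamma> using v[OF ij(1) l(2) ln, of \<gamma>] by (simp add: algebra_simps)
        qed
      qed
    qed
  qed
  have dN: "mdeg (N \<alpha>) = mdeg \<alpha>" "mdeg \<alpha> = mdeg (D \<alpha>) + 2" if "C \<alpha>" for \<alpha>
    using arg_cong[OF split3[OF that], of mdeg] by (simp_all add: N_def)
  \<comment> \<open>Every step of the recursion contributes one value of \<open>G\<close> and lowers
    \<open>Q\<close>, so at most \<open>Q \<alpha>\<close> values occur, all with the same bound
    since a move preserves the degree.\<close>
  have bQ: "norm (\<phi> \<alpha>) \<le> real (Q \<alpha>) * B (mdeg \<alpha>)" for \<alpha>
  proof (induction "Q \<alpha>" arbitrary: \<alpha> rule: less_induct)
    case less
    show ?case
    proof (cases "C \<alpha>")
      case False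
      thus ?thesis using B0[of "mdeg \<alpha>"] by (subst \<phi>) simp
    next
      case True
      have "norm (\<phi> \<alpha>) \<le> norm (\<phi> (N \<alpha>)) + norm (G (p \<alpha>) (q \<alpha> - 1) (D \<alpha>))"
        using \<phi>[of \<alpha>] True by (simp add: norm_triangle_ineq4)
      also have "\<dots> \<le> real (Q (N \<alpha>)) * B (mdeg \<alpha>) + B (mdeg \<alpha>)"
        using less[OF QN[OF True]] B[of "p \<alpha>" "q \<alpha> - 1" "D \<alpha>"] split1[OF True] split2[OF True] dN[OF True]
        by (intro add_mono) auto
      also have "\<dots> = real (Suc (Q (N \<alpha>))) * B (mdeg \<alpha>)" by (simp add: algebra_simps)
      also have "\<dots> \<le> real (Q \<alpha>) * B (mdeg \<alpha>)"
        using QN[OF True] B0[of "mdeg \<alpha>"] by (intro mult_right_mono) (auto simp del: of_nat_Suc)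
      finally show ?thesis .
    qed
  qed
  have Qle: "Q \<alpha> \<le> n\<^sup>2 * mdeg \<alpha>" for \<alpha>
  proof -
    have "Q \<alpha> \<le> (\<Sum>i\<le>n. n\<^sup>2 * \<alpha> (\<iota> i))"
      unfolding Q_def by (rule sum_mono) (simp add: power_mono)
    also have "\<dots> = n\<^sup>2 * (\<Sum>i\<in>\<iota> ` {..n}. \<alpha> i)"
      by (subst sum.reindex[OF inj]) (simp add: sum_distrib_left)
    also have "\<dots> \<le> n\<^sup>2 * mdeg \<alpha>" unfolding mdeg_def by (intro mult_left_mono sum_mono2) auto
    finally show ?thesis .
  qed
  show ?thesis
  proof (rule that)
    show "\<phi> (minc (\<iota> (Suc i)) (minc (\<iota> j) \<beta>)) - \<phi> (minc (\<iota> i) (minc (\<iota> (Suc j)) \<beta>)) = G i j \<beta>"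
      if "i < j" "j < n" for i j \<beta> using main that by blast
    show "norm (\<phi> \<alpha>) \<le> real (n\<^sup>2 * mdeg \<alpha>) * B (mdeg \<alpha>)" for \<alpha>
      by (rule order_trans[OF bQ mult_right_mono[OF _ B0]]) (use Qle[of \<alpha>] in \<open>simp only: of_nat_le_iff\<close>)
  next
    fix t and \<alpha> :: "'n \<Rightarrow> nat" assume t: "t \<notin> \<iota> ` {..n}" and "\<alpha> t \<noteq> 0"
      and z: "\<And>i j \<beta>. i < j \<Longrightarrow> j < n \<Longrightarrow> \<beta> t \<noteq> 0 \<Longrightarrow> G i j \<beta> = 0"
    thus "\<phi> \<alpha> = 0"
    proof (induction "Q \<alpha>" arbitrary: \<alpha> rule: less_induct)
      case less
      show ?case
      proof (cases "C \<alpha>")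
        case True
        have tt: "minc (\<iota> i) \<beta> t = \<beta> t" if "i \<le> n" for i \<beta> using t that by (auto simp: minc_apply)
        note le = split1[OF True] split2[OF True]
        have D: "D \<alpha> t = \<alpha> t"
          using arg_cong[OF split3[OF True], of "\<lambda>\<beta>. \<beta> t"] tt[of "p \<alpha>"] tt[of "q \<alpha>"] le by simp
        moreover have "N \<alpha> t = \<alpha> t"
          unfolding N_def using le tt[of "Suc (p \<alpha>)"] tt[of "q \<alpha> - 1"] D by simp
        moreover have "G (p \<alpha>) (q \<alpha> - 1) (D \<alpha>) = 0"
          by (rule z) (use le D less.prems in auto)
        ultimately show ?thesis using less(1)[OF QN[OF True]] less.prems \<phi>[of \<alpha>] by simp
      qed (simp add: \<phi>)
    qed
  qed
qed

text \<open>The jets of \<open>g\<close> satisfy the syzygies of the preceding lemma. The number of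
  recursion steps, at most n^2 |\<alpha>|, is absorbed by 2^|\<alpha>|, so the solution on jets
  converges.\<close>

lemma analytic_minors_solution:
  fixes a :: "'k::real_or_complex ^ 'n::finite" and \<iota> :: "nat \<Rightarrow> 'n"
  assumes inj: "inj_on \<iota> {..n}"
    and g: "\<And>i j. i < j \<Longrightarrow> j < n \<Longrightarrow> analytic_germ a (g i j)"
    and u: "\<And>i j l. i < j \<Longrightarrow> j < l \<Longrightarrow> l < n \<Longrightarrow> \<forall>\<^sub>F x in nhds a.
      partial_deriv (\<iota> i) (g j l) x - partial_deriv (\<iota> j) (g i l) x + partial_deriv (\<iota> l) (g i j) x = 0"
    and v: "\<And>i j l. i < j \<Longrightarrow> j < l \<Longrightarrow> l < n \<Longrightarrow> \<forall>\<^sub>F x in nhds a.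
      partial_deriv (\<iota> (Suc i)) (g j l) x - partial_deriv (\<iota> (Suc j)) (g i l) x
        + partial_deriv (\<iota> (Suc l)) (g i j) x = 0"
    and dep: "\<And>t i j. t \<in> Z \<Longrightarrow> i < j \<Longrightarrow> j < n \<Longrightarrow> \<forall>\<^sub>F x in nhds a. partial_deriv t (g i j) x = 0"
    and Z: "Z \<inter> \<iota> ` {..n} = {}"
  obtains \<Phi> where "analytic_germ a \<Phi>"
    "\<And>i j. i < j \<Longrightarrow> j < n \<Longrightarrow> \<forall>\<^sub>F x in nhds a. partial_deriv (\<iota> (Suc i)) (partial_deriv (\<iota> j) \<Phi>) x
      - partial_deriv (\<iota> (Suc j)) (partial_deriv (\<iota> i) \<Phi>) x = g i j x"
    "\<And>t. t \<in> Z \<Longrightarrow> \<forall>\<^sub>F x in nhds a. partial_deriv t \<Phi> x = 0"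
proof -
  have jc: "jet a (g j l) (minc p \<beta>) - jet a (g i l) (minc q \<beta>) + jet a (g i j) (minc r \<beta>) = 0"
    if ijl: "i < j" "j < l" "l < n" and ev: "\<forall>\<^sub>F x in nhds a.
      partial_deriv p (g j l) x - partial_deriv q (g i l) x + partial_deriv r (g i j) x = 0" for i j l p q r \<beta>
  proof -
    have 1: "analytic_germ a (g j l)" "analytic_germ a (g i l)" "analytic_germ a (g i j)"
      using g ijl by auto
    have "jet a (\<lambda>x. partial_deriv p (g j l) x - partial_deriv q (g i l) x + partial_deriv r (g i j) x) \<beta> = 0"
      by (subst jet_cong[OF _ ev], intro agerm 1, rule jet_zero)
    thus ?thesis using 1 by (simp add: jet_add jet_diff jet_partial_deriv agerm)
  qed
  define P where "P = {(i, j). i < j \<and> j < n}"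
  have "finite P" by (rule finite_subset[of _ "{..<n} \<times> {..<n}"]) (auto simp: P_def)
  moreover have "jet_bounded (jet a (g (fst p) (snd p)))" if "p \<in> P" for p
    using that g by (auto simp: P_def intro: jet_bounded_jet)
  ultimately obtain M R where MR: "M \<ge> 0" "R \<ge> 1"
    "\<And>p \<alpha>. p \<in> P \<Longrightarrow> norm (jet a (g (fst p) (snd p)) \<alpha>) \<le> M * R ^ mdeg \<alpha> * fact (mdeg \<alpha>)"
    using jet_bounded_family[of P "\<lambda>p. jet a (g (fst p) (snd p))"] by blast
  define B :: "nat \<Rightarrow> real" where "B m = M * R ^ m * fact m" for m
  have Bn: "norm (jet a (g i j) \<beta>) \<le> B (mdeg \<beta> + 2)" if "i < j" "j < n" for i j \<beta>
    using order_trans[OF MR(3)[of "(i, j)" \<beta>] jet_bound_shift[OF MR(1,2), of "mdeg \<beta>" "mdeg \<beta> + 2"]] that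
    by (simp add: B_def P_def)
  have B0: "B m \<ge> 0" for m using MR(1,2) by (simp add: B_def)
  obtain \<phi> where \<phi>: "\<And>i j \<beta>. i < j \<Longrightarrow> j < n \<Longrightarrow>
      \<phi> (minc (\<iota> (Suc i)) (minc (\<iota> j) \<beta>)) - \<phi> (minc (\<iota> i) (minc (\<iota> (Suc j)) \<beta>)) = jet a (g i j) \<beta>"
    and b: "\<And>\<alpha>. norm (\<phi> \<alpha>) \<le> real (n\<^sup>2 * mdeg \<alpha>) * B (mdeg \<alpha>)"
    and s: "\<And>t \<alpha>. t \<notin> \<iota> ` {..n} \<Longrightarrow> \<alpha> t \<noteq> 0 \<Longrightarrow>
      (\<And>i j \<beta>. i < j \<Longrightarrow> j < n \<Longrightarrow> \<beta> t \<noteq> 0 \<Longrightarrow> jet a (g i j) \<beta> = 0) \<Longrightarrow> \<phi> \<alpha> = 0"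
    using jet_minors_solution[of \<iota> n "\<lambda>i j. jet a (g i j)" B, OF inj jc[OF _ _ _ u] jc[OF _ _ _ v] Bn B0]
    by blast
  have "norm (\<phi> \<alpha>) \<le> (real (n\<^sup>2) * M) * (2 * R) ^ mdeg \<alpha> * fact (mdeg \<alpha>)" for \<alpha>
  proof -
    have "norm (\<phi> \<alpha>) \<le> real (n\<^sup>2) * real (mdeg \<alpha>) * B (mdeg \<alpha>)" using b[of \<alpha>] by simp
    also have "\<dots> \<le> real (n\<^sup>2) * 2 ^ mdeg \<alpha> * B (mdeg \<alpha>)"
      by (intro mult_right_mono mult_left_mono real_le_two_power B0) simp
    finally show ?thesis by (simp add: B_def power_mult_distrib mult_ac)
  qed
  hence "jet_bounded \<phi>" unfolding jet_bounded_def by blast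
  then obtain \<Phi> where \<Phi>: "analytic_germ a \<Phi>" "jet a \<Phi> = \<phi>" by (rule ex_germ_of_jet)
  show ?thesis
  proof (rule that[OF \<Phi>(1)])
    fix i j assume ij: "i < j" "j < n"
    show "\<forall>\<^sub>F x in nhds a. partial_deriv (\<iota> (Suc i)) (partial_deriv (\<iota> j) \<Phi>) x
      - partial_deriv (\<iota> (Suc j)) (partial_deriv (\<iota> i) \<Phi>) x = g i j x"
    proof (rule eventually_eq_of_jet_eq)
      show "analytic_germ a (\<lambda>x. partial_deriv (\<iota> (Suc i)) (partial_deriv (\<iota> j) \<Phi>) x
        - partial_deriv (\<iota> (Suc j)) (partial_deriv (\<iota> i) \<Phi>) x)" by (intro agerm \<Phi>)
      show "analytic_germ a (g i j)" by (rule g[OF ij])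
      show "jet a (\<lambda>x. partial_deriv (\<iota> (Suc i)) (partial_deriv (\<iota> j) \<Phi>) x
        - partial_deriv (\<iota> (Suc j)) (partial_deriv (\<iota> i) \<Phi>) x) \<beta> = jet a (g i j) \<beta>" for \<beta>
        using \<phi>[OF ij, of \<beta>] \<Phi>
        by (simp add: jet_diff jet_partial_deriv agerm minc_commute)
    qed
  next
    fix t assume t: "t \<in> Z"
    have "\<phi> (minc t \<alpha>) = 0" for \<alpha>
    proof (rule s[of t])
      fix i j \<beta> assume ij: "i < j" "j < n" and "\<beta> t \<noteq> (0::nat)"
      then obtain \<gamma> where "\<beta> = minc t \<gamma>" using minc_mdec by metis
      thus "jet a (g i j) \<beta> = 0"
        using fun_cong[OF jet_cong[OF analytic_germ_partial_deriv[OF g[OF ij]] dep[OF t ij]], of \<gamma>]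
        by (simp add: jet_partial_deriv g[OF ij] jet_zero)
    qed (use t Z in auto)
    thus "\<forall>\<^sub>F x in nhds a. partial_deriv t \<Phi> x = 0"
      by (intro eventually_eq_of_jet_eq agerm \<Phi>(1))
        (simp add: jet_partial_deriv[OF \<Phi>(1)] \<Phi>(2) jet_zero)
  qed
qed

section \<open>Bihamiltonian structures in coordinates\<close>

definition br :: "('n \<Rightarrow> 'n \<Rightarrow> 'k ^ 'n \<Rightarrow> 'k) \<Rightarrow> ('k::real_or_complex ^ 'n::finite, 'k) bracket" where
  "br \<pi> f g x = (\<Sum>i\<in>UNIV. \<Sum>j\<in>UNIV. \<pi> i j x * partial_deriv i f x * partial_deriv j g x)"

lemma br_cong_eventually:
  assumes "\<forall>\<^sub>F x in nhds a. f x = f' x" "\<forall>\<^sub>F x in nhds a. g x = g' x"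
  shows "\<forall>\<^sub>F x in nhds a. br \<pi> f g x = br \<pi> f' g' x"
proof -
  have "\<forall>\<^sub>F x in nhds a. \<forall>i. partial_deriv i f x = partial_deriv i f' x"
    by (intro eventually_all_finite eventually_partial_deriv_cong assms)
  moreover have "\<forall>\<^sub>F x in nhds a. \<forall>i. partial_deriv i g x = partial_deriv i g' x"
    by (intro eventually_all_finite eventually_partial_deriv_cong assms)
  ultimately show ?thesis by eventually_elim (simp add: br_def)
qed

lemma br_alt: "br \<pi> f g x = (\<Sum>j\<in>UNIV. (\<Sum>i\<in>UNIV. \<pi> i j x * partial_deriv i f x) * partial_deriv j g x)"
  unfolding br_def by (subst sum.swap) (simp add: sum_distrib_right)

lemma br_alt': "br \<pi> f g x = (\<Sum>i\<in>UNIV. partial_deriv i f x * (\<Sum>j\<in>UNIV. \<pi> i j x * partial_deriv j g x))"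
  unfolding br_def by (simp add: sum_distrib_left mult_ac)

lemma br_const_right [simp]: "br \<pi> f (\<lambda>_. c) x = 0"
  and br_const_left [simp]: "br \<pi> (\<lambda>_. c) f x = 0"
  by (simp_all add: br_def)

lemma br_add_right: "kdiff g x \<Longrightarrow> kdiff h x \<Longrightarrow> br \<pi> f (\<lambda>x. g x + h x) x = br \<pi> f g x + br \<pi> f h x"
  by (simp add: br_def partial_deriv_add distrib_left sum.distrib)

lemma br_add_left: "kdiff g x \<Longrightarrow> kdiff h x \<Longrightarrow> br \<pi> (\<lambda>x. g x + h x) f x = br \<pi> g f x + br \<pi> h f x"
  by (simp add: br_def partial_deriv_add distrib_left distrib_right sum.distrib)

lemma br_mult_right: "kdiff g x \<Longrightarrow> kdiff h x \<Longrightarrow>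
    br \<pi> f (\<lambda>x. g x * h x) x = br \<pi> f g x * h x + g x * br \<pi> f h x"
  by (simp add: br_def partial_deriv_mult algebra_simps sum.distrib sum_distrib_left)

lemma br_sum_right: "(\<And>j. j \<in> J \<Longrightarrow> kdiff (g j) x) \<Longrightarrow> br \<pi> f (\<lambda>x. \<Sum>j\<in>J. g j x) x = (\<Sum>j\<in>J. br \<pi> f (g j) x)"
  by (induction J rule: infinite_finite_induct) (simp_all add: br_add_right kdiff_sum)

lemma br_minus_right: "kdiff g x \<Longrightarrow> br \<pi> f (\<lambda>x. - g x) x = - br \<pi> f g x"
  by (simp add: br_def partial_deriv_minus sum_negf)

lemma br_coord_left: "br \<pi> (\<lambda>x. x $ b) f x = (\<Sum>j\<in>UNIV. \<pi> b j x * partial_deriv j f x)"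
  by (simp add: br_alt' partial_deriv_coord if_distrib[of "\<lambda>c. c * _"] cong: if_cong)

lemma br_coord_coord: "br \<pi> (\<lambda>x. x $ b) (\<lambda>x. x $ c) x = \<pi> b c x"
  by (simp add: br_coord_left partial_deriv_coord if_distrib[of "\<lambda>c. _ * c"] cong: if_cong)

lemma br_skew:
  assumes "\<And>i j. \<pi> i j x = - \<pi> j i x" shows "br \<pi> f g x = - br \<pi> g f x"
proof -
  have "br \<pi> f g x = (\<Sum>i\<in>UNIV. \<Sum>j\<in>UNIV. - (\<pi> j i x * partial_deriv j g x * partial_deriv i f x))"
    unfolding br_def
  proof (intro sum.cong refl)
    fix i j
    have "\<pi> i j x = - \<pi> j i x" by (rule assms)
    thus "\<pi> i j x * partial_deriv i f x * partial_deriv j g x =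
        - (\<pi> j i x * partial_deriv j g x * partial_deriv i f x)" by simp
  qed
  also have "\<dots> = - br \<pi> g f x" unfolding br_def by (subst sum.swap) (simp add: sum_negf)
  finally show ?thesis .
qed

lemma analytic_germ_br [agerm]:
  "(\<And>i j. analytic_germ a (\<pi> i j)) \<Longrightarrow> analytic_germ a f \<Longrightarrow> analytic_germ a g \<Longrightarrow> analytic_germ a (br \<pi> f g)"
  unfolding br_def[abs_def] by (intro agerm)

text \<open>Skewness and the chain relation give P(i, j+1) = P(i+1, j): the first index climbs and
  the second falls until an end of the chain, where \<open>Pn\<close> or \<open>Q0\<close> makes the
  value vanish.\<close>

lemma lenard_involution:
  fixes P Q :: "nat \<Rightarrow> nat \<Rightarrow> 'k::field"
  assumes skew: "\<And>i j. i \<le> n \<Longrightarrow> j \<le> n \<Longrightarrow> P i j = - P j i" "\<And>i j. i \<le> n \<Longrightarrow> j \<le> n \<Longrightarrow> Q i j = - Q j i"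
    and Q0: "\<And>j. j \<le> n \<Longrightarrow> Q 0 j = 0" and Pn: "\<And>j. j \<le> n \<Longrightarrow> P n j = 0"
    and chain: "\<And>i j. i < n \<Longrightarrow> j \<le> n \<Longrightarrow> Q (Suc i) j = - P i j"
    and ij: "i \<le> n" "j \<le> n"
  shows "P i j = 0"
  using ij
proof (induction j arbitrary: i)
  case 0
  show ?case
  proof (cases "i = n")
    case True thus ?thesis using Pn by simp
  next
    case False
    hence "P i 0 = - Q (Suc i) 0" using chain[of i 0] 0 by simp
    also have "\<dots> = Q 0 (Suc i)" using skew(2)[of "Suc i" 0] 0 False by simp
    also have "\<dots> = 0" using Q0[of "Suc i"] 0 False by simp
    finally show ?thesis .
  qed
next
  case (Suc j)
  show ?case
  proof (cases "i = n")
    case True thus ?thesis using Pn Suc.prems by simp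
  next
    case False
    hence "P i (Suc j) = - Q (Suc i) (Suc j)" using chain[of i "Suc j"] Suc.prems by simp
    also have "\<dots> = Q (Suc j) (Suc i)" using skew(2)[of "Suc i" "Suc j"] Suc.prems False by simp
    also have "\<dots> = - P j (Suc i)" using chain[of j "Suc i"] Suc.prems False by simp
    also have "\<dots> = P (Suc i) j" using skew(1)[of "Suc i" j] Suc.prems False by simp
    also have "\<dots> = 0" using Suc.IH[of "Suc i"] Suc.prems False by simp
    finally show ?thesis .
  qed
qed

text \<open>\<open>jac12\<close> is the compatibility of the two brackets: the part of the Jacobi
  identity of their combinations that is bilinear in the two brackets.\<close>

locale bihamiltonian_germ =
  fixes a :: "'k::real_or_complex ^ 'n::finite" and \<pi>1 \<pi>2 :: "'n \<Rightarrow> 'n \<Rightarrow> 'k ^ 'n \<Rightarrow> 'k"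
  assumes an1: "analytic_germ a (\<pi>1 i j)" and an2: "analytic_germ a (\<pi>2 i j)"
    and skew1: "\<forall>\<^sub>F x in nhds a. \<forall>i j. \<pi>1 i j x = - \<pi>1 j i x"
    and skew2: "\<forall>\<^sub>F x in nhds a. \<forall>i j. \<pi>2 i j x = - \<pi>2 j i x"
    and jac1: "analytic_germ a f \<Longrightarrow> analytic_germ a g \<Longrightarrow> analytic_germ a h \<Longrightarrow>
      \<forall>\<^sub>F x in nhds a. br \<pi>1 f (br \<pi>1 g h) x + br \<pi>1 g (br \<pi>1 h f) x + br \<pi>1 h (br \<pi>1 f g) x = 0"
    and jac2: "analytic_germ a f \<Longrightarrow> analytic_germ a g \<Longrightarrow> analytic_germ a h \<Longrightarrow>
      \<forall>\<^sub>F x in nhds a. br \<pi>2 f (br \<pi>2 g h) x + br \<pi>2 g (br \<pi>2 h f) x + br \<pi>2 h (br \<pi>2 f g) x = 0"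
    and jac12: "analytic_germ a f \<Longrightarrow> analytic_germ a g \<Longrightarrow> analytic_germ a h \<Longrightarrow>
      \<forall>\<^sub>F x in nhds a. br \<pi>1 f (br \<pi>2 g h) x + br \<pi>1 g (br \<pi>2 h f) x + br \<pi>1 h (br \<pi>2 f g) x +
        (br \<pi>2 f (br \<pi>1 g h) x + br \<pi>2 g (br \<pi>1 h f) x + br \<pi>2 h (br \<pi>1 f g) x) = 0"
begin

lemma ev_skew1: "\<forall>\<^sub>F x in nhds a. \<forall>f g. br \<pi>1 f g x = - br \<pi>1 g f x"
  using skew1 by eventually_elim (auto intro: br_skew)

lemma ev_skew2: "\<forall>\<^sub>F x in nhds a. \<forall>f g. br \<pi>2 f g x = - br \<pi>2 g f x"
  using skew2 by eventually_elim (auto intro: br_skew)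

lemma an_br1 [agerm]: "analytic_germ a f \<Longrightarrow> analytic_germ a g \<Longrightarrow> analytic_germ a (br \<pi>1 f g)"
  and an_br2 [agerm]: "analytic_germ a f \<Longrightarrow> analytic_germ a g \<Longrightarrow> analytic_germ a (br \<pi>2 f g)"
  by (intro analytic_germ_br an1 an2; assumption)+

end

text \<open>The coefficients of the Lax polynomial are here the coordinates with indices
  \<open>\<iota> 0, \<dots>, \<iota> n\<close>; the other coordinates run along their common level sets.\<close>

locale lax_coordinates = bihamiltonian_germ a \<pi>1 \<pi>2
  for a :: "'k::real_or_complex ^ 'n::finite" and \<pi>1 \<pi>2 +
  fixes \<iota> :: "nat \<Rightarrow> 'n" and n :: nat
  assumes inj: "inj_on \<iota> {..n}"
    and chain: "\<forall>\<^sub>F x in nhds a. \<forall>b. \<pi>2 (\<iota> 0) b x = 0 \<and> \<pi>1 (\<iota> n) b x = 0 \<and>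
      (\<forall>i<n. \<pi>2 (\<iota> (Suc i)) b x = - \<pi>1 (\<iota> i) b x)"
    and rows: "(\<And>m. m \<in> - \<iota> ` {..n} \<Longrightarrow> (\<Sum>i<n. v i * \<pi>1 (\<iota> i) m a) = 0) \<Longrightarrow> \<forall>i<n. v i = 0"
    and cols: "(\<And>i. i < n \<Longrightarrow> (\<Sum>m\<in>- \<iota> ` {..n}. \<pi>1 (\<iota> i) m a * w m) = 0) \<Longrightarrow> \<forall>m\<in>- \<iota> ` {..n}. w m = 0"
begin

abbreviation z :: "nat \<Rightarrow> 'k ^ 'n \<Rightarrow> 'k" where "z i \<equiv> \<lambda>x. x $ \<iota> i"

abbreviation T :: "'n set" where "T \<equiv> - \<iota> ` {..n}"

lemma sum_split: "(\<Sum>b\<in>UNIV. h b) = (\<Sum>i\<le>n. h (\<iota> i)) + (\<Sum>m\<in>T. h m)"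
proof -
  have "(\<Sum>b\<in>UNIV. h b) = (\<Sum>b\<in>\<iota> ` {..n} \<union> T. h b)" by (rule sum.cong) auto
  also have "\<dots> = (\<Sum>b\<in>\<iota> ` {..n}. h b) + (\<Sum>m\<in>T. h m)" by (rule sum.union_disjoint) auto
  also have "(\<Sum>b\<in>\<iota> ` {..n}. h b) = (\<Sum>i\<le>n. h (\<iota> i))" using inj by (simp add: sum.reindex)
  finally show ?thesis .
qed

lemma involution: "\<forall>\<^sub>F x in nhds a. \<forall>i\<le>n. \<forall>j\<le>n. \<pi>1 (\<iota> i) (\<iota> j) x = 0 \<and> \<pi>2 (\<iota> i) (\<iota> j) x = 0"
  using chain skew1 skew2
proof eventually_elim
  case (elim x)
  note c = elim(1)[rule_format]
  have 1: "\<pi>1 (\<iota> i) (\<iota> j) x = 0" if "i \<le> n" "j \<le> n" for i j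
    by (rule lenard_involution[of n "\<lambda>i j. \<pi>1 (\<iota> i) (\<iota> j) x" "\<lambda>i j. \<pi>2 (\<iota> i) (\<iota> j) x",
        OF elim(2)[rule_format] elim(3)[rule_format] _ _ _ that]) (use c in auto)
  have 2: "\<pi>2 (\<iota> i) (\<iota> j) x = 0" if "i \<le> n" "j \<le> n" for i j
    using 1[of "i - 1" j] c that by (cases i) auto
  show ?case using 1 2 by blast
qed

lemma br_z: "\<forall>\<^sub>F x in nhds a. \<forall>i\<le>n. \<forall>f. br \<pi>1 (z i) f x = (\<Sum>m\<in>T. \<pi>1 (\<iota> i) m x * partial_deriv m f x)"
  using involution by eventually_elim (simp add: br_coord_left sum_split)

lemma br2_z: "\<forall>\<^sub>F x in nhds a. \<forall>f. br \<pi>2 (z 0) f x = 0 \<and> br \<pi>1 (z n) f x = 0 \<and>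
    (\<forall>i<n. br \<pi>2 (z (Suc i)) f x = - br \<pi>1 (z i) f x)"
  using chain by eventually_elim (simp add: br_coord_left sum_negf)

text \<open>The fields {z_i, -}_1 with i < n span the directions \<open>T\<close> at
  \<open>a\<close> by \<open>cols\<close>; an analytic left inverse of their matrix shows that they
  still do so near \<open>a\<close>.\<close>

lemma cols_near: "\<forall>\<^sub>F x in nhds a. \<forall>w. (\<forall>i<n. (\<Sum>m\<in>T. \<pi>1 (\<iota> i) m x * w m) = 0) \<longrightarrow> (\<forall>m\<in>T. w m = 0)"
proof -
  have "\<forall>p. \<exists>u. \<forall>\<^sub>F x in nhds a. \<forall>m\<in>T. (\<Sum>i<n. \<pi>1 (\<iota> i) m x * u i x) = (if m = p then 1 else 0)"
  proof
    fix p
    have "\<forall>m\<in>T. w m = 0" if "\<And>i. i \<in> {..<n} \<Longrightarrow> (\<Sum>m\<in>T. w m * \<pi>1 (\<iota> i) m a) = 0" for w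
      by (rule cols) (use that in \<open>simp add: mult.commute\<close>)
    from analytic_linear_system[of T "{..<n}" a "\<lambda>m i. \<pi>1 (\<iota> i) m" "\<lambda>m x. if m = p then 1 else 0",
        OF _ _ an1 analytic_germ_const this]
    show "\<exists>u. \<forall>\<^sub>F x in nhds a. \<forall>m\<in>T. (\<Sum>i<n. \<pi>1 (\<iota> i) m x * u i x) = (if m = p then 1 else 0)"
      by (meson finite finite_lessThan)
  qed
  from choice[OF this] obtain u where
    u: "\<And>p. \<forall>\<^sub>F x in nhds a. \<forall>m\<in>T. (\<Sum>i<n. \<pi>1 (\<iota> i) m x * u p i x) = (if m = p then 1 else 0)" by blast
  have "\<forall>\<^sub>F x in nhds a. \<forall>p. \<forall>m\<in>T. (\<Sum>i<n. \<pi>1 (\<iota> i) m x * u p i x) = (if m = p then 1 else 0)"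
    by (rule eventually_all_finite[OF u])
  thus ?thesis
  proof (eventually_elim, intro allI impI ballI)
    fix x w p
    assume u: "\<forall>p. \<forall>m\<in>T. (\<Sum>i<n. \<pi>1 (\<iota> i) m x * u p i x) = (if m = p then 1 else 0)"
      and w: "\<forall>i<n. (\<Sum>m\<in>T. \<pi>1 (\<iota> i) m x * w m) = 0" and p: "p \<in> T"
    have "w p = (\<Sum>m\<in>T. (\<Sum>i<n. \<pi>1 (\<iota> i) m x * u p i x) * w m)"
      using u p by (simp add: if_distrib[of "\<lambda>c. c * _"] cong: if_cong)
    also have "\<dots> = (\<Sum>i<n. u p i x * (\<Sum>m\<in>T. \<pi>1 (\<iota> i) m x * w m))"
      by (simp add: sum_distrib_left sum_distrib_right mult_ac) (rule sum.swap)
    also have "\<dots> = 0" using w by simp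
    finally show "w p = 0" .
  qed
qed

text \<open>A function constant along all these fields depends on the z_i alone; this is how
  brackets of the dual functions will be recognised as functions of L.\<close>

lemma invariant_imp_partial_deriv_0:
  assumes "\<And>i. i < n \<Longrightarrow> \<forall>\<^sub>F x in nhds a. br \<pi>1 (z i) f x = 0"
  shows "\<forall>\<^sub>F x in nhds a. \<forall>m\<in>T. partial_deriv m f x = 0"
proof -
  have "\<forall>\<^sub>F x in nhds a. \<forall>i\<in>{..<n}. br \<pi>1 (z i) f x = 0"
    by (rule eventually_ball_finite) (use assms in auto)
  thus ?thesis using br_z cols_near
  proof eventually_elim
    case (elim x)
    have "(\<Sum>m\<in>T. \<pi>1 (\<iota> i) m x * partial_deriv m f x) = 0" if "i < n" for i
      using elim(1) elim(2)[rule_format, of i f] that by simp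
    thus ?case using elim(3)[rule_format, of "\<lambda>m. partial_deriv m f x"] by blast
  qed
qed

end

lemma eventually_all_less:
  assumes "\<And>i. i < n \<Longrightarrow> \<forall>\<^sub>F x in F. P i x" shows "\<forall>\<^sub>F x in F. \<forall>i<n::nat. P i x"
proof -
  have "\<forall>\<^sub>F x in F. \<forall>i\<in>{..<n}. P i x" by (rule eventually_ball_finite) (use assms in auto)
  thus ?thesis by (rule eventually_mono) simp
qed

lemma br_sum_coord: "br \<pi> f g x = (\<Sum>b\<in>UNIV. partial_deriv b f x * br \<pi> (\<lambda>x. x $ b) g x)"
  unfolding br_coord_left by (rule br_alt')

section \<open>Functions dual to the commuting Hamiltonian fields\<close>

context lax_coordinates
begin

definition dual :: "(nat \<Rightarrow> 'k ^ 'n \<Rightarrow> 'k) \<Rightarrow> bool" where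
  "dual y \<longleftrightarrow> (\<forall>j<n. analytic_germ a (y j)) \<and>
     (\<forall>\<^sub>F x in nhds a. \<forall>i<n. \<forall>j<n. br \<pi>1 (z i) (y j) x = (if i = j then 1 else 0))"

text \<open>By the Jacobi identity the commutator of the fields of z_l and z_i is the field of {z_l,
  z_i}_1, which is 0; the statement is this in components.\<close>

lemma hamiltonians_commute:
  "\<forall>\<^sub>F x in nhds a. \<forall>l<n. \<forall>i<n. \<forall>m. br \<pi>1 (z l) (\<pi>1 (\<iota> i) m) x = br \<pi>1 (z i) (\<pi>1 (\<iota> l) m) x"
proof (intro eventually_all_less eventually_all_finite)
  fix l i m assume l: "l < n" and i: "i < n"
  have e: "br \<pi>1 (\<lambda>x. x $ b) (\<lambda>x. x $ c) = \<pi>1 b c" for b c by (rule ext) (rule br_coord_coord)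
  have J: "\<forall>\<^sub>F x in nhds a. br \<pi>1 (z l) (\<pi>1 (\<iota> i) m) x + br \<pi>1 (z i) (\<pi>1 m (\<iota> l)) x
      + br \<pi>1 (\<lambda>x. x $ m) (\<pi>1 (\<iota> l) (\<iota> i)) x = 0"
    using jac1[OF analytic_germ_coord analytic_germ_coord analytic_germ_coord, of "\<iota> l" "\<iota> i" m] unfolding e .
  have 1: "\<forall>\<^sub>F x in nhds a. br \<pi>1 (z i) (\<pi>1 m (\<iota> l)) x = br \<pi>1 (z i) (\<lambda>x. - \<pi>1 (\<iota> l) m x) x"
  proof (rule br_cong_eventually)
    show "\<forall>\<^sub>F x in nhds a. \<pi>1 m (\<iota> l) x = - \<pi>1 (\<iota> l) m x" using skew1 by (rule eventually_mono) blast
  qed simp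
  have 2: "\<forall>\<^sub>F x in nhds a. br \<pi>1 (\<lambda>x. x $ m) (\<pi>1 (\<iota> l) (\<iota> i)) x = br \<pi>1 (\<lambda>x. x $ m) (\<lambda>x. 0) x"
  proof (rule br_cong_eventually)
    show "\<forall>\<^sub>F x in nhds a. \<pi>1 (\<iota> l) (\<iota> i) x = 0"
      using involution by (rule eventually_mono) (use l i in auto)
  qed simp
  show "\<forall>\<^sub>F x in nhds a. br \<pi>1 (z l) (\<pi>1 (\<iota> i) m) x = br \<pi>1 (z i) (\<pi>1 (\<iota> l) m) x"
    using J 1 2 eventually_analytic_germ[OF an1[of "\<iota> l" m]]
    by eventually_elim (simp add: br_minus_right analytic_germ_kdiff)
qed

text \<open>The duality requirements on the derivatives of y_j along \<open>T\<close>, solved as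
  linear equations; that the solution comes from a function is the business of the next
  lemma.\<close>

lemma ex_dual_covectors:
  assumes "j < n"
  obtains c where "\<And>m. m \<in> T \<Longrightarrow> analytic_germ a (c m)"
    "\<forall>\<^sub>F x in nhds a. \<forall>i<n. (\<Sum>m\<in>T. \<pi>1 (\<iota> i) m x * c m x) = (if i = j then 1 else 0)"
proof -
  have R: "\<forall>i\<in>{..<n}. v i = 0" if "\<And>m. m \<in> T \<Longrightarrow> (\<Sum>i\<in>{..<n}. v i * \<pi>1 (\<iota> i) m a) = 0" for v
  proof -
    have "\<forall>i<n. v i = 0" by (rule rows) (rule that)
    thus ?thesis by blast
  qed
  have "\<exists>c. (\<forall>m\<in>T. analytic_germ a (c m)) \<and>
      (\<forall>\<^sub>F x in nhds a. \<forall>i\<in>{..<n}. (\<Sum>m\<in>T. \<pi>1 (\<iota> i) m x * c m x) = (if i = j then 1 else 0))"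
    by (rule analytic_linear_system[of "{..<n}" T a "\<lambda>i m. \<pi>1 (\<iota> i) m" "\<lambda>i x. if i = j then 1 else 0",
        OF _ _ an1 analytic_germ_const]) (simp, simp, rule R, blast, blast)
  then obtain c where 1: "\<And>m. m \<in> T \<Longrightarrow> analytic_germ a (c m)"
    and 2: "\<forall>\<^sub>F x in nhds a. \<forall>i\<in>{..<n}. (\<Sum>m\<in>T. \<pi>1 (\<iota> i) m x * c m x) = (if i = j then 1 else 0)"
    by blast
  from 2 have "\<forall>\<^sub>F x in nhds a. \<forall>i<n. (\<Sum>m\<in>T. \<pi>1 (\<iota> i) m x * c m x) = (if i = j then 1 else 0)"
    by (rule eventually_mono) auto
  with 1 show ?thesis by (rule that)
qed

text \<open>For commuting fields X_l, X_i and a 1-form c one has dc(X_l, X_i) = X_l c(X_i) - X_i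
  c(X_l). Here the values c(X_i) are constant, so dc vanishes on pairs of fields that span the
  directions \<open>T\<close>.\<close>

lemma dual_covectors_closed:
  assumes c: "\<And>m. m \<in> T \<Longrightarrow> analytic_germ a (c m)"
    and ce: "\<forall>\<^sub>F x in nhds a. \<forall>i<n. (\<Sum>m\<in>T. \<pi>1 (\<iota> i) m x * c m x) = (if i = j then 1 else 0)"
    and p: "p \<in> T" and m: "m \<in> T"
  shows "\<forall>\<^sub>F x in nhds a. partial_deriv p (c m) x = partial_deriv m (c p) x"
proof -
  define e where "e i x = (\<Sum>m\<in>T. \<pi>1 (\<iota> i) m x * c m x)" for i x
  have "\<forall>\<^sub>F x in nhds a. \<forall>l<n. \<forall>i<n. br \<pi>1 (z l) (e i) x = br \<pi>1 (z l) (\<lambda>x. if i = j then 1 else 0) x"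
  proof (intro eventually_all_less br_cong_eventually)
    show "\<forall>\<^sub>F x in nhds a. e i x = (if i = j then 1 else 0)" if "i < n" for i
      using ce by (rule eventually_mono) (use that in \<open>simp add: e_def\<close>)
  qed simp
  moreover have "\<forall>\<^sub>F x in nhds a. \<forall>b b'. analytic_germ x (\<pi>1 b b')"
    by (intro eventually_all_finite eventually_analytic_germ an1)
  moreover have "\<forall>\<^sub>F x in nhds a. \<forall>m\<in>T. analytic_germ x (c m)"
    by (rule eventually_ball_finite) (auto intro: eventually_analytic_germ c)
  ultimately show ?thesis using hamiltonians_commute br_z cols_near
  proof eventually_elim
    case (elim x)
    have k: "kdiff (\<pi>1 b b') x" "m \<in> T \<Longrightarrow> kdiff (c m) x" for b b' m
      using elim(2,3) by (auto intro: analytic_germ_kdiff)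
    define A where "A p m = partial_deriv p (c m) x - partial_deriv m (c p) x" for p m
    have bz: "br \<pi>1 (z l) f x = (\<Sum>p\<in>T. \<pi>1 (\<iota> l) p x * partial_deriv p f x)" if "l < n" for l f
      using elim(5) that by simp
    have E: "(\<Sum>m\<in>T. br \<pi>1 (z l) (\<pi>1 (\<iota> i) m) x * c m x) + (\<Sum>m\<in>T. \<pi>1 (\<iota> i) m x * br \<pi>1 (z l) (c m) x) = 0"
      if "l < n" "i < n" for l i
    proof -
      have "0 = br \<pi>1 (z l) (\<lambda>x. \<Sum>m\<in>T. \<pi>1 (\<iota> i) m x * c m x) x"
        using elim(1)[rule_format, OF that] by (simp add: e_def[abs_def])
      also have "\<dots> = (\<Sum>m\<in>T. br \<pi>1 (z l) (\<lambda>x. \<pi>1 (\<iota> i) m x * c m x) x)"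
        by (rule br_sum_right) (intro kdiff_mult k)
      also have "\<dots> = (\<Sum>m\<in>T. br \<pi>1 (z l) (\<pi>1 (\<iota> i) m) x * c m x + \<pi>1 (\<iota> i) m x * br \<pi>1 (z l) (c m) x)"
        by (rule sum.cong[OF refl], rule br_mult_right; rule k)
      finally show ?thesis by (simp add: sum.distrib)
    qed
    have w: "(\<Sum>m\<in>T. \<pi>1 (\<iota> i) m x * (\<Sum>p\<in>T. \<pi>1 (\<iota> l) p x * A p m)) = 0" if "l < n" "i < n" for l i
    proof -
      have "(\<Sum>m\<in>T. \<pi>1 (\<iota> i) m x * br \<pi>1 (z l) (c m) x) = (\<Sum>m\<in>T. \<pi>1 (\<iota> l) m x * br \<pi>1 (z i) (c m) x)"
        by (rule add_left_imp_eq[OF trans[OF E[OF that] E[OF that(2,1), symmetric, unfolded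
              elim(4)[rule_format, OF that(2,1)]]]])
      also have "\<dots> = (\<Sum>p\<in>T. \<Sum>m\<in>T. \<pi>1 (\<iota> l) p x * (\<pi>1 (\<iota> i) m x * partial_deriv m (c p) x))"
        using bz that by (simp add: sum_distrib_left)
      also have "\<dots> = (\<Sum>m\<in>T. \<Sum>p\<in>T. \<pi>1 (\<iota> l) p x * (\<pi>1 (\<iota> i) m x * partial_deriv m (c p) x))"
        by (rule sum.swap)
      finally show ?thesis using bz that
        by (simp add: A_def right_diff_distrib sum_subtractf sum_distrib_left mult_ac)
    qed
    \<comment> \<open>The spanning property is used once for each of the two arguments of
      dc.\<close>
    have "\<forall>m\<in>T. (\<Sum>p\<in>T. \<pi>1 (\<iota> l) p x * A p m) = 0" if "l < n" for l
      using elim(6)[rule_format, of "\<lambda>m. \<Sum>p\<in>T. \<pi>1 (\<iota> l) p x * A p m"] w[OF that] by blast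
    hence "\<forall>p\<in>T. A p m = 0"
      using elim(6)[rule_format, of "\<lambda>p. A p m"] m by blast
    thus ?case using p by (simp add: A_def)
  qed
qed

lemma ex_dual: obtains y where "dual y"
proof -
  have "\<exists>y. analytic_germ a y \<and> (\<forall>\<^sub>F x in nhds a. \<forall>i<n. br \<pi>1 (z i) y x = (if i = j then 1 else 0))"
    if j: "j < n" for j
  proof -
    obtain c where c: "\<And>m. m \<in> T \<Longrightarrow> analytic_germ a (c m)"
      and ce: "\<forall>\<^sub>F x in nhds a. \<forall>i<n. (\<Sum>m\<in>T. \<pi>1 (\<iota> i) m x * c m x) = (if i = j then 1 else 0)"
      using ex_dual_covectors[OF j] by blast
    obtain y where y: "analytic_germ a y" "\<And>m. m \<in> T \<Longrightarrow> \<forall>\<^sub>F x in nhds a. partial_deriv m y x = c m x"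
      using analytic_potential[of T a c, OF c dual_covectors_closed[OF c ce]] by blast
    have "\<forall>\<^sub>F x in nhds a. \<forall>m\<in>T. partial_deriv m y x = c m x"
      by (rule eventually_ball_finite) (auto intro: y)
    hence "\<forall>\<^sub>F x in nhds a. \<forall>i<n. br \<pi>1 (z i) y x = (if i = j then 1 else 0)"
      using ce br_z by eventually_elim simp
    thus ?thesis using y(1) by blast
  qed
  hence "\<forall>j. \<exists>y. j < n \<longrightarrow> analytic_germ a y \<and> (\<forall>\<^sub>F x in nhds a. \<forall>i<n. br \<pi>1 (z i) y x = (if i = j then 1 else 0))"
    by blast
  from choice[OF this] obtain y where y: "\<And>j. j < n \<Longrightarrow> analytic_germ a (y j)"
    "\<And>j. j < n \<Longrightarrow> \<forall>\<^sub>F x in nhds a. \<forall>i<n. br \<pi>1 (z i) (y j) x = (if i = j then 1 else 0)" by blast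
  have "\<forall>\<^sub>F x in nhds a. \<forall>j<n. \<forall>i<n. br \<pi>1 (z i) (y j) x = (if i = j then 1 else 0)"
    by (rule eventually_all_less[OF y(2)])
  hence "\<forall>\<^sub>F x in nhds a. \<forall>i<n. \<forall>j<n. br \<pi>1 (z i) (y j) x = (if i = j then 1 else 0)"
    by (rule eventually_mono) blast
  thus ?thesis using that[of y] y(1) by (simp add: dual_def)
qed

lemma dual_brackets:
  assumes "dual y"
  shows "\<forall>\<^sub>F x in nhds a. \<forall>i\<le>n. \<forall>j<n. br \<pi>1 (z i) (y j) x = (if i = j then 1 else 0) \<and>
    br \<pi>2 (z i) (y j) x = (if i = Suc j then - 1 else 0)"
proof -
  from assms have "\<forall>\<^sub>F x in nhds a. \<forall>i<n. \<forall>j<n. br \<pi>1 (z i) (y j) x = (if i = j then 1 else 0)"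
    by (simp add: dual_def)
  thus ?thesis using br2_z
  proof (eventually_elim, intro allI impI)
    fix x i j
    assume 1: "\<forall>i<n. \<forall>j<n. br \<pi>1 (z i) (y j) x = (if i = j then 1 else 0)"
      and 2: "\<forall>f. br \<pi>2 (z 0) f x = 0 \<and> br \<pi>1 (z n) f x = 0 \<and> (\<forall>i<n. br \<pi>2 (z (Suc i)) f x = - br \<pi>1 (z i) f x)"
      and i: "i \<le> n" and j: "j < n"
    have "br \<pi>1 (z i) (y j) x = (if i = j then 1 else 0)"
      using 1 2 i j by (cases "i = n") auto
    moreover have "br \<pi>2 (z i) (y j) x = (if i = Suc j then - 1 else 0)"
      using 1 2 i j by (cases i) auto
    ultimately show "br \<pi>1 (z i) (y j) x = (if i = j then 1 else 0) \<and>
      br \<pi>2 (z i) (y j) x = (if i = Suc j then - 1 else 0)" ..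
  qed
qed

text \<open>On functions of the z_i alone, bracketing with y_j is a coordinate derivation. Thereby
  the Jacobi identities among the y_j turn into first-order equations with constant
  coefficients.\<close>

lemma dual_br_basic:
  assumes y: "dual y" and F: "\<forall>\<^sub>F x in nhds a. \<forall>m\<in>T. partial_deriv m F x = 0"
  shows "\<forall>\<^sub>F x in nhds a. \<forall>j<n. br \<pi>1 (y j) F x = - partial_deriv (\<iota> j) F x \<and>
    br \<pi>2 (y j) F x = partial_deriv (\<iota> (Suc j)) F x"
  using F dual_brackets[OF y] ev_skew1 ev_skew2
proof (eventually_elim, intro allI impI)
  fix x j
  assume F: "\<forall>m\<in>T. partial_deriv m F x = 0"
    and d: "\<forall>i\<le>n. \<forall>j<n. br \<pi>1 (z i) (y j) x = (if i = j then 1 else 0) \<and>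
      br \<pi>2 (z i) (y j) x = (if i = Suc j then - 1 else 0)"
    and s1: "\<forall>f g. br \<pi>1 f g x = - br \<pi>1 g f x" and s2: "\<forall>f g. br \<pi>2 f g x = - br \<pi>2 g f x" and j: "j < n"
  have e: "br \<pi> F (y j) x = (\<Sum>i\<le>n. partial_deriv (\<iota> i) F x * br \<pi> (z i) (y j) x)" for \<pi>
    unfolding br_sum_coord[of \<pi> F] sum_split using F by simp
  have "br \<pi>1 F (y j) x = (\<Sum>i\<le>n. if i = j then partial_deriv (\<iota> i) F x else 0)"
    unfolding e by (rule sum.cong) (use d j in auto)
  hence 1: "br \<pi>1 F (y j) x = partial_deriv (\<iota> j) F x" using j by simp
  have "br \<pi>2 F (y j) x = (\<Sum>i\<le>n. if i = Suc j then - partial_deriv (\<iota> i) F x else 0)"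
    unfolding e by (rule sum.cong) (use d j in auto)
  hence 2: "br \<pi>2 F (y j) x = - partial_deriv (\<iota> (Suc j)) F x" using j by simp
  show "br \<pi>1 (y j) F x = - partial_deriv (\<iota> j) F x \<and> br \<pi>2 (y j) F x = partial_deriv (\<iota> (Suc j)) F x"
    using s1[rule_format, of "y j" F] s2[rule_format, of "y j" F] 1 2 by simp
qed

text \<open>In the Jacobi identity of z_l, y_i, y_j the brackets of z_l with the y are constants,
  which leaves {z_l, {y_i, y_j}_1}_1 = 0. The mixed identity has the additional term {z_l, {y_i,
  y_j}_1}_2; by the chain it is 0 or, up to sign, a first bracket with z_{l-1}, so it vanishes by
  the first part.\<close>

lemma dual_br_invariant:
  assumes y: "dual y" and ij: "i < n" "j < n"
  shows "\<forall>\<^sub>F x in nhds a. \<forall>m\<in>T. partial_deriv m (br \<pi>1 (y i) (y j)) x = 0"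
    and "\<forall>\<^sub>F x in nhds a. \<forall>m\<in>T. partial_deriv m (br \<pi>2 (y i) (y j)) x = 0"
proof -
  have an: "analytic_germ a (y i)" "analytic_germ a (y j)" using y ij by (auto simp: dual_def)
  note db = dual_brackets[OF y]
  have c: "\<forall>\<^sub>F x in nhds a. br \<pi>1 f (br \<pi>1 (z l) (y j)) x = 0 \<and> br \<pi>1 f (br \<pi>2 (z l) (y j)) x = 0 \<and>
      br \<pi>2 f (br \<pi>1 (z l) (y j)) x = 0 \<and> br \<pi>1 f (br \<pi>1 (y j) (z l)) x = 0 \<and>
      br \<pi>1 f (br \<pi>2 (y j) (z l)) x = 0 \<and> br \<pi>2 f (br \<pi>1 (y j) (z l)) x = 0"
    if "l \<le> n" "j < n" for l j f
  proof -
    have e1: "\<forall>\<^sub>F x in nhds a. br \<pi>1 (z l) (y j) x = (if l = j then 1 else 0)"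
      and e2: "\<forall>\<^sub>F x in nhds a. br \<pi>2 (z l) (y j) x = (if l = Suc j then - 1 else 0)"
      by (rule eventually_mono[OF db]; use that in simp)+
    have e3: "\<forall>\<^sub>F x in nhds a. br \<pi>1 (y j) (z l) x = - (if l = j then 1 else 0)"
      using e1 ev_skew1
    proof eventually_elim
      case (elim x) show ?case using elim(2)[rule_format, of "y j" "z l"] unfolding elim(1) .
    qed
    have e4: "\<forall>\<^sub>F x in nhds a. br \<pi>2 (y j) (z l) x = - (if l = Suc j then - 1 else 0)"
      using e2 ev_skew2
    proof eventually_elim
      case (elim x) show ?case using elim(2)[rule_format, of "y j" "z l"] unfolding elim(1) .
    qed
    have r: "\<forall>\<^sub>F x in nhds a. f x = f x" by simp
    show ?thesis
      using br_cong_eventually[OF r e1, of \<pi>1] br_cong_eventually[OF r e2, of \<pi>1] br_cong_eventually[OF r e1, of \<pi>2]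
        br_cong_eventually[OF r e3, of \<pi>1] br_cong_eventually[OF r e4, of \<pi>1] br_cong_eventually[OF r e3, of \<pi>2]
      by eventually_elim simp
  qed
  have 1: "\<forall>\<^sub>F x in nhds a. br \<pi>1 (z l) (br \<pi>1 (y i) (y j)) x = 0" if l: "l < n" for l
    using jac1[OF analytic_germ_coord[of a "\<iota> l"] an] c[OF less_imp_le[OF l] ij(2), of "y i"]
      c[OF less_imp_le[OF l] ij(1), of "y j"]
    by eventually_elim simp
  show I1: "\<forall>\<^sub>F x in nhds a. \<forall>m\<in>T. partial_deriv m (br \<pi>1 (y i) (y j)) x = 0"
    by (rule invariant_imp_partial_deriv_0[OF 1])
  show "\<forall>\<^sub>F x in nhds a. \<forall>m\<in>T. partial_deriv m (br \<pi>2 (y i) (y j)) x = 0"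
  proof (rule invariant_imp_partial_deriv_0)
    fix l assume l: "l < n"
    have 2: "\<forall>\<^sub>F x in nhds a. br \<pi>2 (z l) (br \<pi>1 (y i) (y j)) x = 0"
    proof (cases l)
      case 0
      show ?thesis using br2_z by (rule eventually_mono) (simp add: 0)
    next
      case (Suc l')
      have "\<forall>\<^sub>F x in nhds a. br \<pi>1 (z l') (br \<pi>1 (y i) (y j)) x = 0" by (rule 1) (use l Suc in simp)
      thus ?thesis using br2_z by eventually_elim (use l Suc in simp)
    qed
    have l': "l \<le> n" using l by simp
    show "\<forall>\<^sub>F x in nhds a. br \<pi>1 (z l) (br \<pi>2 (y i) (y j)) x = 0"
      using jac12[OF analytic_germ_coord[of a "\<iota> l"] an] 2 c[OF l' ij(2), of "y i"] c[OF l' ij(1), of "y j"]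
      by eventually_elim simp
  qed
qed

end

section \<open>Normalisation of the brackets of the dual functions\<close>

context lax_coordinates
begin

abbreviation basic :: "('k ^ 'n \<Rightarrow> 'k) \<Rightarrow> bool" where
  "basic F \<equiv> analytic_germ a F \<and> (\<forall>\<^sub>F x in nhds a. \<forall>m\<in>T. partial_deriv m F x = 0)"

lemma basic_commute:
  assumes F: "basic F" and G: "basic G"
  shows "\<forall>\<^sub>F x in nhds a. br \<pi>1 F G x = 0 \<and> br \<pi>2 F G x = 0"
  using conjunct2[OF F] conjunct2[OF G] br_z br2_z
proof eventually_elim
  case (elim x)
  have 1: "br \<pi>1 (z i) G x = 0" if "i \<le> n" for i using elim(2,3) that by simp
  have 2: "br \<pi>2 (z i) G x = 0" if "i \<le> n" for i
    using elim(4) 1[of "i - 1"] that by (cases i) auto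
  have "br \<pi> F G x = (\<Sum>i\<le>n. partial_deriv (\<iota> i) F x * br \<pi> (z i) G x)" for \<pi>
    unfolding br_sum_coord[of \<pi> F] sum_split using elim(1) by simp
  thus ?case using 1 2 by simp
qed

text \<open>The freedom in the choice of the dual functions. Functions of L commute for both
  brackets, so only the cross terms survive, and these are derivatives of the h_j by the duality
  relations.\<close>

lemma add_basic:
  assumes y: "dual y" and h: "\<And>j. j < n \<Longrightarrow> basic (h j)"
  defines "y' \<equiv> \<lambda>j x. y j x + h j x"
  shows "dual y'"
    and "i < n \<Longrightarrow> j < n \<Longrightarrow> \<forall>\<^sub>F x in nhds a. br \<pi>1 (y' i) (y' j) x =
        br \<pi>1 (y i) (y j) x - partial_deriv (\<iota> i) (h j) x + partial_deriv (\<iota> j) (h i) x \<and>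
      br \<pi>2 (y' i) (y' j) x =
        br \<pi>2 (y i) (y j) x + partial_deriv (\<iota> (Suc i)) (h j) x - partial_deriv (\<iota> (Suc j)) (h i) x"
proof -
  have any: "\<And>j. j < n \<Longrightarrow> analytic_germ a (y j)" using y by (simp add: dual_def)
  have ev: "\<forall>\<^sub>F x in nhds a. \<forall>j<n. analytic_germ x (y j) \<and> analytic_germ x (h j)"
    by (intro eventually_all_less eventually_conj eventually_analytic_germ any conjunct1[OF h])
  have evh: "\<forall>\<^sub>F x in nhds a. \<forall>j<n. \<forall>m\<in>T. partial_deriv m (h j) x = 0"
    by (intro eventually_all_less conjunct2[OF h])
  have "\<forall>\<^sub>F x in nhds a. \<forall>i<n. \<forall>j<n. br \<pi>1 (z i) (y' j) x = (if i = j then 1 else 0)"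
    using ev evh br_z dual_brackets[OF y]
  proof (eventually_elim, intro allI impI)
    fix x i j
    assume 1: "\<forall>j<n. analytic_germ x (y j) \<and> analytic_germ x (h j)"
      and 2: "\<forall>j<n. \<forall>m\<in>T. partial_deriv m (h j) x = 0"
      and 3: "\<forall>i\<le>n. \<forall>f. br \<pi>1 (z i) f x = (\<Sum>m\<in>T. \<pi>1 (\<iota> i) m x * partial_deriv m f x)"
      and 4: "\<forall>i\<le>n. \<forall>j<n. br \<pi>1 (z i) (y j) x = (if i = j then 1 else 0) \<and>
        br \<pi>2 (z i) (y j) x = (if i = Suc j then - 1 else 0)"
      and i: "i < n" and j: "j < n"
    have "br \<pi>1 (z i) (y' j) x = br \<pi>1 (z i) (y j) x + br \<pi>1 (z i) (h j) x"
      unfolding y'_def using 1 j by (intro br_add_right analytic_germ_kdiff) auto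
    moreover have "br \<pi>1 (z i) (h j) x = 0" using 2 3 i j by simp
    ultimately show "br \<pi>1 (z i) (y' j) x = (if i = j then 1 else 0)" using 4 i j by simp
  qed
  moreover have "analytic_germ a (y' j)" if "j < n" for j
    unfolding y'_def using any h that by (intro agerm) auto
  ultimately show "dual y'" by (simp add: dual_def)
  assume i: "i < n" and j: "j < n"
  show "\<forall>\<^sub>F x in nhds a. br \<pi>1 (y' i) (y' j) x =
        br \<pi>1 (y i) (y j) x - partial_deriv (\<iota> i) (h j) x + partial_deriv (\<iota> j) (h i) x \<and>
      br \<pi>2 (y' i) (y' j) x =
        br \<pi>2 (y i) (y j) x + partial_deriv (\<iota> (Suc i)) (h j) x - partial_deriv (\<iota> (Suc j)) (h i) x"
    using ev dual_br_basic[OF y conjunct2[OF h[OF i]]] dual_br_basic[OF y conjunct2[OF h[OF j]]]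
      basic_commute[OF h[OF i] h[OF j]] ev_skew1 ev_skew2
  proof eventually_elim
    case (elim x)
    have k: "kdiff (y i) x" "kdiff (y j) x" "kdiff (h i) x" "kdiff (h j) x"
      using elim(1) i j by (auto intro: analytic_germ_kdiff)
    have e: "br \<pi> (y' i) (y' j) x = br \<pi> (y i) (y j) x + br \<pi> (y i) (h j) x + (br \<pi> (h i) (y j) x + br \<pi> (h i) (h j) x)"
      for \<pi> unfolding y'_def by (simp only: br_add_left br_add_right k kdiff_add)
    have s: "br \<pi>1 (h i) (y j) x = - br \<pi>1 (y j) (h i) x" "br \<pi>2 (h i) (y j) x = - br \<pi>2 (y j) (h i) x"
      using elim(5,6) by blast+
    show ?case unfolding e s using elim(2,3,4) i j by simp
  qed
qed

lemma dual_basic: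
  assumes "dual y" "i < n" "j < n" shows "basic (br \<pi>1 (y i) (y j))" "basic (br \<pi>2 (y i) (y j))"
  using assms dual_br_invariant[OF assms] by (auto simp: dual_def intro: agerm)

lemma swap1:
  assumes "analytic_germ a g" "analytic_germ a h"
  shows "\<forall>\<^sub>F x in nhds a. br \<pi> f (br \<pi>1 g h) x = - br \<pi> f (br \<pi>1 h g) x"
proof -
  have "\<forall>\<^sub>F x in nhds a. br \<pi> f (br \<pi>1 g h) x = br \<pi> f (\<lambda>x. - br \<pi>1 h g x) x"
  proof (rule br_cong_eventually)
    show "\<forall>\<^sub>F x in nhds a. br \<pi>1 g h x = - br \<pi>1 h g x" using ev_skew1 by (rule eventually_mono) blast
  qed simp
  thus ?thesis using eventually_analytic_germ[OF an_br1[OF assms(2,1)]]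
    by eventually_elim (simp add: br_minus_right analytic_germ_kdiff)
qed

lemma swap2:
  assumes "analytic_germ a g" "analytic_germ a h"
  shows "\<forall>\<^sub>F x in nhds a. br \<pi> f (br \<pi>2 g h) x = - br \<pi> f (br \<pi>2 h g) x"
proof -
  have "\<forall>\<^sub>F x in nhds a. br \<pi> f (br \<pi>2 g h) x = br \<pi> f (\<lambda>x. - br \<pi>2 h g x) x"
  proof (rule br_cong_eventually)
    show "\<forall>\<^sub>F x in nhds a. br \<pi>2 g h x = - br \<pi>2 h g x" using ev_skew2 by (rule eventually_mono) blast
  qed simp
  thus ?thesis using eventually_analytic_germ[OF an_br2[OF assms(2,1)]]
    by eventually_elim (simp add: br_minus_right analytic_germ_kdiff)
qed

text \<open>The Jacobi identities of y_i, y_j, y_l for the first bracket, for the second one, and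
  mixed. The first says that the first brackets form a closed 2-form; the second is the same for the
  second brackets with shifted derivations; the mixed one links the two families.\<close>

lemma dual_closed:
  assumes y: "dual y" and ijl: "i < j" "j < l" "l < n"
  shows "\<forall>\<^sub>F x in nhds a. partial_deriv (\<iota> i) (br \<pi>1 (y j) (y l)) x
      - partial_deriv (\<iota> j) (br \<pi>1 (y i) (y l)) x + partial_deriv (\<iota> l) (br \<pi>1 (y i) (y j)) x = 0" (is ?A)
    and "\<forall>\<^sub>F x in nhds a. partial_deriv (\<iota> (Suc i)) (br \<pi>2 (y j) (y l)) x
      - partial_deriv (\<iota> (Suc j)) (br \<pi>2 (y i) (y l)) x + partial_deriv (\<iota> (Suc l)) (br \<pi>2 (y i) (y j)) x = 0" (is ?B)
    and "\<forall>\<^sub>F x in nhds a. partial_deriv (\<iota> i) (br \<pi>2 (y j) (y l)) x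
      - partial_deriv (\<iota> j) (br \<pi>2 (y i) (y l)) x + partial_deriv (\<iota> l) (br \<pi>2 (y i) (y j)) x =
      partial_deriv (\<iota> (Suc i)) (br \<pi>1 (y j) (y l)) x
      - partial_deriv (\<iota> (Suc j)) (br \<pi>1 (y i) (y l)) x + partial_deriv (\<iota> (Suc l)) (br \<pi>1 (y i) (y j)) x" (is ?C)
proof -
  have l: "i < n" "j < n" "l < n" using ijl by auto
  have an: "analytic_germ a (y i)" "analytic_germ a (y j)" "analytic_germ a (y l)"
    using y l by (auto simp: dual_def)
  note inv1 = dual_br_invariant(1)[OF y] and inv2 = dual_br_invariant(2)[OF y]
  note D1 = dual_br_basic[OF y inv1[OF l(2,3)]] dual_br_basic[OF y inv1[OF l(1,3)]] dual_br_basic[OF y inv1[OF l(1,2)]]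
  note D2 = dual_br_basic[OF y inv2[OF l(2,3)]] dual_br_basic[OF y inv2[OF l(1,3)]] dual_br_basic[OF y inv2[OF l(1,2)]]
  show ?A
    using jac1[OF an] swap1[OF an(3,1), of \<pi>1 "y j"] D1
  proof eventually_elim
    case (elim x)
    show ?case using elim(1) unfolding elim(2) using elim(3-5) l by (simp add: algebra_simps)
  qed
  show ?B
    using jac2[OF an] swap2[OF an(3,1), of \<pi>2 "y j"] D2
  proof eventually_elim
    case (elim x)
    show ?case using elim(1) unfolding elim(2) using elim(3-5) l by (simp add: algebra_simps)
  qed
  show ?C
    using jac12[OF an] swap1[OF an(3,1), of \<pi>2 "y j"] swap2[OF an(3,1), of \<pi>1 "y j"] D1 D2
  proof eventually_elim
    case (elim x)
    show ?case using elim(1) unfolding elim(2,3) using elim(4-9) l by (simp add: algebra_simps)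
  qed
qed

text \<open>After the first brackets are removed, a correction by a gradient h_j = \<partial>_j
  \<Phi> keeps them zero, because second derivatives commute. It changes the second brackets by the
  2 by 2 minors of shifted derivations applied to \<Phi>, so the minors system has to be
  solved.\<close>

theorem flat_coordinates:
  obtains y where "dual y" "\<forall>\<^sub>F x in nhds a. \<forall>i<n. \<forall>j<n. br \<pi>1 (y i) (y j) x = 0 \<and> br \<pi>2 (y i) (y j) x = 0"
proof -
  obtain y where y: "dual y" by (rule ex_dual)
  have inj': "inj_on \<iota> {..<n}" by (rule inj_on_subset[OF inj]) auto
  have Z': "T \<inter> \<iota> ` {..<n} = {}" by auto
  have "analytic_germ a (br \<pi>1 (y i) (y j))" if "i < j" "j < n" for i j
    using dual_basic(1)[OF y, of i j] that by auto
  moreover have "\<forall>\<^sub>F x in nhds a. partial_deriv t (br \<pi>1 (y i) (y j)) x = 0" if "t \<in> T" "i < j" "j < n" for t i j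
    by (rule eventually_mono[OF dual_br_invariant(1)[OF y, of i j]]) (use that in auto)
  ultimately obtain h where h: "\<And>j. analytic_germ a (h j)"
    "\<And>i j. i < j \<Longrightarrow> j < n \<Longrightarrow>
      \<forall>\<^sub>F x in nhds a. partial_deriv (\<iota> i) (h j) x - partial_deriv (\<iota> j) (h i) x = br \<pi>1 (y i) (y j) x"
    "\<And>t j. t \<in> T \<Longrightarrow> j < n \<Longrightarrow> \<forall>\<^sub>F x in nhds a. partial_deriv t (h j) x = 0"
    using analytic_potential_2form[of \<iota> n a "\<lambda>i j. br \<pi>1 (y i) (y j)" T, OF inj' _ dual_closed(1)[OF y] _ Z']
    by blast
  have bh: "basic (h j)" if "j < n" for j
    by (intro conjI h eventually_ball_finite) (use that h in auto)
  define w where "w j x = y j x + h j x" for j x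
  have w: "dual w" unfolding w_def[abs_def] by (rule add_basic(1)[where h = h, OF y bh])
  have w1: "\<forall>\<^sub>F x in nhds a. br \<pi>1 (w i) (w j) x = 0" if ij: "i < j" "j < n" for i j
  proof -
    have i: "i < n" using ij by simp
    have "\<forall>\<^sub>F x in nhds a. br \<pi>1 (w i) (w j) x =
        br \<pi>1 (y i) (y j) x - partial_deriv (\<iota> i) (h j) x + partial_deriv (\<iota> j) (h i) x"
      unfolding w_def[abs_def]
      by (rule eventually_mono[OF add_basic(2)[where y = y and h = h, OF y _ i ij(2)]], rule bh, assumption, blast)
    thus ?thesis using h(2)[OF ij] by eventually_elim (simp add: algebra_simps)
  qed
  have pz: "\<forall>\<^sub>F x in nhds a. partial_deriv b (br \<pi>1 (w i) (w j)) x = 0" if ij: "i < j" "j < n" for i j b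
    using eventually_partial_deriv_cong[OF w1[OF ij], of b] by simp
  \<comment> \<open>The sign of the correction in \<open>add_basic\<close>: the minors of \<Phi> are
    to cancel the second brackets.\<close>
  define g where "g i j x = - br \<pi>2 (w i) (w j) x" for i j x
  have ang: "analytic_germ a (g i j)" if "i < j" "j < n" for i j
    unfolding g_def[abs_def] by (rule analytic_germ_minus) (use dual_basic(2)[OF w, of i j] that in auto)
  have dg: "\<forall>\<^sub>F x in nhds a. \<forall>b. partial_deriv b (g i j) x = - partial_deriv b (br \<pi>2 (w i) (w j)) x"
    if "i < j" "j < n" for i j
  proof -
    have "analytic_germ a (br \<pi>2 (w i) (w j))" using dual_basic(2)[OF w, of i j] that by auto
    from eventually_analytic_germ[OF this] show ?thesis
      unfolding g_def[abs_def] by eventually_elim (simp add: partial_deriv_minus analytic_germ_kdiff)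
  qed
  \<comment> \<open>The first brackets now vanish near \<open>a\<close>, so the right-hand side of
    the mixed identity drops out.\<close>
  have U: "\<forall>\<^sub>F x in nhds a. partial_deriv (\<iota> i) (g j l) x - partial_deriv (\<iota> j) (g i l) x
      + partial_deriv (\<iota> l) (g i j) x = 0" if ijl: "i < j" "j < l" "l < n" for i j l
  proof -
    have o: "i < l" "j < n" using ijl by auto
    show ?thesis
      using dual_closed(3)[OF w ijl] dg[OF ijl(2,3)] dg[OF o(1) ijl(3)] dg[OF ijl(1) o(2)]
        pz[OF ijl(2,3), of "\<iota> (Suc i)"] pz[OF o(1) ijl(3), of "\<iota> (Suc j)"] pz[OF ijl(1) o(2), of "\<iota> (Suc l)"]
      by eventually_elim (simp add: algebra_simps)
  qed
  have V: "\<forall>\<^sub>F x in nhds a. partial_deriv (\<iota> (Suc i)) (g j l) x - partial_deriv (\<iota> (Suc j)) (g i l) x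
      + partial_deriv (\<iota> (Suc l)) (g i j) x = 0" if ijl: "i < j" "j < l" "l < n" for i j l
  proof -
    have o: "i < l" "j < n" using ijl by auto
    show ?thesis
      using dual_closed(2)[OF w ijl] dg[OF ijl(2,3)] dg[OF o(1) ijl(3)] dg[OF ijl(1) o(2)]
      by eventually_elim (simp add: algebra_simps)
  qed
  have dep: "\<forall>\<^sub>F x in nhds a. partial_deriv t (g i j) x = 0" if "t \<in> T" "i < j" "j < n" for t i j
  proof -
    have "\<forall>\<^sub>F x in nhds a. \<forall>m\<in>T. partial_deriv m (br \<pi>2 (w i) (w j)) x = 0"
      by (rule dual_br_invariant(2)[OF w]) (use that in auto)
    thus ?thesis using dg[OF that(2,3)] by eventually_elim (use that in simp)
  qed
  have Z: "T \<inter> \<iota> ` {..n} = {}" by auto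
  obtain \<Phi> where \<Phi>: "analytic_germ a \<Phi>"
    "\<And>i j. i < j \<Longrightarrow> j < n \<Longrightarrow> \<forall>\<^sub>F x in nhds a. partial_deriv (\<iota> (Suc i)) (partial_deriv (\<iota> j) \<Phi>) x
      - partial_deriv (\<iota> (Suc j)) (partial_deriv (\<iota> i) \<Phi>) x = g i j x"
    "\<And>t. t \<in> T \<Longrightarrow> \<forall>\<^sub>F x in nhds a. partial_deriv t \<Phi> x = 0"
    using analytic_minors_solution[of \<iota> n a g T, OF inj ang U V dep Z] by blast
  have comm: "\<forall>\<^sub>F x in nhds a. \<forall>b c. partial_deriv b (partial_deriv c \<Phi>) x = partial_deriv c (partial_deriv b \<Phi>) x"
    using eventually_analytic_germ[OF \<Phi>(1)] by eventually_elim (blast intro: analytic_germ_partial_deriv_commute)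
  have bk: "basic (partial_deriv (\<iota> j) \<Phi>)" for j
  proof (intro conjI agerm \<Phi> eventually_ball_finite ballI)
    fix m assume "m \<in> T"
    have "\<forall>\<^sub>F x in nhds a. partial_deriv (\<iota> j) (partial_deriv m \<Phi>) x = partial_deriv (\<iota> j) (\<lambda>_. 0) x"
      by (rule eventually_partial_deriv_cong[OF \<Phi>(3)[OF \<open>m \<in> T\<close>]])
    thus "\<forall>\<^sub>F x in nhds a. partial_deriv m (partial_deriv (\<iota> j) \<Phi>) x = 0"
      using comm by eventually_elim simp
  qed simp
  define v where "v j x = w j x + partial_deriv (\<iota> j) \<Phi> x" for j x
  have v: "dual v" unfolding v_def[abs_def] by (rule add_basic(1)[where h = "\<lambda>j. partial_deriv (\<iota> j) \<Phi>", OF w bk])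
  have v0: "\<forall>\<^sub>F x in nhds a. br \<pi>1 (v i) (v j) x = 0 \<and> br \<pi>2 (v i) (v j) x = 0" if ij: "i < j" "j < n" for i j
  proof -
    have i: "i < n" using ij by simp
    show ?thesis
      using add_basic(2)[where y = w and h = "\<lambda>j. partial_deriv (\<iota> j) \<Phi>", OF w bk i ij(2)] \<Phi>(2)[OF ij] comm w1[OF ij]
      unfolding v_def[abs_def]
    proof eventually_elim
      case (elim x)
      have "partial_deriv (\<iota> (Suc i)) (partial_deriv (\<iota> j) \<Phi>) x
          - partial_deriv (\<iota> (Suc j)) (partial_deriv (\<iota> i) \<Phi>) x = - br \<pi>2 (w i) (w j) x"
        using elim(2) by (simp add: g_def)
      hence "br \<pi>2 (w i) (w j) x + partial_deriv (\<iota> (Suc i)) (partial_deriv (\<iota> j) \<Phi>) x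
          - partial_deriv (\<iota> (Suc j)) (partial_deriv (\<iota> i) \<Phi>) x = 0"
        by (metis add.right_inverse add_diff_eq)
      moreover have "partial_deriv (\<iota> i) (partial_deriv (\<iota> j) \<Phi>) x = partial_deriv (\<iota> j) (partial_deriv (\<iota> i) \<Phi>) x"
        using elim(3) by blast
      ultimately show ?case using elim(1,4) by simp
    qed
  qed
  have "\<forall>\<^sub>F x in nhds a. \<forall>j<n. \<forall>i<j. br \<pi>1 (v i) (v j) x = 0 \<and> br \<pi>2 (v i) (v j) x = 0"
    by (intro eventually_all_less v0)
  hence "\<forall>\<^sub>F x in nhds a. \<forall>i<n. \<forall>j<n. br \<pi>1 (v i) (v j) x = 0 \<and> br \<pi>2 (v i) (v j) x = 0"
    using ev_skew1 ev_skew2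
  proof (eventually_elim, intro allI impI)
    fix x i j
    assume 0: "\<forall>j<n. \<forall>i<j. br \<pi>1 (v i) (v j) x = 0 \<and> br \<pi>2 (v i) (v j) x = 0"
      and 1: "\<forall>f g. br \<pi>1 f g x = - br \<pi>1 g f x" and 2: "\<forall>f g. br \<pi>2 f g x = - br \<pi>2 g f x"
      and ij: "i < n" "j < n"
    consider "i < j" | "j < i" | "i = j" by linarith
    thus "br \<pi>1 (v i) (v j) x = 0 \<and> br \<pi>2 (v i) (v j) x = 0"
    proof cases
      case 1 thus ?thesis using 0 ij by blast
    next
      case 2
      hence "br \<pi>1 (v j) (v i) x = 0 \<and> br \<pi>2 (v j) (v i) x = 0" using 0 ij by blast
      thus ?thesis using 1[rule_format, of "v i" "v j"] \<open>\<forall>f g. br \<pi>2 f g x = - br \<pi>2 g f x\<close>[rule_format, of "v i" "v j"]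
        by simp
    next
      case 3
      have self: "c = 0" if "c = - c" for c :: 'k using that
        by (metis add.inverse_inverse eq_neg_iff_add_eq_0 mult_2 mult_eq_0_iff zero_neq_numeral)
      show ?thesis using self[OF 1[rule_format, of "v i" "v i"]] self[OF 2[rule_format, of "v i" "v i"]] 3 by simp
    qed
  qed
  with v show ?thesis by (rule that)
qed

end

section \<open>Frames and changes of coordinates\<close>

lemma filterlim_vec_germs:
  fixes F :: "'p::finite \<Rightarrow> 'k::real_or_complex ^ 'n::finite \<Rightarrow> 'k"
  assumes "\<And>i. analytic_germ a (F i)" "\<And>i. F i a = b $ i"
  shows "filterlim (\<lambda>x. \<chi> i. F i x) (nhds b) (nhds a)"
proof -
  have "filterlim (\<lambda>x. \<chi> i. F i x) (nhds (\<chi> i. F i a)) (nhds a)"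
    by (intro tendsto_vec_lambda)
      (use analytic_germ_isCont[OF assms(1)] in \<open>simp add: continuous_at tendsto_at_iff_tendsto_nhds\<close>)
  moreover have "(\<chi> i. F i a) = b" by (simp add: vec_eq_iff assms(2))
  ultimately show ?thesis by simp
qed

lemma lessThan_double_Suc: "{..<2 * n + 1} = {..n} \<union> (\<lambda>i. n + 1 + i) ` {..<n :: nat}"
proof (intro equalityI subsetI)
  fix x assume x: "x \<in> {..<2 * n + 1}"
  show "x \<in> {..n} \<union> (\<lambda>i. n + 1 + i) ` {..<n}"
  proof (cases "x \<le> n")
    case False
    hence "x = n + 1 + (x - (n + 1))" "x - (n + 1) < n" using x by auto
    thus ?thesis by blast
  qed simp
qed auto

lemma sum_frame:
  fixes e :: "nat \<Rightarrow> 'n::finite" and h :: "'n \<Rightarrow> 'k::comm_monoid_add"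
  assumes "bij_betw e {..<2 * n + 1} UNIV"
  shows "(\<Sum>l\<in>UNIV. h l) = (\<Sum>i\<le>n. h (e i)) + (\<Sum>i<n. h (e (n + 1 + i)))"
proof -
  have "(\<Sum>l\<in>UNIV. h l) = (\<Sum>i<2*n+1. h (e i))" using sum.reindex_bij_betw[OF assms, of h] by simp
  also have "{..<2*n+1} = {..n} \<union> (\<lambda>i. n + 1 + i) ` {..<n}" by (rule lessThan_double_Suc)
  also have "(\<Sum>i\<in>{..n} \<union> (\<lambda>i. n + 1 + i) ` {..<n}. h (e i)) =
      (\<Sum>i\<le>n. h (e i)) + (\<Sum>i\<in>(\<lambda>i. n + 1 + i) ` {..<n}. h (e i))"
    by (rule sum.union_disjoint) auto
  also have "(\<Sum>i\<in>(\<lambda>i. n + 1 + i) ` {..<n}. h (e i)) = (\<Sum>i<n. h (e (n + 1 + i)))"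
    by (subst sum.reindex) (auto simp: inj_on_def)
  finally show ?thesis .
qed

text \<open>The covectors \<open>w\<close> separate the \<open>p\<close> from each other and
  annihilate the \<open>u\<close>, so p_0, ..., p_n, u_0, ..., u_{n-1} are independent; being 2n + 1
  in number they are the columns of an invertible matrix, in the order given by
  \<open>e\<close>.\<close>

lemma frame_matrix:
  fixes w :: "nat \<Rightarrow> 'n::finite \<Rightarrow> 'k::real_or_complex" and e :: "nat \<Rightarrow> 'n"
  assumes e: "bij_betw e {..<2 * n + 1} UNIV"
    and p: "\<And>i j. i \<le> n \<Longrightarrow> j \<le> n \<Longrightarrow> (\<Sum>b\<in>UNIV. w i b * p j b) = (if i = j then 1 else 0)"
    and u: "\<And>v. (\<And>b. (\<Sum>i<n. v i * u i b) = 0) \<Longrightarrow> \<forall>i<n. v i = 0"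
    and wu: "\<And>i j. i \<le> n \<Longrightarrow> j < n \<Longrightarrow> (\<Sum>b\<in>UNIV. w i b * u j b) = 0"
  obtains A S where "\<And>i b. i \<le> n \<Longrightarrow> A b (e i) = p i b" "\<And>i b. i < n \<Longrightarrow> A b (e (n + 1 + i)) = u i b"
    "\<And>i j. (\<Sum>l\<in>UNIV. S i l * A l j) = (if i = j then 1 else 0)"
    "\<And>i j. (\<Sum>l\<in>UNIV. A i l * S l j) = (if i = j then 1 else 0)"
proof -
  define d where "d = inv_into {..<2*n+1} e"
  have de: "d (e i) = i" if "i < 2*n+1" for i
    unfolding d_def using e that by (intro inv_into_f_f) (auto simp: bij_betw_def)
  define A where "A b l = (if d l \<le> n then p (d l) b else u (d l - (n + 1)) b)" for b l
  have A1: "A b (e i) = p i b" if "i \<le> n" for b i using that by (simp add: A_def de)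
  have A2: "A b (e (n + 1 + i)) = u i b" if "i < n" for b i
    using that de[of "n + 1 + i"] by (simp add: A_def)
  have Asum: "(\<Sum>l\<in>UNIV. A b l * v l) = (\<Sum>i\<le>n. p i b * v (e i)) + (\<Sum>i<n. u i b * v (e (n + 1 + i)))" for b v
    unfolding sum_frame[OF e] by (simp add: A1 A2 del: add_Suc_right One_nat_def)
  have injA: "\<forall>l. v l = 0" if v: "\<And>b. (\<Sum>l\<in>UNIV. A b l * v l) = 0" for v
  proof -
    have v1: "v (e j) = 0" if j: "j \<le> n" for j
    proof -
      have "0 = (\<Sum>b\<in>UNIV. w j b * (\<Sum>l\<in>UNIV. A b l * v l))" by (simp add: v)
      also have "\<dots> = (\<Sum>i\<le>n. (\<Sum>b\<in>UNIV. w j b * p i b) * v (e i)) +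
          (\<Sum>i<n. (\<Sum>b\<in>UNIV. w j b * u i b) * v (e (n + 1 + i)))"
        unfolding Asum distrib_left sum.distrib sum_distrib_left sum_distrib_right
        by (subst (1 3) sum.swap) (simp add: mult.assoc)
      also have "\<dots> = v (e j)"
        using j by (simp add: p wu if_distrib[of "\<lambda>c. c * _"] cong: if_cong)
      finally show ?thesis ..
    qed
    have "\<forall>i<n. v (e (n + 1 + i)) = 0"
      by (rule u) (use v[unfolded Asum] v1 in \<open>simp add: mult.commute\<close>)
    with v1 have "v (e i) = 0" if "i < 2 * n + 1" for i
      using that by (cases "i \<le> n") (auto dest!: spec[of _ "i - (n + 1)"])
    thus ?thesis using e by (auto simp: bij_betw_def image_iff) (metis UNIV_I imageE lessThan_iff)
  qed
  obtain S where S: "\<And>i j. (\<Sum>l\<in>UNIV. S i l * A l j) = (if i = j then 1 else 0)"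
    and S': "\<And>i j. (\<Sum>l\<in>UNIV. A i l * S l j) = (if i = j then 1 else 0)"
    using jacobian_inverse[of A, OF injA] by blast
  show ?thesis by (rule that[of A S]) (fact A1 A2 S S')+
qed

text \<open>A bracket at a point depends on first derivatives there only, so on the right the
  brackets of the new coordinates are frozen at the single point \<open>x\<close>.\<close>

lemma br_compose:
  assumes kf: "kdiff f (\<chi> i. F i x)" and kg: "kdiff g (\<chi> i. F i x)" and kF: "\<And>i. kdiff (F i) x"
  shows "br \<pi> (\<lambda>x. f (\<chi> i. F i x)) (\<lambda>x. g (\<chi> i. F i x)) x = br (\<lambda>l m _. br \<pi> (F l) (F m) x) f g (\<chi> i. F i x)"
proof -
  let ?y = "\<chi> i. F i x"
  have "br \<pi> (\<lambda>x. f (\<chi> i. F i x)) (\<lambda>x. g (\<chi> i. F i x)) x = (\<Sum>i\<in>UNIV. \<Sum>j\<in>UNIV. \<Sum>l\<in>UNIV. \<Sum>m\<in>UNIV.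
      \<pi> i j x * partial_deriv i (F l) x * partial_deriv j (F m) x * partial_deriv l f ?y * partial_deriv m g ?y)"
    unfolding br_def partial_deriv_compose[OF kf kF] partial_deriv_compose[OF kg kF]
    by (simp add: sum_distrib_left sum_distrib_right mult_ac)
  also have "\<dots> = (\<Sum>i\<in>UNIV. \<Sum>l\<in>UNIV. \<Sum>j\<in>UNIV. \<Sum>m\<in>UNIV.
      \<pi> i j x * partial_deriv i (F l) x * partial_deriv j (F m) x * partial_deriv l f ?y * partial_deriv m g ?y)"
    by (intro sum.cong refl sum.swap)
  also have "\<dots> = (\<Sum>l\<in>UNIV. \<Sum>i\<in>UNIV. \<Sum>j\<in>UNIV. \<Sum>m\<in>UNIV.
      \<pi> i j x * partial_deriv i (F l) x * partial_deriv j (F m) x * partial_deriv l f ?y * partial_deriv m g ?y)"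
    by (rule sum.swap)
  also have "\<dots> = (\<Sum>l\<in>UNIV. \<Sum>i\<in>UNIV. \<Sum>m\<in>UNIV. \<Sum>j\<in>UNIV.
      \<pi> i j x * partial_deriv i (F l) x * partial_deriv j (F m) x * partial_deriv l f ?y * partial_deriv m g ?y)"
    by (intro sum.cong refl sum.swap)
  also have "\<dots> = (\<Sum>l\<in>UNIV. \<Sum>m\<in>UNIV. \<Sum>i\<in>UNIV. \<Sum>j\<in>UNIV.
      \<pi> i j x * partial_deriv i (F l) x * partial_deriv j (F m) x * partial_deriv l f ?y * partial_deriv m g ?y)"
    by (intro sum.cong refl sum.swap)
  also have "\<dots> = br (\<lambda>l m _. br \<pi> (F l) (F m) x) f g ?y"
    unfolding br_def by (simp add: sum_distrib_left sum_distrib_right)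
  finally show ?thesis .
qed

locale coordinate_change =
  fixes a b :: "'k::real_or_complex ^ 'n::finite" and F G :: "'n \<Rightarrow> 'k ^ 'n \<Rightarrow> 'k"
  assumes anF: "analytic_germ a (F i)" and anG: "analytic_germ b (G i)"
    and Fa: "F i a = b $ i" and Ga: "G i b = a $ i"
    and FG: "\<forall>\<^sub>F y in nhds b. \<forall>i. F i (\<chi> j. G j y) = y $ i"
    and GF: "\<forall>\<^sub>F x in nhds a. \<forall>i. G i (\<chi> j. F j x) = x $ i"
begin

abbreviation pull :: "('k ^ 'n \<Rightarrow> 'k) \<Rightarrow> 'k ^ 'n \<Rightarrow> 'k" where
  "pull f \<equiv> \<lambda>x. f (\<chi> i. F i x)"

text \<open>The structure functions of the same bracket in the new coordinates: brackets of the F_l,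
  evaluated at the old point that corresponds to \<open>y\<close>.\<close>

definition push :: "('n \<Rightarrow> 'n \<Rightarrow> 'k ^ 'n \<Rightarrow> 'k) \<Rightarrow> 'n \<Rightarrow> 'n \<Rightarrow> 'k ^ 'n \<Rightarrow> 'k" where
  "push \<pi> l m y = br \<pi> (F l) (F m) (\<chi> i. G i y)"

lemma limF: "filterlim (\<lambda>x. \<chi> i. F i x) (nhds b) (nhds a)"
  by (rule filterlim_vec_germs[OF anF Fa])

lemma limG: "filterlim (\<lambda>y. \<chi> i. G i y) (nhds a) (nhds b)"
  by (rule filterlim_vec_germs[OF anG Ga])

lemma analytic_germ_pull [agerm]: "analytic_germ b f \<Longrightarrow> analytic_germ a (pull f)"
  by (rule analytic_germ_compose[OF _ anF Fa])

lemma eventually_pull: "\<forall>\<^sub>F y in nhds b. P y \<Longrightarrow> \<forall>\<^sub>F x in nhds a. P (\<chi> i. F i x)"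
  by (rule eventually_compose_filterlim[OF _ limF])

lemma eventually_push:
  assumes "\<forall>\<^sub>F x in nhds a. P (\<chi> i. F i x)" shows "\<forall>\<^sub>F y in nhds b. P y"
  using eventually_compose_filterlim[OF assms limG] FG
proof eventually_elim
  case (elim y)
  have "(\<chi> i. F i (\<chi> j. G j y)) = y" using elim(2) by (simp add: vec_eq_iff)
  thus ?case using elim(1) by simp
qed

lemma analytic_germ_push: "(\<And>i j. analytic_germ a (\<pi> i j)) \<Longrightarrow> analytic_germ b (push \<pi> l m)"
  unfolding push_def[abs_def] by (rule analytic_germ_compose[OF _ anG Ga]) (intro agerm anF)

lemma br_pull:
  assumes f: "analytic_germ b f" and g: "analytic_germ b g"
  shows "\<forall>\<^sub>F x in nhds a. br (push \<pi>) f g (\<chi> i. F i x) = br \<pi> (pull f) (pull g) x"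
proof -
  have "\<forall>\<^sub>F x in nhds a. \<forall>i. analytic_germ x (F i)"
    by (intro eventually_all_finite eventually_analytic_germ anF)
  thus ?thesis using GF eventually_pull[OF eventually_analytic_germ[OF f]] eventually_pull[OF eventually_analytic_germ[OF g]]
  proof eventually_elim
    case (elim x)
    let ?y = "\<chi> i. F i x"
    have kF: "\<And>i. kdiff (F i) x" and kf: "kdiff f ?y" and kg: "kdiff g ?y"
      using elim by (auto intro: analytic_germ_kdiff)
    have x: "(\<chi> i. G i ?y) = x" using elim(2) by (simp add: vec_eq_iff)
    have "br (push \<pi>) f g ?y = br (\<lambda>l m _. br \<pi> (F l) (F m) x) f g ?y"
      by (simp only: br_def[where \<pi> = "push \<pi>"] br_def[where \<pi> = "\<lambda>l m _. br \<pi> (F l) (F m) x"] push_def x)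
    thus ?case unfolding br_compose[OF kf kg kF] .
  qed
qed

lemma br_pull_pull:
  assumes f: "analytic_germ b f" and g: "analytic_germ b g" and h: "analytic_germ b h"
    and an: "\<And>i j. analytic_germ a (\<pi>' i j)"
  shows "\<forall>\<^sub>F x in nhds a. br (push \<pi>) f (br (push \<pi>') g h) (\<chi> i. F i x) =
    br \<pi> (pull f) (br \<pi>' (pull g) (pull h)) x"
proof -
  have gh: "analytic_germ b (br (push \<pi>') g h)"
    by (intro analytic_germ_br analytic_germ_push an g h)
  have "\<forall>\<^sub>F x in nhds a. pull f x = pull f x" by simp
  from br_pull[OF f gh, of \<pi>] br_cong_eventually[OF this br_pull[OF g h, of \<pi>'], of \<pi>]
  show ?thesis by eventually_elim simp
qed

text \<open>Each identity at \<open>b\<close> is transported along \<open>F\<close> to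
  \<open>a\<close>, where it is the corresponding identity for the pulled back functions.\<close>

lemma bihamiltonian_push:
  assumes "bihamiltonian_germ a \<pi>1 \<pi>2"
  shows "bihamiltonian_germ b (push \<pi>1) (push \<pi>2)"
proof -
  interpret bihamiltonian_germ a \<pi>1 \<pi>2 by fact
  note P1 = br_pull_pull[where \<pi>' = \<pi>1, OF _ _ _ an1] and P2 = br_pull_pull[where \<pi>' = \<pi>2, OF _ _ _ an2]
  show ?thesis
  proof
    show "analytic_germ b (push \<pi>1 i j)" "analytic_germ b (push \<pi>2 i j)" for i j
      by (intro analytic_germ_push an1 an2)+
    show "\<forall>\<^sub>F x in nhds b. \<forall>i j. push \<pi>1 i j x = - push \<pi>1 j i x"
      unfolding push_def using eventually_compose_filterlim[OF ev_skew1 limG] by (rule eventually_mono) blast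
    show "\<forall>\<^sub>F x in nhds b. \<forall>i j. push \<pi>2 i j x = - push \<pi>2 j i x"
      unfolding push_def using eventually_compose_filterlim[OF ev_skew2 limG] by (rule eventually_mono) blast
  next
    fix f g h assume f: "analytic_germ b f" and g: "analytic_germ b g" and h: "analytic_germ b h"
    note pf = analytic_germ_pull[OF f] analytic_germ_pull[OF g] analytic_germ_pull[OF h]
    show "\<forall>\<^sub>F x in nhds b. br (push \<pi>1) f (br (push \<pi>1) g h) x +
        br (push \<pi>1) g (br (push \<pi>1) h f) x + br (push \<pi>1) h (br (push \<pi>1) f g) x = 0"
      apply (rule eventually_push)
      using jac1[OF pf] P1[OF f g h, where \<pi> = \<pi>1] P1[OF g h f, where \<pi> = \<pi>1] P1[OF h f g, where \<pi> = \<pi>1]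
      by eventually_elim simp
    show "\<forall>\<^sub>F x in nhds b. br (push \<pi>2) f (br (push \<pi>2) g h) x +
        br (push \<pi>2) g (br (push \<pi>2) h f) x + br (push \<pi>2) h (br (push \<pi>2) f g) x = 0"
      apply (rule eventually_push)
      using jac2[OF pf] P2[OF f g h, where \<pi> = \<pi>2] P2[OF g h f, where \<pi> = \<pi>2] P2[OF h f g, where \<pi> = \<pi>2]
      by eventually_elim simp
    show "\<forall>\<^sub>F x in nhds b. br (push \<pi>1) f (br (push \<pi>2) g h) x + br (push \<pi>1) g (br (push \<pi>2) h f) x +
        br (push \<pi>1) h (br (push \<pi>2) f g) x + (br (push \<pi>2) f (br (push \<pi>1) g h) x +
        br (push \<pi>2) g (br (push \<pi>1) h f) x + br (push \<pi>2) h (br (push \<pi>1) f g) x) = 0"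
      apply (rule eventually_push)
      using jac12[OF pf] P1[OF f g h, where \<pi> = \<pi>2] P1[OF g h f, where \<pi> = \<pi>2] P1[OF h f g, where \<pi> = \<pi>2]
          P2[OF f g h, where \<pi> = \<pi>1] P2[OF g h f, where \<pi> = \<pi>1] P2[OF h f g, where \<pi> = \<pi>1]
      by eventually_elim simp
  qed
qed

end

lemma br_eq_sum_right: "br \<pi> f g x = (\<Sum>c\<in>UNIV. br \<pi> f (\<lambda>x. x $ c) x * partial_deriv c g x)"
proof -
  have "br \<pi> f (\<lambda>x. x $ c) x = (\<Sum>i\<in>UNIV. \<pi> i c x * partial_deriv i f x)" for c
    by (simp add: br_alt partial_deriv_coord if_distrib[of "\<lambda>c. _ * c"] cong: if_cong)
  thus ?thesis by (simp add: br_alt)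
qed

section \<open>Kronecker coordinates from a Casimir chain\<close>

context bihamiltonian_germ
begin

text \<open>The vectors \<open>p j\<close>, dual to the differentials of the \<open>L i\<close>, together with the Hamiltonian vector
  fields of the \<open>L i\<close> form a basis; the functionals dual to the latter complete the \<open>L i\<close> to coordinates.\<close>

lemma kronecker_coordinates:
  fixes L :: "nat \<Rightarrow> 'k ^ 'n \<Rightarrow> 'k" and n :: nat
  assumes card: "CARD('n) = 2 * n + 1"
    and L: "\<And>i. i \<le> n \<Longrightarrow> analytic_germ a (L i)"
    and chain: "\<forall>\<^sub>F x in nhds a. \<forall>f. br \<pi>2 (L 0) f x = 0 \<and> br \<pi>1 (L n) f x = 0 \<and>
      (\<forall>i<n. br \<pi>2 (L (Suc i)) f x = - br \<pi>1 (L i) f x)"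
    and p: "\<And>i j. i \<le> n \<Longrightarrow> j \<le> n \<Longrightarrow> (\<Sum>b\<in>UNIV. partial_deriv b (L i) a * p j b) = (if i = j then 1 else 0)"
    and u: "\<And>v. (\<And>b. (\<Sum>i<n. v i * br \<pi>1 (L i) (\<lambda>x. x $ b) a) = 0) \<Longrightarrow> \<forall>i<n. v i = 0"
  obtains \<psi> where "\<And>l. l < 2 * n + 1 \<Longrightarrow> analytic_germ a (\<psi> l)"
    "\<forall>\<^sub>F x in nhds a. \<forall>l<2*n+1. \<forall>m<2*n+1. br \<pi>1 (\<psi> l) (\<psi> m) x = kron1 l m \<and> br \<pi>2 (\<psi> l) (\<psi> m) x = kron2 l m"
    "\<And>c. (\<And>b. (\<Sum>l<2*n+1. c l * partial_deriv b (\<psi> l) a) = 0) \<Longrightarrow> \<forall>l<2*n+1. c l = 0"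
proof -
  have invol: "\<forall>\<^sub>F x in nhds a. \<forall>i\<le>n. \<forall>j\<le>n. br \<pi>1 (L i) (L j) x = 0 \<and> br \<pi>2 (L i) (L j) x = 0"
    using chain ev_skew1 ev_skew2
  proof eventually_elim
    case (elim x)
    have s1: "br \<pi>1 (L i) (L j) x = - br \<pi>1 (L j) (L i) x" for i j using elim(2) by blast
    have s2: "br \<pi>2 (L i) (L j) x = - br \<pi>2 (L j) (L i) x" for i j using elim(3) by blast
    have 1: "br \<pi>1 (L i) (L j) x = 0" if "i \<le> n" "j \<le> n" for i j
      by (rule lenard_involution[of n "\<lambda>i j. br \<pi>1 (L i) (L j) x" "\<lambda>i j. br \<pi>2 (L i) (L j) x", OF s1 s2 _ _ _ that])
        (use elim(1) in auto)
    have "br \<pi>2 (L i) (L j) x = 0" if "i \<le> n" "j \<le> n" for i j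
      using 1[of "i - 1" j] elim(1) that by (cases i) auto
    with 1 show ?case by blast
  qed
  have invol_a: "br \<pi>1 (L i) (L j) a = 0" if "i \<le> n" "j \<le> n" for i j
    using eventually_nhds_x_imp_x[OF invol] that by blast
  obtain e :: "nat \<Rightarrow> 'n" where e: "bij_betw e {..<2*n+1} UNIV"
    using ex_bij_betw_nat_finite[of "UNIV :: 'n set"] card by (auto simp: atLeast0LessThan)
  have e_eq: "e i = e j \<longleftrightarrow> i = j" if "i < 2*n+1" "j < 2*n+1" for i j
    using e that by (auto simp: bij_betw_def dest: inj_onD)
  define d where "d = inv_into {..<2*n+1} e"
  have de: "d (e i) = i" if "i < 2*n+1" for i
    unfolding d_def using e that by (intro inv_into_f_f) (auto simp: bij_betw_def)
  define X where "X i b = br \<pi>1 (L i) (\<lambda>x. x $ b) a" for i b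
  have LX: "(\<Sum>b\<in>UNIV. partial_deriv b (L i) a * X j b) = 0" if "i \<le> n" "j \<le> n" for i j
    using invol_a[OF that(2,1)] unfolding br_eq_sum_right[of \<pi>1 "L j" "L i"] by (simp add: X_def mult.commute)
  have Xu: "\<forall>i<n. v i = 0" if "\<And>b. (\<Sum>i<n. v i * X i b) = 0" for v
    by (rule u) (use that in \<open>simp add: X_def\<close>)
  obtain A S where A1: "\<And>i b. i \<le> n \<Longrightarrow> A b (e i) = p i b" and A2: "\<And>i b. i < n \<Longrightarrow> A b (e (n + 1 + i)) = X i b"
    and S: "\<And>i j. (\<Sum>l\<in>UNIV. S i l * A l j) = (if i = j then 1 else 0)"
    and S': "\<And>i j. (\<Sum>l\<in>UNIV. A i l * S l j) = (if i = j then 1 else 0)"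
    by (rule frame_matrix[of e n "\<lambda>i b. partial_deriv b (L i) a" p X, OF e])
      (assumption | rule p Xu LX less_imp_le that)+
  have Asum: "(\<Sum>l\<in>UNIV. A b l * v l) = (\<Sum>i\<le>n. p i b * v (e i)) + (\<Sum>i<n. X i b * v (e (n + 1 + i)))" for b v
    unfolding sum_frame[OF e] by (simp add: A1 A2 del: add_Suc_right One_nat_def)
  define F where "F l = (if d l \<le> n then L (d l) else (\<lambda>x. \<Sum>b\<in>UNIV. S l b * x $ b))" for l
  have F1: "F (e i) = L i" if "i \<le> n" for i using that by (simp add: F_def de)
  have F2: "F (e (n + 1 + i)) = (\<lambda>x. \<Sum>b\<in>UNIV. S (e (n + 1 + i)) b * x $ b)" if "i < n" for i
    using that de[of "n + 1 + i"] by (simp add: F_def)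
  have anF: "analytic_germ a (F l)" for l
  proof (cases "d l \<le> n")
    case True thus ?thesis using L by (simp add: F_def)
  next
    case False
    have "analytic_germ a (\<lambda>x. \<Sum>b\<in>UNIV. S l b * x $ b)" by (intro agerm)
    thus ?thesis using False by (simp add: F_def)
  qed
  have pF2: "partial_deriv b (F (e (n + 1 + i))) x = S (e (n + 1 + i)) b" if "i < n" for i b x
    unfolding F2[OF that]
    by (simp add: partial_deriv_sum kdiff_cmult partial_deriv_cmult partial_deriv_coord
        if_distrib[of "\<lambda>c. _ * c"] cong: if_cong)
  have injF: "\<forall>j. v j = 0" if v: "\<And>i. (\<Sum>j\<in>UNIV. partial_deriv j (F i) a * v j) = 0" for v
  proof -
    define s where "s l = (\<Sum>b\<in>UNIV. S l b * v b)" for l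
    have vA: "v b = (\<Sum>l\<in>UNIV. A b l * s l)" for b
    proof -
      have "(\<Sum>l\<in>UNIV. A b l * s l) = (\<Sum>c\<in>UNIV. (\<Sum>l\<in>UNIV. A b l * S l c) * v c)"
        unfolding s_def sum_distrib_left sum_distrib_right by (subst sum.swap) (simp add: mult.assoc)
      thus ?thesis by (simp add: S' if_distrib[of "\<lambda>c. c * _"] cong: if_cong)
    qed
    have s2: "s (e (n + 1 + i)) = 0" if "i < n" for i
      using v[of "e (n + 1 + i)"] by (simp only: pF2[OF that] s_def)
    have vp: "v b = (\<Sum>i\<le>n. p i b * s (e i))" for b
      unfolding vA Asum using s2 by simp
    have s1: "s (e j) = 0" if j: "j \<le> n" for j
    proof -
      have "0 = (\<Sum>b\<in>UNIV. partial_deriv b (L j) a * v b)" using v[of "e j"] j by (simp add: F1)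
      also have "\<dots> = (\<Sum>i\<le>n. (\<Sum>b\<in>UNIV. partial_deriv b (L j) a * p i b) * s (e i))"
        unfolding vp sum_distrib_left sum_distrib_right by (subst sum.swap) (simp add: mult.assoc)
      also have "\<dots> = s (e j)" using j by (simp add: p if_distrib[of "\<lambda>c. c * _"] cong: if_cong)
      finally show ?thesis ..
    qed
    show ?thesis unfolding vp using s1 by simp
  qed
  define b where "b = (\<chi> i. F i a)"
  obtain G where G: "\<And>i. analytic_germ b (G i)" "\<And>i. G i b = a $ i"
    "\<forall>\<^sub>F y in nhds b. \<forall>i. F i (\<chi> j. G j y) = y $ i"
    "\<forall>\<^sub>F x in nhds a. \<forall>i. G i (\<chi> j. F j x) = x $ i"
    using analytic_local_inverse[where F = F, OF anF injF b_def] by blast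
  interpret cc: coordinate_change a b F G
    by unfold_locales (use anF G in \<open>simp_all add: b_def\<close>)
  interpret B: bihamiltonian_germ b "cc.push \<pi>1" "cc.push \<pi>2"
    by (rule cc.bihamiltonian_push) unfold_locales
  have T: "- e ` {..n} = (\<lambda>i. e (n + 1 + i)) ` {..<n}"
  proof -
    have "UNIV = e ` {..<2*n+1}" using e by (simp add: bij_betw_def)
    also have "{..<2*n+1} = {..n} \<union> (\<lambda>i. n + 1 + i) ` {..<n}" by (rule lessThan_double_Suc)
    finally have 1: "UNIV = e ` {..n} \<union> (\<lambda>i. e (n + 1 + i)) ` {..<n}" by (simp add: image_Un image_image)
    have 2: "e ` {..n} \<inter> (\<lambda>i. e (n + 1 + i)) ` {..<n} = {}"
      by (auto simp: e_eq)
    show ?thesis using 1 2 by blast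
  qed
  have Ga: "(\<chi> i. G i b) = a" by (simp add: vec_eq_iff G)
  \<comment> \<open>The added coordinates are dual to the Hamiltonian vectors, so the matrix of
    these fields along the level sets is the identity at \<open>b\<close>; \<open>rows\<close> and
    \<open>cols\<close> follow at once.\<close>
  have delta: "cc.push \<pi>1 (e i) (e (n + 1 + j)) b = (if i = j then 1 else 0)" if "i < n" "j < n" for i j
  proof -
    have "cc.push \<pi>1 (e i) (e (n + 1 + j)) b = br \<pi>1 (L i) (F (e (n + 1 + j))) a"
      unfolding cc.push_def Ga using that by (simp add: F1)
    also have "\<dots> = (\<Sum>c\<in>UNIV. S (e (n + 1 + j)) c * A c (e (n + 1 + i)))"
      unfolding br_eq_sum_right[of _ _ "F _"] pF2[OF that(2)] A2[OF that(1)] X_def by (simp add: mult.commute)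
    also have "\<dots> = (if i = j then 1 else 0)" unfolding S using that e_eq[of "n + 1 + j" "n + 1 + i"] by auto
    finally show ?thesis .
  qed
  have injT: "inj_on (\<lambda>i. e (n + 1 + i)) {..<n}" by (auto simp: inj_on_def e_eq)
  interpret lc: lax_coordinates b "cc.push \<pi>1" "cc.push \<pi>2" e n
  proof
    show "inj_on e {..n}" by (auto simp: inj_on_def e_eq)
    show "\<forall>\<^sub>F x in nhds b. \<forall>m. cc.push \<pi>2 (e 0) m x = 0 \<and> cc.push \<pi>1 (e n) m x = 0 \<and>
        (\<forall>i<n. cc.push \<pi>2 (e (Suc i)) m x = - cc.push \<pi>1 (e i) m x)"
      using eventually_compose_filterlim[OF chain cc.limG]
      by (rule eventually_mono) (simp add: cc.push_def F1)
  next
    fix v assume v: "\<And>m. m \<in> - e ` {..n} \<Longrightarrow> (\<Sum>i<n. v i * cc.push \<pi>1 (e i) m b) = 0"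
    show "\<forall>i<n. v i = 0"
    proof (intro allI impI)
      fix j assume j: "j < n"
      have "(\<Sum>i<n. v i * cc.push \<pi>1 (e i) (e (n + 1 + j)) b) = 0" by (rule v) (use j T in blast)
      moreover have "(\<Sum>i<n. v i * cc.push \<pi>1 (e i) (e (n + 1 + j)) b) = (\<Sum>i<n. if i = j then v j else 0)"
        by (rule sum.cong) (use j delta in auto)
      ultimately show "v j = 0" using j by simp
    qed
  next
    fix w assume w: "\<And>i. i < n \<Longrightarrow> (\<Sum>m\<in>- e ` {..n}. cc.push \<pi>1 (e i) m b * w m) = 0"
    have "w (e (n + 1 + i)) = 0" if i: "i < n" for i
    proof -
      have "(\<Sum>j<n. cc.push \<pi>1 (e i) (e (n + 1 + j)) b * w (e (n + 1 + j))) = 0"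
        using w[OF i] unfolding T by (subst (asm) sum.reindex[OF injT]) simp
      moreover have "(\<Sum>j<n. cc.push \<pi>1 (e i) (e (n + 1 + j)) b * w (e (n + 1 + j))) =
          (\<Sum>j<n. if j = i then w (e (n + 1 + i)) else 0)"
        by (rule sum.cong) (use i delta in auto)
      ultimately show ?thesis using i by simp
    qed
    thus "\<forall>m\<in>- e ` {..n}. w m = 0" unfolding T by blast
  qed
  obtain y where y: "lc.dual y" and yy: "\<forall>\<^sub>F x in nhds b. \<forall>i<n. \<forall>j<n.
      br (cc.push \<pi>1) (y i) (y j) x = 0 \<and> br (cc.push \<pi>2) (y i) (y j) x = 0"
    by (rule lc.flat_coordinates)
  have any: "analytic_germ b (y j)" if "j < n" for j using y that by (simp add: lc.dual_def)
  have pz: "(\<lambda>x. (\<chi> l. F l x) $ e i) = L i" if "i \<le> n" for i using F1[OF that] by simp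
  have Ly: "\<forall>\<^sub>F x in nhds a. \<forall>i<Suc n. \<forall>j<n. br \<pi>1 (L i) (cc.pull (y j)) x = (if i = j then 1 else 0) \<and>
      br \<pi>2 (L i) (cc.pull (y j)) x = (if i = Suc j then - 1 else 0)"
  proof (intro eventually_all_less)
    fix i j assume i: "i < Suc n" and j: "j < n"
    hence i': "i \<le> n" by simp
    show "\<forall>\<^sub>F x in nhds a. br \<pi>1 (L i) (cc.pull (y j)) x = (if i = j then 1 else 0) \<and>
        br \<pi>2 (L i) (cc.pull (y j)) x = (if i = Suc j then - 1 else 0)"
      using cc.eventually_pull[OF lc.dual_brackets[OF y]]
        cc.br_pull[OF analytic_germ_coord any[OF j], of \<pi>1 "e i", unfolded pz[OF i']]
        cc.br_pull[OF analytic_germ_coord any[OF j], of \<pi>2 "e i", unfolded pz[OF i']]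
      by eventually_elim (use i' j in auto)
  qed
  have yy': "\<forall>\<^sub>F x in nhds a. \<forall>i<n. \<forall>j<n. br \<pi>1 (cc.pull (y i)) (cc.pull (y j)) x = 0 \<and>
      br \<pi>2 (cc.pull (y i)) (cc.pull (y j)) x = 0"
  proof (intro eventually_all_less)
    fix i j assume i: "i < n" and j: "j < n"
    show "\<forall>\<^sub>F x in nhds a. br \<pi>1 (cc.pull (y i)) (cc.pull (y j)) x = 0 \<and>
        br \<pi>2 (cc.pull (y i)) (cc.pull (y j)) x = 0"
      using cc.eventually_pull[OF yy] cc.br_pull[OF any[OF i] any[OF j], of \<pi>1] cc.br_pull[OF any[OF i] any[OF j], of \<pi>2]
      by eventually_elim (use i j in auto)
  qed
  \<comment> \<open>The interleaving of the model: {L_i, y_i}_1 = 1 belongs to the positions 2i,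
    2i+1, and {y_i, L_{i+1}}_2 = 1 to 2i+1, 2i+2.\<close>
  define \<psi> where "\<psi> l = (if even l then L (l div 2) else cc.pull (y (l div 2)))" for l
  show ?thesis
  proof (rule that)
    show "analytic_germ a (\<psi> l)" if "l < 2 * n + 1" for l
    proof (cases "even l")
      case True
      hence "l div 2 \<le> n" using that by auto
      thus ?thesis using True L by (simp add: \<psi>_def)
    next
      case False
      hence "l div 2 < n" using that by (auto elim!: oddE)
      thus ?thesis using False cc.analytic_germ_pull[OF any] by (simp add: \<psi>_def)
    qed
    show ev: "\<forall>\<^sub>F x in nhds a. \<forall>l<2*n+1. \<forall>m<2*n+1.
        br \<pi>1 (\<psi> l) (\<psi> m) x = kron1 l m \<and> br \<pi>2 (\<psi> l) (\<psi> m) x = kron2 l m"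
      using Ly yy' invol ev_skew1 ev_skew2
    proof (eventually_elim, intro allI impI)
      fix x l m
      assume h1: "\<forall>i<Suc n. \<forall>j<n. br \<pi>1 (L i) (cc.pull (y j)) x = (if i = j then 1 else 0) \<and>
          br \<pi>2 (L i) (cc.pull (y j)) x = (if i = Suc j then - 1 else 0)"
        and h2: "\<forall>i<n. \<forall>j<n. br \<pi>1 (cc.pull (y i)) (cc.pull (y j)) x = 0 \<and> br \<pi>2 (cc.pull (y i)) (cc.pull (y j)) x = 0"
        and h3: "\<forall>i\<le>n. \<forall>j\<le>n. br \<pi>1 (L i) (L j) x = 0 \<and> br \<pi>2 (L i) (L j) x = 0"
        and s1: "\<forall>f g. br \<pi>1 f g x = - br \<pi>1 g f x" and s2: "\<forall>f g. br \<pi>2 f g x = - br \<pi>2 g f x"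
        and l: "l < 2 * n + 1" and m: "m < 2 * n + 1"
      consider i j where "l = 2 * i" "m = 2 * j" "i \<le> n" "j \<le> n"
        | i j where "l = 2 * i" "m = 2 * j + 1" "i < Suc n" "j < n"
        | i j where "l = 2 * i + 1" "m = 2 * j" "i < n" "j < Suc n"
        | i j where "l = 2 * i + 1" "m = 2 * j + 1" "i < n" "j < n"
        using l m by (cases "even l"; cases "even m") (auto elim!: evenE oddE)
      thus "br \<pi>1 (\<psi> l) (\<psi> m) x = kron1 l m \<and> br \<pi>2 (\<psi> l) (\<psi> m) x = kron2 l m"
      proof cases
        case (1 i j)
        thus ?thesis using h3 by (simp add: \<psi>_def kron1_def kron2_def) presburger
      next
        case (2 i j)
        have "\<psi> l = L i" "\<psi> m = cc.pull (y j)" using 2 by (simp_all add: \<psi>_def)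
        moreover have "kron1 l m = (if i = j then 1 else 0 :: 'k)" "kron2 l m = (if i = Suc j then - 1 else 0 :: 'k)"
          using 2 by (auto simp: kron1_def kron2_def)
        ultimately show ?thesis using h1 2 by simp
      next
        case (3 i j)
        have "\<psi> m = L j" "\<psi> l = cc.pull (y i)" using 3 by (simp_all add: \<psi>_def)
        moreover have "kron1 l m = - (if j = i then 1 else 0 :: 'k)" "kron2 l m = - (if j = Suc i then - 1 else 0 :: 'k)"
          using 3 by (auto simp: kron1_def kron2_def)
        ultimately show ?thesis using h1 3 s1[rule_format, of "cc.pull (y i)" "L j"] s2[rule_format, of "cc.pull (y i)" "L j"]
          by simp
      next
        case (4 i j)
        thus ?thesis using h2 by (simp add: \<psi>_def kron1_def kron2_def) presburger
      qed
    qed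
    fix c assume c: "\<And>b. (\<Sum>l<2*n+1. c l * partial_deriv b (\<psi> l) a) = 0"
    have split: "(\<Sum>l<2*n+1. h l) = (\<Sum>i\<le>n. h (2 * i)) + (\<Sum>i<n. h (2 * i + 1))" for h :: "nat \<Rightarrow> 'k"
      by (induction n) (simp_all add: add_ac)
    \<comment> \<open>Among the \<psi> the field {L_i, -}_1 sees y_i only, which isolates its
      coefficient; what then remains is a relation among the dL_i, excluded by the dual vectors
      \<open>p j\<close>.\<close>
    have c1: "c (2 * i + 1) = 0" if i: "i < n" for i
    proof -
      note k = eventually_nhds_x_imp_x[OF ev, rule_format]
      have "0 = (\<Sum>b\<in>UNIV. br \<pi>1 (\<psi> (2 * i)) (\<lambda>x. x $ b) a * (\<Sum>l<2*n+1. c l * partial_deriv b (\<psi> l) a))"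
        unfolding c by simp
      also have "\<dots> = (\<Sum>l<2*n+1. c l * br \<pi>1 (\<psi> (2 * i)) (\<psi> l) a)"
        unfolding br_eq_sum_right[of \<pi>1 "\<psi> (2 * i)" "\<psi> _"] sum_distrib_left
        by (subst sum.swap) (simp add: mult_ac)
      also have "\<dots> = (\<Sum>l<2*n+1. if l = 2 * i + 1 then c (2 * i + 1) else 0)"
      proof (rule sum.cong)
        fix l assume "l \<in> {..<2*n+1}"
        hence "br \<pi>1 (\<psi> (2 * i)) (\<psi> l) a = kron1 (2 * i) l" using k[of "2 * i" l] i by simp
        also have "kron1 (2 * i) l = (if l = 2 * i + 1 then 1 else 0 :: 'k)"
          unfolding kron1_def by (auto, presburger)
        finally show "c l * br \<pi>1 (\<psi> (2 * i)) (\<psi> l) a = (if l = 2 * i + 1 then c (2 * i + 1) else 0)" by simp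
      qed simp
      also have "\<dots> = c (2 * i + 1)" using i by simp
      finally show ?thesis ..
    qed
    have c0: "c (2 * j) = 0" if j: "j \<le> n" for j
    proof -
      have "(\<Sum>i\<le>n. c (2 * i) * partial_deriv b (L i) a) = 0" for b
        using c[of b] unfolding split using c1 by (simp add: \<psi>_def)
      hence "0 = (\<Sum>b\<in>UNIV. (\<Sum>i\<le>n. c (2 * i) * partial_deriv b (L i) a) * p j b)" by simp
      also have "\<dots> = (\<Sum>i\<le>n. c (2 * i) * (\<Sum>b\<in>UNIV. partial_deriv b (L i) a * p j b))"
        unfolding sum_distrib_left sum_distrib_right by (subst sum.swap) (simp add: mult.assoc)
      also have "\<dots> = c (2 * j)" using j by (simp add: p if_distrib[of "\<lambda>c. _ * c"] cong: if_cong)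
      finally show ?thesis ..
    qed
    show "\<forall>l<2*n+1. c l = 0"
    proof (intro allI impI)
      fix l assume "l < 2 * n + 1"
      thus "c l = 0" using c0[of "l div 2"] c1[of "l div 2"] by (cases "even l") (auto elim!: evenE oddE)
    qed
  qed
qed

end

section \<open>Smooth functions\<close>

lemma C_k_on_cong:
  assumes "open S" "\<And>x. x \<in> S \<Longrightarrow> f x = g x" "C_k_on k S f" shows "C_k_on k S g"
proof (cases k)
  case 0
  thus ?thesis using assms continuous_on_cong[of S S f g] by simp
next
  case (Suc l)
  from assms(3) obtain d where d: "\<forall>x\<in>S. (f has_derivative (\<lambda>h. \<Sum>i\<in>UNIV. d i x * h $ i)) (at x)"
    "\<forall>i. C_k_on l S (d i)" by (auto simp: Suc)
  have "(g has_derivative (\<lambda>h. \<Sum>i\<in>UNIV. d i x * h $ i)) (at x)" if "x \<in> S" for x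
    by (rule has_derivative_transform_within_open[OF d(1)[rule_format, OF that] assms(1) that assms(2)])
  with d(2) show ?thesis by (auto simp: Suc)
qed

text \<open>On an open set the functions \<open>g\<close> in the definition are forced to be the
  partial derivatives, which removes the existential quantifier.\<close>

lemma C_k_on_Suc_iff:
  assumes "open S"
  shows "C_k_on (Suc k) S f \<longleftrightarrow> (\<forall>x\<in>S. kdiff f x) \<and> (\<forall>i. C_k_on k S (partial_deriv i f))"
proof
  assume "C_k_on (Suc k) S f"
  then obtain d where d: "\<forall>x\<in>S. (f has_derivative (\<lambda>h. \<Sum>i\<in>UNIV. d i x * h $ i)) (at x)"
    "\<forall>i. C_k_on k S (d i)" by auto
  have "C_k_on k S (partial_deriv i f)" for i
    by (rule C_k_on_cong[OF assms _ d(2)[rule_format, of i]]) (use d(1) kdiffI(2) in metis)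
  moreover have "kdiff f x" if "x \<in> S" for x
    by (rule kdiffI(1)[OF d(1)[rule_format, OF that]])
  ultimately show "(\<forall>x\<in>S. kdiff f x) \<and> (\<forall>i. C_k_on k S (partial_deriv i f))" by blast
next
  assume "(\<forall>x\<in>S. kdiff f x) \<and> (\<forall>i. C_k_on k S (partial_deriv i f))"
  thus "C_k_on (Suc k) S f" by (auto simp: kdiff_def intro!: exI[of _ "\<lambda>i. partial_deriv i f"])
qed

declare C_k_on.simps(2) [simp del]

lemma C_k_on_less:
  assumes "open S" "C_k_on (Suc k) S f" shows "C_k_on k S f"
  using assms(2)
proof (induction k arbitrary: f)
  case 0
  hence "\<forall>x\<in>S. isCont f x" using assms(1) by (auto simp: C_k_on_Suc_iff intro: kdiff_isCont)
  thus ?case by (simp add: continuous_at_imp_continuous_on)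
next
  case (Suc k)
  have "C_k_on k S (partial_deriv i f)" for i
    by (rule Suc.IH) (use Suc.prems assms(1) in \<open>simp add: C_k_on_Suc_iff[OF assms(1), of "Suc k"]\<close>)
  thus ?case using Suc.prems by (simp add: C_k_on_Suc_iff[OF assms(1)])
qed

lemma C_k_on_continuous: "open S \<Longrightarrow> C_k_on k S f \<Longrightarrow> continuous_on S f"
  by (induction k) (auto intro: C_k_on_less)

lemma C_k_on_subset: "C_k_on k S f \<Longrightarrow> T \<subseteq> S \<Longrightarrow> C_k_on k T f"
proof (induction k arbitrary: f)
  case 0 thus ?case by (auto intro: continuous_on_subset)
next
  case (Suc k)
  then obtain g where "\<forall>x\<in>S. (f has_derivative (\<lambda>h. \<Sum>i\<in>UNIV. g i x * h $ i)) (at x)" "\<forall>i. C_k_on k S (g i)"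
    unfolding C_k_on.simps(2) by blast
  hence "(\<forall>x\<in>T. (f has_derivative (\<lambda>h. \<Sum>i\<in>UNIV. g i x * h $ i)) (at x)) \<and> (\<forall>i. C_k_on k T (g i))"
    using Suc.IH Suc.prems(2) by blast
  thus ?case unfolding C_k_on.simps(2) by blast
qed

lemma C_k_on_const: "C_k_on k S (\<lambda>_. c)"
proof (induction k arbitrary: c)
  case (Suc k)
  show ?case unfolding C_k_on.simps(2)
    by (rule exI[of _ "\<lambda>_ _. 0"]) (use Suc in simp)
qed simp

lemma C_k_on_add:
  assumes "open S" shows "C_k_on k S f \<Longrightarrow> C_k_on k S g \<Longrightarrow> C_k_on k S (\<lambda>x. f x + g x)"
proof (induction k arbitrary: f g)
  case 0 thus ?case by (simp add: continuous_on_add)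
next
  case (Suc k)
  have "C_k_on k S (partial_deriv i (\<lambda>x. f x + g x))" for i
    by (rule C_k_on_cong[OF assms _ Suc.IH[of "partial_deriv i f" "partial_deriv i g"]])
      (use Suc.prems in \<open>simp_all add: C_k_on_Suc_iff[OF assms] partial_deriv_add\<close>)
  thus ?case using Suc.prems by (simp add: C_k_on_Suc_iff[OF assms] kdiff_add)
qed

lemma C_k_on_mult:
  assumes "open S" shows "C_k_on k S f \<Longrightarrow> C_k_on k S g \<Longrightarrow> C_k_on k S (\<lambda>x. f x * g x)"
proof (induction k arbitrary: f g)
  case 0 thus ?case by (simp add: continuous_on_mult)
next
  case (Suc k)
  have l: "C_k_on k S f" "C_k_on k S g" using Suc.prems C_k_on_less[OF assms] by blast+
  have "C_k_on k S (partial_deriv i (\<lambda>x. f x * g x))" for i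
  proof (rule C_k_on_cong[OF assms])
    show "C_k_on k S (\<lambda>x. partial_deriv i f x * g x + f x * partial_deriv i g x)"
      using Suc.prems l by (intro C_k_on_add[OF assms] Suc.IH) (simp_all add: C_k_on_Suc_iff[OF assms])
  qed (use Suc.prems in \<open>simp add: C_k_on_Suc_iff[OF assms] partial_deriv_mult\<close>)
  thus ?case using Suc.prems by (simp add: C_k_on_Suc_iff[OF assms] kdiff_mult)
qed

lemma C_k_on_sum:
  assumes "open S" shows "(\<And>j. j \<in> J \<Longrightarrow> C_k_on k S (f j)) \<Longrightarrow> C_k_on k S (\<lambda>x. \<Sum>j\<in>J. f j x)"
  by (induction J rule: infinite_finite_induct) (auto intro: C_k_on_const C_k_on_add[OF assms])

lemma C_k_on_analytic:
  assumes "open S" shows "(\<And>x. x \<in> S \<Longrightarrow> analytic_germ x f) \<Longrightarrow> C_k_on k S f"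
proof (induction k arbitrary: f)
  case 0
  hence "\<forall>x\<in>S. isCont f x" by (auto intro: analytic_germ_isCont)
  thus ?case by (simp add: continuous_at_imp_continuous_on)
next
  case (Suc k)
  have "C_k_on k S (partial_deriv i f)" for i by (rule Suc.IH) (intro agerm Suc.prems)
  thus ?case using Suc.prems by (simp add: C_k_on_Suc_iff[OF assms] analytic_germ_kdiff)
qed

lemma C_k_on_compose:
  fixes g :: "'p::finite \<Rightarrow> 'k::real_or_complex ^ 'n::finite \<Rightarrow> 'k"
  assumes S: "open S" and T: "open T" and g: "\<And>i. C_k_on k T (g i)" and ST: "\<And>x. x \<in> T \<Longrightarrow> (\<chi> i. g i x) \<in> S"
  shows "C_k_on k S F \<Longrightarrow> C_k_on k T (\<lambda>x. F (\<chi> i. g i x))"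
  using g
proof (induction k arbitrary: F)
  case 0
  hence "continuous_on T (\<lambda>x. \<chi> i. g i x)" by (auto intro: continuous_on_vec_lambda)
  thus ?case using 0 ST by (auto intro: continuous_on_compose2)
next
  case (Suc k)
  have l: "C_k_on k T (g i)" for i using Suc.prems C_k_on_less[OF T] by blast
  note kd = Suc.prems[unfolded C_k_on_Suc_iff[OF S] C_k_on_Suc_iff[OF T]]
  have "C_k_on k T (partial_deriv i (\<lambda>x. F (\<chi> i. g i x)))" for i
  proof (rule C_k_on_cong[OF T])
    show "C_k_on k T (\<lambda>x. \<Sum>j\<in>UNIV. partial_deriv j F (\<chi> j. g j x) * partial_deriv i (g j) x)"
      using kd l by (intro C_k_on_sum[OF T] C_k_on_mult[OF T] Suc.IH) auto
    show "(\<Sum>j\<in>UNIV. partial_deriv j F (\<chi> j. g j x) * partial_deriv i (g j) x) =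
        partial_deriv i (\<lambda>x. F (\<chi> i. g i x)) x" if "x \<in> T" for x
      by (rule partial_deriv_compose[symmetric]) (use kd ST that in auto)
  qed
  moreover have "kdiff (\<lambda>x. F (\<chi> i. g i x)) x" if "x \<in> T" for x
    by (rule kdiff_compose) (use kd ST that in auto)
  ultimately show ?case by (simp add: C_k_on_Suc_iff[OF T])
qed

lemma smooth_on_kdiff: "open S \<Longrightarrow> smooth_on S f \<Longrightarrow> x \<in> S \<Longrightarrow> kdiff f x"
  unfolding smooth_on_def using C_k_on_Suc_iff by blast

lemma smooth_on_partial_deriv: "open S \<Longrightarrow> smooth_on S f \<Longrightarrow> smooth_on S (partial_deriv i f)"
  unfolding smooth_on_def using C_k_on_Suc_iff by blast

lemma smooth_on_analytic: "open S \<Longrightarrow> (\<And>x. x \<in> S \<Longrightarrow> analytic_germ x f) \<Longrightarrow> smooth_on S f"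
  unfolding smooth_on_def using C_k_on_analytic by blast

lemma smooth_on_subset: "smooth_on S f \<Longrightarrow> T \<subseteq> S \<Longrightarrow> smooth_on T f"
  unfolding smooth_on_def using C_k_on_subset by blast

lemma smooth_on_cong: "open S \<Longrightarrow> (\<And>x. x \<in> S \<Longrightarrow> f x = g x) \<Longrightarrow> smooth_on S f \<Longrightarrow> smooth_on S g"
  unfolding smooth_on_def using C_k_on_cong by blast

lemma smooth_on_add: "open S \<Longrightarrow> smooth_on S f \<Longrightarrow> smooth_on S g \<Longrightarrow> smooth_on S (\<lambda>x. f x + g x)"
  unfolding smooth_on_def using C_k_on_add by blast

lemma smooth_on_mult: "open S \<Longrightarrow> smooth_on S f \<Longrightarrow> smooth_on S g \<Longrightarrow> smooth_on S (\<lambda>x. f x * g x)"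
  unfolding smooth_on_def using C_k_on_mult by blast

lemma smooth_on_const: "smooth_on S (\<lambda>_. c)"
  unfolding smooth_on_def using C_k_on_const by blast

lemma smooth_on_compose:
  assumes "open S" "open T" "\<And>i. smooth_on T (g i)" "\<And>x. x \<in> T \<Longrightarrow> (\<chi> i. g i x) \<in> S" "smooth_on S F"
  shows "smooth_on T (\<lambda>x. F (\<chi> i. g i x))"
  unfolding smooth_on_def using assms by (auto intro!: C_k_on_compose[of S T] simp: smooth_on_def)

lemma smooth_on_continuous: "smooth_on S f \<Longrightarrow> continuous_on S f"
  unfolding smooth_on_def by (metis C_k_on.simps(1))

section \<open>Hadamard's lemma and mixed derivatives of smooth functions\<close>

lemma segment_in_convex:
  assumes "convex S" "a \<in> S" "x \<in> S" "t \<in> {0..1::real}" shows "a + t *\<^sub>R (x - a) \<in> S"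
proof -
  have "(1 - t) *\<^sub>R a + t *\<^sub>R x \<in> S" by (rule convexD[OF assms(1)]) (use assms in auto)
  thus ?thesis by (simp add: algebra_simps)
qed

text \<open>The exponent \<open>m\<close> is there for the induction: each differentiation under the
  integral sign turns t^m F into t^(m+1) times a partial derivative of F.\<close>

lemma C_k_on_radial_integral:
  fixes a :: "'k::real_or_complex ^ 'n::finite"
  assumes S: "open S" "convex S" "a \<in> S"
  shows "C_k_on k S F \<Longrightarrow> C_k_on k S (\<lambda>x. integral (cbox 0 1) (\<lambda>t::real. of_real (t ^ m) * F (a + t *\<^sub>R (x - a))))"
proof (induction k arbitrary: F m)
  case 0
  have "continuous_on (S \<times> cbox 0 1) (\<lambda>(x, t). of_real (t ^ m) * F (a + t *\<^sub>R (x - a)))"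
    unfolding split_beta
    by (intro continuous_intros continuous_on_compose2[OF 0[unfolded C_k_on.simps(1)]])
      (auto intro!: segment_in_convex[OF S(2,3)])
  thus ?case by (simp only: C_k_on.simps(1)) (rule integral_continuous_on_param)
next
  case (Suc k)
  note kd = Suc.prems[unfolded C_k_on_Suc_iff[OF S(1)]]
  have cF: "continuous_on S F"
    using kd by (auto intro!: continuous_at_imp_continuous_on kdiff_isCont)
  have cpF: "continuous_on S (partial_deriv i F)" for i
    using C_k_on_continuous[OF S(1)] kd by blast
  define G where "G i x = integral (cbox 0 1) (\<lambda>t::real. of_real (t ^ Suc m) * partial_deriv i F (a + t *\<^sub>R (x - a)))" for i x
  have GC: "C_k_on k S (G i)" for i unfolding G_def by (rule Suc.IH) (use kd in blast)
  define f where "f x t = of_real (t ^ m) * F (a + t *\<^sub>R (x - a))" for x and t :: real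
  define pr :: "'n \<Rightarrow> ('k ^ 'n) \<Rightarrow>\<^sub>L 'k" where "pr i = Blinfun (\<lambda>h. h $ i)" for i
  have pr: "blinfun_apply (pr i) h = h $ i" for i h
    unfolding pr_def by (simp add: bounded_linear_Blinfun_apply bounded_linear_vec_nth)
  \<comment> \<open>The Leibniz rule takes the derivative of the integrand as a continuous family of
    bounded linear maps; \<open>fx\<close> packs the partial derivatives into such a family.\<close>
  define fx where "fx x t = (\<Sum>i\<in>UNIV. blinfun_mult_right (of_real (t ^ Suc m) * partial_deriv i F (a + t *\<^sub>R (x - a))) o\<^sub>L pr i)"
    for x and t :: real
  have fx: "blinfun_apply (fx x t) h = (\<Sum>i\<in>UNIV. of_real (t ^ Suc m) * partial_deriv i F (a + t *\<^sub>R (x - a)) * h $ i)"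
    for x t h unfolding fx_def by (simp add: blinfun.sum_left pr)
  have cont: "continuous_on (S \<times> cbox 0 1) (\<lambda>(x, t). of_real (t ^ Suc m) * partial_deriv i F (a + t *\<^sub>R (x - a)))" for i
    unfolding split_beta
    by (intro continuous_intros continuous_on_compose2[OF cpF])
      (auto intro!: segment_in_convex[OF S(2,3)])
  have D: "((\<lambda>x. integral (cbox 0 1) (f x)) has_derivative (\<lambda>h. \<Sum>i\<in>UNIV. G i x * h $ i)) (at x)"
    if x: "x \<in> S" for x
  proof -
    have 1: "((\<lambda>x. f x t) has_derivative blinfun_apply (fx y t)) (at y within S)"
      if y: "y \<in> S" and t: "t \<in> cbox 0 1" for y t
    proof -
      have "a + t *\<^sub>R (y - a) \<in> S" by (rule segment_in_convex[OF S(2,3) y]) (use t in simp)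
      hence dF: "(F has_derivative (\<lambda>h. \<Sum>i\<in>UNIV. partial_deriv i F (a + t *\<^sub>R (y - a)) * h $ i)) (at (a + t *\<^sub>R (y - a)))"
        using kd by (simp add: kdiff_def)
      have "((\<lambda>x. a + t *\<^sub>R (x - a)) has_derivative (\<lambda>h. t *\<^sub>R h)) (at y within S)"
        by (auto intro!: derivative_eq_intros)
      from has_derivative_mult_right[OF has_derivative_compose[OF this dF], of "of_real (t ^ m)"]
      have "((\<lambda>x. f x t) has_derivative (\<lambda>h. of_real (t ^ m) *
          (\<Sum>i\<in>UNIV. partial_deriv i F (a + t *\<^sub>R (y - a)) * (t *\<^sub>R h) $ i))) (at y within S)"
        unfolding f_def .
      moreover have "(t *\<^sub>R h) $ i = of_real t * h $ i" for h :: "'k ^ 'n" and i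
        by (subst vector_scaleR_component) (rule scaleR_conv_of_real)
      hence "(\<lambda>h. of_real (t ^ m) * (\<Sum>i\<in>UNIV. partial_deriv i F (a + t *\<^sub>R (y - a)) * (t *\<^sub>R h) $ i)) =
          blinfun_apply (fx y t)"
        by (simp only: fun_eq_iff fx sum_distrib_left power_Suc of_real_mult) (simp only: mult_ac simp_thms)
      ultimately show ?thesis by simp
    qed
    have 2: "f y integrable_on cbox 0 1" if "y \<in> S" for y
      unfolding f_def
      by (intro integrable_continuous continuous_intros continuous_on_compose2[OF cF])
        (use that in \<open>auto intro!: segment_in_convex[OF S(2,3)]\<close>)
    have 3: "continuous_on (S \<times> cbox 0 1) (\<lambda>(x, t). fx x t)"
    proof -
      have "continuous_on (S \<times> cbox 0 1) (\<lambda>p. \<Sum>i\<in>UNIV. blinfun_mult_right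
          (case p of (x, t) \<Rightarrow> of_real (t ^ Suc m) * partial_deriv i F (a + t *\<^sub>R (x - a))) o\<^sub>L pr i)"
        by (intro continuous_on_sum bounded_bilinear.continuous_on[OF bounded_bilinear_blinfun_compose]
            bounded_linear.continuous_on[OF bounded_linear_blinfun_mult_right] cont continuous_on_const)
      thus ?thesis by (simp add: fx_def split_beta)
    qed
    have i: "(\<lambda>t. fx x t) integrable_on cbox 0 1"
    proof (rule integrable_continuous)
      have "continuous_on (cbox 0 1) (\<lambda>t. case (x, t) of (x, t) \<Rightarrow> fx x t)"
        by (rule continuous_on_compose2[OF 3]) (use x in \<open>auto intro!: continuous_intros\<close>)
      thus "continuous_on (cbox 0 1) (fx x)" by simp
    qed
    have ii: "(\<lambda>t. of_real (t ^ Suc m) * partial_deriv i F (a + t *\<^sub>R (x - a))) integrable_on cbox 0 1" for i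
    proof (rule integrable_continuous)
      have "continuous_on (cbox 0 1) (\<lambda>t. case (x, t) of (x, t) \<Rightarrow> of_real (t ^ Suc m) * partial_deriv i F (a + t *\<^sub>R (x - a)))"
        by (rule continuous_on_compose2[OF cont]) (use x in \<open>auto intro!: continuous_intros\<close>)
      thus "continuous_on (cbox 0 1) (\<lambda>t. of_real (t ^ Suc m) * partial_deriv i F (a + t *\<^sub>R (x - a)))" by simp
    qed
    have LR: "((\<lambda>x. integral (cbox 0 1) (f x)) has_derivative blinfun_apply (integral (cbox 0 1) (fx x))) (at x within S)"
      by (rule leibniz_rule[OF 1 2 3 x S(2)])
    have "blinfun_apply (integral (cbox 0 1) (fx x)) h = (\<Sum>i\<in>UNIV. G i x * h $ i)" for h
    proof -
      have "blinfun_apply (integral (cbox 0 1) (fx x)) h = integral (cbox 0 1) (\<lambda>t. blinfun_apply (fx x t) h)"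
        by (rule blinfun_apply_integral[OF i])
      also have "\<dots> = (\<Sum>i\<in>UNIV. integral (cbox 0 1) (\<lambda>t. of_real (t ^ Suc m) * partial_deriv i F (a + t *\<^sub>R (x - a)) * h $ i))"
        unfolding fx by (rule integral_sum) (use ii integrable_on_mult_left in auto)
      also have "\<dots> = (\<Sum>i\<in>UNIV. G i x * h $ i)"
        unfolding G_def by (intro sum.cong refl integral_mult_left)
      finally show ?thesis .
    qed
    hence "blinfun_apply (integral (cbox 0 1) (fx x)) = (\<lambda>h. \<Sum>i\<in>UNIV. G i x * h $ i)" by (rule ext)
    with LR show ?thesis using at_within_open[OF x S(1)] by simp
  qed
  show ?case unfolding C_k_on.simps(2) f_def[symmetric] using D GC by (intro exI[of _ G]) (simp add: f_def[abs_def])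
qed


text \<open>The fundamental theorem of calculus along the segment from \<open>a\<close> to
  \<open>x\<close>; \<open>g i\<close> is the mean of the i-th partial derivative over this
  segment.\<close>

lemma hadamard:
  fixes a :: "'k::real_or_complex ^ 'n::finite"
  assumes S: "open S" "convex S" "a \<in> S" and f: "smooth_on S f"
  obtains g where "\<And>i. smooth_on S (g i)"
    "\<And>x. x \<in> S \<Longrightarrow> f x = f a + (\<Sum>i\<in>UNIV. (x $ i - a $ i) * g i x)"
proof -
  define g where "g i x = integral (cbox 0 1) (\<lambda>t::real. of_real (t ^ 0) * partial_deriv i f (a + t *\<^sub>R (x - a)))" for i x
  have sp: "smooth_on S (partial_deriv i f)" for i by (rule smooth_on_partial_deriv[OF S(1) f])
  have "smooth_on S (g i)" for i
    unfolding smooth_on_def g_def using sp[of i] C_k_on_radial_integral[OF S] unfolding smooth_on_def by blast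
  moreover have "f x = f a + (\<Sum>i\<in>UNIV. (x $ i - a $ i) * g i x)" if x: "x \<in> S" for x
  proof -
    define D where "D i t = partial_deriv i f (a + t *\<^sub>R (x - a))" for i and t :: real
    have cD: "continuous_on (cbox 0 1) (D i)" for i
      unfolding D_def
      by (intro continuous_on_compose2[OF smooth_on_continuous[OF sp]] continuous_intros)
        (use x in \<open>auto intro!: segment_in_convex[OF S(2,3)]\<close>)
    have iD: "D i integrable_on cbox 0 1" for i by (rule integrable_continuous[OF cD])
    have vd: "((\<lambda>t. f (a + t *\<^sub>R (x - a))) has_vector_derivative (\<Sum>i\<in>UNIV. D i t * (x $ i - a $ i))) (at t within {0..1})"
      if t: "t \<in> {0..1}" for t :: real
    proof -
      have "a + t *\<^sub>R (x - a) \<in> S" by (rule segment_in_convex[OF S(2,3) x t])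
      hence dF: "(f has_derivative (\<lambda>h. \<Sum>i\<in>UNIV. D i t * h $ i)) (at (a + t *\<^sub>R (x - a)))"
        using smooth_on_kdiff[OF S(1) f] by (simp add: kdiff_def D_def)
      have "((\<lambda>t. a + t *\<^sub>R (x - a)) has_derivative (\<lambda>s. s *\<^sub>R (x - a))) (at t within {0..1})"
        by (auto intro!: derivative_eq_intros)
      from has_derivative_compose[OF this dF]
      have "((\<lambda>t. f (a + t *\<^sub>R (x - a))) has_derivative (\<lambda>s. \<Sum>i\<in>UNIV. D i t * (s *\<^sub>R (x - a)) $ i)) (at t within {0..1})" .
      moreover have "D i t * (s *\<^sub>R (x - a)) $ i = s *\<^sub>R (D i t * (x $ i - a $ i))" for s i
        by (subst vector_scaleR_component) simp
      ultimately show ?thesis by (simp add: has_vector_derivative_def scaleR_sum_right)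
    qed
    have "((\<lambda>t. \<Sum>i\<in>UNIV. D i t * (x $ i - a $ i)) has_integral f (a + 1 *\<^sub>R (x - a)) - f (a + 0 *\<^sub>R (x - a))) {0..1}"
      by (rule fundamental_theorem_of_calculus) (use vd in auto)
    hence "f x - f a = integral (cbox 0 1) (\<lambda>t. \<Sum>i\<in>UNIV. D i t * (x $ i - a $ i))"
      by (simp add: integral_unique)
    also have "\<dots> = (\<Sum>i\<in>UNIV. integral (cbox 0 1) (\<lambda>t. D i t * (x $ i - a $ i)))"
      by (rule integral_sum) (use iD integrable_on_mult_left in auto)
    also have "\<dots> = (\<Sum>i\<in>UNIV. (x $ i - a $ i) * g i x)"
      by (rule sum.cong[OF refl], subst integral_mult_left) (simp add: g_def D_def[abs_def])
    finally show ?thesis by (simp add: algebra_simps)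
  qed
  ultimately show ?thesis by (rule that)
qed

text \<open>
  In Hadamard's representation of \<open>f\<close> at \<open>x\<close> the second derivative at \<open>x\<close> is
  \<open>\<partial>\<^sub>i g\<^sub>j + \<partial>\<^sub>j g\<^sub>i\<close>.
\<close>

lemma smooth_on_partial_deriv_commute:
  fixes a :: "'k::real_or_complex ^ 'n::finite"
  assumes S: "open S" "a \<in> S" and f: "smooth_on S f"
  shows "partial_deriv i (partial_deriv j f) a = partial_deriv j (partial_deriv i f) a"
proof -
  obtain r where r: "r > 0" "ball a r \<subseteq> S" using S open_contains_ball by blast
  have fr: "smooth_on (ball a r) f" by (rule smooth_on_subset[OF f r(2)])
  obtain g where g: "\<And>i. smooth_on (ball a r) (g i)"
    "\<And>x. x \<in> ball a r \<Longrightarrow> f x = f a + (\<Sum>i\<in>UNIV. (x $ i - a $ i) * g i x)"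
    using hadamard[OF open_ball convex_ball _ fr, of a] r(1) by auto
  have kg: "kdiff (g l) x" "kdiff (partial_deriv k (g l)) x" if "x \<in> ball a r" for l k x
    using that by (auto intro!: smooth_on_kdiff[OF open_ball] smooth_on_partial_deriv g(1))
  have "partial_deriv k (partial_deriv l f) a = partial_deriv k (g l) a + partial_deriv l (g k) a" for k l
  proof -
    have "partial_deriv l f x = g l x + (\<Sum>i\<in>UNIV. (x $ i - a $ i) * partial_deriv l (g i) x)" if x: "x \<in> ball a r" for x
    proof -
      have "partial_deriv l f x = partial_deriv l (\<lambda>x. f a + (\<Sum>i\<in>UNIV. (x $ i - a $ i) * g i x)) x"
        by (rule eventually_eq_imp_partial_deriv_eq)
          (use eventually_nhds_in_open[OF open_ball x] g(2) in \<open>auto elim!: eventually_mono\<close>)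
      also have "\<dots> = (\<Sum>i\<in>UNIV. (if l = i then 1 else 0) * g i x + (x $ i - a $ i) * partial_deriv l (g i) x)"
        using kg(1)[OF x] by (simp add: partial_deriv_add partial_deriv_sum partial_deriv_mult partial_deriv_diff
          kdiff_sum kdiff_mult kdiff_diff kdiff_coord kdiff_const partial_deriv_const partial_deriv_coord eq_commute)
      finally show ?thesis by (simp add: sum.distrib if_distrib[of "\<lambda>c. c * _"] cong: if_cong)
    qed
    hence "partial_deriv k (partial_deriv l f) a =
        partial_deriv k (\<lambda>x. g l x + (\<Sum>i\<in>UNIV. (x $ i - a $ i) * partial_deriv l (g i) x)) a"
      by (intro eventually_eq_imp_partial_deriv_eq)
        (use eventually_nhds_in_open[OF open_ball, of a a r] r(1) in \<open>auto elim!: eventually_mono\<close>)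
    also have "\<dots> = partial_deriv k (g l) a + (\<Sum>i\<in>UNIV. (if k = i then 1 else 0) * partial_deriv l (g i) a)"
      using kg[of a] r(1) by (simp add: partial_deriv_add partial_deriv_sum partial_deriv_mult partial_deriv_diff
          kdiff_sum kdiff_mult kdiff_diff kdiff_coord kdiff_const partial_deriv_const partial_deriv_coord eq_commute)
    finally show ?thesis by (simp add: if_distrib[of "\<lambda>c. c * _"] cong: if_cong)
  qed
  thus ?thesis by simp
qed

section \<open>Smooth Casimir chains are analytic\<close>

text \<open>In dimension 2n + 1 the covectors that annihilate the n independent vectors
  \<open>u j\<close> form a space of dimension n + 1, and the independent \<open>w i\<close> already
  span it. The coefficients are found by pairing with the \<open>p j\<close>.\<close>

lemma jacobian_kernel:
  fixes w :: "nat \<Rightarrow> 'n::finite \<Rightarrow> 'k::real_or_complex"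
  assumes card: "CARD('n) = 2 * n + 1"
    and p: "\<And>i j. i \<le> n \<Longrightarrow> j \<le> n \<Longrightarrow> (\<Sum>b\<in>UNIV. w i b * p j b) = (if i = j then 1 else 0)"
    and u: "\<And>v. (\<And>b. (\<Sum>i<n. v i * u i b) = 0) \<Longrightarrow> \<forall>i<n. v i = 0"
    and wu: "\<And>i j. i \<le> n \<Longrightarrow> j < n \<Longrightarrow> (\<Sum>b\<in>UNIV. w i b * u j b) = 0"
    and z: "\<And>j. j < n \<Longrightarrow> (\<Sum>b\<in>UNIV. z b * u j b) = 0"
  obtains c where "\<And>b. z b = (\<Sum>i\<le>n. c i * w i b)"
proof -
  obtain e :: "nat \<Rightarrow> 'n" where e: "bij_betw e {..<2*n+1} UNIV"
    using ex_bij_betw_nat_finite[of "UNIV :: 'n set"] card by (auto simp: atLeast0LessThan)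
  obtain A S where A1: "\<And>i b. i \<le> n \<Longrightarrow> A b (e i) = p i b" and A2: "\<And>i b. i < n \<Longrightarrow> A b (e (n + 1 + i)) = u i b"
    and S: "\<And>i j. (\<Sum>l\<in>UNIV. S i l * A l j) = (if i = j then 1 else 0)"
    and S': "\<And>i j. (\<Sum>l\<in>UNIV. A i l * S l j) = (if i = j then 1 else 0)"
    by (rule frame_matrix[of e n w p u, OF e]) (assumption | rule p u wu that)+
  define c where "c j = (\<Sum>b\<in>UNIV. z b * p j b)" for j
  define y where "y b = z b - (\<Sum>i\<le>n. c i * w i b)" for b
  have yA: "(\<Sum>b\<in>UNIV. y b * A b l) = 0" for l
  proof -
    have *: "(\<Sum>b\<in>UNIV. y b * q b) = (\<Sum>b\<in>UNIV. z b * q b) - (\<Sum>i\<le>n. c i * (\<Sum>b\<in>UNIV. w i b * q b))" for q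
      unfolding y_def left_diff_distrib sum_subtractf sum_distrib_left sum_distrib_right
      by (subst (2) sum.swap) (simp add: mult.assoc)
    obtain i where i: "i < 2 * n + 1" "l = e i" using e by (auto simp: bij_betw_def image_iff)
    show ?thesis
    proof (cases "i \<le> n")
      case True
      have "(\<Sum>b\<in>UNIV. y b * p i b) = c i - (\<Sum>j\<le>n. c j * (\<Sum>b\<in>UNIV. w j b * p i b))"
        unfolding * by (simp add: c_def)
      also have "\<dots> = 0" using True by (simp add: p if_distrib[of "\<lambda>c. _ * c"] cong: if_cong)
      finally show ?thesis using A1[OF True] i by simp
    next
      case False
      then obtain j where j: "i = n + 1 + j" "j < n" using i by (intro that[of "i - (n + 1)"]) auto
      have "(\<Sum>b\<in>UNIV. y b * u j b) = 0" unfolding * using j by (simp add: z wu)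
      thus ?thesis unfolding i(2) j(1) by (simp only: A2[OF j(2)])
    qed
  qed
  have "y k = 0" for k
  proof -
    have "y k = (\<Sum>b\<in>UNIV. y b * (\<Sum>l\<in>UNIV. A b l * S l k))"
      by (simp add: S' if_distrib[of "\<lambda>c. _ * c"] cong: if_cong)
    also have "\<dots> = (\<Sum>l\<in>UNIV. (\<Sum>b\<in>UNIV. y b * A b l) * S l k)"
      unfolding sum_distrib_left sum_distrib_right by (subst sum.swap) (simp add: mult.assoc)
    finally show ?thesis by (simp add: yA)
  qed
  thus ?thesis by (intro that[of c]) (simp add: y_def)
qed

text \<open>First, the kernel of Q is spanned by w_0: by skewness a null covector z annihilates all
  Q w_{j+1} = - P w_j, so it is a combination of the w_i, and the independence of the P w_i leaves
  only w_0. Next, v_i minus a suitable convolution of earlier constants with the chain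
  \<open>w\<close> lies in this kernel, so v_i = \<Sum>s\<le>i. c_s w_{i-s} by induction. Finally P
  v_n = 0 forces c_s = 0 for s > 0, again by independence.\<close>

lemma lenard_chain_unique:
  fixes w v :: "nat \<Rightarrow> 'n::finite \<Rightarrow> 'k::real_or_complex" and P Q :: "'n \<Rightarrow> 'n \<Rightarrow> 'k"
  assumes card: "CARD('n) = 2 * n + 1"
    and skew: "\<And>b c. P b c = - P c b" "\<And>b c. Q b c = - Q c b"
    and w0: "\<And>b. (\<Sum>c\<in>UNIV. Q c b * w 0 c) = 0" and wn: "\<And>b. (\<Sum>c\<in>UNIV. P c b * w n c) = 0"
    and ws: "\<And>i b. i < n \<Longrightarrow> (\<Sum>c\<in>UNIV. Q c b * w (Suc i) c) = - (\<Sum>c\<in>UNIV. P c b * w i c)"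
    and v0: "\<And>b. (\<Sum>c\<in>UNIV. Q c b * v 0 c) = 0" and vn: "\<And>b. (\<Sum>c\<in>UNIV. P c b * v n c) = 0"
    and vs: "\<And>i b. i < n \<Longrightarrow> (\<Sum>c\<in>UNIV. Q c b * v (Suc i) c) = - (\<Sum>c\<in>UNIV. P c b * v i c)"
    and p: "\<And>i j. i \<le> n \<Longrightarrow> j \<le> n \<Longrightarrow> (\<Sum>b\<in>UNIV. w i b * p j b) = (if i = j then 1 else 0)"
    and u: "\<And>v. (\<And>b. (\<Sum>i<n. v i * (\<Sum>c\<in>UNIV. P c b * w i c)) = 0) \<Longrightarrow> \<forall>i<n. v i = 0"
  obtains c where "\<And>i b. i \<le> n \<Longrightarrow> v i b = c * w i b"
proof -
  define U where "U i b = (\<Sum>c\<in>UNIV. P c b * w i c)" for i b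
  define V where "V i b = (\<Sum>c\<in>UNIV. Q c b * w i c)" for i b
  have sk: "(\<Sum>b\<in>UNIV. x b * (\<Sum>c\<in>UNIV. X c b * y c)) = - (\<Sum>b\<in>UNIV. y b * (\<Sum>c\<in>UNIV. X c b * x c))"
    if X: "\<And>b c. X b c = - X c b" for X :: "'n \<Rightarrow> 'n \<Rightarrow> 'k" and x y
  proof -
    have "(\<Sum>b\<in>UNIV. x b * (\<Sum>c\<in>UNIV. X c b * y c)) = (\<Sum>c\<in>UNIV. \<Sum>b\<in>UNIV. y c * (X c b * x b))"
      unfolding sum_distrib_left by (subst sum.swap) (simp add: mult_ac)
    also have "\<dots> = (\<Sum>c\<in>UNIV. \<Sum>b\<in>UNIV. - (y c * (X b c * x b)))"
    proof (intro sum.cong refl)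
      fix c b
      have "X c b = - X b c" by (rule X)
      thus "y c * (X c b * x b) = - (y c * (X b c * x b))" by simp
    qed
    finally show ?thesis by (simp add: sum_negf sum_distrib_left)
  qed
  have PV: "U i b = - V (Suc i) b" if "i < n" for i b using ws[OF that] by (simp add: U_def V_def)
  have wu: "(\<Sum>b\<in>UNIV. w i b * U j b) = 0" if "i \<le> n" "j < n" for i j
  proof -
    let ?P = "\<lambda>i j. \<Sum>b\<in>UNIV. w j b * U i b" and ?Q = "\<lambda>i j. \<Sum>b\<in>UNIV. w j b * V i b"
    have "?P j i = 0"
    proof (rule lenard_involution[of n ?P ?Q])
      show "?P i j = - ?P j i" for i j unfolding U_def by (rule sk[OF skew(1)])
      show "?Q i j = - ?Q j i" for i j unfolding V_def by (rule sk[OF skew(2)])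
    qed (use that w0 wn PV in \<open>simp_all add: U_def V_def sum_negf\<close>)
    thus ?thesis .
  qed
  have uU: "\<forall>i<n. v i = 0" if "\<And>b. (\<Sum>i<n. v i * U i b) = 0" for v
    by (rule u) (use that in \<open>simp add: U_def\<close>)
  have ker: "\<exists>c. \<forall>b. z b = c * w 0 b" if z: "\<And>b. (\<Sum>c\<in>UNIV. Q c b * z c) = 0" for z
  proof -
    have zU: "(\<Sum>b\<in>UNIV. z b * U j b) = 0" if "j < n" for j
    proof -
      have "(\<Sum>b\<in>UNIV. z b * V (Suc j) b) = 0" unfolding V_def sk[OF skew(2), of z] by (simp add: z)
      thus ?thesis using PV[OF that] by (simp add: sum_negf)
    qed
    have "\<exists>c. \<forall>b. z b = (\<Sum>i\<le>n. c i * w i b)"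
      by (rule jacobian_kernel[of n w p U z, OF card]) (fact p uU wu zU | blast)+
    then obtain c where c: "\<And>b. z b = (\<Sum>i\<le>n. c i * w i b)" by blast
    have "(\<Sum>i<n. c (Suc i) * U i b) = 0" for b
    proof -
      have "0 = (\<Sum>i\<le>n. c i * V i b)"
        using z[of b] unfolding c V_def sum_distrib_left by (subst (asm) sum.swap) (simp add: mult_ac)
      also have "{..n} = insert 0 (Suc ` {..<n})"
        by (metis lessThan_Suc_atMost lessThan_Suc_eq_insert_0)
      also have "(\<Sum>i\<in>insert 0 (Suc ` {..<n}). c i * V i b) = (\<Sum>i<n. c (Suc i) * V (Suc i) b)"
        using w0[of b] by (simp add: sum.reindex V_def)
      also have "\<dots> = - (\<Sum>i<n. c (Suc i) * U i b)" by (simp add: PV sum_negf)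
      finally show ?thesis by simp
    qed
    hence c0: "\<forall>i<n. c (Suc i) = 0" using u[of "\<lambda>i. c (Suc i)"] by (simp add: U_def)
    have "z b = c 0 * w 0 b" for b
      unfolding c by (rule sum.mono_neutral_right[of _ "{0}", simplified]) (use c0 in \<open>auto simp: gr0_conv_Suc\<close>)
    thus ?thesis by blast
  qed
  have "\<exists>c. \<forall>i\<le>m. \<forall>b. v i b = (\<Sum>s\<le>i. c s * w (i - s) b)" if "m \<le> n" for m
    using that
  proof (induction m)
    case 0
    obtain c where c: "\<forall>b. v 0 b = c * w 0 b" using ker[of "v 0"] v0 by blast
    show ?case by (rule exI[of _ "\<lambda>_. c"]) (use c in simp)
  next
    case (Suc m)
    then obtain c where c: "\<And>i b. i \<le> m \<Longrightarrow> v i b = (\<Sum>s\<le>i. c s * w (i - s) b)" by auto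
    define z where "z b = v (Suc m) b - (\<Sum>s\<le>m. c s * w (Suc m - s) b)" for b
    have "(\<Sum>k\<in>UNIV. Q k b * z k) = 0" for b
    proof -
      have "(\<Sum>k\<in>UNIV. Q k b * z k) = (\<Sum>k\<in>UNIV. Q k b * v (Suc m) k) - (\<Sum>s\<le>m. c s * V (Suc m - s) b)"
        unfolding z_def V_def right_diff_distrib sum_subtractf sum_distrib_left
        by (subst (2) sum.swap) (simp add: mult_ac)
      also have "(\<Sum>k\<in>UNIV. Q k b * v (Suc m) k) = - (\<Sum>k\<in>UNIV. P k b * v m k)" using vs Suc.prems by simp
      also have "(\<Sum>k\<in>UNIV. P k b * v m k) = (\<Sum>s\<le>m. c s * U (m - s) b)"
        unfolding c[OF order.refl] U_def sum_distrib_left by (subst sum.swap) (simp add: mult_ac)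
      also have "(\<Sum>s\<le>m. c s * V (Suc m - s) b) = - (\<Sum>s\<le>m. c s * U (m - s) b)"
        using Suc.prems by (simp add: PV Suc_diff_le sum_negf[symmetric])
      finally show ?thesis by simp
    qed
    then obtain k where k: "\<And>b. z b = k * w 0 b" using ker[of z] by blast
    have "v i b = (\<Sum>s\<le>i. (c(Suc m := k)) s * w (i - s) b)" if "i \<le> Suc m" for i b
    proof (cases "i \<le> m")
      case True thus ?thesis by (simp add: c)
    next
      case False
      hence i: "i = Suc m" using that by simp
      show ?thesis using k[of b] unfolding i z_def by (simp add: algebra_simps)
    qed
    thus ?case by blast
  qed
  from this[OF order.refl] obtain c where "\<forall>i\<le>n. \<forall>b. v i b = (\<Sum>s\<le>i. c s * w (i - s) b)" ..
  hence c: "v i b = (\<Sum>s\<le>i. c s * w (i - s) b)" if "i \<le> n" for i b using that by simp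
  have "(\<Sum>i<n. c (n - i) * (\<Sum>k\<in>UNIV. P k b * w i k)) = 0" for b
  proof -
    have "0 = (\<Sum>s\<le>n. c s * U (n - s) b)"
      using vn[of b] unfolding c[OF order.refl] U_def sum_distrib_left by (subst (asm) sum.swap) (simp add: mult_ac)
    also have "\<dots> = (\<Sum>i\<le>n. c (n - i) * U i b)"
      by (rule sum.reindex_bij_witness[of _ "\<lambda>i. n - i" "\<lambda>i. n - i"]) auto
    also have "\<dots> = (\<Sum>i<n. c (n - i) * U i b)"
      using wn[of b] by (simp add: lessThan_Suc_atMost[symmetric] U_def)
    finally show ?thesis by (simp add: U_def)
  qed
  hence cz: "\<forall>i<n. c (n - i) = 0" using u[of "\<lambda>i. c (n - i)"] by simp
  have c0: "c s = 0" if "0 < s" "s \<le> n" for s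
    using cz[rule_format, of "n - s"] that by simp
  have "v i b = c 0 * w i b" if "i \<le> n" for i b
    unfolding c[OF that]
    by (subst sum.mono_neutral_right[of _ "{0}"]) (use c0 that in auto)
  thus ?thesis by (rule that)
qed

lemma eventually_nhds_openI: "open S \<Longrightarrow> a \<in> S \<Longrightarrow> (\<And>x. x \<in> S \<Longrightarrow> P x) \<Longrightarrow> \<forall>\<^sub>F x in nhds a. P x"
  by (auto simp: eventually_nhds)

lemma eventually_const_germ:
  fixes f :: "'k::real_or_complex ^ 'n::finite \<Rightarrow> 'k"
  assumes "\<forall>\<^sub>F x in nhds a. kdiff f x \<and> (\<forall>i. partial_deriv i f x = 0)"
  obtains c where "\<forall>\<^sub>F x in nhds a. f x = c"
proof -
  obtain r where r: "r > 0" "\<And>x. x \<in> ball a r \<Longrightarrow> kdiff f x \<and> (\<forall>i. partial_deriv i f x = 0)"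
    using assms unfolding eventually_nhds_metric by (auto simp: dist_commute)
  have "(f has_derivative (\<lambda>h. 0)) (at x within ball a r)" if "x \<in> ball a r" for x
    using has_derivative_at_withinI[of f "\<lambda>h. \<Sum>i\<in>UNIV. partial_deriv i f x * h $ i"] r(2)[OF that]
    by (auto simp: kdiff_def)
  from has_derivative_zero_constant[OF convex_ball this]
  obtain c where "\<And>x. x \<in> ball a r \<Longrightarrow> f x = c" by auto
  thus ?thesis by (intro that eventually_nhds_openI[of "ball a r"]) (use r(1) in auto)
qed

text \<open>Mixed derivatives of a smooth function commute, so the partial derivatives have an
  analytic primitive, and it differs from \<open>f\<close> by a constant.\<close>

lemma analytic_germ_of_partial_derivs:
  fixes f :: "'k::real_or_complex ^ 'n::finite \<Rightarrow> 'k"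
  assumes S: "open S" "a \<in> S" and f: "smooth_on S f" and an: "\<And>i. analytic_germ a (partial_deriv i f)"
  shows "analytic_germ a f"
proof -
  obtain y where y: "analytic_germ a y" "\<And>m. \<forall>\<^sub>F x in nhds a. partial_deriv m y x = partial_deriv m f x"
  proof (rule analytic_potential[of UNIV a "\<lambda>i. partial_deriv i f"])
    show "\<forall>\<^sub>F x in nhds a. partial_deriv p (partial_deriv m f) x = partial_deriv m (partial_deriv p f) x" for p m
      by (rule eventually_nhds_openI[OF S smooth_on_partial_deriv_commute[OF S(1) _ f]])
  qed (use an in auto)
  have "\<forall>\<^sub>F x in nhds a. x \<in> S" by (rule eventually_nhds_in_open[OF S])
  moreover have "\<forall>\<^sub>F x in nhds a. analytic_germ x y" by (rule eventually_analytic_germ[OF y(1)])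
  moreover have "\<forall>\<^sub>F x in nhds a. \<forall>m. partial_deriv m y x = partial_deriv m f x"
    by (intro eventually_all_finite y(2))
  ultimately have "\<forall>\<^sub>F x in nhds a. kdiff (\<lambda>x. f x - y x) x \<and> (\<forall>i. partial_deriv i (\<lambda>x. f x - y x) x = 0)"
  proof eventually_elim
    case (elim x)
    have "kdiff f x" by (rule smooth_on_kdiff[OF S(1) f elim(1)])
    moreover have "kdiff y x" by (rule analytic_germ_kdiff[OF elim(2)])
    ultimately show ?case using elim(3) by (simp add: kdiff_diff partial_deriv_diff)
  qed
  then obtain c where c: "\<forall>\<^sub>F x in nhds a. f x - y x = c" by (rule eventually_const_germ)
  have 1: "analytic_germ a (\<lambda>x. y x + c)" by (intro agerm y)
  have 2: "\<forall>\<^sub>F x in nhds a. y x + c = f x"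
    using c by eventually_elim (simp add: algebra_simps)
  show ?thesis by (rule analytic_germ_cong[OF 1 2])
qed

lemma br_coord_right: "br \<pi> f (\<lambda>x. x $ b) x = (\<Sum>c\<in>UNIV. \<pi> c b x * partial_deriv c f x)"
  by (simp add: br_alt partial_deriv_coord if_distrib[of "\<lambda>c. _ * c"] cong: if_cong)

lemma eventually_kdiff_smooth: "open S \<Longrightarrow> a \<in> S \<Longrightarrow> smooth_on S f \<Longrightarrow> \<forall>\<^sub>F x in nhds a. kdiff f x"
  by (rule eventually_nhds_openI) (auto intro: smooth_on_kdiff)

text \<open>
  The differentials of the \<open>L i\<close> divided by one of the coefficients are analytic, since they solve
  the linear equations of a chain.  Closedness of the differentials then gives linear equations for
  the logarithmic differential of that coefficient.
\<close>

context bihamiltonian_germ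
begin

lemma casimir_chain_analytic:
  fixes L :: "nat \<Rightarrow> 'k ^ 'n \<Rightarrow> 'k" and n :: nat
  assumes card: "CARD('n) = 2 * n + 1" and n: "n \<ge> 1"
    and S: "open S" "a \<in> S" and L: "\<And>i. i \<le> n \<Longrightarrow> smooth_on S (L i)"
    and chain: "\<forall>\<^sub>F x in nhds a. \<forall>f. br \<pi>2 (L 0) f x = 0 \<and> br \<pi>1 (L n) f x = 0 \<and>
      (\<forall>i<n. br \<pi>2 (L (Suc i)) f x = - br \<pi>1 (L i) f x)"
    and p: "\<And>i j. i \<le> n \<Longrightarrow> j \<le> n \<Longrightarrow> (\<Sum>b\<in>UNIV. partial_deriv b (L i) a * p j b) = (if i = j then 1 else 0)"
    and u: "\<And>v. (\<And>b. (\<Sum>i<n. v i * br \<pi>1 (L i) (\<lambda>x. x $ b) a) = 0) \<Longrightarrow> \<forall>i<n. v i = 0"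
    and i: "i \<le> n"
  shows "analytic_germ a (L i)"
proof -
  define D where "D i b = partial_deriv b (L i)" for i b
  have sD: "smooth_on S (D i b)" if "i \<le> n" for i b
    unfolding D_def by (rule smooth_on_partial_deriv[OF S(1) L[OF that]])
  have kD: "\<forall>\<^sub>F x in nhds a. kdiff (D i b) x" if "i \<le> n" for i b
    by (rule eventually_kdiff_smooth[OF S sD[OF that]])
  \<comment> \<open>The common factor \<mu> will be a component of dL_0 that does not vanish at
    \<open>a\<close>; there is one because dL_0 pairs with \<open>p 0\<close> to 1.\<close>
  have "(\<Sum>b\<in>UNIV. D 0 b a * p 0 b) \<noteq> 0" using p[of 0 0] by (simp add: D_def)
  then obtain b0 where "D 0 b0 a * p 0 b0 \<noteq> 0" by (rule sum.not_neutral_contains_not_neutral)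
  hence b0: "D 0 b0 a \<noteq> 0" by auto
  define \<mu> where "\<mu> = D 0 b0"
  have \<mu>a: "\<mu> a \<noteq> 0" using b0 by (simp add: \<mu>_def)
  have s\<mu>: "smooth_on S \<mu>" unfolding \<mu>_def by (rule sD) simp
  have k\<mu>: "\<forall>\<^sub>F x in nhds a. kdiff \<mu> x" by (rule eventually_kdiff_smooth[OF S s\<mu>])
  have \<mu>0: "\<forall>\<^sub>F x in nhds a. \<mu> x \<noteq> 0"
    by (rule eventually_neq[where f = \<mu>]) (use kdiff_isCont[OF smooth_on_kdiff[OF S(1) s\<mu> S(2)]] \<mu>a in simp_all)
  define \<alpha> where "\<alpha> i b x = D i b x / \<mu> x" for i b x
  have D\<alpha>: "\<forall>\<^sub>F x in nhds a. \<forall>i b. D i b x = \<alpha> i b x * \<mu> x"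
    using \<mu>0 by eventually_elim (simp add: \<alpha>_def)
  have ch: "\<forall>\<^sub>F x in nhds a. \<forall>b. (\<Sum>c\<in>UNIV. \<pi>2 c b x * D 0 c x) = 0 \<and> (\<Sum>c\<in>UNIV. \<pi>1 c b x * D n c x) = 0 \<and>
      (\<forall>i<n. (\<Sum>c\<in>UNIV. \<pi>2 c b x * D (Suc i) c x) = - (\<Sum>c\<in>UNIV. \<pi>1 c b x * D i c x))"
    using chain
  proof eventually_elim
    case (elim x)
    show ?case
    proof
      fix b
      show "(\<Sum>c\<in>UNIV. \<pi>2 c b x * D 0 c x) = 0 \<and> (\<Sum>c\<in>UNIV. \<pi>1 c b x * D n c x) = 0 \<and>
          (\<forall>i<n. (\<Sum>c\<in>UNIV. \<pi>2 c b x * D (Suc i) c x) = - (\<Sum>c\<in>UNIV. \<pi>1 c b x * D i c x))"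
        using elim[rule_format, of "\<lambda>x. x $ b"] by (simp add: br_coord_right D_def)
    qed
  qed
  have ch\<alpha>: "\<forall>\<^sub>F x in nhds a. \<forall>b. (\<Sum>c\<in>UNIV. \<pi>2 c b x * \<alpha> 0 c x) = 0 \<and> (\<Sum>c\<in>UNIV. \<pi>1 c b x * \<alpha> n c x) = 0 \<and>
      (\<forall>i<n. (\<Sum>c\<in>UNIV. \<pi>1 c b x * \<alpha> i c x) + (\<Sum>c\<in>UNIV. \<pi>2 c b x * \<alpha> (Suc i) c x) = 0)"
    using ch by eventually_elim (simp add: \<alpha>_def sum_divide_distrib[symmetric] add_divide_distrib[symmetric])
  \<comment> \<open>Unknowns are indexed by (i, c), equations by (k, b). For k \<le> n + 1 the row
    says that the second bracket on the k-th covector plus the first bracket on the (k-1)-th one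
    vanishes, missing covectors counting as 0; this includes both ends of the chain. The row k = n +
    2 is the normalisation of the component b0 of the 0-th covector.\<close>
  define T where "T r j x = (case r of (k, b) \<Rightarrow> case j of (i, c) \<Rightarrow>
      (if i = k then \<pi>2 c b x else 0) + (if Suc i = k then \<pi>1 c b x else 0) +
      (if k = n + 2 \<and> i = 0 \<and> c = b0 then 1 else 0))" for r j :: "nat \<times> 'n" and x
  define C where "C r x = (if fst r = n + 2 then 1 else 0 :: 'k)" for r :: "nat \<times> 'n" and x :: "'k ^ 'n"
  have TS: "(\<Sum>j\<in>{..n} \<times> UNIV. T (k, b) j x * v j) =
      (if k \<le> n then \<Sum>c\<in>UNIV. \<pi>2 c b x * v (k, c) else 0) +
      (if 0 < k \<and> k \<le> n + 1 then \<Sum>c\<in>UNIV. \<pi>1 c b x * v (k - 1, c) else 0) +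
      (if k = n + 2 then v (0, b0) else 0)" for k b x v
  proof -
    have "(\<Sum>j\<in>{..n} \<times> UNIV. T (k, b) j x * v j) = (\<Sum>i\<le>n. \<Sum>c\<in>UNIV. T (k, b) (i, c) x * v (i, c))"
      by (simp add: sum.cartesian_product split_beta)
    also have "\<dots> = (\<Sum>i\<le>n. if i = k then \<Sum>c\<in>UNIV. \<pi>2 c b x * v (i, c) else 0) +
        (\<Sum>i\<le>n. if Suc i = k then \<Sum>c\<in>UNIV. \<pi>1 c b x * v (i, c) else 0) +
        (\<Sum>i\<le>n. if i = 0 then (if k = n + 2 then v (0, b0) else 0) else 0)"
      unfolding sum.distrib[symmetric]
      by (rule sum.cong[OF refl])
        (auto simp: T_def distrib_right sum.distrib if_distrib[of "\<lambda>c. c * _"] cong: if_cong)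
    also have "(\<Sum>i\<le>n. if Suc i = k then \<Sum>c\<in>UNIV. \<pi>1 c b x * v (i, c) else 0) =
        (if 0 < k \<and> k \<le> n + 1 then \<Sum>c\<in>UNIV. \<pi>1 c b x * v (k - 1, c) else 0)"
      by (cases k) auto
    finally show ?thesis by simp
  qed
  have agif: "analytic_germ a (\<lambda>x. if Q then f x else 0)" if "analytic_germ a f" for f :: "'k ^ 'n \<Rightarrow> 'k" and Q
    using that by (cases Q) (auto intro: agerm)
  have an\<alpha>: "analytic_germ a (\<alpha> i b)" if "i \<le> n" for i b
  proof -
    have "analytic_germ a ((\<lambda>(i, b). \<alpha> i b) (i, b))"
    proof (rule analytic_linear_system_unique[where R = "{..n + 2} \<times> UNIV" and J = "{..n} \<times> UNIV" and T = T and c = C])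
      show "analytic_germ a (T r j)" for r j
        unfolding T_def[abs_def] by (cases r; cases j; simp only: prod.case; intro agif agerm an1 an2)
      show "analytic_germ a (C r)" for r unfolding C_def[abs_def] by (intro agerm)
      show "\<forall>\<^sub>F x in nhds a. \<forall>r\<in>{..n + 2} \<times> UNIV. (\<Sum>j\<in>{..n} \<times> UNIV. T r j x * (case j of (i, b) \<Rightarrow> \<alpha> i b) x) = C r x"
        using ch\<alpha> \<mu>0
      proof (eventually_elim, intro ballI)
        fix x and r :: "nat \<times> 'n"
        assume c: "\<forall>b. (\<Sum>c\<in>UNIV. \<pi>2 c b x * \<alpha> 0 c x) = 0 \<and> (\<Sum>c\<in>UNIV. \<pi>1 c b x * \<alpha> n c x) = 0 \<and>
          (\<forall>i<n. (\<Sum>c\<in>UNIV. \<pi>1 c b x * \<alpha> i c x) + (\<Sum>c\<in>UNIV. \<pi>2 c b x * \<alpha> (Suc i) c x) = 0)"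
          and m: "\<mu> x \<noteq> 0" and "r \<in> {..n + 2} \<times> (UNIV :: 'n set)"
        then obtain k b where r: "r = (k, b)" "k \<le> n + 2" by auto
        have a1: "\<alpha> 0 b0 x = 1" using m by (simp add: \<alpha>_def \<mu>_def)
        consider "k = 0" | i where "k = Suc i" "i < n" | "k = n + 1" | "k = n + 2" using r(2)
          by (cases k) (auto simp: le_Suc_eq less_Suc_eq_le)
        thus "(\<Sum>j\<in>{..n} \<times> UNIV. T r j x * (case j of (i, b) \<Rightarrow> \<alpha> i b) x) = C r x"
          unfolding r(1) TS by cases (use c a1 in \<open>simp_all add: C_def add.commute\<close>)
      qed
      show "\<forall>j\<in>{..n} \<times> UNIV. v j = 0" if v: "\<And>r. r \<in> {..n + 2} \<times> UNIV \<Longrightarrow> (\<Sum>j\<in>{..n} \<times> UNIV. T r j a * v j) = 0" for v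
      proof -
        have 0: "(if k \<le> n then \<Sum>c\<in>UNIV. \<pi>2 c b a * v (k, c) else 0) +
          (if 0 < k \<and> k \<le> n + 1 then \<Sum>c\<in>UNIV. \<pi>1 c b a * v (k - 1, c) else 0) +
          (if k = n + 2 then v (0, b0) else 0) = 0" if "k \<le> n + 2" for k b
          using v[of "(k, b)"] that unfolding TS by simp
        \<comment> \<open>A homogeneous solution is itself a chain, hence a multiple of the given
          one; the normalisation row makes the multiple 0.\<close>
        have "\<exists>c. \<forall>i\<le>n. \<forall>b. v (i, b) = c * D i b a"
        proof (rule lenard_chain_unique[of n "\<lambda>b c. \<pi>1 b c a" "\<lambda>b c. \<pi>2 b c a" "\<lambda>i b. D i b a" "\<lambda>i b. v (i, b)" p, OF card])
          show "\<pi>1 b c a = - \<pi>1 c b a" for b c using eventually_nhds_x_imp_x[OF skew1] by blast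
          show "\<pi>2 b c a = - \<pi>2 c b a" for b c using eventually_nhds_x_imp_x[OF skew2] by blast
          show "(\<Sum>c\<in>UNIV. \<pi>2 c b a * D 0 c a) = 0" for b using eventually_nhds_x_imp_x[OF ch] by blast
          show "(\<Sum>c\<in>UNIV. \<pi>1 c b a * D n c a) = 0" for b using eventually_nhds_x_imp_x[OF ch] by blast
          show "(\<Sum>c\<in>UNIV. \<pi>2 c b a * D (Suc i) c a) = - (\<Sum>c\<in>UNIV. \<pi>1 c b a * D i c a)" if "i < n" for i b
            using eventually_nhds_x_imp_x[OF ch] that by blast
          show "(\<Sum>c\<in>UNIV. \<pi>2 c b a * v (0, c)) = 0" for b using 0[of 0 b] by simp
          show "(\<Sum>c\<in>UNIV. \<pi>1 c b a * v (n, c)) = 0" for b using 0[of "n + 1" b] by simp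
          show "(\<Sum>c\<in>UNIV. \<pi>2 c b a * v (Suc i, c)) = - (\<Sum>c\<in>UNIV. \<pi>1 c b a * v (i, c))" if "i < n" for i b
            using 0[of "Suc i" b] that by (simp add: eq_neg_iff_add_eq_0)
          show "(\<Sum>b\<in>UNIV. D i b a * p j b) = (if i = j then 1 else 0)" if "i \<le> n" "j \<le> n" for i j
            unfolding D_def by (rule p[OF that])
          show "\<forall>i<n. v i = 0" if "\<And>b. (\<Sum>i<n. v i * (\<Sum>c\<in>UNIV. \<pi>1 c b a * D i c a)) = 0" for v
            by (rule u) (use that in \<open>simp add: br_coord_right D_def\<close>)
        qed blast
        then obtain c where c: "\<forall>i\<le>n. \<forall>b. v (i, b) = c * D i b a" ..
        have "v (0, b0) = 0" using 0[of "n + 2" undefined] by simp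
        hence "c = 0" using c b0 by simp
        with c show ?thesis by auto
      qed
    qed (use that in auto)
    thus ?thesis by simp
  qed
  define \<beta> where "\<beta> b x = partial_deriv b \<mu> x / \<mu> x" for b x
  \<comment> \<open>The closedness of \<mu> \<alpha>_i, divided by \<mu>: linear equations for
    \<open>\<beta>\<close> whose coefficients and right-hand sides are analytic by now.\<close>
  have D\<alpha>2: "\<forall>\<^sub>F x in nhds a. \<alpha> i c x * \<beta> b x - \<alpha> i b x * \<beta> c x =
      partial_deriv c (\<alpha> i b) x - partial_deriv b (\<alpha> i c) x" if i: "i \<le> n" for i b c
  proof -
    have 1: "\<forall>\<^sub>F x in nhds a. partial_deriv c (D i b) x = partial_deriv c (\<alpha> i b) x * \<mu> x + \<alpha> i b x * partial_deriv c \<mu> x"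
      for b c
    proof -
      have "\<forall>\<^sub>F x in nhds a. D i b x = \<alpha> i b x * \<mu> x" using D\<alpha> by eventually_elim blast
      hence "\<forall>\<^sub>F x in nhds a. partial_deriv c (D i b) x = partial_deriv c (\<lambda>x. \<alpha> i b x * \<mu> x) x"
        by (rule eventually_partial_deriv_cong)
      with k\<mu> eventually_analytic_germ[OF an\<alpha>[OF i, of b]] show ?thesis
        by eventually_elim (simp add: partial_deriv_mult analytic_germ_kdiff)
    qed
    have 2: "\<forall>\<^sub>F x in nhds a. partial_deriv c (D i b) x = partial_deriv b (D i c) x"
      unfolding D_def by (rule eventually_nhds_openI[OF S smooth_on_partial_deriv_commute[OF S(1) _ L[OF i]]])
    show ?thesis using 1[of c b] 1[of b c] 2 \<mu>0
      by eventually_elim (simp add: \<beta>_def field_simps)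
  qed
  define T' where "T' r j x = (case r of (i, b, c) \<Rightarrow> (if j = b then \<alpha> i c x else 0) - (if j = c then \<alpha> i b x else 0))"
    for r :: "nat \<times> 'n \<times> 'n" and j and x
  have T'S: "(\<Sum>j\<in>UNIV. T' (i, b, c) j x * v j) = \<alpha> i c x * v b - \<alpha> i b x * v c" for i b c x v
    by (simp add: T'_def left_diff_distrib sum_subtractf if_distrib[of "\<lambda>c. c * _"] cong: if_cong)
  have an\<beta>: "analytic_germ a (\<beta> b)" for b
  proof (rule analytic_linear_system_unique[where R = "{..n} \<times> UNIV" and J = UNIV and T = T'
        and c = "\<lambda>(i, b, c) x. partial_deriv c (\<alpha> i b) x - partial_deriv b (\<alpha> i c) x"])
    show "analytic_germ a (T' r j)" if "r \<in> {..n} \<times> UNIV" for r j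
      using that unfolding T'_def[abs_def] by (cases r; simp only: prod.case; intro agif agerm an\<alpha>) auto
    show "analytic_germ a ((\<lambda>(i, b, c) x. partial_deriv c (\<alpha> i b) x - partial_deriv b (\<alpha> i c) x) r)"
      if "r \<in> {..n} \<times> UNIV" for r
      using that by (cases r) (auto intro!: agerm an\<alpha>)
    have "\<forall>\<^sub>F x in nhds a. \<forall>i<Suc n. \<forall>b c. \<alpha> i c x * \<beta> b x - \<alpha> i b x * \<beta> c x =
      partial_deriv c (\<alpha> i b) x - partial_deriv b (\<alpha> i c) x"
      by (intro eventually_all_less eventually_all_finite D\<alpha>2) simp
    thus "\<forall>\<^sub>F x in nhds a. \<forall>r\<in>{..n} \<times> UNIV. (\<Sum>j\<in>UNIV. T' r j x * \<beta> j x) =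
        (case r of (i, b, c) \<Rightarrow> \<lambda>x. partial_deriv c (\<alpha> i b) x - partial_deriv b (\<alpha> i c) x) x"
      by eventually_elim (auto simp: T'S less_Suc_eq_le)
    \<comment> \<open>A homogeneous solution is proportional to every dL_i at \<open>a\<close>.
      Since dL_0 and dL_1 are independent it is 0; here n \<ge> 1 enters.\<close>
    show "\<forall>j\<in>UNIV. v j = 0" if v: "\<And>r. r \<in> {..n} \<times> UNIV \<Longrightarrow> (\<Sum>j\<in>UNIV. T' r j a * v j) = 0" for v
    proof -
      have "\<alpha> i c a * v b = \<alpha> i b a * v c" if "i \<le> n" for i b c
        using v[of "(i, b, c)"] that by (simp add: T'S)
      hence w: "D i c a * v b = D i b a * v c" if "i \<le> n" for i b c
        using that \<mu>a by (simp add: \<alpha>_def)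
      define q where "q j = (\<Sum>c\<in>UNIV. v c * p j c)" for j
      have vq: "v b = D i b a * q i" if "i \<le> n" for i b
      proof -
        have "(\<Sum>c\<in>UNIV. D i c a * v b * p i c) = (\<Sum>c\<in>UNIV. D i b a * v c * p i c)" using w[OF that] by simp
        hence "v b * (\<Sum>c\<in>UNIV. D i c a * p i c) = D i b a * q i"
          by (simp add: q_def sum_distrib_left mult_ac)
        moreover have "(\<Sum>c\<in>UNIV. D i c a * p i c) = 1" using p[OF that that] by (simp add: D_def)
        ultimately show ?thesis by simp
      qed
      have "q 0 = (\<Sum>b\<in>UNIV. D 1 b a * p 0 b) * q 1"
        unfolding q_def[of 0] by (subst vq[OF n]) (simp add: sum_distrib_left sum_distrib_right mult_ac)
      also have "\<dots> = 0" using p[of 1 0] n by (simp add: D_def)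
      finally show ?thesis using vq[of 0] by simp
    qed
  qed auto
  have d\<mu>: "\<forall>\<^sub>F x in nhds a. \<forall>b. partial_deriv b \<mu> x = \<beta> b x * \<mu> x"
    using \<mu>0 by eventually_elim (simp add: \<beta>_def)
  have comm: "\<forall>\<^sub>F x in nhds a. partial_deriv c (\<beta> b) x = partial_deriv b (\<beta> c) x" for b c
  proof -
    have 1: "\<forall>\<^sub>F x in nhds a. partial_deriv c (partial_deriv b \<mu>) x = (partial_deriv c (\<beta> b) x + \<beta> b x * \<beta> c x) * \<mu> x"
      for b c
    proof -
      have "\<forall>\<^sub>F x in nhds a. partial_deriv b \<mu> x = \<beta> b x * \<mu> x" using d\<mu> by eventually_elim blast
      hence "\<forall>\<^sub>F x in nhds a. partial_deriv c (partial_deriv b \<mu>) x = partial_deriv c (\<lambda>x. \<beta> b x * \<mu> x) x"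
        by (rule eventually_partial_deriv_cong)
      with k\<mu> eventually_analytic_germ[OF an\<beta>[of b]] d\<mu> show ?thesis
        by eventually_elim (simp add: partial_deriv_mult analytic_germ_kdiff distrib_right)
    qed
    have 2: "\<forall>\<^sub>F x in nhds a. partial_deriv c (partial_deriv b \<mu>) x = partial_deriv b (partial_deriv c \<mu>) x"
      by (rule eventually_nhds_openI[OF S smooth_on_partial_deriv_commute[OF S(1) _ s\<mu>]])
    show ?thesis using 1[of c b] 1[of b c] 2 \<mu>0 by eventually_elim (simp add: mult.commute)
  qed
  \<comment> \<open>A primitive of d\<mu>/\<mu>, that is, a logarithm of \<mu> up to a constant;
    then \<mu> is a constant multiple of exp \<nu>.\<close>
  obtain \<nu> where \<nu>: "analytic_germ a \<nu>" "\<And>b. \<forall>\<^sub>F x in nhds a. partial_deriv b \<nu> x = \<beta> b x"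
    using analytic_potential[of UNIV a \<beta>, OF an\<beta> comm] by auto
  have an\<nu>: "analytic_germ a (\<lambda>x. exp (- \<nu> x))" by (intro agerm \<nu>)
  have "\<forall>\<^sub>F x in nhds a. \<forall>b. partial_deriv b \<nu> x = \<beta> b x" by (intro eventually_all_finite \<nu>(2))
  with k\<mu> d\<mu> eventually_analytic_germ[OF \<nu>(1)] eventually_analytic_germ[OF an\<nu>]
  have "\<forall>\<^sub>F x in nhds a. kdiff (\<lambda>x. \<mu> x * exp (- \<nu> x)) x \<and> (\<forall>i. partial_deriv i (\<lambda>x. \<mu> x * exp (- \<nu> x)) x = 0)"
    by eventually_elim (simp add: kdiff_mult analytic_germ_kdiff partial_deriv_mult partial_deriv_exp
        kdiff_minus partial_deriv_minus)
  then obtain K where K: "\<forall>\<^sub>F x in nhds a. \<mu> x * exp (- \<nu> x) = K" by (rule eventually_const_germ)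
  have K': "\<forall>\<^sub>F x in nhds a. K * exp (\<nu> x) = \<mu> x"
    using K by eventually_elim (auto simp: exp_minus)
  have an\<mu>: "analytic_germ a \<mu>" by (rule analytic_germ_cong[OF _ K']) (intro agerm \<nu>)
  show ?thesis
  proof (rule analytic_germ_of_partial_derivs[OF S L[OF i]])
    fix b
    have "\<forall>\<^sub>F x in nhds a. \<alpha> i b x * \<mu> x = partial_deriv b (L i) x"
      using D\<alpha> by eventually_elim (simp add: D_def)
    thus "analytic_germ a (partial_deriv b (L i))"
      by (rule analytic_germ_cong[rotated]) (intro agerm an\<alpha>[OF i] an\<mu>)
  qed
qed

end

section \<open>Pairs of skew-symmetric forms\<close>

definition form :: "('n \<Rightarrow> 'n \<Rightarrow> complex) \<Rightarrow> 'n::finite pairing" where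
  "form M v w = (\<Sum>i\<in>UNIV. \<Sum>j\<in>UNIV. v $ i * w $ j * M i j)"

lemma form_alt: "form M v w = (\<Sum>j\<in>UNIV. (\<Sum>i\<in>UNIV. v $ i * M i j) * w $ j)"
  unfolding form_def by (subst sum.swap) (simp add: sum_distrib_left sum_distrib_right mult_ac)

lemma form_comb: "l1 * form M v w + l2 * form N v w = form (\<lambda>i j. l1 * M i j + l2 * N i j) v w"
  by (simp add: form_def distrib_left sum.distrib sum_distrib_left mult_ac)

lemma form_zero_left [simp]: "form M 0 w = 0" and form_zero_right [simp]: "form M v 0 = 0"
  and form_add_left: "form M (v + v') w = form M v w + form M v' w"
  and form_add_right: "form M v (w + w') = form M v w + form M v w'"
  and form_scale_left: "form M (c *s v) w = c * form M v w"
  and form_scale_right: "form M v (c *s w) = c * form M v w"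
  by (simp_all add: form_def distrib_left distrib_right sum.distrib sum_distrib_left mult_ac)

lemma form_sum_left: "form M (\<Sum>l\<in>I. v l) w = (\<Sum>l\<in>I. form M (v l) w)"
  by (induction I rule: infinite_finite_induct) (simp_all add: form_add_left)

lemma form_sum_right: "form M v (\<Sum>l\<in>I. w l) = (\<Sum>l\<in>I. form M v (w l))"
  by (induction I rule: infinite_finite_induct) (simp_all add: form_add_right)

lemma form_skew:
  assumes "\<And>i j. M i j = - M j i" shows "form M v w = - form M w v"
proof -
  have "form M v w = (\<Sum>i\<in>UNIV. \<Sum>j\<in>UNIV. - (w $ j * v $ i * M j i))"
    unfolding form_def
  proof (intro sum.cong refl)
    fix i j
    have "M i j = - M j i" by (rule assms)
    thus "v $ i * w $ j * M i j = - (w $ j * v $ i * M j i)" by simp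
  qed
  also have "\<dots> = - form M w v" unfolding form_def by (subst sum.swap) (simp add: sum_negf)
  finally show ?thesis .
qed

lemma form_null_iff: "(\<forall>w. form M v w = 0) \<longleftrightarrow> (\<forall>j. (\<Sum>i\<in>UNIV. v $ i * M i j) = 0)"
proof
  assume *: "\<forall>w. form M v w = 0"
  show "\<forall>j. (\<Sum>i\<in>UNIV. v $ i * M i j) = 0"
  proof
    fix j
    have "form M v (axis j 1) = (\<Sum>i\<in>UNIV. v $ i * M i j)"
      by (simp add: form_alt axis_def if_distrib[of "\<lambda>c. _ * c"] cong: if_cong)
    thus "(\<Sum>i\<in>UNIV. v $ i * M i j) = 0" using * by simp
  qed
qed (simp add: form_alt)

lemma corank_1_null:
  assumes "pairing_corank (form M) = 1"
  obtains v where "v \<noteq> 0" "\<And>w. form M v w = 0"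
    "\<And>z. (\<And>w. form M z w = 0) \<Longrightarrow> \<exists>t. z = t *s v"
proof -
  let ?N = "{v. \<forall>w. form M v w = 0}"
  obtain B where B: "B \<subseteq> ?N" "vec.independent B" "?N \<subseteq> vec.span B" "card B = 1"
    using vec.basis_exists[of ?N] assms by (auto simp: pairing_corank_def)
  then obtain v where v: "B = {v}" by (auto simp: card_1_singleton_iff)
  show ?thesis
  proof (rule that[of v])
    show "v \<noteq> 0" using B(2) v vec.dependent_zero by blast
    show "form M v w = 0" for w using B(1) v by auto
    show "\<exists>t. z = t *s v" if "\<And>w. form M z w = 0" for z
      using B(3) that by (auto simp: v vec.span_singleton)
  qed
qed

lemma corank_1_null_prop:
  assumes "pairing_corank (form M) = 1" "\<And>w. form M z w = 0" "\<And>w. form M y w = 0" "z \<noteq> 0"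
  shows "\<exists>t. y = t *s z"
proof -
  obtain v where v: "\<And>z. (\<And>w. form M z w = 0) \<Longrightarrow> \<exists>t. z = t *s v"
    using corank_1_null[OF assms(1)] by metis
  obtain s where s: "z = s *s v" using v[of z] assms(2) by blast
  obtain t where t: "y = t *s v" using v[of y] assms(3) by blast
  have "s \<noteq> 0" using s assms(4) by auto
  hence "y = (t / s) *s z" by (simp add: s t vector_smult_assoc)
  thus ?thesis ..
qed

text \<open>
  Replacing a row and the column of the same index by a unit vector, at an index where the null
  vector does not vanish, gives a regular matrix; transposition changes the signs of its other rows.
\<close>

lemma skew_corank_1_odd:
  fixes M :: "'n::finite \<Rightarrow> 'n \<Rightarrow> complex"
  assumes skew: "\<And>i j. M i j = - M j i" and cork: "pairing_corank (form M) = 1"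
  shows "odd CARD('n)"
proof -
  obtain v where v: "v \<noteq> 0" "\<And>w. form M v w = 0" "\<And>z. (\<And>w. form M z w = 0) \<Longrightarrow> \<exists>t. z = t *s v"
    using corank_1_null[OF cork] by metis
  obtain p where p: "v $ p \<noteq> 0" using v(1) by (auto simp: vec_eq_iff)
  define A where "A i j = (if i = p \<or> j = p then (if i = j then 1 else 0) else M i j)" for i j
  \<comment> \<open>Row p gives y p = 0, so all components of M y but the one at p vanish. Pairing
    with the null vector, nonzero at p, removes that one too. Thus y is a multiple of
    \<open>v\<close> that vanishes at p, hence 0.\<close>
  have "\<forall>j. y j = 0" if y: "\<And>i. (\<Sum>j\<in>UNIV. A i j * y j) = 0" for y
  proof -
    have yp: "y p = 0" using y[of p] by (simp add: A_def if_distrib[of "\<lambda>c. c * _"] cong: if_cong)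
    have 1: "(\<Sum>j\<in>UNIV. M i j * y j) = 0" if "i \<noteq> p" for i
    proof -
      have "(\<Sum>j\<in>UNIV. M i j * y j) = (\<Sum>j\<in>UNIV. A i j * y j)"
        by (rule sum.cong) (use that yp in \<open>auto simp: A_def\<close>)
      thus ?thesis using y[of i] by simp
    qed
    define z where "z = (\<chi> i. y i)"
    have 2: "(\<Sum>i\<in>UNIV. z $ i * M i j) = - (\<Sum>i\<in>UNIV. M j i * y i)" for j
      unfolding sum_negf[symmetric]
    proof (rule sum.cong[OF refl])
      fix i
      have "M i j = - M j i" by (rule skew)
      thus "z $ i * M i j = - (M j i * y i)" by (simp add: z_def)
    qed
    have "0 = form M v z" by (simp add: v(2))
    also have "\<dots> = - form M z v" by (rule form_skew[OF skew])
    also have "form M z v = (\<Sum>j\<in>UNIV. if j = p then (\<Sum>i\<in>UNIV. z $ i * M i p) * v $ p else 0)"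
      unfolding form_alt by (rule sum.cong) (use 1 2 in auto)
    finally have "(\<Sum>i\<in>UNIV. z $ i * M i p) = 0" using p by simp
    hence "\<forall>j. (\<Sum>i\<in>UNIV. z $ i * M i j) = 0" using 1 2 by (metis neg_equal_0_iff_equal)
    hence "form M z w = 0" for w using form_null_iff by blast
    then obtain t where t: "z = t *s v" using v(3) by blast
    have "z $ p = 0" using yp by (simp add: z_def)
    hence "t = 0" using p t by simp
    hence "z = 0" using t by simp
    thus ?thesis by (simp add: z_def vec_eq_iff)
  qed
  then obtain S where S: "\<And>i j. (\<Sum>l\<in>UNIV. S i l * A l j) = (if i = j then 1 else 0)"
    and S': "\<And>i j. (\<Sum>l\<in>UNIV. A i l * S l j) = (if i = j then 1 else 0)"
    using jacobian_inverse[of A] by blast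
  define X where "X = (\<chi> i j. A i j)"
  define Y where "Y = (\<chi> i j. S i j)"
  have "Y ** X = mat 1" by (simp add: vec_eq_iff matrix_matrix_mult_def mat_def X_def Y_def S)
  hence "det Y * det X = 1" by (metis det_I det_mul)
  hence X0: "det X \<noteq> 0" by auto
  define J :: "complex ^ 'n ^ 'n" where "J = (\<chi> i j. if i = j then (if i = p then 1 else - 1) else 0)"
  have "transpose X = J ** X"
  proof -
    have 1: "A j i = (if i = p then 1 else - 1) * A i j" for i j
      unfolding A_def by (subst skew) auto
    have 2: "(J ** X) $ i $ j = (if i = p then 1 else - 1) * A i j" for i j
      by (simp add: matrix_matrix_mult_def X_def J_def if_distrib[of "\<lambda>c. c * _"] cong: if_cong)
    have 3: "transpose X $ i $ j = A j i" for i j by (simp add: transpose_def X_def)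
    show ?thesis unfolding vec_eq_iff using trans[OF 3 trans[OF 1 2[symmetric]]] by blast
  qed
  hence "det X = det J * det X" by (metis det_mul det_transpose)
  hence "det J = 1" using X0 by simp
  moreover have "det J = (\<Prod>i\<in>UNIV. if i = p then 1 else - 1)"
    by (subst det_diagonal) (simp_all add: J_def)
  moreover have "\<dots> = (\<Prod>i\<in>- {p}. - 1)"
    by (rule prod.mono_neutral_cong_right) auto
  moreover have "\<dots> = (- 1) ^ (CARD('n) - 1)" by (simp add: card_Diff_singleton Compl_eq_Diff_UNIV)
  ultimately have 1: "(- 1 :: complex) ^ (CARD('n) - 1) = 1" by simp
  have "even (CARD('n) - 1)"
  proof (rule ccontr)
    assume "odd (CARD('n) - 1)"
    hence "(- 1 :: complex) ^ (CARD('n) - 1) = - 1" by (rule neg_one_odd_power)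
    with 1 show False by simp
  qed
  moreover have "CARD('n) = Suc (CARD('n) - 1)" using zero_less_card_finite[where 'a = 'n] by linarith
  ultimately show ?thesis by (metis even_Suc)
qed

text \<open>Independence is stated as unique representation of 0, by arbitrary functions on
  \<open>D\<close>; this form glues along a union in the induction below.\<close>

definition direct_sum :: "(complex ^ 'n::finite) set set \<Rightarrow> (complex ^ 'n) set \<Rightarrow> bool" where
  "direct_sum D W \<longleftrightarrow> finite D \<and> (\<forall>X\<in>D. X \<subseteq> W) \<and>
     (\<forall>v\<in>W. \<exists>f. (\<forall>X\<in>D. f X \<in> X) \<and> v = (\<Sum>X\<in>D. f X)) \<and>
     (\<forall>f. (\<forall>X\<in>D. f X \<in> X) \<longrightarrow> (\<Sum>X\<in>D. f X) = 0 \<longrightarrow> (\<forall>X\<in>D. f X = 0))"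

lemma direct_sum_Un:
  fixes D E :: "(complex ^ 'n::finite) set set"
  assumes D: "direct_sum D X" "direct_sum E Y" and sub: "vec.subspace X" "vec.subspace Y"
    and XY: "X \<inter> Y = {0}" and W: "W = {x + y | x y. x \<in> X \<and> y \<in> Y}" and disj: "D \<inter> E = {}"
  shows "direct_sum (D \<union> E) W"
proof -
  note d = D[unfolded direct_sum_def]
  have fin: "finite D" "finite E" using d by auto
  have split: "(\<Sum>Z\<in>D \<union> E. f Z) = (\<Sum>Z\<in>D. f Z) + (\<Sum>Z\<in>E. f Z)" for f :: "(complex ^ 'n) set \<Rightarrow> complex ^ 'n"
    by (rule sum.union_disjoint[OF fin disj])
  have 1: "X \<subseteq> W" "Y \<subseteq> W"
    unfolding W using vec.subspace_0[OF sub(1)] vec.subspace_0[OF sub(2)] by force+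
  have 2: "\<exists>f. (\<forall>Z\<in>D \<union> E. f Z \<in> Z) \<and> v = (\<Sum>Z\<in>D \<union> E. f Z)" if "v \<in> W" for v
  proof -
    obtain x y where v: "v = x + y" "x \<in> X" "y \<in> Y" using \<open>v \<in> W\<close> unfolding W by blast
    obtain f where f: "\<forall>Z\<in>D. f Z \<in> Z" "x = (\<Sum>Z\<in>D. f Z)" using d(1) v(2) by blast
    obtain g where g: "\<forall>Z\<in>E. g Z \<in> Z" "y = (\<Sum>Z\<in>E. g Z)" using d(2) v(3) by blast
    have "(\<Sum>Z\<in>D. if Z \<in> D then f Z else g Z) = x" unfolding f(2) by (rule sum.cong) auto
    moreover have "(\<Sum>Z\<in>E. if Z \<in> D then f Z else g Z) = y"
      unfolding g(2) by (rule sum.cong) (use disj in auto)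
    ultimately show ?thesis
      by (intro exI[of _ "\<lambda>Z. if Z \<in> D then f Z else g Z"]) (use v(1) f(1) g(1) in \<open>auto simp: split\<close>)
  qed
  have 3: "\<forall>Z\<in>D \<union> E. f Z = 0" if f: "\<forall>Z\<in>D \<union> E. f Z \<in> Z" "(\<Sum>Z\<in>D \<union> E. f Z) = 0" for f
  proof -
    have x: "(\<Sum>Z\<in>D. f Z) \<in> X" by (rule vec.subspace_sum[OF sub(1)]) (use f(1) d(1) in blast)
    have y: "(\<Sum>Z\<in>E. f Z) \<in> Y" by (rule vec.subspace_sum[OF sub(2)]) (use f(1) d(2) in blast)
    have e: "(\<Sum>Z\<in>D. f Z) = - (\<Sum>Z\<in>E. f Z)" using f(2) unfolding split by (simp add: eq_neg_iff_add_eq_0)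
    have "(\<Sum>Z\<in>D. f Z) \<in> Y" unfolding e by (rule vec.subspace_neg[OF sub(2) y])
    hence D0: "(\<Sum>Z\<in>D. f Z) = 0" using x XY by blast
    hence E0: "(\<Sum>Z\<in>E. f Z) = 0" using e by simp
    have fD: "\<forall>Z\<in>D. f Z \<in> Z" and fE: "\<forall>Z\<in>E. f Z \<in> Z" using f(1) by blast+
    have "\<forall>Z\<in>D. f Z = 0"
      by (rule d(1)[THEN conjunct2, THEN conjunct2, THEN conjunct2, THEN spec, THEN mp, THEN mp, OF fD D0])
    moreover have "\<forall>Z\<in>E. f Z = 0"
      by (rule d(2)[THEN conjunct2, THEN conjunct2, THEN conjunct2, THEN spec, THEN mp, THEN mp, OF fE E0])
    ultimately show ?thesis by blast
  qed
  have 4: "\<forall>Z\<in>D \<union> E. Z \<subseteq> W" using d(1)[THEN conjunct2, THEN conjunct1] d(2)[THEN conjunct2, THEN conjunct1] 1 by blast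
  show ?thesis unfolding direct_sum_def
  proof (intro conjI ballI allI impI)
    show "finite (D \<union> E)" using fin by simp
    show "Z \<subseteq> W" if "Z \<in> D \<union> E" for Z using 4 that by blast
    show "\<exists>f. (\<forall>Z\<in>D \<union> E. f Z \<in> Z) \<and> v = (\<Sum>Z\<in>D \<union> E. f Z)" if "v \<in> W" for v by (rule 2[OF that])
    show "f Z = 0" if "\<forall>Z\<in>D \<union> E. f Z \<in> Z" "(\<Sum>Z\<in>D \<union> E. f Z) = 0" "Z \<in> D \<union> E" for f Z
      using 3[OF that(1,2)] that(3) by blast
  qed
qed

text \<open>The summands are subspaces, so two representations of a vector can be subtracted, which
  reduces uniqueness to the vector 0.\<close>

lemma pair_decomposition_iff:
  fixes a b :: "'n::finite pairing"
  shows "pair_decomposition a b D \<longleftrightarrow> direct_sum D UNIV \<and> (\<forall>W\<in>D. pair_indecomposable a b W) \<and>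
    (\<forall>X\<in>D. \<forall>Y\<in>D. X \<noteq> Y \<longrightarrow> pair_orthogonal a b X Y)"
  (is "?L \<longleftrightarrow> ?R")
proof
  assume R: ?R
  hence ind: "\<forall>W\<in>D. pair_indecomposable a b W" and D: "direct_sum D UNIV" by auto
  have "\<exists>!f. f \<in> (\<Pi>\<^sub>E W\<in>D. W) \<and> v = (\<Sum>W\<in>D. f W)" for v
  proof -
    obtain f where f: "\<forall>X\<in>D. f X \<in> X" "v = (\<Sum>X\<in>D. f X)" using D unfolding direct_sum_def by blast
    show ?thesis
    proof (rule ex1I[of _ "restrict f D"])
      show "restrict f D \<in> (\<Pi>\<^sub>E W\<in>D. W) \<and> v = (\<Sum>W\<in>D. restrict f D W)" using f by auto
      fix g assume g: "g \<in> (\<Pi>\<^sub>E W\<in>D. W) \<and> v = (\<Sum>W\<in>D. g W)"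
      have s: "(\<Sum>X\<in>D. g X - f X) = 0" using f(2) g by (simp add: sum_subtractf)
      have m: "g X - f X \<in> X" if "X \<in> D" for X
        by (rule vec.subspace_diff) (use ind f g that in \<open>auto simp: pair_indecomposable_def\<close>)
      have 2: "\<forall>f. (\<forall>X\<in>D. f X \<in> X) \<longrightarrow> (\<Sum>X\<in>D. f X) = 0 \<longrightarrow> (\<forall>X\<in>D. f X = 0)"
        using D unfolding direct_sum_def by blast
      have "\<forall>X\<in>D. g X - f X = 0" using 2[rule_format, of "\<lambda>X. g X - f X"] s m by blast
      thus "g = restrict f D" using g by (auto simp: fun_eq_iff PiE_def extensional_def)
    qed
  qed
  thus ?L using R unfolding pair_decomposition_def direct_sum_def by blast
next
  assume L: ?L
  hence ind: "\<forall>W\<in>D. pair_indecomposable a b W" unfolding pair_decomposition_def by blast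
  have z: "0 \<in> X" if "X \<in> D" for X
    using ind that unfolding pair_indecomposable_def by (blast intro: vec.subspace_0)
  have ex: "\<exists>!f. f \<in> (\<Pi>\<^sub>E W\<in>D. W) \<and> v = (\<Sum>W\<in>D. f W)" for v
    by (rule L[unfolded pair_decomposition_def, THEN conjunct2, THEN conjunct2, THEN conjunct1, THEN spec])
  have "direct_sum D UNIV" unfolding direct_sum_def
  proof (intro conjI ballI allI impI)
    show "finite D" using L by (simp add: pair_decomposition_def)
    show "\<exists>f. (\<forall>X\<in>D. f X \<in> X) \<and> v = (\<Sum>X\<in>D. f X)" for v
      using ex[of v] by (auto simp: PiE_iff)
    fix f X assume f: "\<forall>X\<in>D. f X \<in> X" "(\<Sum>X\<in>D. f X) = 0" "X \<in> D"
    have 1: "restrict f D \<in> (\<Pi>\<^sub>E W\<in>D. W) \<and> 0 = (\<Sum>W\<in>D. restrict f D W)" using f by auto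
    have 2: "restrict (\<lambda>_. 0) D \<in> (\<Pi>\<^sub>E W\<in>D. W) \<and> 0 = (\<Sum>W\<in>D. restrict (\<lambda>_. 0) D W)" using z by auto
    have "\<exists>g. \<forall>h. h \<in> (\<Pi>\<^sub>E W\<in>D. W) \<and> 0 = (\<Sum>W\<in>D. h W) \<longrightarrow> h = g"
      using ex[of 0] by (rule ex1E) (rule exI)
    then obtain g where g: "\<forall>h. h \<in> (\<Pi>\<^sub>E W\<in>D. W) \<and> 0 = (\<Sum>W\<in>D. h W) \<longrightarrow> h = g" ..
    have "restrict f D = restrict (\<lambda>_. 0) D"
      using g[THEN spec, THEN mp, OF 1] g[THEN spec, THEN mp, OF 2] by simp
    from fun_cong[OF this, of X] show "f X = 0" using f(3) by simp
  qed simp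
  thus ?R using ind L[unfolded pair_decomposition_def, THEN conjunct2, THEN conjunct2, THEN conjunct2] by simp
qed

text \<open>Split decomposable subspaces, by induction on the dimension. Existence turns the
  arbitrary choice in \<open>num_kronecker_blocks\<close> into an actual decomposition.\<close>

lemma ex_pair_decomposition:
  fixes a b :: "'n::finite pairing"
  assumes skew: "\<And>v w. a v w = - a w v" "\<And>v w. b v w = - b w v"
  shows "\<exists>D. pair_decomposition a b D"
proof -
  have "\<exists>D. direct_sum D W \<and> (\<forall>X\<in>D. pair_indecomposable a b X) \<and>
      (\<forall>X\<in>D. \<forall>Y\<in>D. X \<noteq> Y \<longrightarrow> pair_orthogonal a b X Y)" if "vec.subspace W" for W
    using that
  proof (induction "vec.dim W" arbitrary: W rule: less_induct)
    case less
    consider "W = {0}" | "pair_indecomposable a b W" | "W \<noteq> {0}" "\<not> pair_indecomposable a b W" by blast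
    thus ?case
    proof cases
      case 1
      thus ?thesis by (intro exI[of _ "{}"]) (simp add: direct_sum_def)
    next
      case 2
      have "direct_sum {W} W" by (auto simp: direct_sum_def intro!: exI[of _ "\<lambda>_. _"])
      thus ?thesis using 2 by (intro exI[of _ "{W}"]) simp
    next
      case 3
      then obtain X Y where XY: "vec.subspace X" "vec.subspace Y" "X \<noteq> {0}" "Y \<noteq> {0}" "X \<inter> Y = {0}"
        "W = {x + y | x y. x \<in> X \<and> y \<in> Y}" "pair_orthogonal a b X Y"
        using less.prems unfolding pair_indecomposable_def by blast
      have sub: "X \<subseteq> W" "Y \<subseteq> W"
        unfolding XY(6) using vec.subspace_0[OF XY(1)] vec.subspace_0[OF XY(2)] by force+
      have ne: "X \<noteq> W" "Y \<noteq> W"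
        using sub XY(3-5) vec.subspace_0[OF XY(1)] vec.subspace_0[OF XY(2)] by auto
      have dim: "vec.dim X < vec.dim W" "vec.dim Y < vec.dim W"
        using sub ne by (auto intro!: vec.dim_psubset simp: vec.span_eq_iff[THEN iffD2] XY(1,2) less.prems)
      from less.hyps[OF dim(1) XY(1)] obtain D where
        D: "direct_sum D X" "\<forall>X\<in>D. pair_indecomposable a b X" "\<forall>X\<in>D. \<forall>Y\<in>D. X \<noteq> Y \<longrightarrow> pair_orthogonal a b X Y"
        by (elim exE conjE)
      from less.hyps[OF dim(2) XY(2)] obtain E where
        E: "direct_sum E Y" "\<forall>X\<in>E. pair_indecomposable a b X" "\<forall>X\<in>E. \<forall>Y\<in>E. X \<noteq> Y \<longrightarrow> pair_orthogonal a b X Y"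
        by (elim exE conjE)
      have DX: "Z \<subseteq> X" if "Z \<in> D" for Z using D(1) that unfolding direct_sum_def by blast
      have EY: "Z \<subseteq> Y" if "Z \<in> E" for Z using E(1) that unfolding direct_sum_def by blast
      have disj: "D \<inter> E = {}"
      proof (rule ccontr)
        assume "D \<inter> E \<noteq> {}"
        then obtain Z where Z: "Z \<in> D" "Z \<in> E" by blast
        hence "Z \<subseteq> {0}" using DX EY XY(5) by blast
        moreover have "vec.subspace Z" "Z \<noteq> {0}" using D(2) Z(1) unfolding pair_indecomposable_def by blast+
        ultimately show False using vec.subspace_0 by blast
      qed
      have ds: "direct_sum (D \<union> E) W" by (rule direct_sum_Un[OF D(1) E(1) XY(1,2,5,6) disj])
      have 1: "pair_orthogonal a b Z Z'" if "Z \<in> D" "Z' \<in> E" for Z Z'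
        using XY(7) DX[OF that(1)] EY[OF that(2)] unfolding pair_orthogonal_def by blast
      have 2: "pair_orthogonal a b Z' Z" if "pair_orthogonal a b Z Z'" for Z Z'
        unfolding pair_orthogonal_def
      proof (intro ballI conjI)
        fix x y assume "x \<in> Z'" "y \<in> Z"
        hence "a y x = 0" "b y x = 0" using that unfolding pair_orthogonal_def by auto
        thus "a x y = 0" "b x y = 0" using skew(1)[of x y] skew(2)[of x y] by auto
      qed
      have "pair_orthogonal a b Z Z'" if "Z \<in> D \<union> E" "Z' \<in> D \<union> E" "Z \<noteq> Z'" for Z Z'
        using that(1)
      proof
        assume Z: "Z \<in> D"
        from that(2) show ?thesis
        proof
          assume "Z' \<in> D" thus ?thesis using D(3) Z that(3) by simp
        qed (rule 1[OF Z])
      next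
        assume Z: "Z \<in> E"
        from that(2) show ?thesis
        proof
          assume "Z' \<in> D" thus ?thesis by (rule 2[OF 1[OF _ Z]])
        next
          assume "Z' \<in> E" thus ?thesis using E(3) Z that(3) by simp
        qed
      qed
      moreover have "\<forall>Z\<in>D \<union> E. pair_indecomposable a b Z" using D(2) E(2) by auto
      ultimately show ?thesis using ds by (intro exI[of _ "D \<union> E"]) simp
    qed
  qed
  from this[OF vec.subspace_UNIV] show ?thesis by (simp add: pair_decomposition_iff)
qed

text \<open>A combination \<Sum>l. c_l w_{2l} pairs trivially with the even basis vectors, and with
  w_{2i+1} to l1 c_i - l2 c_{i+1}. So it is null when l1 c_i = l2 c_{i+1}, which the homogeneous
  monomials c_l = l1^l l2^(k-1-l) satisfy without any division.\<close>

lemma kronecker_block_null: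
  fixes M N :: "'n::finite \<Rightarrow> 'n \<Rightarrow> complex"
  assumes "kronecker_block (form M) (form N) W"
  obtains z where "z \<in> W" "z \<noteq> 0" "\<And>x. x \<in> W \<Longrightarrow> l1 * form M z x + l2 * form N z x = 0"
proof -
  from assms obtain k and w :: "nat \<Rightarrow> complex ^ 'n" where k: "k \<ge> 1" "inj_on w {..<2*k-1}"
    and ind: "vec.independent (w ` {..<2*k-1})" and span: "vec.span (w ` {..<2*k-1}) = W"
    and vals: "\<And>i j. i < 2*k-1 \<Longrightarrow> j < 2*k-1 \<Longrightarrow> form M (w i) (w j) = kron1 i j \<and> form N (w i) (w j) = kron2 i j"
    unfolding kronecker_block_def by blast
  define P where "P = form (\<lambda>i j. l1 * M i j + l2 * N i j)"
  have Pw: "P (w i) (w j) = l1 * kron1 i j + l2 * kron2 i j" if "i < 2*k-1" "j < 2*k-1" for i j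
    using vals[OF that] by (simp add: P_def form_comb[symmetric])
  have "\<exists>c. (\<exists>l<k. c l \<noteq> 0) \<and> (\<forall>l. Suc l < k \<longrightarrow> l1 * c l = l2 * c (Suc l))"
  proof (cases "l1 = 0 \<and> l2 = 0")
    case True thus ?thesis using k(1) by (intro exI[of _ "\<lambda>_. 1"]) (auto intro!: exI[of _ 0])
  next
    case False
    have "l1 * (l1 ^ l * l2 ^ (k - 1 - l)) = l2 * (l1 ^ Suc l * l2 ^ (k - 1 - Suc l))" if "Suc l < k" for l
    proof -
      have "k - 1 - l = Suc (k - 1 - Suc l)" using that by simp
      thus ?thesis by simp
    qed
    \<comment> \<open>If one of the two coefficients is 0, one end of the sequence is still nonzero
      because 0^0 = 1.\<close>
    moreover have "\<exists>l<k. l1 ^ l * l2 ^ (k - 1 - l) \<noteq> 0"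
    proof (cases "l2 = 0")
      case True
      show ?thesis by (rule exI[of _ "k - 1"]) (use True False k(1) in auto)
    next
      case l2: False
      show ?thesis by (rule exI[of _ 0]) (use l2 k(1) in auto)
    qed
    ultimately show ?thesis by (intro exI[of _ "\<lambda>l. l1 ^ l * l2 ^ (k - 1 - l)"]) blast
  qed
  then obtain c l0 where c: "l0 < k" "c l0 \<noteq> 0" "\<And>l. Suc l < k \<Longrightarrow> l1 * c l = l2 * c (Suc l)" by blast
  define z where "z = (\<Sum>l<k. c l *s w (2 * l))"
  have wW: "w i \<in> W" if "i < 2*k-1" for i unfolding span[symmetric] by (rule vec.span_base) (use that in auto)
  have zW: "z \<in> W"
    unfolding z_def span[symmetric]
    by (intro vec.span_sum vec.span_scale vec.span_base) auto
  have "P z (w j) = 0" if j: "j < 2*k-1" for j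
  proof -
    have "P z (w j) = (\<Sum>l<k. c l * P (w (2 * l)) (w j))"
      by (simp add: z_def P_def form_sum_left form_scale_left)
    also have "\<dots> = (\<Sum>l<k. c l * (l1 * kron1 (2 * l) j + l2 * kron2 (2 * l) j))"
      by (rule sum.cong) (use Pw j in auto)
    also have "\<dots> = 0"
    proof (cases "even j")
      case True
      have "kron1 (2 * l) j = (0 :: complex)" "kron2 (2 * l) j = (0 :: complex)" for l
        using True by (auto simp: kron1_def kron2_def) presburger+
      thus ?thesis by simp
    next
      case False
      then obtain i where i: "j = 2 * i + 1" by (elim oddE)
      hence ik: "Suc i < k" using j by linarith
      have "(\<Sum>l<k. c l * (l1 * kron1 (2 * l) j + l2 * kron2 (2 * l) j)) =
          (\<Sum>l\<in>{i, Suc i}. c l * (l1 * kron1 (2 * l) j + l2 * kron2 (2 * l) j))"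
        by (rule sum.mono_neutral_right) (use ik in \<open>auto simp: kron1_def kron2_def i\<close>)
      also have "\<dots> = c i * l1 - c (Suc i) * l2" by (simp add: i kron1_def kron2_def)
      finally show ?thesis using c(3)[OF ik] by (simp add: mult.commute)
    qed
    finally show ?thesis .
  qed
  note zw = this
  have Pz: "P z x = 0" if "x \<in> W" for x
  proof -
    from that have "x \<in> vec.span (w ` {..<2*k-1})" by (simp only: span)
    thus ?thesis
    proof (rule vec.span_induct[where P = "\<lambda>x. P z x = 0"])
      show "vec.subspace {x. P z x = 0}"
        by (rule vec.subspaceI) (simp_all add: P_def form_add_right form_scale_right)
    qed (use zw in auto)
  qed
  have "z \<noteq> 0"
  proof
    assume "z = 0"
    define u where "u v = (let i = inv_into {..<2*k-1} w v in if even i then c (i div 2) else 0)" for v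
    have u: "u (w i) = (if even i then c (i div 2) else 0)" if "i < 2*k-1" for i
      using k(2) that by (simp add: u_def)
    have "(\<Sum>v\<in>w ` {..<2*k-1}. u v *s v) = (\<Sum>i<2*k-1. u (w i) *s w i)"
      by (simp only: sum.reindex[OF k(2)] o_def)
    also have "\<dots> = (\<Sum>i\<in>(\<lambda>l. 2 * l) ` {..<k}. u (w i) *s w i)"
    proof (rule sum.mono_neutral_right)
      show "\<forall>i\<in>{..<2*k-1} - (\<lambda>l. 2 * l) ` {..<k}. u (w i) *s w i = 0"
      proof
        fix i assume i: "i \<in> {..<2*k-1} - (\<lambda>l. 2 * l) ` {..<k}"
        have "odd i"
        proof
          assume "even i"
          then obtain l where l: "i = 2 * l" by blast
          hence "l < k" using i by auto
          thus False using i l by blast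
        qed
        thus "u (w i) *s w i = 0" using u[of i] i by simp
      qed
    qed (use k(1) in auto)
    also have "\<dots> = (\<Sum>l<k. u (w (2 * l)) *s w (2 * l))"
      by (subst sum.reindex) (auto simp: inj_on_def)
    also have "\<dots> = z" unfolding z_def by (rule sum.cong) (auto simp: u)
    finally have "(\<Sum>v\<in>w ` {..<2*k-1}. u v *s v) = 0" using \<open>z = 0\<close> by simp
    from vec.independentD[OF ind _ order.refl this, of "w (2 * l0)"] c(1)
    have "u (w (2 * l0)) = 0" by auto
    thus False using c(1,2) u[of "2 * l0"] by simp
  qed
  show ?thesis
  proof (rule that[OF zW \<open>z \<noteq> 0\<close>])
    show "l1 * form M z x + l2 * form N z x = 0" if "x \<in> W" for x
      using Pz[OF that] by (simp add: P_def form_comb)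
  qed
qed

text \<open>The summands are orthogonal for both forms, so a null vector of the combination on a
  block is null on the whole space. In corank 1 the null vectors of two blocks would be
  proportional, against the directness of the sum.\<close>

lemma num_kronecker_blocks_le_1:
  fixes M N :: "'n::finite \<Rightarrow> 'n \<Rightarrow> complex"
  assumes skew: "\<And>i j. M i j = - M j i" "\<And>i j. N i j = - N j i"
    and cork: "pairing_corank (form (\<lambda>i j. l1 * M i j + l2 * N i j)) = 1"
  shows "num_kronecker_blocks (form M) (form N) \<le> 1"
proof -
  define D where "D = (SOME D. pair_decomposition (form M) (form N) D)"
  have "pair_decomposition (form M) (form N) D"
    unfolding D_def by (rule someI_ex[OF ex_pair_decomposition]) (rule form_skew, rule skew)+
  hence D: "direct_sum D UNIV" "\<forall>X\<in>D. \<forall>Y\<in>D. X \<noteq> Y \<longrightarrow> pair_orthogonal (form M) (form N) X Y"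
    "\<forall>X\<in>D. pair_indecomposable (form M) (form N) X"
    unfolding pair_decomposition_iff by simp_all
  have fin: "finite D" using D(1) unfolding direct_sum_def by simp
  have sub: "vec.subspace X" if "X \<in> D" for X using D(3) that unfolding pair_indecomposable_def by simp
  have null: "\<exists>z\<in>X. z \<noteq> 0 \<and> (\<forall>w. form (\<lambda>i j. l1 * M i j + l2 * N i j) z w = 0)"
    if X: "X \<in> D" "kronecker_block (form M) (form N) X" for X
  proof -
    obtain z where z: "z \<in> X" "z \<noteq> 0" "\<And>x. x \<in> X \<Longrightarrow> l1 * form M z x + l2 * form N z x = 0"
      using kronecker_block_null[OF X(2), where ?l1.0 = l1 and ?l2.0 = l2] by blast
    have "form (\<lambda>i j. l1 * M i j + l2 * N i j) z w = 0" for w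
    proof -
      obtain f where f: "\<forall>Y\<in>D. f Y \<in> Y" "w = (\<Sum>Y\<in>D. f Y)" using D(1) unfolding direct_sum_def by blast
      have "form (\<lambda>i j. l1 * M i j + l2 * N i j) z (f Y) = 0" if Y: "Y \<in> D" for Y
      proof (cases "Y = X")
        case True
        thus ?thesis using z(3) f(1) Y by (simp add: form_comb[symmetric])
      next
        case False
        hence "pair_orthogonal (form M) (form N) X Y" using D(2) X(1) Y by simp
        thus ?thesis using z(1) f(1) Y by (simp add: pair_orthogonal_def form_comb[symmetric])
      qed
      thus ?thesis by (simp add: f(2) form_sum_right)
    qed
    with z show ?thesis by blast
  qed
  have "X = Y" if X: "X \<in> D" "kronecker_block (form M) (form N) X" and Y: "Y \<in> D" "kronecker_block (form M) (form N) Y" for X Y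
  proof (rule ccontr)
    assume ne: "X \<noteq> Y"
    obtain x where x: "x \<in> X" "x \<noteq> 0" "\<And>w. form (\<lambda>i j. l1 * M i j + l2 * N i j) x w = 0" using null[OF X] by auto
    obtain y where y: "y \<in> Y" "y \<noteq> 0" "\<And>w. form (\<lambda>i j. l1 * M i j + l2 * N i j) y w = 0" using null[OF Y] by auto
    obtain t where t: "y = t *s x" using corank_1_null_prop[OF cork x(3) y(3) x(2)] by auto
    have yX: "y \<in> X" unfolding t by (rule vec.subspace_scale[OF sub[OF X(1)] x(1)])
    define f where "f Z = (if Z = X then y else if Z = Y then - y else 0)" for Z
    have 1: "\<forall>Z\<in>D. f Z \<in> Z"
      using yX vec.subspace_neg[OF sub[OF Y(1)] y(1)] vec.subspace_0[OF sub] by (auto simp: f_def)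
    have "(\<Sum>Z\<in>D. f Z) = (\<Sum>Z\<in>{X, Y}. f Z)"
      by (rule sum.mono_neutral_right) (use fin X(1) Y(1) in \<open>auto simp: f_def\<close>)
    also have "\<dots> = 0" using ne by (simp add: f_def)
    finally have "f X = 0" using D(1) 1 X(1) unfolding direct_sum_def by simp
    thus False using y(2) by (simp add: f_def)
  qed
  hence "card {W \<in> D. kronecker_block (form M) (form N) W} \<le> 1"
    using fin by (auto simp: card_le_Suc0_iff_eq)
  thus ?thesis by (simp add: num_kronecker_blocks_def D_def)
qed

lemma pair_action_dim_bounds:
  fixes M N :: "'n::finite \<Rightarrow> 'n \<Rightarrow> complex"
  assumes "\<And>i j. M i j = - M j i" "\<And>i j. N i j = - N j i"
    "pairing_corank (form (\<lambda>i j. l1 * M i j + l2 * N i j)) = 1"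
  shows "real CARD('n) / 2 \<le> pair_action_dim (form M) (form N)"
    "pair_action_dim (form M) (form N) \<le> (real CARD('n) + 1) / 2"
  using num_kronecker_blocks_le_1[of M N l1 l2, OF assms] by (simp_all add: pair_action_dim_def)

text \<open>
  A relation among the \<open>P w\<^sub>i\<close> would give a second null vector \<open>\<Sum> a\<^sub>i w\<^sub>i\<close> of \<open>l1 P + l2 Q\<close>, since the
  latter takes this vector to \<open>\<Sum> (l1 a\<^sub>i - l2 a\<^bsub>i+1\<^esub>) P w\<^sub>i\<close>.
\<close>

lemma lenard_chain_independent:
  fixes M N :: "'n::finite \<Rightarrow> 'n \<Rightarrow> complex" and w :: "nat \<Rightarrow> 'n \<Rightarrow> complex"
  assumes cork: "pairing_corank (form (\<lambda>i j. l1 * M i j + l2 * N i j)) = 1"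
    and w0: "\<And>b. (\<Sum>c\<in>UNIV. N c b * w 0 c) = 0" and wn: "\<And>b. (\<Sum>c\<in>UNIV. M c b * w n c) = 0"
    and ws: "\<And>i b. i < n \<Longrightarrow> (\<Sum>c\<in>UNIV. N c b * w (Suc i) c) = - (\<Sum>c\<in>UNIV. M c b * w i c)"
    and p: "\<And>i j. i \<le> n \<Longrightarrow> j \<le> n \<Longrightarrow> (\<Sum>b\<in>UNIV. w i b * p j b) = (if i = j then 1 else 0)"
    and t: "\<And>b. (\<Sum>i<n. t i * (\<Sum>c\<in>UNIV. M c b * w i c)) = 0"
  shows "\<forall>i<n. t i = 0"
proof -
  define x where "x a = (\<chi> b. \<Sum>i\<le>n. a i * w i b)" for a :: "nat \<Rightarrow> complex"
  define U where "U i b = (\<Sum>c\<in>UNIV. M c b * w i c)" for i b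
  have xp: "(\<Sum>b\<in>UNIV. x a $ b * p j b) = a j" if "j \<le> n" for a j
  proof -
    have "(\<Sum>b\<in>UNIV. x a $ b * p j b) = (\<Sum>i\<le>n. a i * (\<Sum>b\<in>UNIV. w i b * p j b))"
      unfolding x_def vec_lambda_beta sum_distrib_left sum_distrib_right by (subst sum.swap) (simp add: mult_ac)
    also have "\<dots> = (\<Sum>i\<le>n. a i * (if i = j then 1 else 0))" using p that by simp
    also have "\<dots> = a j" using that by (simp add: if_distrib[of "\<lambda>c. _ * c"] cong: if_cong)
    finally show ?thesis .
  qed
  have null: "form (\<lambda>i j. l1 * M i j + l2 * N i j) (x a) v = 0"
    if "\<And>i. i < n \<Longrightarrow> l1 * a i - l2 * a (Suc i) = s * t i" for a s v
  proof -
    have "(\<Sum>c\<in>UNIV. x a $ c * (l1 * M c b + l2 * N c b)) = 0" for b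
    proof -
      have "(\<Sum>c\<in>UNIV. x a $ c * (l1 * M c b + l2 * N c b)) =
          (\<Sum>i\<le>n. l1 * a i * U i b) + (\<Sum>i\<le>n. l2 * a i * (\<Sum>c\<in>UNIV. N c b * w i c))"
        unfolding x_def vec_lambda_beta U_def sum_distrib_left sum_distrib_right sum.distrib[symmetric]
        by (subst sum.swap) (simp add: algebra_simps sum.distrib)
      also have "(\<Sum>i\<le>n. l1 * a i * U i b) = (\<Sum>i<n. l1 * a i * U i b)"
        using wn[of b] by (simp add: lessThan_Suc_atMost[symmetric] U_def)
      also have "(\<Sum>i\<le>n. l2 * a i * (\<Sum>c\<in>UNIV. N c b * w i c)) = (\<Sum>i<n. l2 * a (Suc i) * (\<Sum>c\<in>UNIV. N c b * w (Suc i) c))"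
        using w0[of b] by (simp add: lessThan_Suc_atMost[symmetric] sum.lessThan_Suc_shift del: sum.lessThan_Suc)
      also have "\<dots> = - (\<Sum>i<n. l2 * a (Suc i) * U i b)" by (simp add: ws U_def sum_negf)
      also have "(\<Sum>i<n. l1 * a i * U i b) + - (\<Sum>i<n. l2 * a (Suc i) * U i b) = (\<Sum>i<n. (l1 * a i - l2 * a (Suc i)) * U i b)"
        by (simp add: left_diff_distrib sum_subtractf)
      also have "\<dots> = (\<Sum>i<n. s * t i * U i b)" by (rule sum.cong) (use that in auto)
      also have "\<dots> = s * (\<Sum>i<n. t i * U i b)" by (simp add: sum_distrib_left mult_ac)
      also have "\<dots> = 0" using t[of b] by (simp add: U_def)
      finally show ?thesis .
    qed
    thus ?thesis using form_null_iff by blast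
  qed
  \<comment> \<open>Coefficients that satisfy the recurrence with right-hand side a multiple of
    \<open>t\<close> give null vectors, and corank 1 makes two of these proportional; the index i
    with a i = 1 determines the factor.\<close>
  have two: "a' j = a' i * a j" if a: "\<And>i. i < n \<Longrightarrow> l1 * a i - l2 * a (Suc i) = s * t i"
    and a': "\<And>i. i < n \<Longrightarrow> l1 * a' i - l2 * a' (Suc i) = s' * t i" and i: "i \<le> n" "a i = 1" and j: "j \<le> n" for a a' s s' i j
  proof -
    have "x a \<noteq> 0" using xp[of i a] i by auto
    then obtain \<tau> where \<tau>: "x a' = \<tau> *s x a"
      using corank_1_null_prop[OF cork null[of a s, OF a] null[of a' s', OF a']] by blast
    have "a' j = \<tau> * a j" if "j \<le> n" for j
      using xp[OF that, of a'] xp[OF that, of a] unfolding \<tau> by (simp add: sum_distrib_left[symmetric] mult.assoc)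
    from this[of i] this[of j] show ?thesis using i j by simp
  qed
  show ?thesis
  proof (cases "l2 = 0")
    case l2: False
    \<comment> \<open>\<open>a\<close> solves the homogeneous recurrence, and \<open>a'\<close> the
      one with right-hand side \<open>t\<close> and initial value 0. Proportionality, compared at
      index 0, forces a' = 0 and so t = 0.\<close>
    define a where "a i = (l1 / l2) ^ i" for i
    define a' where "a' = rec_nat 0 (\<lambda>i y. (l1 * y - t i) / l2)"
    have 1: "l1 * a i - l2 * a (Suc i) = 0 * t i" for i using l2 by (simp add: a_def)
    have a': "a' 0 = 0" "a' (Suc i) = (l1 * a' i - t i) / l2" for i by (simp_all add: a'_def)
    have 2: "l1 * a' i - l2 * a' (Suc i) = 1 * t i" for i using l2 by (simp add: a')
    have "a' j = 0" if "j \<le> n" for j using two[of a 0 a' 1 0 j, OF 1 2] that by (simp add: a_def a')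
    thus ?thesis using 2 by (metis Suc_leI diff_zero less_imp_le mult_zero_right mult_1)
  next
    case l2: True
    show ?thesis
    proof (cases "l1 = 0")
      case l1: True
      show ?thesis
      proof (cases n)
        case (Suc m)
        \<comment> \<open>If l1 = l2 = 0 every vector is null, and for n \<ge> 1 the independent w_0
          and w_1 contradict corank 1.\<close>
        define a where "a i = (if i = 0 then 1 else 0 :: complex)" for i :: nat
        define a' where "a' i = (if i = 1 then 1 else 0 :: complex)" for i :: nat
        have 1: "l1 * a i - l2 * a (Suc i) = 0 * t i" "l1 * a' i - l2 * a' (Suc i) = 0 * t i" for i using l1 l2 by auto
        show ?thesis using two[of a 0 a' 0 0 1, OF 1] Suc by (simp add: a_def a'_def)
      qed simp
    next
      case l1: False
      \<comment> \<open>For l2 = 0 the recurrence does not restrict the entry at n: it carries the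
        homogeneous solution and is 0 in the particular one.\<close>
      define a where "a i = (if i = n then 1 else 0 :: complex)" for i
      define a' where "a' i = (if i = n then 0 else t i / l1)" for i
      have 1: "l1 * a i - l2 * a (Suc i) = 0 * t i" if "i < n" for i using l2 that by (simp add: a_def)
      have 2: "l1 * a' i - l2 * a' (Suc i) = 1 * t i" if "i < n" for i using l2 l1 that by (simp add: a'_def)
      have "a' j = 0" if "j \<le> n" for j using two[of a 0 a' 1 n j, OF 1 2] that by (simp add: a_def a'_def)
      hence "a' i = 0" if "i < n" for i using that by simp
      thus ?thesis using l1 by (simp add: a'_def)
    qed
  qed
qed

section \<open>Analytic manifolds\<close>

text \<open>Unconditional summability in the ground field is absolute, by passing to real and
  imaginary parts. This connects the definition of analyticity with weighted norms.\<close>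

lemma summable_on_imp_norm_summable_on:
  fixes f :: "'a \<Rightarrow> 'k::real_or_complex"
  assumes "f summable_on X" shows "(\<lambda>x. norm (f x)) summable_on X"
proof -
  have "(\<lambda>x. to_complex (f x)) summable_on X" by (rule summable_on_bounded_linear[OF bounded_linear_to_complex assms])
  hence s: "(\<lambda>x. Re (to_complex (f x))) summable_on X" "(\<lambda>x. Im (to_complex (f x))) summable_on X"
    by (rule summable_on_bounded_linear[OF bounded_linear_Re], rule summable_on_bounded_linear[OF bounded_linear_Im])
  have "(\<lambda>x. norm (Re (to_complex (f x))) + norm (Im (to_complex (f x)))) summable_on X"
    by (intro summable_on_add s[THEN summable_on_iff_abs_summable_on_real[THEN iffD1]])
  moreover have "norm (f x) \<le> norm (Re (to_complex (f x))) + norm (Im (to_complex (f x)))" for x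
    using cmod_le[of "to_complex (f x)"] by (simp add: norm_to_complex)
  ultimately show ?thesis by (rule summable_on_comparison_test) simp
qed

lemma power_series_on_iff:
  fixes f :: "'k::real_or_complex ^ 'n::finite \<Rightarrow> 'k"
  shows "power_series_on S f \<longleftrightarrow> (\<forall>a\<in>S. analytic_germ a f)"
  unfolding power_series_on_def
proof (rule ball_cong[OF refl], rule iffI)
  fix a assume "\<exists>c r. r > 0 \<and> (\<forall>x\<in>ball a r. ((\<lambda>\<alpha>. c \<alpha> * (\<Prod>i\<in>UNIV. (x $ i - a $ i) ^ \<alpha> i)) has_sum f x) UNIV)"
  then obtain c :: "('n \<Rightarrow> nat) \<Rightarrow> 'k" and r where r: "r > 0"
    and c: "\<And>x. x \<in> ball a r \<Longrightarrow> ((\<lambda>\<alpha>. c \<alpha> * (\<Prod>i\<in>UNIV. (x $ i - a $ i) ^ \<alpha> i)) has_sum f x) UNIV" by blast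
  have "\<forall>\<^sub>F x in nhds a. x \<in> ball a r" using r by (intro eventually_nhds_in_open) auto
  then obtain \<rho> where \<rho>: "\<rho> > 0" "\<And>x. x \<in> polydisc a \<rho> \<Longrightarrow> x \<in> ball a r"
    unfolding eventually_nhds_polydisc by blast
  have c': "((\<lambda>\<alpha>. c \<alpha> * mpow (x - a) \<alpha>) has_sum f x) UNIV" if "x \<in> polydisc a \<rho>" for x
    using c[OF \<rho>(2)[OF that]] by (simp add: mpow_def)
  \<comment> \<open>At this corner of the polydisc every monomial attains its maximal absolute value
    \<rho>^|\<alpha>|, so absolute summability there is the weighted summability of the
    coefficients.\<close>
  define y where "y = (\<chi> i. a $ i + of_real \<rho>)"
  have y: "y \<in> polydisc a \<rho>" using \<rho>(1) by (simp add: polydisc_def y_def)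
  have "norm (c \<alpha> * mpow (y - a) \<alpha>) = norm (c \<alpha>) * \<rho> ^ mdeg \<alpha>" for \<alpha>
    using \<rho>(1) by (simp add: mpow_def y_def norm_mult norm_power mdeg_def power_sum flip: prod_norm)
  hence "(\<lambda>\<alpha>. norm (c \<alpha>) * \<rho> ^ mdeg \<alpha>) summable_on UNIV"
    using summable_on_imp_norm_summable_on[OF has_sum_imp_summable[OF c'[OF y]]] by simp
  hence "has_expansion a \<rho> c f" using \<rho>(1) c' by (simp add: has_expansion_def)
  thus "analytic_germ a f" by (rule analytic_germI)
next
  fix a assume "analytic_germ a f"
  then obtain \<rho> c where c: "has_expansion a \<rho> c f" by (rule analytic_germE)
  have "((\<lambda>\<alpha>. c \<alpha> * (\<Prod>i\<in>UNIV. (x $ i - a $ i) ^ \<alpha> i)) has_sum f x) UNIV" if "x \<in> ball a \<rho>" for x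
    using has_expansionD(3)[OF c, of x] subsetD[OF cball_subset_polydisc[of a \<rho>], of x] that by (simp add: mpow_def)
  thus "\<exists>c r. r > 0 \<and> (\<forall>x\<in>ball a r. ((\<lambda>\<alpha>. c \<alpha> * (\<Prod>i\<in>UNIV. (x $ i - a $ i) ^ \<alpha> i)) has_sum f x) UNIV)"
    using has_expansionD(1)[OF c] by blast
qed

lemma chart_open_image:
  assumes "chart U \<phi>" "open W" "W \<subseteq> U" shows "open (\<phi> ` W)"
proof -
  have h: "homeomorphism U (\<phi> ` U) \<phi> (inv_into U \<phi>)" and o: "open U" "open (\<phi> ` U)" using assms(1) by (auto simp: chart_def)
  have "openin (top_of_set U) W" using assms(2,3) o(1) by (simp add: openin_open_eq)
  from homeomorphism_imp_open_map[OF h this] show ?thesis using o(2) by (simp add: openin_open_eq)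
qed

lemma chart_open_preimage:
  assumes "chart U \<phi>" "open V" shows "open {m \<in> U. \<phi> m \<in> V}"
proof -
  have "homeomorphism U (\<phi> ` U) \<phi> (inv_into U \<phi>)" and o: "open U" using assms(1) by (auto simp: chart_def)
  hence "continuous_on U \<phi>" by (simp add: homeomorphism_def)
  from continuous_open_preimage[OF this o assms(2)] show ?thesis by (simp add: vimage_def Int_def)
qed

locale manifold_chart =
  fixes A :: "('m::{t2_space, second_countable_topology}, 'k::real_or_complex, 'n::finite) atlas" and U and \<phi> :: "'m \<Rightarrow> 'k ^ 'n"
  assumes man: "analytic_manifold A" and in_atlas: "(U, \<phi>) \<in> A"
begin

abbreviation "\<phi>' \<equiv> inv_into U \<phi>"

lemma chart: "chart U \<phi>" using man in_atlas by (auto simp: analytic_manifold_def)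

lemma open_U: "open U" and open_image: "open (\<phi> ` U)" and inj: "inj_on \<phi> U"
  using chart by (simp_all add: chart_def)

lemma inv_phi: "m \<in> U \<Longrightarrow> \<phi>' (\<phi> m) = m" using inj by simp

lemma phi_inv: "x \<in> \<phi> ` U \<Longrightarrow> \<phi> (\<phi>' x) = x" by (rule f_inv_into_f)

lemma inv_mem: "x \<in> \<phi> ` U \<Longrightarrow> \<phi>' x \<in> U" by (rule inv_into_into)

lemma transition:
  assumes "(V, \<eta>) \<in> A" "m \<in> U \<inter> V" shows "analytic_germ (\<eta> m) (\<lambda>x. \<phi> (inv_into V \<eta> x) $ i)"
  using man in_atlas assms unfolding analytic_manifold_def analytic_transition_def power_series_on_iff by blast

lemma chart_change:
  assumes V: "(V, \<eta>) \<in> A" and W: "open W" "W \<subseteq> U"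
  shows "open (\<eta> ` (V \<inter> W))" "x \<in> \<eta> ` (V \<inter> W) \<Longrightarrow> inv_into V \<eta> x \<in> V \<inter> W \<and> \<eta> (inv_into V \<eta> x) = x"
proof -
  have c: "chart V \<eta>" using man V by (auto simp: analytic_manifold_def)
  show "open (\<eta> ` (V \<inter> W))"
    by (rule chart_open_image[OF c]) (use c W in \<open>auto simp: chart_def\<close>)
  show "inv_into V \<eta> x \<in> V \<inter> W \<and> \<eta> (inv_into V \<eta> x) = x" if "x \<in> \<eta> ` (V \<inter> W)"
    using that c by (auto simp: chart_def)
qed

text \<open>One chart containing \<open>W\<close> decides for all charts, because the transition
  maps are analytic and thus smooth.\<close>

lemma smooth_fun_iff:
  assumes W: "open W" "W \<subseteq> U"
  shows "smooth_fun A W f \<longleftrightarrow> smooth_on (\<phi> ` W) (f \<circ> \<phi>')"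
proof
  assume "smooth_fun A W f"
  moreover have "U \<inter> W = W" using W by blast
  ultimately show "smooth_on (\<phi> ` W) (f \<circ> \<phi>')" using in_atlas unfolding smooth_fun_def by fastforce
next
  assume f: "smooth_on (\<phi> ` W) (f \<circ> \<phi>')"
  show "smooth_fun A W f" unfolding smooth_fun_def
  proof clarify
    fix V \<eta> assume V: "(V, \<eta>) \<in> A"
    note cc = chart_change[OF V W]
    have "smooth_on (\<eta> ` (V \<inter> W)) (\<lambda>x. (f \<circ> \<phi>') (\<chi> i. \<phi> (inv_into V \<eta> x) $ i))"
    proof (rule smooth_on_compose[OF chart_open_image[OF chart W] cc(1) _ _ f])
      show "smooth_on (\<eta> ` (V \<inter> W)) (\<lambda>x. \<phi> (inv_into V \<eta> x) $ i)" for i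
        by (rule smooth_on_analytic[OF cc(1)]) (use W transition[OF V] in auto)
      show "(\<chi> i. \<phi> (inv_into V \<eta> x) $ i) \<in> \<phi> ` W" if "x \<in> \<eta> ` (V \<inter> W)" for x
        using cc(2)[OF that] by simp
    qed
    thus "smooth_on (\<eta> ` (V \<inter> W)) (f \<circ> inv_into V \<eta>)"
    proof (rule smooth_on_cong[OF cc(1), rotated])
      show "(f \<circ> \<phi>') (\<chi> i. \<phi> (inv_into V \<eta> x) $ i) = (f \<circ> inv_into V \<eta>) x" if "x \<in> \<eta> ` (V \<inter> W)" for x
        using cc(2)[OF that] inv_phi[of "inv_into V \<eta> x"] W(2) by auto
    qed
  qed
qed

lemma analytic_fun_iff:
  assumes W: "open W" "W \<subseteq> U"
  shows "analytic_fun A W f \<longleftrightarrow> (\<forall>m\<in>W. analytic_germ (\<phi> m) (f \<circ> \<phi>'))"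
proof
  assume "analytic_fun A W f"
  moreover have "U \<inter> W = W" using W by blast
  ultimately show "\<forall>m\<in>W. analytic_germ (\<phi> m) (f \<circ> \<phi>')"
    using in_atlas unfolding analytic_fun_def power_series_on_iff by fastforce
next
  assume f: "\<forall>m\<in>W. analytic_germ (\<phi> m) (f \<circ> \<phi>')"
  show "analytic_fun A W f" unfolding analytic_fun_def power_series_on_iff
  proof clarify
    fix V \<eta> x assume V: "(V, \<eta>) \<in> A" and x: "x \<in> V" "x \<in> W"
    note cc = chart_change[OF V W]
    have 1: "inv_into V \<eta> (\<eta> x) = x"
      using man V x by (auto simp: analytic_manifold_def chart_def)
    have "analytic_germ (\<eta> x) (\<lambda>y. (f \<circ> \<phi>') (\<chi> i. \<phi> (inv_into V \<eta> y) $ i))"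
    proof (rule analytic_germ_compose)
      show "analytic_germ (\<phi> x) (f \<circ> \<phi>')" using f x by blast
      show "analytic_germ (\<eta> x) (\<lambda>y. \<phi> (inv_into V \<eta> y) $ i)" for i
        by (rule transition[OF V]) (use x W in auto)
      show "\<phi> (inv_into V \<eta> (\<eta> x)) $ i = \<phi> x $ i" for i by (simp add: 1)
    qed
    moreover have "\<forall>\<^sub>F y in nhds (\<eta> x). (f \<circ> \<phi>') (\<chi> i. \<phi> (inv_into V \<eta> y) $ i) = (f \<circ> inv_into V \<eta>) y"
    proof (rule eventually_nhds_openI[OF cc(1)])
      show "(f \<circ> \<phi>') (\<chi> i. \<phi> (inv_into V \<eta> y) $ i) = (f \<circ> inv_into V \<eta>) y" if "y \<in> \<eta> ` (V \<inter> W)" for y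
        using cc(2)[OF that] inv_phi[of "inv_into V \<eta> y"] W(2) by auto
    qed (use x in auto)
    ultimately show "analytic_germ (\<eta> x) (f \<circ> inv_into V \<eta>)" by (rule analytic_germ_cong)
  qed
qed

end

section \<open>Poisson brackets in a chart\<close>

lemma
  assumes B: "poisson_bracket A B" and W: "open W"
    and f: "smooth_fun A W f" and g: "smooth_fun A W g" and h: "smooth_fun A W h"
  shows poisson_smooth: "smooth_fun A W (B f g)"
    and poisson_local: "(\<And>m. m \<in> W \<Longrightarrow> f' m = f m) \<Longrightarrow> m \<in> W \<Longrightarrow> B f' g m = B f g m"
    and poisson_skew: "m \<in> W \<Longrightarrow> B f g m = - B g f m"
    and poisson_linear: "m \<in> W \<Longrightarrow> B (\<lambda>x. c * f x + g x) h m = c * B f h m + B g h m"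
    and poisson_leibniz: "m \<in> W \<Longrightarrow> B (\<lambda>x. f x * g x) h m = f m * B g h m + B f h m * g m"
    and poisson_jacobi: "m \<in> W \<Longrightarrow> B f (B g h) m + B g (B h f) m + B h (B f g) m = 0"
  using B[unfolded poisson_bracket_def, rule_format, OF W f g h] by blast+

text \<open>The Leibniz rule for 0 * 0 and for 1 * 1 settles the constants 0 and 1; linearity does
  the rest.\<close>

lemma poisson_const:
  assumes B: "poisson_bracket A B" and W: "open W" "m \<in> W"
    and c: "\<And>c. smooth_fun A W (\<lambda>_. c)" and h: "smooth_fun A W h"
  shows "B (\<lambda>_. c) h m = 0"
proof -
  have 0: "B (\<lambda>_. 0) h m = 0" using poisson_leibniz[OF B W(1) c c h W(2), of 0 0] by simp
  have 1: "B (\<lambda>_. 1) h m = 0" using poisson_leibniz[OF B W(1) c c h W(2), of 1 1] by simp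
  show ?thesis using poisson_linear[OF B W(1) c c h W(2), of c 1 0] by (simp add: 0 1)
qed

lemma smooth_on_sum:
  "open S \<Longrightarrow> (\<And>j. j \<in> J \<Longrightarrow> smooth_on S (f j)) \<Longrightarrow> smooth_on S (\<lambda>x. \<Sum>j\<in>J. f j x)"
  unfolding smooth_on_def by (blast intro: C_k_on_sum)

context manifold_chart
begin

definition structure_functions :: "('m, 'k) bracket \<Rightarrow> 'n \<Rightarrow> 'n \<Rightarrow> 'k ^ 'n \<Rightarrow> 'k" where
  "structure_functions B i j x = B (\<lambda>m. \<phi> m $ i) (\<lambda>m. \<phi> m $ j) (\<phi>' x)"

lemma smooth_fun_pull:
  assumes "open W" "W \<subseteq> U" "smooth_on (\<phi> ` W) f" shows "smooth_fun A W (\<lambda>m. f (\<phi> m))"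
  unfolding smooth_fun_iff[OF assms(1,2)]
  by (rule smooth_on_cong[OF chart_open_image[OF chart assms(1,2)] _ assms(3)]) (use assms(2) inv_phi in auto)

lemma smooth_fun_const: "open W \<Longrightarrow> W \<subseteq> U \<Longrightarrow> smooth_fun A W (\<lambda>_. c)"
  using smooth_fun_pull[of W "\<lambda>_. c"] by (simp add: smooth_on_const)

lemma smooth_on_coord: "open S \<Longrightarrow> smooth_on S (\<lambda>x :: 'k ^ 'n. x $ i)"
  by (rule smooth_on_analytic) (auto intro: agerm)

lemma smooth_fun_coord: "open W \<Longrightarrow> W \<subseteq> U \<Longrightarrow> smooth_fun A W (\<lambda>m. \<phi> m $ i)"
  by (rule smooth_fun_pull) (auto intro!: smooth_on_coord chart_open_image[OF chart])

lemma smooth_fun_subset: "smooth_fun A W f \<Longrightarrow> W' \<subseteq> W \<Longrightarrow> smooth_fun A W' f"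
  unfolding smooth_fun_def by (fast intro: smooth_on_subset)

lemma pull_back: "W \<subseteq> U \<Longrightarrow> m \<in> W \<Longrightarrow> (f \<circ> \<phi>') (\<phi> m) = f m"
  using inv_phi by auto

lemma ball_chart:
  assumes W: "open W" "W \<subseteq> U" "m \<in> W"
  obtains r W' where "r > 0" "open W'" "W' \<subseteq> W" "m \<in> W'" "\<phi> ` W' = ball (\<phi> m) r"
proof -
  obtain r where r: "r > 0" "ball (\<phi> m) r \<subseteq> \<phi> ` W"
    using chart_open_image[OF chart W(1,2)] W(3) open_contains_ball by blast
  define W' where "W' = {m' \<in> U. \<phi> m' \<in> ball (\<phi> m) r} \<inter> W"
  have "open W'" unfolding W'_def by (intro open_Int chart_open_preimage[OF chart] W(1)) simp
  moreover have "\<phi> ` W' = ball (\<phi> m) r" using r(2) W(2) unfolding W'_def by (auto simp del: mem_ball)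
  ultimately show ?thesis using r W by (intro that[of r W']) (auto simp: W'_def)
qed

text \<open>By Hadamard's lemma a derivation is determined by its values on the coordinates.\<close>

lemma bracket_left:
  assumes B: "poisson_bracket A B" and W: "open W" "W \<subseteq> U" "m \<in> W"
    and f: "smooth_fun A W f" and h: "smooth_fun A W h"
  shows "B f h m = (\<Sum>i\<in>UNIV. partial_deriv i (f \<circ> \<phi>') (\<phi> m) * B (\<lambda>m. \<phi> m $ i) h m)"
proof -
  obtain r W' where r: "r > 0" and W': "open W'" "W' \<subseteq> W" "m \<in> W'" "\<phi> ` W' = ball (\<phi> m) r"
    by (rule ball_chart[OF W])
  have W'U: "W' \<subseteq> U" using W' W by blast
  define a where "a = \<phi> m"
  have f': "smooth_fun A W' f" and h': "smooth_fun A W' h" using f h W' smooth_fun_subset by blast+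
  have "smooth_on (ball a r) (f \<circ> \<phi>')" using f' smooth_fun_iff[OF W'(1) W'U, of f] by (simp add: W'(4) a_def)
  then obtain g where g: "\<And>i. smooth_on (ball a r) (g i)"
    "\<And>x. x \<in> ball a r \<Longrightarrow> (f \<circ> \<phi>') x = (f \<circ> \<phi>') a + (\<Sum>i\<in>UNIV. (x $ i - a $ i) * g i x)"
    using hadamard[OF open_ball convex_ball _ , of a a r "f \<circ> \<phi>'"] r by auto
  have fg: "f m' = f m + (\<Sum>i\<in>UNIV. (\<phi> m' $ i - a $ i) * g i (\<phi> m'))" if "m' \<in> W'" for m'
  proof -
    have "\<phi> m' \<in> ball a r" using W'(4) that a_def by blast
    from g(2)[OF this] show ?thesis
      unfolding a_def pull_back[OF W'U that, of f] pull_back[OF W'U W'(3), of f] .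
  qed
  have pd: "partial_deriv l (f \<circ> \<phi>') a = g l a" for l
  proof -
    have kg: "kdiff (g i) a" for i by (rule smooth_on_kdiff[OF open_ball g(1)]) (use r in simp)
    have "partial_deriv l (f \<circ> \<phi>') a = partial_deriv l (\<lambda>x. (f \<circ> \<phi>') a + (\<Sum>i\<in>UNIV. (x $ i - a $ i) * g i x)) a"
      by (rule eventually_eq_imp_partial_deriv_eq, rule eventually_nhds_openI[OF open_ball _ g(2)]) (use r in auto)
    also have "\<dots> = (\<Sum>i\<in>UNIV. (if l = i then 1 else 0) * g i a)"
      using kg by (simp add: partial_deriv_add partial_deriv_sum partial_deriv_mult partial_deriv_diff
          kdiff_sum kdiff_mult kdiff_diff partial_deriv_coord eq_commute)
    finally show ?thesis by (simp add: if_distrib[of "\<lambda>c. c * _"] cong: if_cong)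
  qed
  define T where "T i m' = (\<phi> m' $ i - a $ i) * g i (\<phi> m')" for i m'
  have sg: "smooth_fun A W' (\<lambda>m'. g i (\<phi> m'))" for i
    by (rule smooth_fun_pull[OF W'(1) W'U]) (use g(1) W'(4) a_def in simp)
  have sx: "smooth_fun A W' (\<lambda>m'. \<phi> m' $ i - a $ i)" for i
  proof (rule smooth_fun_pull[OF W'(1) W'U])
    show "smooth_on (\<phi> ` W') (\<lambda>x. x $ i - a $ i)"
      by (rule smooth_on_analytic[OF chart_open_image[OF chart W'(1) W'U]]) (intro agerm)
  qed
  have c': "smooth_fun A W' (\<lambda>_. c)" for c by (rule smooth_fun_const[OF W'(1) W'U])
  have sd: "smooth_on (ball a r) (\<lambda>x. x $ i - a $ i)" for i
    by (rule smooth_on_analytic[OF open_ball]) (intro agerm)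
  have sT: "smooth_fun A W' (T i)" for i
    unfolding T_def[abs_def]
    by (rule smooth_fun_pull[OF W'(1) W'U, of "\<lambda>x. (x $ i - a $ i) * g i x"])
      (unfold W'(4) a_def[symmetric], intro smooth_on_mult open_ball sd g(1))
  have sS: "smooth_fun A W' (\<lambda>m'. \<Sum>i\<in>I. T i m')" for I
    unfolding T_def
  proof (rule smooth_fun_pull[OF W'(1) W'U, of "\<lambda>x. \<Sum>i\<in>I. (x $ i - a $ i) * g i x"], unfold W'(4) a_def[symmetric])
    show "smooth_on (ball a r) (\<lambda>x. \<Sum>i\<in>I. (x $ i - a $ i) * g i x)"
      by (intro smooth_on_sum open_ball smooth_on_mult sd g(1))
  qed
  have lin: "B (\<lambda>m'. F m' + G m') h m = B F h m + B G h m" if "smooth_fun A W' F" "smooth_fun A W' G" for F G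
    using poisson_linear[OF B W'(1) that h' W'(3), of 1] by simp
  \<comment> \<open>The factor \<open>\<phi> m' $ i - a $ i\<close> vanishes at \<open>m\<close>, so
    one of the two Leibniz terms drops out.\<close>
  have TT: "B (T i) h m = g i a * B (\<lambda>m. \<phi> m $ i) h m" for i
  proof -
    have "B (\<lambda>m'. \<phi> m' $ i - a $ i) h m = B (\<lambda>m'. \<phi> m' $ i + - (a $ i)) h m" by simp
    also have "\<dots> = B (\<lambda>m'. \<phi> m' $ i) h m"
      using lin[OF smooth_fun_coord[OF W'(1) W'U] c', of i "- (a $ i)"] poisson_const[OF B W'(1,3) c' h'] by simp
    finally have 1: "B (\<lambda>m'. \<phi> m' $ i - a $ i) h m = B (\<lambda>m'. \<phi> m' $ i) h m" .
    show ?thesis unfolding T_def[abs_def]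
      using poisson_leibniz[OF B W'(1) sx sg h' W'(3), of i i, unfolded 1] by (simp add: a_def)
  qed
  have SS: "B (\<lambda>m'. \<Sum>i\<in>I. T i m') h m = (\<Sum>i\<in>I. B (T i) h m)" if "finite I" for I
    using that
  proof (induction I)
    case empty
    show ?case using poisson_const[OF B W'(1,3) c' h', of 0] by simp
  next
    case (insert i I)
    thus ?case using lin[OF sT sS, of i I] by simp
  qed
  have "B f h m = B (\<lambda>m'. f m + (\<Sum>i\<in>UNIV. T i m')) h m"
  proof (rule poisson_local[OF B W'(1) _ h' h' _ W'(3)])
    show "smooth_fun A W' (\<lambda>m'. f m + (\<Sum>i\<in>UNIV. T i m'))"
      unfolding T_def
    proof (rule smooth_fun_pull[OF W'(1) W'U, of "\<lambda>x. f m + (\<Sum>i\<in>UNIV. (x $ i - a $ i) * g i x)"], unfold W'(4) a_def[symmetric])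
      show "smooth_on (ball a r) (\<lambda>x. f m + (\<Sum>i\<in>UNIV. (x $ i - a $ i) * g i x))"
        by (intro smooth_on_add smooth_on_const smooth_on_sum open_ball smooth_on_mult sd g(1))
    qed
    show "f m' = f m + (\<Sum>i\<in>UNIV. T i m')" if "m' \<in> W'" for m' using fg[OF that] by (simp add: T_def)
  qed
  also have "\<dots> = (\<Sum>i\<in>UNIV. B (T i) h m)"
    using lin[OF c' sS, of "f m" UNIV] SS[of UNIV] poisson_const[OF B W'(1,3) c' h'] by simp
  finally show ?thesis unfolding TT unfolding pd[symmetric] unfolding a_def .
qed

lemma bracket_coordinates:
  assumes B: "poisson_bracket A B" and W: "open W" "W \<subseteq> U" "m \<in> W"
    and f: "smooth_fun A W f" and g: "smooth_fun A W g"
  shows "B f g m = br (structure_functions B) (f \<circ> \<phi>') (g \<circ> \<phi>') (\<phi> m)"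
proof -
  have s: "smooth_fun A W (\<lambda>m. \<phi> m $ i)" for i by (rule smooth_fun_coord[OF W(1,2)])
  have "B (\<lambda>m. \<phi> m $ i) g m = (\<Sum>j\<in>UNIV. structure_functions B i j (\<phi> m) * partial_deriv j (g \<circ> \<phi>') (\<phi> m))" for i
  proof -
    have "B (\<lambda>m. \<phi> m $ i) g m = - B g (\<lambda>m. \<phi> m $ i) m" by (rule poisson_skew[OF B W(1) s g g W(3)])
    also have "B g (\<lambda>m. \<phi> m $ i) m = (\<Sum>j\<in>UNIV. partial_deriv j (g \<circ> \<phi>') (\<phi> m) * B (\<lambda>m. \<phi> m $ j) (\<lambda>m. \<phi> m $ i) m)"
      by (rule bracket_left[OF B W g s])
    also have "- \<dots> = (\<Sum>j\<in>UNIV. partial_deriv j (g \<circ> \<phi>') (\<phi> m) * - B (\<lambda>m. \<phi> m $ j) (\<lambda>m. \<phi> m $ i) m)"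
      by (simp add: sum_negf)
    also have "\<dots> = (\<Sum>j\<in>UNIV. structure_functions B i j (\<phi> m) * partial_deriv j (g \<circ> \<phi>') (\<phi> m))"
    proof (rule sum.cong[OF refl])
      fix j
      have "B (\<lambda>m. \<phi> m $ i) (\<lambda>m. \<phi> m $ j) m = - B (\<lambda>m. \<phi> m $ j) (\<lambda>m. \<phi> m $ i) m"
        by (rule poisson_skew[OF B W(1) s s g W(3)])
      moreover have "\<phi>' (\<phi> m) = m" using inv_phi W by blast
      ultimately show "partial_deriv j (g \<circ> \<phi>') (\<phi> m) * - B (\<lambda>m. \<phi> m $ j) (\<lambda>m. \<phi> m $ i) m =
          structure_functions B i j (\<phi> m) * partial_deriv j (g \<circ> \<phi>') (\<phi> m)"
        by (simp add: structure_functions_def)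
    qed
    finally show ?thesis .
  qed
  thus ?thesis unfolding bracket_left[OF B W f g] br_alt' by simp
qed

lemma bracket_pull:
  assumes B: "poisson_bracket A B" and W: "open W" "W \<subseteq> U" "m \<in> W"
    and f: "smooth_on (\<phi> ` W) f" and g: "smooth_on (\<phi> ` W) g"
  shows "B (\<lambda>m. f (\<phi> m)) (\<lambda>m. g (\<phi> m)) m = br (structure_functions B) f g (\<phi> m)"
proof -
  have e: "\<forall>\<^sub>F x in nhds (\<phi> m). ((\<lambda>m. F (\<phi> m)) \<circ> \<phi>') x = F x" for F :: "'k ^ 'n \<Rightarrow> 'k"
    by (rule eventually_nhds_openI[OF open_image]) (use W phi_inv in auto)
  show ?thesis
    unfolding bracket_coordinates[OF B W smooth_fun_pull[OF W(1,2) f] smooth_fun_pull[OF W(1,2) g]]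
    by (rule eventually_nhds_x_imp_x[OF br_cong_eventually[OF e e]])
qed

lemma structure_functions_skew:
  assumes "poisson_bracket A B" "x \<in> \<phi> ` U"
  shows "structure_functions B i j x = - structure_functions B j i x"
  unfolding structure_functions_def
  by (rule poisson_skew[OF assms(1) open_U smooth_fun_coord smooth_fun_coord smooth_fun_coord inv_mem[OF assms(2)]])
    (auto intro: open_U)

lemma structure_functions_analytic:
  assumes "analytic_bracket A B" "x \<in> \<phi> ` U"
  shows "analytic_germ x (structure_functions B i j)"
proof -
  have "analytic_fun A U (\<lambda>m. \<phi> m $ i)" for i
    unfolding analytic_fun_iff[OF open_U order.refl]
  proof
    fix m assume m: "m \<in> U"
    have 1: "\<forall>\<^sub>F x in nhds (\<phi> m). x $ i = ((\<lambda>m. \<phi> m $ i) \<circ> \<phi>') x"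
      by (rule eventually_nhds_openI[OF open_image]) (use m phi_inv in auto)
    show "analytic_germ (\<phi> m) ((\<lambda>m. \<phi> m $ i) \<circ> \<phi>')"
      by (rule analytic_germ_cong[OF _ 1]) (intro agerm)
  qed
  hence "analytic_fun A U (B (\<lambda>m. \<phi> m $ i) (\<lambda>m. \<phi> m $ j))"
    using assms(1) open_U unfolding analytic_bracket_def by blast
  hence "analytic_germ x (B (\<lambda>m. \<phi> m $ i) (\<lambda>m. \<phi> m $ j) \<circ> \<phi>')"
    unfolding analytic_fun_iff[OF open_U order.refl] using assms(2) by blast
  moreover have "structure_functions B i j = B (\<lambda>m. \<phi> m $ i) (\<lambda>m. \<phi> m $ j) \<circ> \<phi>'"
    by (simp add: structure_functions_def fun_eq_iff)
  ultimately show ?thesis by simp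
qed

text \<open>The inner bracket is smooth on a neighbourhood and agrees there with its coordinate
  expression, so the outer bracket can be computed in coordinates too.\<close>

lemma structure_functions_jacobi:
  assumes B: "poisson_bracket A B" and m: "m \<in> U"
    and f: "analytic_germ (\<phi> m) f" and g: "analytic_germ (\<phi> m) g" and h: "analytic_germ (\<phi> m) h"
  defines "\<pi> \<equiv> structure_functions B"
  shows "\<forall>\<^sub>F x in nhds (\<phi> m). br \<pi> f (br \<pi> g h) x + br \<pi> g (br \<pi> h f) x + br \<pi> h (br \<pi> f g) x = 0"
proof -
  have "\<forall>\<^sub>F x in nhds (\<phi> m). analytic_germ x f \<and> analytic_germ x g \<and> analytic_germ x h"
    by (intro eventually_conj eventually_analytic_germ f g h)
  then obtain S where S: "open S" "\<phi> m \<in> S" "\<And>x. x \<in> S \<Longrightarrow> analytic_germ x f \<and> analytic_germ x g \<and> analytic_germ x h"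
    unfolding eventually_nhds by blast
  define W where "W = {m' \<in> U. \<phi> m' \<in> S}"
  have W: "open W" "W \<subseteq> U" "m \<in> W" using m S chart_open_preimage[OF chart S(1)] by (auto simp: W_def)
  have oW: "open (\<phi> ` W)" by (rule chart_open_image[OF chart W(1,2)])
  have an: "analytic_germ x f" "analytic_germ x g" "analytic_germ x h" if "x \<in> \<phi> ` W" for x
    using that S(3) by (auto simp: W_def)
  have sm: "smooth_on (\<phi> ` W) f" "smooth_on (\<phi> ` W) g" "smooth_on (\<phi> ` W) h"
    using an smooth_on_analytic[OF oW] by blast+
  have two: "B (\<lambda>m. f1 (\<phi> m)) (B (\<lambda>m. f2 (\<phi> m)) (\<lambda>m. f3 (\<phi> m))) m' = br \<pi> f1 (br \<pi> f2 f3) (\<phi> m')"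
    if m': "m' \<in> W" and f: "smooth_on (\<phi> ` W) f1" "smooth_on (\<phi> ` W) f2" "smooth_on (\<phi> ` W) f3" for f1 f2 f3 m'
  proof -
    note s = smooth_fun_pull[OF W(1,2) f(1)] smooth_fun_pull[OF W(1,2) f(2)] smooth_fun_pull[OF W(1,2) f(3)]
    have s23: "smooth_fun A W (B (\<lambda>m. f2 (\<phi> m)) (\<lambda>m. f3 (\<phi> m)))" by (rule poisson_smooth[OF B W(1) s(2,3,3)])
    have e1: "\<forall>\<^sub>F x in nhds (\<phi> m'). ((\<lambda>m. f1 (\<phi> m)) \<circ> \<phi>') x = f1 x"
      by (rule eventually_nhds_openI[OF open_image]) (use W m' phi_inv in auto)
    have e2: "\<forall>\<^sub>F x in nhds (\<phi> m'). (B (\<lambda>m. f2 (\<phi> m)) (\<lambda>m. f3 (\<phi> m)) \<circ> \<phi>') x = br \<pi> f2 f3 x"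
    proof (rule eventually_nhds_openI[OF oW])
      fix x assume x: "x \<in> \<phi> ` W"
      hence "\<phi>' x \<in> W" "\<phi> (\<phi>' x) = x" using W(2) inv_phi phi_inv by auto
      thus "(B (\<lambda>m. f2 (\<phi> m)) (\<lambda>m. f3 (\<phi> m)) \<circ> \<phi>') x = br \<pi> f2 f3 x"
        using bracket_pull[OF B W(1,2) _ f(2,3), of "\<phi>' x"] by (simp add: \<pi>_def)
    qed (use m' in auto)
    show ?thesis
      unfolding bracket_coordinates[OF B W(1,2) m' s(1) s23] \<pi>_def[symmetric]
      by (rule eventually_nhds_x_imp_x[OF br_cong_eventually[OF e1 e2]])
  qed
  have "br \<pi> f (br \<pi> g h) (\<phi> m') + br \<pi> g (br \<pi> h f) (\<phi> m') + br \<pi> h (br \<pi> f g) (\<phi> m') = 0" if "m' \<in> W" for m'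
    unfolding two[OF that sm(1,2,3), symmetric] two[OF that sm(2,3,1), symmetric] two[OF that sm(3,1,2), symmetric]
    by (rule poisson_jacobi[OF B W(1) smooth_fun_pull[OF W(1,2) sm(1)] smooth_fun_pull[OF W(1,2) sm(2)] smooth_fun_pull[OF W(1,2) sm(3)] that])
  thus ?thesis by (intro eventually_nhds_openI[OF oW]) (use W in auto)
qed

text \<open>The mixed identity is what the Jacobi identity of the sum of the brackets leaves after
  those of the two summands are subtracted.\<close>

lemma bihamiltonian_germ_structure_functions:
  assumes "bihamiltonian A B1 B2" "analytic_bracket A B1" "analytic_bracket A B2" and m: "m \<in> U"
  shows "bihamiltonian_germ (\<phi> m) (structure_functions B1) (structure_functions B2)"
proof -
  have B: "poisson_bracket A B1" "poisson_bracket A B2" "poisson_bracket A (bracket_comb 1 1 B1 B2)"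
    using assms(1) by (simp_all add: bihamiltonian_def)
  let ?p = "structure_functions B1" and ?q = "structure_functions B2" and ?s = "structure_functions (bracket_comb 1 1 B1 B2)"
  have s: "br ?s f g x = br ?p f g x + br ?q f g x" for f g x
    by (simp add: br_def structure_functions_def bracket_comb_def distrib_right sum.distrib)
  have oU: "\<forall>\<^sub>F x in nhds (\<phi> m). x \<in> \<phi> ` U" by (rule eventually_nhds_in_open[OF open_image]) (use m in auto)
  have an: "analytic_germ (\<phi> m) (?p i j)" "analytic_germ (\<phi> m) (?q i j)" for i j
    by (rule structure_functions_analytic[OF assms(2)] structure_functions_analytic[OF assms(3)]; use m in blast)+
  show ?thesis
  proof
    show "analytic_germ (\<phi> m) (?p i j)" "analytic_germ (\<phi> m) (?q i j)" for i j by (rule an)+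
    show "\<forall>\<^sub>F x in nhds (\<phi> m). \<forall>i j. ?p i j x = - ?p j i x"
      using oU by eventually_elim (intro allI structure_functions_skew[OF B(1)])
    show "\<forall>\<^sub>F x in nhds (\<phi> m). \<forall>i j. ?q i j x = - ?q j i x"
      using oU by eventually_elim (intro allI structure_functions_skew[OF B(2)])
    fix f g h assume an3: "analytic_germ (\<phi> m) f" "analytic_germ (\<phi> m) g" "analytic_germ (\<phi> m) h"
    note J = structure_functions_jacobi[OF B(1) m an3] structure_functions_jacobi[OF B(2) m an3]
      structure_functions_jacobi[OF B(3) m an3]
    show "\<forall>\<^sub>F x in nhds (\<phi> m). br ?p f (br ?p g h) x + br ?p g (br ?p h f) x + br ?p h (br ?p f g) x = 0" by (rule J)
    show "\<forall>\<^sub>F x in nhds (\<phi> m). br ?q f (br ?q g h) x + br ?q g (br ?q h f) x + br ?q h (br ?q f g) x = 0" by (rule J)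
    have k: "\<forall>\<^sub>F x in nhds (\<phi> m). kdiff (br ?p F G) x \<and> kdiff (br ?q F G) x"
      if "analytic_germ (\<phi> m) F" "analytic_germ (\<phi> m) G" for F G
    proof -
      have "analytic_germ (\<phi> m) (br ?p F G)" "analytic_germ (\<phi> m) (br ?q F G)"
        by (intro analytic_germ_br an that)+
      from eventually_analytic_germ[OF this(1)] eventually_analytic_germ[OF this(2)]
      show ?thesis by eventually_elim (simp add: analytic_germ_kdiff)
    qed
    have s2: "br ?s F (br ?s G H) x = br ?p F (br ?p G H) x + br ?p F (br ?q G H) x + (br ?q F (br ?p G H) x + br ?q F (br ?q G H) x)"
      if "kdiff (br ?p G H) x \<and> kdiff (br ?q G H) x" for F G H x
    proof -
      have "br ?s G H = (\<lambda>x. br ?p G H x + br ?q G H x)" by (simp add: s fun_eq_iff)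
      thus ?thesis using that by (simp add: s br_add_right)
    qed
    show "\<forall>\<^sub>F x in nhds (\<phi> m). br ?p f (br ?q g h) x + br ?p g (br ?q h f) x + br ?p h (br ?q f g) x +
        (br ?q f (br ?p g h) x + br ?q g (br ?p h f) x + br ?q h (br ?p f g) x) = 0"
      using J k[OF an3(2,3)] k[OF an3(3,1)] k[OF an3(1,2)]
    proof eventually_elim
      case (elim x)
      show ?case using elim(1,2,3) unfolding s2[OF elim(4)] s2[OF elim(5)] s2[OF elim(6)] by algebra
    qed
  qed
qed

end

lemma constant_bracket_eq_br: "constant_bracket e s f g x = br (\<lambda>i j _. s (e i) (e j)) f g x"
  by (simp add: constant_bracket_def br_def)

text \<open>From germs back to sets. If the two inversions hold on open S1 and V1, take S to be the
  part of S1 that \<open>F\<close> maps into V1; its image is the part of V1 that \<open>G\<close>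
  maps into S1, and both are open by continuity.\<close>

lemma inverse_germs_domains:
  fixes F G :: "'n::finite \<Rightarrow> 'k::real_or_complex ^ 'n \<Rightarrow> 'k"
  assumes F: "\<And>i. analytic_germ a (F i)" and G: "\<And>i. analytic_germ b (G i)" and b: "b = (\<chi> i. F i a)"
    and FG: "\<forall>\<^sub>F y in nhds b. \<forall>i. F i (\<chi> j. G j y) = y $ i"
    and GF: "\<forall>\<^sub>F x in nhds a. \<forall>i. G i (\<chi> j. F j x) = x $ i"
    and P: "\<forall>\<^sub>F x in nhds a. P x"
  obtains S where "open S" "a \<in> S" "\<And>x. x \<in> S \<Longrightarrow> P x" "open ((\<lambda>x. \<chi> i. F i x) ` S)"
    "\<And>x i. x \<in> S \<Longrightarrow> analytic_germ x (F i)" "\<And>x. x \<in> S \<Longrightarrow> (\<chi> i. G i (\<chi> j. F j x)) = x"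
    "\<And>x i. x \<in> S \<Longrightarrow> analytic_germ (\<chi> j. F j x) (G i)"
proof -
  have "\<forall>\<^sub>F x in nhds a. P x \<and> (\<forall>i. G i (\<chi> j. F j x) = x $ i) \<and> (\<forall>i. analytic_germ x (F i))"
    by (intro eventually_conj P GF eventually_all_finite eventually_analytic_germ F)
  then obtain S1 where S1: "open S1" "a \<in> S1"
    "\<And>x. x \<in> S1 \<Longrightarrow> P x \<and> (\<forall>i. G i (\<chi> j. F j x) = x $ i) \<and> (\<forall>i. analytic_germ x (F i))"
    unfolding eventually_nhds by blast
  have "\<forall>\<^sub>F y in nhds b. (\<forall>i. F i (\<chi> j. G j y) = y $ i) \<and> (\<forall>i. analytic_germ y (G i))"
    by (intro eventually_conj FG eventually_all_finite eventually_analytic_germ G)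
  then obtain V1 where V1: "open V1" "b \<in> V1"
    "\<And>y. y \<in> V1 \<Longrightarrow> (\<forall>i. F i (\<chi> j. G j y) = y $ i) \<and> (\<forall>i. analytic_germ y (G i))"
    unfolding eventually_nhds by blast
  have cF: "continuous_on S1 (\<lambda>x. \<chi> i. F i x)"
    by (intro continuous_on_vec_lambda continuous_at_imp_continuous_on ballI analytic_germ_isCont) (use S1(3) in blast)
  have cG: "continuous_on V1 (\<lambda>y. \<chi> i. G i y)"
    by (intro continuous_on_vec_lambda continuous_at_imp_continuous_on ballI analytic_germ_isCont) (use V1(3) in blast)
  define S where "S = S1 \<inter> (\<lambda>x. \<chi> i. F i x) -` V1"
  have GFx: "(\<chi> i. G i (\<chi> j. F j x)) = x" if "x \<in> S1" for x using S1(3)[OF that] by (simp add: vec_eq_iff)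
  have FGy: "(\<chi> i. F i (\<chi> j. G j y)) = y" if "y \<in> V1" for y using V1(3)[OF that] by (simp add: vec_eq_iff)
  have im: "(\<lambda>x. \<chi> i. F i x) ` S = V1 \<inter> (\<lambda>y. \<chi> i. G i y) -` S1"
  proof (intro set_eqI iffI)
    fix y assume "y \<in> (\<lambda>x. \<chi> i. F i x) ` S"
    then obtain x where x: "x \<in> S1" "(\<chi> i. F i x) \<in> V1" "y = (\<chi> i. F i x)" by (auto simp: S_def)
    thus "y \<in> V1 \<inter> (\<lambda>y. \<chi> i. G i y) -` S1" using GFx[OF x(1)] by simp
  next
    fix y assume y: "y \<in> V1 \<inter> (\<lambda>y. \<chi> i. G i y) -` S1"
    hence "(\<chi> i. F i (\<chi> j. G j y)) = y" using FGy by blast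
    moreover from this have "(\<chi> j. G j y) \<in> S" using y by (simp add: S_def)
    ultimately show "y \<in> (\<lambda>x. \<chi> i. F i x) ` S" by (metis image_eqI)
  qed
  show ?thesis
  proof (rule that[of S])
    show "open S" unfolding S_def by (rule continuous_open_preimage[OF cF S1(1) V1(1)])
    show "a \<in> S" using S1(2) V1(2) b by (simp add: S_def)
    show "open ((\<lambda>x. \<chi> i. F i x) ` S)" unfolding im by (rule continuous_open_preimage[OF cG V1(1) S1(1)])
    show "P x" if "x \<in> S" for x using that S1(3) by (simp add: S_def)
    show "analytic_germ x (F i)" if "x \<in> S" for x i using that S1(3) by (simp add: S_def)
    show "(\<chi> i. G i (\<chi> j. F j x)) = x" if "x \<in> S" for x by (rule GFx) (use that in \<open>simp add: S_def\<close>)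
    show "analytic_germ (\<chi> j. F j x) (G i)" if "x \<in> S" for x i using that V1(3) by (simp add: S_def)
  qed
qed

section \<open>Kronecker coordinates as a chart of the manifold\<close>

context manifold_chart
begin

lemma transition':
  assumes "(V, \<eta>) \<in> A" "m \<in> U \<inter> V" shows "analytic_germ (\<phi> m) (\<lambda>x. \<eta> (\<phi>' x) $ i)"
  using man in_atlas assms unfolding analytic_manifold_def analytic_transition_def power_series_on_iff by blast

lemma kronecker_of_coordinates:
  fixes \<psi> :: "nat \<Rightarrow> 'k ^ 'n \<Rightarrow> 'k"
  assumes B: "poisson_bracket A B1" "poisson_bracket A B2" and m0: "m0 \<in> U" and odd: "odd CARD('n)"
    and an: "\<And>l. l < CARD('n) \<Longrightarrow> analytic_germ (\<phi> m0) (\<psi> l)"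
    and rel: "\<forall>\<^sub>F x in nhds (\<phi> m0). \<forall>l<CARD('n). \<forall>m<CARD('n).
      br (structure_functions B1) (\<psi> l) (\<psi> m) x = kron1 l m \<and> br (structure_functions B2) (\<psi> l) (\<psi> m) x = kron2 l m"
    and ind: "\<And>c. (\<And>b. (\<Sum>l<CARD('n). c l * partial_deriv b (\<psi> l) (\<phi> m0)) = 0) \<Longrightarrow> \<forall>l<CARD('n). c l = 0"
  shows "kronecker_of_type_near A B1 B2 CARD('n) m0"
proof -
  obtain e :: "'n \<Rightarrow> nat" where e: "bij_betw e UNIV {..<CARD('n)}"
    using ex_bij_betw_finite_nat[of "UNIV :: 'n set"] by (auto simp: atLeast0LessThan)
  have el: "e i < CARD('n)" for i using e by (auto simp: bij_betw_def)
  define F where "F i = \<psi> (e i)" for i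
  define a where "a = \<phi> m0"
  have anF: "analytic_germ a (F i)" for i unfolding F_def a_def by (rule an[OF el])
  have injc: "\<forall>i. c i = 0" if c: "\<And>b. (\<Sum>i\<in>UNIV. partial_deriv b (F i) a * c i) = 0" for c
  proof -
    define c' where "c' l = c (inv_into UNIV e l)" for l
    have c': "c' (e i) = c i" for i using e by (simp add: c'_def bij_betw_def)
    have "(\<Sum>l<CARD('n). c' l * partial_deriv b (\<psi> l) a) = 0" for b
    proof -
      have "(\<Sum>l<CARD('n). c' l * partial_deriv b (\<psi> l) a) = (\<Sum>i\<in>UNIV. c' (e i) * partial_deriv b (\<psi> (e i)) a)"
        by (rule sum.reindex_bij_betw[OF e, symmetric])
      thus ?thesis using c[of b] by (simp add: c' F_def mult.commute)
    qed
    hence "\<forall>l<CARD('n). c' l = 0" by (intro ind) (simp add: a_def)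
    thus ?thesis using el c' by metis
  qed
  \<comment> \<open>The hypothesis \<open>ind\<close> is injectivity of the transposed Jacobian; a
    two-sided inverse converts it into injectivity of the Jacobian, which the inverse function
    theorem asks for.\<close>
  obtain R where R: "\<And>i j. (\<Sum>l\<in>UNIV. R i l * partial_deriv l (F j) a) = (if i = j then 1 else 0)"
    and R': "\<And>i j. (\<Sum>l\<in>UNIV. partial_deriv i (F l) a * R l j) = (if i = j then 1 else 0)"
    using jacobian_inverse[of "\<lambda>b i. partial_deriv b (F i) a", OF injc] by blast
  have inj: "\<forall>j. v j = 0" if v: "\<And>i. (\<Sum>j\<in>UNIV. partial_deriv j (F i) a * v j) = 0" for v
  proof
    fix j
    have "v j = (\<Sum>i\<in>UNIV. v i * (\<Sum>l\<in>UNIV. partial_deriv i (F l) a * R l j))"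
      by (simp add: R' if_distrib[of "\<lambda>c. _ * c"] cong: if_cong)
    also have "\<dots> = (\<Sum>l\<in>UNIV. (\<Sum>i\<in>UNIV. partial_deriv i (F l) a * v i) * R l j)"
      unfolding sum_distrib_left sum_distrib_right by (subst sum.swap) (simp add: mult_ac)
    finally show "v j = 0" by (simp add: v)
  qed
  define b where "b = (\<chi> i. F i a)"
  obtain G where G: "\<And>i. analytic_germ b (G i)" "\<And>i. G i b = a $ i"
    "\<forall>\<^sub>F y in nhds b. \<forall>i. F i (\<chi> j. G j y) = y $ i"
    "\<forall>\<^sub>F x in nhds a. \<forall>i. G i (\<chi> j. F j x) = x $ i"
    using analytic_local_inverse[where F = F, OF anF inj b_def] by blast
  have "\<forall>\<^sub>F x in nhds a. x \<in> \<phi> ` U" by (rule eventually_nhds_in_open[OF open_image]) (use m0 a_def in auto)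
  hence "\<forall>\<^sub>F x in nhds a. x \<in> \<phi> ` U \<and> (\<forall>l<CARD('n). \<forall>m<CARD('n).
      br (structure_functions B1) (\<psi> l) (\<psi> m) x = kron1 l m \<and> br (structure_functions B2) (\<psi> l) (\<psi> m) x = kron2 l m)"
    using rel unfolding a_def by (rule eventually_conj)
  then obtain S where S: "open S" "a \<in> S" and SP: "\<And>x. x \<in> S \<Longrightarrow> x \<in> \<phi> ` U \<and> (\<forall>l<CARD('n). \<forall>m<CARD('n).
      br (structure_functions B1) (\<psi> l) (\<psi> m) x = kron1 l m \<and> br (structure_functions B2) (\<psi> l) (\<psi> m) x = kron2 l m)"
    and FS: "open ((\<lambda>x. \<chi> i. F i x) ` S)"
    and anS: "\<And>x i. x \<in> S \<Longrightarrow> analytic_germ x (F i)" and GF: "\<And>x. x \<in> S \<Longrightarrow> (\<chi> i. G i (\<chi> j. F j x)) = x"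
    and anG: "\<And>x i. x \<in> S \<Longrightarrow> analytic_germ (\<chi> j. F j x) (G i)"
    by (rule inverse_germs_domains[OF anF G(1) b_def G(3,4)]) (assumption | rule that)+
  define U' where "U' = {m \<in> U. \<phi> m \<in> S}"
  define \<psi>' where "\<psi>' m = (\<chi> i. F i (\<phi> m))" for m
  have oU': "open U'" unfolding U'_def by (rule chart_open_preimage[OF chart S(1)])
  have U'U: "U' \<subseteq> U" by (auto simp: U'_def)
  have SU: "S \<subseteq> \<phi> ` U" using SP by blast
  hence phiU': "\<phi> ` U' = S" by (auto simp: U'_def)
  have imU': "\<psi>' ` U' = (\<lambda>x. \<chi> i. F i x) ` S" unfolding \<psi>'_def phiU'[symmetric] by (simp add: image_image)
  have inv: "\<phi>' (\<chi> i. G i (\<psi>' m)) = m" if "m \<in> U'" for m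
    using GF[of "\<phi> m"] that inv_phi by (simp add: \<psi>'_def U'_def)
  have inj': "inj_on \<psi>' U'" by (rule inj_on_inverseI[where g = "\<lambda>y. \<phi>' (\<chi> i. G i y)"]) (rule inv)
  have invU': "inv_into U' \<psi>' y = \<phi>' (\<chi> i. G i y)" if "y \<in> \<psi>' ` U'" for y
    using that inj' inv by auto
  have h: "homeomorphism U (\<phi> ` U) \<phi> \<phi>'" using chart by (simp add: chart_def)
  have hom: "homeomorphism U' (\<psi>' ` U') \<psi>' (inv_into U' \<psi>')"
  proof (rule homeomorphismI)
    have cU': "continuous_on U' \<phi>" using h U'U by (auto simp: homeomorphism_def intro: continuous_on_subset)
    have cS: "continuous_on S (F i)" for i
      by (intro continuous_at_imp_continuous_on ballI analytic_germ_isCont anS)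
    have "continuous_on U' (\<lambda>m. F i (\<phi> m))" for i
      by (rule continuous_on_compose2[OF cS cU']) (simp add: phiU')
    thus "continuous_on U' \<psi>'" unfolding \<psi>'_def[abs_def] by (rule continuous_on_vec_lambda)
    have c1: "continuous_on (\<psi>' ` U') (\<lambda>y. \<chi> i. G i y)"
      unfolding imU' by (intro continuous_on_vec_lambda continuous_at_imp_continuous_on ballI analytic_germ_isCont) (use anG in auto)
    have c2: "continuous_on S \<phi>'"
      by (rule continuous_on_subset[of "\<phi> ` U"]) (use h SU in \<open>auto simp: homeomorphism_def\<close>)
    have c3: "(\<lambda>y. \<chi> i. G i y) ` (\<psi>' ` U') \<subseteq> S" unfolding imU' using GF by auto
    have "continuous_on (\<psi>' ` U') (\<lambda>y. \<phi>' (\<chi> i. G i y))" by (rule continuous_on_compose2[OF c2 c1 c3])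
    thus "continuous_on (\<psi>' ` U') (inv_into U' \<psi>')"
      by (simp only: continuous_on_cong[OF refl invU'])
  qed (use inj' in \<open>auto simp: f_inv_into_f inv_into_into\<close>)
  have ch: "chart U' \<psi>'" using oU' FS inj' hom by (simp add: chart_def imU')
  have tr1: "analytic_transition (U', \<psi>') (V, \<eta>)" if V: "(V, \<eta>) \<in> A" for V \<eta>
    unfolding analytic_transition_def prod.case power_series_on_iff
  proof clarify
    fix i m assume m: "m \<in> U'" "m \<in> V"
    have 1: "analytic_germ (\<psi>' m) (\<lambda>y. (\<lambda>x. \<eta> (\<phi>' x) $ i) (\<chi> j. G j y))"
    proof (rule analytic_germ_compose[OF transition'[OF V]])
      show "m \<in> U \<inter> V" using m U'U by blast
      show "analytic_germ (\<psi>' m) (G j)" for j unfolding \<psi>'_def by (rule anG) (use m in \<open>simp add: U'_def\<close>)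
      show "G j (\<psi>' m) = \<phi> m $ j" for j
        using GF[of "\<phi> m"] m by (simp add: U'_def \<psi>'_def vec_eq_iff)
    qed
    have 2: "\<forall>\<^sub>F y in nhds (\<psi>' m). \<eta> (\<phi>' (\<chi> j. G j y)) $ i = \<eta> (inv_into U' \<psi>' y) $ i"
      by (rule eventually_nhds_openI[of "\<psi>' ` U'"]) (use FS imU' m invU' in auto)
    show "analytic_germ (\<psi>' m) (\<lambda>x. \<eta> (inv_into U' \<psi>' x) $ i)" by (rule analytic_germ_cong[OF 1 2])
  qed
  have tr2: "analytic_transition (V, \<eta>) (U', \<psi>')" if V: "(V, \<eta>) \<in> A" for V \<eta>
    unfolding analytic_transition_def prod.case power_series_on_iff
  proof clarify
    fix i m assume m: "m \<in> V" "m \<in> U'"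
    have 0: "inv_into V \<eta> (\<eta> m) = m" using man V m by (auto simp: analytic_manifold_def chart_def)
    have "analytic_germ (\<eta> m) (\<lambda>x. F i (\<chi> j. \<phi> (inv_into V \<eta> x) $ j))"
    proof (rule analytic_germ_compose)
      show "analytic_germ (\<phi> m) (F i)" by (rule anS) (use m in \<open>simp add: U'_def\<close>)
      show "analytic_germ (\<eta> m) (\<lambda>x. \<phi> (inv_into V \<eta> x) $ j)" for j by (rule transition[OF V]) (use m U'U in auto)
    qed (simp add: 0)
    thus "analytic_germ (\<eta> m) (\<lambda>x. \<psi>' (inv_into V \<eta> x) $ i)" by (simp add: \<psi>'_def)
  qed
  \<comment> \<open>Here f and g are merely smooth, and only on V. Over the preimage W of V the
    chain rule reduces the bracket to the constants given by the brackets of the new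
    coordinates.\<close>
  have bracket: "B (f \<circ> \<psi>') (g \<circ> \<psi>') m = constant_bracket e s f g (\<psi>' m)"
    if B: "poisson_bracket A B" and s: "\<And>x l m. x \<in> S \<Longrightarrow> l < CARD('n) \<Longrightarrow> m < CARD('n) \<Longrightarrow> br (structure_functions B) (\<psi> l) (\<psi> m) x = s l m"
      and V: "open V" and f: "smooth_on V f" and g: "smooth_on V g" and m: "m \<in> U'" "\<psi>' m \<in> V" for B s V f g m
  proof -
    define W where "W = {m \<in> U'. \<psi>' m \<in> V}"
    have W: "open W" "W \<subseteq> U" "m \<in> W" unfolding W_def using chart_open_preimage[OF ch V] U'U m by auto
    have oW: "open (\<phi> ` W)" by (rule chart_open_image[OF chart W(1,2)])
    have WS: "\<phi> ` W \<subseteq> S" using phiU' by (auto simp: W_def)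
    have FV: "(\<chi> i. F i x) \<in> V" if "x \<in> \<phi> ` W" for x using that by (auto simp: W_def \<psi>'_def)
    have sF: "smooth_on (\<phi> ` W) (F i)" for i by (rule smooth_on_analytic[OF oW]) (use anS WS in blast)
    have sc: "smooth_on (\<phi> ` W) (\<lambda>x. h (\<chi> i. F i x))" if "smooth_on V h" for h
      by (rule smooth_on_compose[OF V oW sF FV that])
    have se: "br (structure_functions B) (F i) (F j) (\<phi> m) = s (e i) (e j)" for i j
      unfolding F_def by (rule s[OF _ el el]) (use WS W(3) in blast)
    have "B (f \<circ> \<psi>') (g \<circ> \<psi>') m = B (\<lambda>m. (\<lambda>x. f (\<chi> i. F i x)) (\<phi> m)) (\<lambda>m. (\<lambda>x. g (\<chi> i. F i x)) (\<phi> m)) m"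
      by (simp add: o_def \<psi>'_def)
    also have "\<dots> = br (structure_functions B) (\<lambda>x. f (\<chi> i. F i x)) (\<lambda>x. g (\<chi> i. F i x)) (\<phi> m)"
      by (rule bracket_pull[OF B W sc[OF f] sc[OF g]])
    also have "\<dots> = br (\<lambda>i j _. br (structure_functions B) (F i) (F j) (\<phi> m)) f g (\<chi> i. F i (\<phi> m))"
      by (rule br_compose) (use smooth_on_kdiff[OF V] f g m smooth_on_kdiff[OF oW sF] W(3) in \<open>auto simp: \<psi>'_def\<close>)
    finally show ?thesis by (simp add: se constant_bracket_eq_br \<psi>'_def)
  qed
  have "local_isomorphism A B1 B2 (constant_bracket e kron1) (constant_bracket e kron2) U' \<psi>'"
    unfolding local_isomorphism_def
  proof (intro conjI allI impI ballI)
    show "chart U' \<psi>'" by (rule ch)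
    fix c assume "c \<in> A"
    thus "analytic_transition (U', \<psi>') c" "analytic_transition c (U', \<psi>')"
      using tr1[of "fst c" "snd c"] tr2[of "fst c" "snd c"] by simp_all
  next
    fix V f g m assume "open V" "smooth_on V f" "smooth_on V g" "m \<in> U'" "\<psi>' m \<in> V"
    thus "B1 (f \<circ> \<psi>') (g \<circ> \<psi>') m = constant_bracket e kron1 f g (\<psi>' m)"
      "B2 (f \<circ> \<psi>') (g \<circ> \<psi>') m = constant_bracket e kron2 f g (\<psi>' m)"
      by (auto intro!: bracket[OF B(1)] bracket[OF B(2)] simp: SP)
  qed
  moreover have "m0 \<in> U'" using m0 S(2) by (simp add: U'_def a_def)
  ultimately show ?thesis using odd e unfolding kronecker_of_type_near_def by blast
qed

end

section \<open>The coefficients of the Lax polynomial, and the conclusion\<close>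

lemma poly_chain_coefficients:
  fixes c1 c2 :: "nat \<Rightarrow> 'k::real_or_complex"
  assumes "\<And>l::real. of_real l * (\<Sum>i\<le>n. of_real l ^ i * c1 i) + (\<Sum>i\<le>n. of_real l ^ i * c2 i) = 0"
  shows "c2 0 = 0" "c1 n = 0" "i < n \<Longrightarrow> c2 (Suc i) = - c1 i"
proof -
  \<comment> \<open>This polynomial in \<lambda> vanishes at all reals. \<open>pCons 0\<close> is
    the factor \<lambda>, which moves the coefficients of the first bracket up by one; hence
    \<open>c2 (Suc i)\<close> meets \<open>c1 i\<close>.\<close>
  define p where "p = pCons 0 (\<Sum>i\<le>n. monom (c1 i) i) + (\<Sum>i\<le>n. monom (c2 i) i)"
  have "poly p (of_real l) = 0" for l
    using assms[of l] by (simp add: p_def poly_sum poly_monom mult.commute)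
  hence "range of_real \<subseteq> {x. poly p x = 0}" by auto
  moreover have "infinite (range (of_real :: real \<Rightarrow> 'k))"
    using finite_imageD[of "of_real :: real \<Rightarrow> 'k" UNIV] infinite_UNIV_char_0[where 'a = real] by (auto simp: inj_def)
  ultimately have "p = 0" using poly_roots_finite[of p] finite_subset by blast
  hence c: "coeff p j = 0" for j by simp
  have cs: "coeff (\<Sum>i\<le>n. monom (c i) i) j = (if j \<le> n then c j else 0)" for c :: "nat \<Rightarrow> 'k" and j
    by (simp add: coeff_sum)
  show "c2 0 = 0" using c[of 0] by (simp add: p_def cs)
  show "c1 n = 0" using c[of "Suc n"] by (simp add: p_def cs)
  show "c2 (Suc i) = - c1 i" if "i < n" using c[of "Suc i"] that by (simp add: p_def cs eq_neg_iff_add_eq_0 add.commute)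
qed

lemma poly_space_altdef:
  fixes p :: "'k::real_or_complex poly"
  assumes "p \<in> poly_space (Suc n)" shows "poly p x = (\<Sum>i\<le>n. x ^ i * coeff p i)"
proof -
  have "degree p \<le> n" by (rule degree_le) (use assms in \<open>auto simp: poly_space_def\<close>)
  hence "(\<Sum>i\<le>n. coeff p i * x ^ i) = (\<Sum>i\<le>degree p. coeff p i * x ^ i)"
    by (intro sum.mono_neutral_right) (auto intro: coeff_eq_0)
  thus ?thesis by (simp add: poly_altdef mult.commute)
qed

context manifold_chart
begin

text \<open>The Casimir condition is tested on the coordinate functions, where it becomes a
  polynomial identity in \<lambda>; for other functions the relations follow since a bracket is a
  combination of those with the coordinates.\<close>

lemma lax_chain:
  assumes B: "poisson_bracket A B1" "poisson_bracket A B2"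
    and L: "weak_lax_structure_on A B1 B2 W (Suc n) L" and W: "open W" and x: "x \<in> \<phi> ` (U \<inter> W)"
  defines "\<l> \<equiv> \<lambda>i x. coeff (L (\<phi>' x)) i"
  shows "br (structure_functions B2) (\<l> 0) f x = 0" "br (structure_functions B1) (\<l> n) f x = 0"
    "i < n \<Longrightarrow> br (structure_functions B2) (\<l> (Suc i)) f x = - br (structure_functions B1) (\<l> i) f x"
proof -
  let ?p = "structure_functions B1" and ?q = "structure_functions B2"
  define W0 where "W0 = U \<inter> W"
  have W0: "open W0" "W0 \<subseteq> U" "W0 \<subseteq> W" using open_U W by (auto simp: W0_def)
  have oW: "open (\<phi> ` W0)" by (rule chart_open_image[OF chart W0(1,2)])
  have x': "x \<in> \<phi> ` W0" using x by (simp add: W0_def)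
  define m where "m = \<phi>' x"
  have m: "m \<in> W0" "\<phi> m = x" using x' W0(2) inv_phi by (auto simp: m_def)
  have sl: "smooth_on (\<phi> ` W0) (\<l> i)" for i
  proof -
    have "smooth_fun A W (\<lambda>m. coeff (L m) i)" using L by (simp add: weak_lax_structure_on_def)
    hence "smooth_fun A W0 (\<lambda>m. coeff (L m) i)" by (rule smooth_fun_subset[OF _ W0(3)])
    thus ?thesis using smooth_fun_iff[OF W0(1,2)] by (simp add: \<l>_def o_def)
  qed
  have kl: "kdiff (\<l> i) x" for i by (rule smooth_on_kdiff[OF oW sl x'])
  have sc: "smooth_fun A W0 (\<lambda>m. \<phi> m $ b)" for b by (rule smooth_fun_coord[OF W0(1,2)])
  have key: "of_real l * (\<Sum>i\<le>n. of_real l ^ i * br ?p (\<l> i) (\<lambda>x. x $ b) x) +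
      (\<Sum>i\<le>n. of_real l ^ i * br ?q (\<l> i) (\<lambda>x. x $ b) x) = 0" for l :: real and b
  proof -
    define P where "P m = poly (L m) (of_real l)" for m
    have cas: "casimir_on A (bracket_comb (of_real l) 1 B1 B2) W P"
      using L by (simp add: weak_lax_structure_on_def P_def[abs_def])
    have sP: "smooth_fun A W0 P" by (rule smooth_fun_subset[OF _ W0(3)]) (use cas in \<open>simp add: casimir_on_def\<close>)
    have "bracket_comb (of_real l) 1 B1 B2 P (\<lambda>m. \<phi> m $ b) m = 0"
      using cas W0(1,3) sc m(1) unfolding casimir_on_def by blast
    hence 0: "of_real l * B1 P (\<lambda>m. \<phi> m $ b) m + B2 P (\<lambda>m. \<phi> m $ b) m = 0" by (simp add: bracket_comb_def)
    have BP: "B P (\<lambda>m. \<phi> m $ b) m = (\<Sum>i\<le>n. of_real l ^ i * br (structure_functions B) (\<l> i) (\<lambda>x. x $ b) x)"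
      if "poisson_bracket A B" for B
    proof -
      have e1: "\<forall>\<^sub>F y in nhds x. (P \<circ> \<phi>') y = (\<Sum>i\<le>n. of_real l ^ i * \<l> i y)"
      proof (rule eventually_nhds_openI[OF oW x'])
        fix y assume "y \<in> \<phi> ` W0"
        then obtain m' where "m' \<in> W0" "y = \<phi> m'" by blast
        moreover from this have "\<phi>' y = m'" "m' \<in> W" using W0 inv_phi by blast+
        ultimately have "L (\<phi>' y) \<in> poly_space (Suc n)" using L by (simp add: weak_lax_structure_on_def)
        thus "(P \<circ> \<phi>') y = (\<Sum>i\<le>n. of_real l ^ i * \<l> i y)" by (simp add: P_def \<l>_def poly_space_altdef)
      qed
      have e2: "\<forall>\<^sub>F y in nhds x. ((\<lambda>m. \<phi> m $ b) \<circ> \<phi>') y = y $ b"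
        by (rule eventually_nhds_openI[OF oW x']) (use W0(2) phi_inv in auto)
      have "B P (\<lambda>m. \<phi> m $ b) m = br (structure_functions B) (P \<circ> \<phi>') ((\<lambda>m. \<phi> m $ b) \<circ> \<phi>') x"
        using bracket_coordinates[OF that W0(1,2) m(1) sP sc[of b]] by (simp add: m(2))
      also have "\<dots> = br (structure_functions B) (\<lambda>y. \<Sum>i\<le>n. of_real l ^ i * \<l> i y) (\<lambda>y. y $ b) x"
        by (rule eventually_nhds_x_imp_x[OF br_cong_eventually[OF e1 e2]])
      also have "\<dots> = (\<Sum>c\<in>UNIV. structure_functions B c b x * (\<Sum>i\<le>n. of_real l ^ i * partial_deriv c (\<l> i) x))"
        unfolding br_coord_right by (simp add: partial_deriv_sum kdiff_cmult kl partial_deriv_cmult)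
      also have "\<dots> = (\<Sum>i\<le>n. of_real l ^ i * br (structure_functions B) (\<l> i) (\<lambda>x. x $ b) x)"
        unfolding br_coord_right sum_distrib_left by (subst sum.swap) (simp add: mult_ac)
      finally show ?thesis .
    qed
    show ?thesis using 0 unfolding BP[OF B(1)] BP[OF B(2)] .
  qed
  note c = poly_chain_coefficients[where n = n and ?c1.0 = "\<lambda>i. br ?p (\<l> i) (\<lambda>x. x $ b) x" and ?c2.0 = "\<lambda>i. br ?q (\<l> i) (\<lambda>x. x $ b) x" for b, OF key]
  show "br ?q (\<l> 0) f x = 0" "br ?p (\<l> n) f x = 0"
    unfolding br_eq_sum_right[of _ _ f] by (simp_all add: c)
  show "br ?q (\<l> (Suc i)) f x = - br ?p (\<l> i) f x" if "i < n"
    unfolding br_eq_sum_right[of _ _ f] by (simp add: c(3)[OF that] sum_negf)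
qed

end

theorem theorem15p2:
  fixes A :: "('m::{t2_space, second_countable_topology}, 'k::real_or_complex, 'n::finite) atlas"
    and B1 B2 :: "('m, 'k) bracket"
    and m0 :: 'm
  assumes "analytic_bihamiltonian A B1 B2"
    and "\<exists>U L. lax_structure_near A B1 B2 m0 U L"
    and "\<exists>l1 l2 :: complex. has_constant_corank A B1 B2 l1 l2 1"
  shows "kronecker_of_type_near A B1 B2 CARD('n) m0"
proof -
  have man: "analytic_manifold A" and biham: "bihamiltonian A B1 B2"
    and anB: "analytic_bracket A B1" "analytic_bracket A B2"
    using assms(1) by (simp_all add: analytic_bihamiltonian_def)
  have B: "poisson_bracket A B1" "poisson_bracket A B2" using biham by (simp_all add: bihamiltonian_def)
  obtain W L k where W: "open W" "m0 \<in> W" and dimk: "has_action_dim_at A B1 B2 m0 k"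
    and lax: "weak_lax_structure_on A B1 B2 W k L" and subm: "submersion_on A W k L"
    using assms(2) unfolding lax_structure_near_def by blast
  obtain l1 l2 :: complex where cork: "has_constant_corank A B1 B2 l1 l2 1" using assms(3) by blast
  have "m0 \<in> (\<Union>(U, \<phi>)\<in>A. U)" using man by (simp add: analytic_manifold_def)
  then obtain U \<phi> where U: "(U, \<phi>) \<in> A" "m0 \<in> U" by auto
  interpret manifold_chart A U \<phi> by unfold_locales (fact man U(1))+
  let ?p = "structure_functions B1" and ?q = "structure_functions B2"
  define a where "a = \<phi> m0"
  interpret bihamiltonian_germ a ?p ?q
    unfolding a_def by (rule bihamiltonian_germ_structure_functions[OF biham anB U(2)])
  define M where "M B m i j = to_complex (structure_functions B i j (\<phi> m))" for B m i j
  have cp: "cotangent_pairing \<phi> B m = form (M B m)" if "m \<in> U" for B m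
    using inv_phi[OF that] by (simp add: fun_eq_iff cotangent_pairing_def form_def M_def structure_functions_def)
  have Mskew: "M B m i j = - M B m j i" if "poisson_bracket A B" "m \<in> U" for B m i j
    unfolding M_def by (subst structure_functions_skew[OF that(1)]) (use that(2) in \<open>simp_all add: to_complex_minus\<close>)
  have cork': "pairing_corank (form (\<lambda>i j. l1 * M B1 m i j + l2 * M B2 m i j)) = 1" if m: "m \<in> U" for m
  proof -
    have "pairing_corank (\<lambda>v w. l1 * cotangent_pairing \<phi> B1 m v w + l2 * cotangent_pairing \<phi> B2 m v w) = 1"
      using cork U(1) m unfolding has_constant_corank_def by blast
    thus ?thesis by (simp add: cp[OF m] form_comb)
  qed
  have odd: "odd CARD('n)"
  proof (rule skew_corank_1_odd[OF _ cork'[OF U(2)]])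
    fix i j
    have "M B1 m0 i j = - M B1 m0 j i" "M B2 m0 i j = - M B2 m0 j i" by (rule Mskew[OF B(1) U(2)], rule Mskew[OF B(2) U(2)])
    thus "l1 * M B1 m0 i j + l2 * M B2 m0 i j = - (l1 * M B1 m0 j i + l2 * M B2 m0 j i)" by simp
  qed
  then obtain n where n: "CARD('n) = 2 * n + 1" by (elim oddE)
  have k: "k = Suc n"
  proof -
    let ?f = "\<lambda>m. ereal (pair_action_dim (cotangent_pairing \<phi> B1 m) (cotangent_pairing \<phi> B2 m))"
    have lim: "Liminf (at m0) ?f = ereal (real k)" using dimk U unfolding has_action_dim_at_def by blast
    have ev: "\<forall>\<^sub>F m in at m0. m \<in> U" using open_U U(2) by (auto simp: eventually_at_topological)
    have 1: "\<forall>\<^sub>F m in at m0. ereal ((2 * real n + 1) / 2) \<le> ?f m"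
      using ev
    proof eventually_elim
      case (elim m)
      show ?case
        using pair_action_dim_bounds(1)[OF Mskew[OF B(1) elim] Mskew[OF B(2) elim] cork'[OF elim]] n by (simp add: cp[OF elim])
    qed
    have 2: "\<forall>\<^sub>F m in at m0. ?f m \<le> ereal (real n + 1)"
      using ev
    proof eventually_elim
      case (elim m)
      show ?case
        using pair_action_dim_bounds(2)[OF Mskew[OF B(1) elim] Mskew[OF B(2) elim] cork'[OF elim]] n by (simp add: cp[OF elim])
    qed
    \<comment> \<open>At an isolated point the lower limit would be infinite, whereas it is the
      number \<open>k\<close>.\<close>
    have "at m0 \<noteq> bot"
    proof
      assume b: "at m0 = bot"
      have "Liminf (at m0) ?f = top" unfolding b by simp
      thus False using lim by (simp add: top_ereal_def)
    qed
    hence "Liminf (at m0) ?f \<le> ereal (real n + 1)"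
      using Liminf_le_Limsup Limsup_bounded[OF 2] order_trans by blast
    moreover have "ereal ((2 * real n + 1) / 2) \<le> Liminf (at m0) ?f" by (rule Liminf_bounded[OF 1])
    ultimately have "real k \<le> real n + 1" "(2 * real n + 1) / 2 \<le> real k" unfolding lim by simp_all
    hence "real k \<le> real (Suc n)" "real (2 * n + 1) \<le> real (2 * k)" by simp_all
    thus ?thesis unfolding of_nat_le_iff by linarith
  qed
  define \<l> where "\<l> = (\<lambda>i x. coeff (L (\<phi>' x)) i)"
  define S where "S = \<phi> ` (U \<inter> W)"
  have S: "open S" "a \<in> S"
    unfolding S_def a_def using U(2) W by (auto intro!: chart_open_image[OF chart] open_U)
  have sl: "smooth_on S (\<l> i)" for i
  proof -
    have "smooth_fun A W (\<lambda>m. coeff (L m) i)" using lax by (simp add: weak_lax_structure_on_def)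
    hence "smooth_fun A (U \<inter> W) (\<lambda>m. coeff (L m) i)" by (rule smooth_fun_subset) simp
    thus ?thesis using smooth_fun_iff[of "U \<inter> W"] open_U W(1) by (simp add: \<l>_def o_def S_def open_Int)
  qed
  have chain: "\<forall>\<^sub>F x in nhds a. \<forall>f. br ?q (\<l> 0) f x = 0 \<and> br ?p (\<l> n) f x = 0 \<and>
      (\<forall>i<n. br ?q (\<l> (Suc i)) f x = - br ?p (\<l> i) f x)"
    by (rule eventually_nhds_openI[OF S])
      (use lax_chain[OF B lax[unfolded k] W(1)] in \<open>simp add: \<l>_def S_def\<close>)
  have "\<exists>v. \<forall>i\<le>n. (\<Sum>b\<in>UNIV. partial_deriv b (\<l> i) a * v b) = (if i = j then 1 else 0)" if j: "j \<le> n" for j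
  proof -
    \<comment> \<open>Tangent vectors that the submersion maps to the monomials are dual to the
      differentials of the coefficients; they serve as the \<open>p j\<close>.\<close>
    have "monom 1 j \<in> (poly_space k :: 'k poly set)" using j k by (auto simp: poly_space_def)
    then obtain v :: "'k ^ 'n" where v: "\<And>i. frechet_derivative (\<l> i) (at a) v = coeff (monom 1 j :: 'k poly) i"
      using subm U W(2) unfolding submersion_on_def \<l>_def a_def by blast
    have "(\<Sum>b\<in>UNIV. partial_deriv b (\<l> i) a * v $ b) = (if i = j then 1 else 0)" for i
    proof -
      have "(\<l> i has_derivative (\<lambda>h. \<Sum>b\<in>UNIV. partial_deriv b (\<l> i) a * h $ b)) (at a)"
        using smooth_on_kdiff[OF S(1) sl S(2)] by (simp add: kdiff_def)
      from frechet_derivative_at[OF this] v[of i] show ?thesis by (simp add: fun_eq_iff eq_commute)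
    qed
    thus ?thesis by (intro exI[of _ "\<lambda>b. v $ b"]) simp
  qed
  hence "\<forall>j. \<exists>v. j \<le> n \<longrightarrow> (\<forall>i\<le>n. (\<Sum>b\<in>UNIV. partial_deriv b (\<l> i) a * v b) = (if i = j then 1 else 0))" by blast
  from choice[OF this] obtain p where "\<forall>j. j \<le> n \<longrightarrow> (\<forall>i\<le>n. (\<Sum>b\<in>UNIV. partial_deriv b (\<l> i) a * p j b) = (if i = j then 1 else 0))" ..
  hence p: "(\<Sum>b\<in>UNIV. partial_deriv b (\<l> i) a * p j b) = (if i = j then 1 else 0)" if "i \<le> n" "j \<le> n" for i j
    using that by blast
  have u: "\<forall>i<n. v i = 0" if v: "\<And>b. (\<Sum>i<n. v i * br ?p (\<l> i) (\<lambda>x. x $ b) a) = 0" for v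
  proof -
    note ch = eventually_nhds_x_imp_x[OF chain, THEN spec, of "\<lambda>x. x $ b" for b, unfolded br_coord_right]
    \<comment> \<open>The corank hypothesis concerns a complex combination, so over the reals the
      chain is complexified first; injectivity of \<open>to_complex\<close> brings the coefficients
      back.\<close>
    define w where "w i b = to_complex (partial_deriv b (\<l> i) a)" for i b
    have tc: "(\<Sum>c\<in>UNIV. M B m0 c b * w i c) = to_complex (\<Sum>c\<in>UNIV. structure_functions B c b a * partial_deriv c (\<l> i) a)" for B b i
      by (simp add: M_def w_def to_complex_sum to_complex_mult a_def)
    have "\<forall>i<n. to_complex (v i) = 0"
    proof (rule lenard_chain_independent[OF cork'[OF U(2)], of w n "\<lambda>j b. to_complex (p j b)"])
      show "(\<Sum>c\<in>UNIV. M B2 m0 c b * w 0 c) = 0" for b unfolding tc using ch by simp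
      show "(\<Sum>c\<in>UNIV. M B1 m0 c b * w n c) = 0" for b unfolding tc using ch by simp
      show "(\<Sum>c\<in>UNIV. M B2 m0 c b * w (Suc i) c) = - (\<Sum>c\<in>UNIV. M B1 m0 c b * w i c)" if "i < n" for i b
        unfolding tc using ch that by (simp add: to_complex_minus)
      show "(\<Sum>b\<in>UNIV. w i b * to_complex (p j b)) = (if i = j then 1 else 0)" if "i \<le> n" "j \<le> n" for i j
      proof -
        have "(\<Sum>b\<in>UNIV. w i b * to_complex (p j b)) = to_complex (\<Sum>b\<in>UNIV. partial_deriv b (\<l> i) a * p j b)"
          by (simp add: w_def to_complex_sum to_complex_mult)
        thus ?thesis unfolding p[OF that] by (simp add: to_complex_one)
      qed
      show "(\<Sum>i<n. to_complex (v i) * (\<Sum>c\<in>UNIV. M B1 m0 c b * w i c)) = 0" for b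
      proof -
        have "(\<Sum>i<n. to_complex (v i) * (\<Sum>c\<in>UNIV. M B1 m0 c b * w i c)) =
            to_complex (\<Sum>i<n. v i * br ?p (\<l> i) (\<lambda>x. x $ b) a)"
          unfolding tc br_coord_right by (simp add: to_complex_sum to_complex_mult)
        thus ?thesis by (simp add: v)
      qed
    qed
    thus ?thesis by simp
  qed
  obtain \<psi> where \<psi>: "\<And>l. l < 2 * n + 1 \<Longrightarrow> analytic_germ a (\<psi> l)"
    "\<forall>\<^sub>F x in nhds a. \<forall>l<2*n+1. \<forall>m<2*n+1. br ?p (\<psi> l) (\<psi> m) x = kron1 l m \<and> br ?q (\<psi> l) (\<psi> m) x = kron2 l m"
    "\<And>c. (\<And>b. (\<Sum>l<2*n+1. c l * partial_deriv b (\<psi> l) a) = 0) \<Longrightarrow> \<forall>l<2*n+1. c l = 0"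
  proof (cases "n = 0")
    case False
    have "analytic_germ a (\<l> i)" if "i \<le> n" for i
      by (rule casimir_chain_analytic[OF n _ S sl chain p u that]) (use False in auto)
    from kronecker_coordinates[OF n this chain p u] that show ?thesis by blast
  next
    case True
    \<comment> \<open>In dimension 1 both brackets vanish by skewness and any coordinate is a
      Kronecker coordinate; the Lax function itself may fail to be analytic here.\<close>
    define i0 :: 'n where "i0 = undefined"
    show ?thesis
    proof (rule that[of "\<lambda>_ x. x $ i0"])
      show "\<forall>\<^sub>F x in nhds a. \<forall>l<2*n+1. \<forall>m<2*n+1. br ?p (\<lambda>x. x $ i0) (\<lambda>x. x $ i0) x = kron1 l m \<and>
          br ?q (\<lambda>x. x $ i0) (\<lambda>x. x $ i0) x = kron2 l m"
        using skew1 skew2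
      proof eventually_elim
        case (elim x)
        have "?p i0 i0 x = - ?p i0 i0 x" "?q i0 i0 x = - ?q i0 i0 x" using elim by blast+
        thus ?case using True by (simp add: br_coord_coord kron1_def kron2_def)
      qed
      show "\<forall>l<2*n+1. c l = 0" if "\<And>b. (\<Sum>l<2*n+1. c l * partial_deriv b (\<lambda>x. x $ i0) a) = 0" for c
        using that[of i0] True by (simp add: partial_deriv_coord)
    qed (intro agerm)
  qed
  show ?thesis
    by (rule kronecker_of_coordinates[OF B U(2) odd, of \<psi>]) (use \<psi> n in \<open>simp_all add: a_def\<close>)
qed

end
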